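(* Let $Y$ be a finite-dimensional Yetter–Drinfeld module (over $\mathbb C$) for a group $G$. Then there is an isomorphism $$\phi\colon \mathcal A_Y\rtimes G\xrightarrow{\ \sim\ }\mathcal H_Y$$ of algebras, defined on generators $v\in Y$, $f\in Y^*$ and $g\in G$ of $\mathcal A_Y\rtimes G$ by $\phi(v)=v$, $\phi(f)=x f$ (the product of $x$ and $f$ in $\mathcal H_Y$) if $f\in(Y^* )_x$ where $x\in G$, and $\phi(g)=g$.
   Context: All tensor products are over $\mathbb C$. A Yetter–Drinfeld module for $G$ is a $\mathbb CG$-module $Y$ (action $\triangleright$) with a grading $Y=\bigoplus_{g\in G}Y_g$ such that $g\triangleright Y_h=Y_{ghg^{-1}}$. The coaction is $\delta(v)=v\otimes g$ for $v\in Y_g$, written $\delta(v)=v^{(0)}\otimes v^{(1)}$. The braiding is $\Psi(y\otimes z)=(g\triangleright z)\otimes y$ for $y\in Y_g$. The dual $Y^*$ has the dual action and grading $(Y^* )_g=(Y_{g^{-1}})^*$; its braiding as a Yetter–Drinfeld module is denoted $\Psi^*$. $\tau$ is the flip $u\otimes v\mapsto v\otimes u$, and $\langle\,,\rangle$ the evaluation pairing between $Y^*$ and $Y$. For a finite-dimensional vector space $V$ with $\Psi\in GL(V\otimes V)$ satisfying the braid equation, $\mathcal B(V,\Psi)=T(V)/I_\Psi$, $I_\Psi=\bigoplus_n\ker[n]!_\Psi$, $[n]!_\Psi=\sum_{\sigma\in S_n}\Psi_\sigma$, where $\Psi_\sigma=\Psi_{i_1,i_1+1}\cdots\Psi_{i_l,i_l+1}$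 for a reduced expression $\sigma=s_{i_1}\cdots s_{i_l}$. For a Yetter–Drinfeld module, $\mathcal B(Y)=\mathcal B(Y,\Psi)$ and $\mathcal B(Y^* )=\mathcal B(Y^*,\Psi^* )$. For a $G$-module algebra $A$, $A\rtimes G$ is $A\otimes\mathbb CG$ with $A$ and $\mathbb CG$ subalgebras and $ga=(g\triangleright a)g$. The braided Heisenberg double $\mathcal H_Y$ is the quotient of $T(Y\oplus Y^* )\rtimes G$ by the two-sided ideal generated by $I_\Psi\subset T(Y)$, $I_{\tau\Psi^*\tau}\subset T(Y^* )$ and $f\otimes v-v\otimes f-\langle f,v^{(0)}\rangle v^{(1)}$ for $f\in Y^*$, $v\in Y$. Multiplication gives a vector space isomorphism $\mathcal B(Y,\Psi)\otimes\mathbb CG\otimes\mathcal B(Y^*,\tau\Psi^*\tau)\cong\mathcal H_Y$. The braided Weyl algebra $\mathcal A_Y$ is $\mathcal B(Y)\otimes\mathcal B(Y^* )$ as a vector space, where $\mathcal B(Y)$ and $\mathcal B(Y^* )$ are subalgebras and $fv-(g\triangleright v)f=\langle f,v\rangle\cdot1$ for $f\in(Y^* )_g$, $v\in Y$; these conditions determine the multiplication uniquely and it is well defined. $G$ acts on $\mathcal A_Y$ by algebra automorphisms extending the actions on $Y$ and $Y^*$. *)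

theory Defs
  imports
    Complex_Main
    "HOL-Library.Function_Algebras"
    "HOL-Combinatorics.Permutations"
    "HOL-Algebra.Algebraic_Closure_Type"
begin

section \<open>Complex algebras\<close>

text \<open>
  The library locale \<open>algebra\<close> is restricted to commutative algebras, so (associative, unital)
  complex algebras are introduced here, on the same records.
\<close>

abbreviation CC :: "complex ring"
  where "CC \<equiv> ring_of_type_algebra"

definition complex_algebra :: "(complex, 'a) module \<Rightarrow> bool"
  where "complex_algebra A \<longleftrightarrow> ring A \<and> module CC A \<and>
    (\<forall>c. \<forall>x\<in>carrier A. \<forall>y\<in>carrier A.
      (c \<odot>\<^bsub>A\<^esub> x) \<otimes>\<^bsub>A\<^esub> y = c \<odot>\<^bsub>A\<^esub> (x \<otimes>\<^bsub>A\<^esub> y) \<and>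
      x \<otimes>\<^bsub>A\<^esub> (c \<odot>\<^bsub>A\<^esub> y) = c \<odot>\<^bsub>A\<^esub> (x \<otimes>\<^bsub>A\<^esub> y))"

definition algebra_iso ::
    "(complex, 'a) module \<Rightarrow> (complex, 'b) module \<Rightarrow> ('a \<Rightarrow> 'b) \<Rightarrow> bool"
  where "algebra_iso A B h \<longleftrightarrow> complex_algebra A \<and> complex_algebra B \<and> h \<in> ring_iso A B \<and>
    (\<forall>c. \<forall>x\<in>carrier A. h (c \<odot>\<^bsub>A\<^esub> x) = c \<odot>\<^bsub>B\<^esub> h x)"

text \<open>
  \<open>quotient A I\<close> is used both for a two-sided ideal of an algebra and for a subspace of a vector
  space; in the second case the multiplicative part of the record is meaningless.
\<close>

definition quotient :: "(complex, 'a) module \<Rightarrow> 'a set \<Rightarrow> (complex, 'a set) module"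
  where "quotient A I =
    \<lparr>carrier = carrier (A Quot I), monoid.mult = monoid.mult (A Quot I), one = one (A Quot I),
     zero = zero (A Quot I), add = add (A Quot I),
     module.smult = (\<lambda>c S. \<Union>x\<in>S. I +>\<^bsub>A\<^esub> (c \<odot>\<^bsub>A\<^esub> x))\<rparr>"

definition free_space :: "'x set \<Rightarrow> (complex, 'x \<Rightarrow> complex) module"
  where "free_space E =
    \<lparr>carrier = {p. finite {x. p x \<noteq> 0} \<and> {x. p x \<noteq> 0} \<subseteq> E},
     monoid.mult = undefined, one = undefined,
     zero = (\<lambda>_. 0), add = (\<lambda>p q x. p x + q x), module.smult = (\<lambda>c p x. c * p x)\<rparr>"

definition delta :: "'x \<Rightarrow> 'x \<Rightarrow> complex"
  where "delta x = (\<lambda>y. if y = x then 1 else 0)"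

subsection \<open>Tensor products of vector spaces\<close>

definition bilinear_relations ::
    "(complex, 'u) module \<Rightarrow> (complex, 'w) module \<Rightarrow> ('u \<times> 'w \<Rightarrow> complex) set"
  where "bilinear_relations U W =
    {(\<lambda>z. delta (u \<oplus>\<^bsub>U\<^esub> u', w) z - delta (u, w) z - delta (u', w) z) | u u' w.
        u \<in> carrier U \<and> u' \<in> carrier U \<and> w \<in> carrier W} \<union>
    {(\<lambda>z. delta (u, w \<oplus>\<^bsub>W\<^esub> w') z - delta (u, w) z - delta (u, w') z) | u w w'.
        u \<in> carrier U \<and> w \<in> carrier W \<and> w' \<in> carrier W} \<union>
    {(\<lambda>z. delta (c \<odot>\<^bsub>U\<^esub> u, w) z - c * delta (u, w) z) | c u w.
        u \<in> carrier U \<and> w \<in> carrier W} \<union>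
    {(\<lambda>z. delta (u, c \<odot>\<^bsub>W\<^esub> w) z - c * delta (u, w) z) | c u w.
        u \<in> carrier U \<and> w \<in> carrier W}"

definition bilinear_subspace ::
    "(complex, 'u) module \<Rightarrow> (complex, 'w) module \<Rightarrow> ('u \<times> 'w \<Rightarrow> complex) set"
  where "bilinear_subspace U W =
    \<Inter>{N. submodule N CC (free_space (carrier U \<times> carrier W)) \<and> bilinear_relations U W \<subseteq> N}"

definition tensor_space ::
    "(complex, 'u) module \<Rightarrow> (complex, 'w) module \<Rightarrow> (complex, ('u \<times> 'w \<Rightarrow> complex) set) module"
  where "tensor_space U W =
    quotient (free_space (carrier U \<times> carrier W)) (bilinear_subspace U W)"

definition tensor ::
    "(complex, 'u) module \<Rightarrow> (complex, 'w) module \<Rightarrow> 'u \<Rightarrow> 'w \<Rightarrow> ('u \<times> 'w \<Rightarrow> complex) set"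
  where "tensor U W u w =
    bilinear_subspace U W +>\<^bsub>free_space (carrier U \<times> carrier W)\<^esub> delta (u, w)"

subsection \<open>Tensor algebras\<close>

text \<open>
  The tensor algebra of a vector space with basis \<open>B\<close> is the free algebra on \<open>B\<close>: the word
  \<open>[b\<^sub>1, \<dots>, b\<^sub>n]\<close> stands for the basis element \<open>b\<^sub>1 \<otimes> \<dots> \<otimes> b\<^sub>n\<close> of the \<open>n\<close>-th tensor power, and an
  element is the finitely supported function giving the coefficients of the words.
\<close>

definition tensor_algebra :: "'b set \<Rightarrow> (complex, 'b list \<Rightarrow> complex) module"
  where "tensor_algebra B = (free_space (lists B))
    \<lparr>monoid.mult := (\<lambda>p q w. \<Sum>k\<le>length w. p (take k w) * q (drop k w)), one := delta []\<rparr>"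

text \<open>The degree one element of the tensor algebra given by a vector in the span of \<open>B\<close>.\<close>

definition vec :: "(complex \<Rightarrow> 'v \<Rightarrow> 'v) \<Rightarrow> 'v set \<Rightarrow> 'v::ab_group_add \<Rightarrow> 'v list \<Rightarrow> complex"
  where "vec s B v = (\<lambda>w. case w of [b] \<Rightarrow> module.representation s B v b | _ \<Rightarrow> 0)"

text \<open>The algebra homomorphism from a tensor algebra to \<open>A\<close> with values \<open>h\<close> on the letters.\<close>

definition extend_hom :: "(complex, 'a) module \<Rightarrow> ('b \<Rightarrow> 'a) \<Rightarrow> ('b list \<Rightarrow> complex) \<Rightarrow> 'a"
  where "extend_hom A h p =
    finsum A (\<lambda>w. p w \<odot>\<^bsub>A\<^esub> foldr (\<lambda>b x. h b \<otimes>\<^bsub>A\<^esub> x) w \<one>\<^bsub>A\<^esub>) {w. p w \<noteq> 0}"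

subsection \<open>Crossed products\<close>

text \<open>
  An element of \<open>A \<otimes> \<complex>G\<close> is written uniquely as a finite sum of \<open>F(g) \<otimes> g\<close>, and is represented
  by the function \<open>F\<close>.
\<close>

definition crossed_product ::
    "(complex, 'a) module \<Rightarrow> 'g monoid \<Rightarrow> ('g \<Rightarrow> 'a \<Rightarrow> 'a) \<Rightarrow> (complex, 'g \<Rightarrow> 'a) module"
  where "crossed_product A G \<alpha> =
    \<lparr>carrier = {F. (\<forall>g\<in>carrier G. F g \<in> carrier A) \<and> (\<forall>g. g \<notin> carrier G \<longrightarrow> F g = \<zero>\<^bsub>A\<^esub>) \<and>
                   finite {g. F g \<noteq> \<zero>\<^bsub>A\<^esub>}},
     monoid.mult = (\<lambda>F H k. if k \<in> carrier G
       then finsum A (\<lambda>g. F g \<otimes>\<^bsub>A\<^esub> \<alpha> g (H (inv\<^bsub>G\<^esub> g \<otimes>\<^bsub>G\<^esub> k))) {g \<in> carrier G. F g \<noteq> \<zero>\<^bsub>A\<^esub>}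
       else \<zero>\<^bsub>A\<^esub>),
     one = (\<lambda>k. if k = \<one>\<^bsub>G\<^esub> then \<one>\<^bsub>A\<^esub> else \<zero>\<^bsub>A\<^esub>),
     zero = (\<lambda>k. \<zero>\<^bsub>A\<^esub>),
     add = (\<lambda>F H k. F k \<oplus>\<^bsub>A\<^esub> H k),
     module.smult = (\<lambda>c F k. c \<odot>\<^bsub>A\<^esub> F k)\<rparr>"

text \<open>The element \<open>a \<otimes> g\<close>.\<close>

definition crossed :: "(complex, 'a) module \<Rightarrow> 'a \<Rightarrow> 'g \<Rightarrow> 'g \<Rightarrow> 'a"
  where "crossed A a g = (\<lambda>k. if k = g then a else \<zero>\<^bsub>A\<^esub>)"


section \<open>Nichols algebras\<close>

text \<open>
  A linear map \<open>\<Psi>\<close> on \<open>V \<otimes> V\<close> is given by the images \<open>\<Psi> b c\<close> of the basis elements \<open>b \<otimes> c\<close>, as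
  degree two elements of the tensor algebra. \<open>braid_at B \<Psi> i\<close> applies \<open>\<Psi>\<close> to the tensor factors
  \<open>i\<close> and \<open>i + 1\<close>, where the factors are numbered from \<open>0\<close>.
\<close>

definition braid_at ::
    "'b set \<Rightarrow> ('b \<Rightarrow> 'b \<Rightarrow> 'b list \<Rightarrow> complex) \<Rightarrow> nat \<Rightarrow> ('b list \<Rightarrow> complex) \<Rightarrow> 'b list \<Rightarrow> complex"
  where "braid_at B \<Psi> i p = (\<lambda>w. if Suc i < length w
    then \<Sum>b\<in>B. \<Sum>c\<in>B. p (w[i := b, Suc i := c]) * \<Psi> b c [w ! i, w ! Suc i]
    else p w)"

definition perm_of_word :: "nat list \<Rightarrow> nat \<Rightarrow> nat"
  where "perm_of_word is = foldr (\<lambda>i \<pi>. transpose i (Suc i) \<circ> \<pi>) is id"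

definition reduced_word :: "nat \<Rightarrow> (nat \<Rightarrow> nat) \<Rightarrow> nat list \<Rightarrow> bool"
  where "reduced_word n \<sigma> is \<longleftrightarrow>
    (\<forall>i\<in>set is. Suc i < n) \<and> perm_of_word is = \<sigma> \<and>
    (\<forall>js. (\<forall>j\<in>set js. Suc j < n) \<and> perm_of_word js = \<sigma> \<longrightarrow> length is \<le> length js)"

text \<open>By the braid equation, the choice of the reduced expression is immaterial.\<close>

definition braid_perm ::
    "'b set \<Rightarrow> ('b \<Rightarrow> 'b \<Rightarrow> 'b list \<Rightarrow> complex) \<Rightarrow> nat \<Rightarrow> (nat \<Rightarrow> nat) \<Rightarrow>
     ('b list \<Rightarrow> complex) \<Rightarrow> 'b list \<Rightarrow> complex"
  where "braid_perm B \<Psi> n \<sigma> =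
    foldr (\<lambda>i T. braid_at B \<Psi> i \<circ> T) (SOME is. reduced_word n \<sigma> is) id"

definition braided_factorial ::
    "'b set \<Rightarrow> ('b \<Rightarrow> 'b \<Rightarrow> 'b list \<Rightarrow> complex) \<Rightarrow> nat \<Rightarrow> ('b list \<Rightarrow> complex) \<Rightarrow> 'b list \<Rightarrow> complex"
  where "braided_factorial B \<Psi> n p = (\<lambda>w. \<Sum>\<sigma> | \<sigma> permutes {..<n}. braid_perm B \<Psi> n \<sigma> p w)"

definition homogeneous_part :: "nat \<Rightarrow> ('b list \<Rightarrow> complex) \<Rightarrow> 'b list \<Rightarrow> complex"
  where "homogeneous_part n p = (\<lambda>w. if length w = n then p w else 0)"

definition nichols_ideal ::
    "'b set \<Rightarrow> ('b \<Rightarrow> 'b \<Rightarrow> 'b list \<Rightarrow> complex) \<Rightarrow> ('b list \<Rightarrow> complex) set"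
  where "nichols_ideal B \<Psi> = {p \<in> carrier (tensor_algebra B).
    \<forall>n. braided_factorial B \<Psi> n (homogeneous_part n p) = (\<lambda>_. 0)}"

definition nichols_algebra ::
    "'b set \<Rightarrow> ('b \<Rightarrow> 'b \<Rightarrow> 'b list \<Rightarrow> complex) \<Rightarrow> (complex, ('b list \<Rightarrow> complex) set) module"
  where "nichols_algebra B \<Psi> = quotient (tensor_algebra B) (nichols_ideal B \<Psi>)"

text \<open>The map \<open>\<tau>\<Psi>\<tau>\<close>; the flip \<open>\<tau>\<close> reverses the words of length two.\<close>

definition flip_conj :: "('b \<Rightarrow> 'b \<Rightarrow> 'b list \<Rightarrow> complex) \<Rightarrow> 'b \<Rightarrow> 'b \<Rightarrow> 'b list \<Rightarrow> complex"
  where "flip_conj \<Psi> b c = (\<lambda>w. \<Psi> c b (rev w))"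


section \<open>Yetter--Drinfeld modules\<close>

text \<open>
  The underlying vector space is a subspace \<open>vspace Y\<close> of the vector space formed by a type with
  the scalar multiplication \<open>scale Y\<close>, so that the dual can be formed as a space of functions.
\<close>

record ('g, 'v) yd_module =
  scale :: "complex \<Rightarrow> 'v \<Rightarrow> 'v"
  vspace :: "'v set"
  act :: "'g \<Rightarrow> 'v \<Rightarrow> 'v"
  grade :: "'g \<Rightarrow> 'v set"

definition decomposition ::
    "'g monoid \<Rightarrow> ('g, 'v::ab_group_add) yd_module \<Rightarrow> 'v \<Rightarrow> ('g \<Rightarrow> 'v) \<Rightarrow> bool"
  where "decomposition G Y v c \<longleftrightarrow>
    (\<forall>g\<in>carrier G. c g \<in> grade Y g) \<and> (\<forall>g. g \<notin> carrier G \<longrightarrow> c g = 0) \<and>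
    finite {g. c g \<noteq> 0} \<and> v = (\<Sum>g | c g \<noteq> 0. c g)"

definition fin_dim_yetter_drinfeld ::
    "'g monoid \<Rightarrow> ('g, 'v::ab_group_add) yd_module \<Rightarrow> bool"
  where "fin_dim_yetter_drinfeld G Y \<longleftrightarrow>
    group G \<and> vector_space (scale Y) \<and> module.subspace (scale Y) (vspace Y) \<and>
    (\<exists>S. finite S \<and> S \<subseteq> vspace Y \<and> vspace Y \<subseteq> module.span (scale Y) S) \<and>
    (\<forall>g\<in>carrier G. \<forall>v\<in>vspace Y. act Y g v \<in> vspace Y) \<and>
    (\<forall>g\<in>carrier G. \<forall>v\<in>vspace Y. \<forall>w\<in>vspace Y. act Y g (v + w) = act Y g v + act Y g w) \<and>
    (\<forall>g\<in>carrier G. \<forall>c. \<forall>v\<in>vspace Y. act Y g (scale Y c v) = scale Y c (act Y g v)) \<and>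
    (\<forall>v\<in>vspace Y. act Y \<one>\<^bsub>G\<^esub> v = v) \<and>
    (\<forall>g\<in>carrier G. \<forall>h\<in>carrier G. \<forall>v\<in>vspace Y. act Y (g \<otimes>\<^bsub>G\<^esub> h) v = act Y g (act Y h v)) \<and>
    (\<forall>g\<in>carrier G. module.subspace (scale Y) (grade Y g) \<and> grade Y g \<subseteq> vspace Y) \<and>
    (\<forall>v\<in>vspace Y. \<exists>!c. decomposition G Y v c) \<and>
    (\<forall>g\<in>carrier G. \<forall>h\<in>carrier G. act Y g ` grade Y h = grade Y (g \<otimes>\<^bsub>G\<^esub> h \<otimes>\<^bsub>G\<^esub> inv\<^bsub>G\<^esub> g))"

definition component :: "'g monoid \<Rightarrow> ('g, 'v::ab_group_add) yd_module \<Rightarrow> 'v \<Rightarrow> 'g \<Rightarrow> 'v"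
  where "component G Y v = (THE c. decomposition G Y v c)"

text \<open>
  Functionals are extended by \<open>0\<close> outside \<open>vspace Y\<close>. The dual of the component of degree \<open>h\<close> is
  the space of functionals that vanish on all other components.
\<close>

definition dual :: "'g monoid \<Rightarrow> ('g, 'v::ab_group_add) yd_module \<Rightarrow> ('g, 'v \<Rightarrow> complex) yd_module"
  where "dual G Y = (let D = {f.
        (\<forall>v. v \<notin> vspace Y \<longrightarrow> f v = 0) \<and>
        (\<forall>v\<in>vspace Y. \<forall>w\<in>vspace Y. f (v + w) = f v + f w) \<and>
        (\<forall>c. \<forall>v\<in>vspace Y. f (scale Y c v) = c * f v)} in
    \<lparr>scale = (\<lambda>c f v. c * f v),
     vspace = D,
     act = (\<lambda>g f v. if v \<in> vspace Y then f (act Y (inv\<^bsub>G\<^esub> g) v) else 0),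
     grade = (\<lambda>g. {f \<in> D. \<forall>h\<in>carrier G. h \<noteq> inv\<^bsub>G\<^esub> g \<longrightarrow> (\<forall>v\<in>grade Y h. f v = 0)})\<rparr>)"

text \<open>
  The tensor algebras are written in terms of a basis of homogeneous vectors of \<open>Y\<close> and the dual
  basis of its dual.
\<close>

definition hom_basis :: "'g monoid \<Rightarrow> ('g, 'v::ab_group_add) yd_module \<Rightarrow> 'v set"
  where "hom_basis G Y = (SOME B. \<not> module.dependent (scale Y) B \<and>
    module.span (scale Y) B = vspace Y \<and> B \<subseteq> (\<Union>g\<in>carrier G. grade Y g))"

definition dual_basis :: "'g monoid \<Rightarrow> ('g, 'v::ab_group_add) yd_module \<Rightarrow> ('v \<Rightarrow> complex) set"
  where "dual_basis G Y =
    (\<lambda>b v. module.representation (scale Y) (hom_basis G Y) v b) ` hom_basis G Y"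

definition yd_degree :: "'g monoid \<Rightarrow> ('g, 'v) yd_module \<Rightarrow> 'v \<Rightarrow> 'g"
  where "yd_degree G Y v = (THE g. g \<in> carrier G \<and> v \<in> grade Y g)"

text \<open>The braiding, for a basis \<open>B\<close> of homogeneous vectors.\<close>

definition braiding ::
    "'g monoid \<Rightarrow> ('g, 'v::ab_group_add) yd_module \<Rightarrow> 'v set \<Rightarrow> 'v \<Rightarrow> 'v \<Rightarrow> 'v list \<Rightarrow> complex"
  where "braiding G Y B b c =
    vec (scale Y) B (act Y (yd_degree G Y b) c) \<otimes>\<^bsub>tensor_algebra B\<^esub> delta [b]"

abbreviation \<Psi>\<^sub>Y :: "'g monoid \<Rightarrow> ('g, 'v::ab_group_add) yd_module \<Rightarrow> 'v \<Rightarrow> 'v \<Rightarrow> 'v list \<Rightarrow> complex"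
  where "\<Psi>\<^sub>Y G Y \<equiv> braiding G Y (hom_basis G Y)"

abbreviation \<Psi>\<^sub>D :: "'g monoid \<Rightarrow> ('g, 'v::ab_group_add) yd_module \<Rightarrow>
    ('v \<Rightarrow> complex) \<Rightarrow> ('v \<Rightarrow> complex) \<Rightarrow> ('v \<Rightarrow> complex) list \<Rightarrow> complex"
  where "\<Psi>\<^sub>D G Y \<equiv> braiding G (dual G Y) (dual_basis G Y)"


section \<open>The braided Heisenberg double\<close>

text \<open>
  The disjoint union of the bases of \<open>Y\<close> and of its dual is a basis of their direct sum.
\<close>

type_synonym 'v sum_tensors = "('v + ('v \<Rightarrow> complex)) list \<Rightarrow> complex"

definition sum_algebra ::
    "'g monoid \<Rightarrow> ('g, 'v::ab_group_add) yd_module \<Rightarrow> (complex, 'v sum_tensors) module"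
  where "sum_algebra G Y = tensor_algebra (hom_basis G Y <+> dual_basis G Y)"

definition inc_Y ::
    "'g monoid \<Rightarrow> ('g, 'v::ab_group_add) yd_module \<Rightarrow> ('v list \<Rightarrow> complex) \<Rightarrow> 'v sum_tensors"
  where "inc_Y G Y = extend_hom (sum_algebra G Y) (\<lambda>b. delta [Inl b])"

definition inc_D ::
    "'g monoid \<Rightarrow> ('g, 'v::ab_group_add) yd_module \<Rightarrow>
     (('v \<Rightarrow> complex) list \<Rightarrow> complex) \<Rightarrow> 'v sum_tensors"
  where "inc_D G Y = extend_hom (sum_algebra G Y) (\<lambda>b. delta [Inr b])"

definition sum_vec :: "'g monoid \<Rightarrow> ('g, 'v::ab_group_add) yd_module \<Rightarrow> 'v \<Rightarrow> 'v sum_tensors"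
  where "sum_vec G Y v = inc_Y G Y (vec (scale Y) (hom_basis G Y) v)"

definition sum_covec ::
    "'g monoid \<Rightarrow> ('g, 'v::ab_group_add) yd_module \<Rightarrow> ('v \<Rightarrow> complex) \<Rightarrow> 'v sum_tensors"
  where "sum_covec G Y f = inc_D G Y (vec (scale (dual G Y)) (dual_basis G Y) f)"

definition sum_act ::
    "'g monoid \<Rightarrow> ('g, 'v::ab_group_add) yd_module \<Rightarrow> 'g \<Rightarrow> 'v sum_tensors \<Rightarrow> 'v sum_tensors"
  where "sum_act G Y g = extend_hom (sum_algebra G Y)
    (case_sum (\<lambda>b. sum_vec G Y (act Y g b)) (\<lambda>b. sum_covec G Y (act (dual G Y) g b)))"

definition big_algebra ::
    "'g monoid \<Rightarrow> ('g, 'v::ab_group_add) yd_module \<Rightarrow> (complex, 'g \<Rightarrow> 'v sum_tensors) module"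
  where "big_algebra G Y = crossed_product (sum_algebra G Y) G (sum_act G Y)"

definition big_inc ::
    "'g monoid \<Rightarrow> ('g, 'v::ab_group_add) yd_module \<Rightarrow> 'v sum_tensors \<Rightarrow> 'g \<Rightarrow> 'v sum_tensors"
  where "big_inc G Y p = crossed (sum_algebra G Y) p \<one>\<^bsub>G\<^esub>"

text \<open>The element \<open>\<langle>f, v\<^sup>(\<^sup>0\<^sup>)\<rangle> v\<^sup>(\<^sup>1\<^sup>)\<close> of the group algebra.\<close>

definition pairing_term :: "'g monoid \<Rightarrow> ('g, 'v::ab_group_add) yd_module \<Rightarrow>
    ('v \<Rightarrow> complex) \<Rightarrow> 'v \<Rightarrow> 'g \<Rightarrow> 'v sum_tensors"
  where "pairing_term G Y f v = (\<lambda>g. if g \<in> carrier G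
    then f (component G Y v g) \<odot>\<^bsub>sum_algebra G Y\<^esub> \<one>\<^bsub>sum_algebra G Y\<^esub>
    else \<zero>\<^bsub>sum_algebra G Y\<^esub>)"

definition heisenberg_relations ::
    "'g monoid \<Rightarrow> ('g, 'v::ab_group_add) yd_module \<Rightarrow> ('g \<Rightarrow> 'v sum_tensors) set"
  where "heisenberg_relations G Y = (let T = big_algebra G Y in
    big_inc G Y ` inc_Y G Y ` nichols_ideal (hom_basis G Y) (\<Psi>\<^sub>Y G Y) \<union>
    big_inc G Y ` inc_D G Y ` nichols_ideal (dual_basis G Y) (flip_conj (\<Psi>\<^sub>D G Y)) \<union>
    {big_inc G Y (sum_covec G Y f) \<otimes>\<^bsub>T\<^esub> big_inc G Y (sum_vec G Y v)
       \<ominus>\<^bsub>T\<^esub> big_inc G Y (sum_vec G Y v) \<otimes>\<^bsub>T\<^esub> big_inc G Y (sum_covec G Y f)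
       \<ominus>\<^bsub>T\<^esub> pairing_term G Y f v | f v. f \<in> vspace (dual G Y) \<and> v \<in> vspace Y})"

definition heisenberg_ideal ::
    "'g monoid \<Rightarrow> ('g, 'v::ab_group_add) yd_module \<Rightarrow> ('g \<Rightarrow> 'v sum_tensors) set"
  where "heisenberg_ideal G Y = Idl\<^bsub>big_algebra G Y\<^esub> (heisenberg_relations G Y)"

definition heisenberg_double ::
    "'g monoid \<Rightarrow> ('g, 'v::ab_group_add) yd_module \<Rightarrow>
     (complex, ('g \<Rightarrow> 'v sum_tensors) set) module"
  where "heisenberg_double G Y = quotient (big_algebra G Y) (heisenberg_ideal G Y)"

definition heis_vec ::
    "'g monoid \<Rightarrow> ('g, 'v::ab_group_add) yd_module \<Rightarrow> 'v \<Rightarrow> ('g \<Rightarrow> 'v sum_tensors) set"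
  where "heis_vec G Y v =
    heisenberg_ideal G Y +>\<^bsub>big_algebra G Y\<^esub> big_inc G Y (sum_vec G Y v)"

definition heis_covec ::
    "'g monoid \<Rightarrow> ('g, 'v::ab_group_add) yd_module \<Rightarrow> ('v \<Rightarrow> complex) \<Rightarrow>
     ('g \<Rightarrow> 'v sum_tensors) set"
  where "heis_covec G Y f =
    heisenberg_ideal G Y +>\<^bsub>big_algebra G Y\<^esub> big_inc G Y (sum_covec G Y f)"

definition heis_grp ::
    "'g monoid \<Rightarrow> ('g, 'v::ab_group_add) yd_module \<Rightarrow> 'g \<Rightarrow> ('g \<Rightarrow> 'v sum_tensors) set"
  where "heis_grp G Y g =
    heisenberg_ideal G Y +>\<^bsub>big_algebra G Y\<^esub> crossed (sum_algebra G Y) \<one>\<^bsub>sum_algebra G Y\<^esub> g"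


section \<open>The braided Weyl algebra\<close>

type_synonym 'v weyl_elem =
  "(('v list \<Rightarrow> complex) set \<times> (('v \<Rightarrow> complex) list \<Rightarrow> complex) set \<Rightarrow> complex) set"

abbreviation nichols_Y ::
    "'g monoid \<Rightarrow> ('g, 'v::ab_group_add) yd_module \<Rightarrow> (complex, ('v list \<Rightarrow> complex) set) module"
  where "nichols_Y G Y \<equiv> nichols_algebra (hom_basis G Y) (\<Psi>\<^sub>Y G Y)"

abbreviation nichols_D ::
    "'g monoid \<Rightarrow> ('g, 'v::ab_group_add) yd_module \<Rightarrow>
     (complex, (('v \<Rightarrow> complex) list \<Rightarrow> complex) set) module"
  where "nichols_D G Y \<equiv> nichols_algebra (dual_basis G Y) (\<Psi>\<^sub>D G Y)"

text \<open>The subspaces \<open>\<B>(Y) \<otimes> 1\<close> and \<open>1 \<otimes> \<B>(Y\<^sup>*)\<close> of \<open>\<B>(Y) \<otimes> \<B>(Y\<^sup>*)\<close>, and the generators in them.\<close>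

definition weyl_left :: "'g monoid \<Rightarrow> ('g, 'v::ab_group_add) yd_module \<Rightarrow>
    ('v list \<Rightarrow> complex) set \<Rightarrow> 'v weyl_elem"
  where "weyl_left G Y a = tensor (nichols_Y G Y) (nichols_D G Y) a \<one>\<^bsub>nichols_D G Y\<^esub>"

definition weyl_right :: "'g monoid \<Rightarrow> ('g, 'v::ab_group_add) yd_module \<Rightarrow>
    (('v \<Rightarrow> complex) list \<Rightarrow> complex) set \<Rightarrow> 'v weyl_elem"
  where "weyl_right G Y b = tensor (nichols_Y G Y) (nichols_D G Y) \<one>\<^bsub>nichols_Y G Y\<^esub> b"

definition weyl_vec :: "'g monoid \<Rightarrow> ('g, 'v::ab_group_add) yd_module \<Rightarrow> 'v \<Rightarrow> 'v weyl_elem"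
  where "weyl_vec G Y v = weyl_left G Y
    (nichols_ideal (hom_basis G Y) (\<Psi>\<^sub>Y G Y)
      +>\<^bsub>tensor_algebra (hom_basis G Y)\<^esub> vec (scale Y) (hom_basis G Y) v)"

definition weyl_covec ::
    "'g monoid \<Rightarrow> ('g, 'v::ab_group_add) yd_module \<Rightarrow> ('v \<Rightarrow> complex) \<Rightarrow> 'v weyl_elem"
  where "weyl_covec G Y f = weyl_right G Y
    (nichols_ideal (dual_basis G Y) (\<Psi>\<^sub>D G Y)
      +>\<^bsub>tensor_algebra (dual_basis G Y)\<^esub> vec (scale (dual G Y)) (dual_basis G Y) f)"

definition weyl_with ::
    "'g monoid \<Rightarrow> ('g, 'v::ab_group_add) yd_module \<Rightarrow>
     ('v weyl_elem \<Rightarrow> 'v weyl_elem \<Rightarrow> 'v weyl_elem) \<Rightarrow> (complex, 'v weyl_elem) module"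
  where "weyl_with G Y m = (tensor_space (nichols_Y G Y) (nichols_D G Y))
    \<lparr>monoid.mult := m,
     one := tensor (nichols_Y G Y) (nichols_D G Y) \<one>\<^bsub>nichols_Y G Y\<^esub> \<one>\<^bsub>nichols_D G Y\<^esub>\<rparr>"

definition is_weyl_mult ::
    "'g monoid \<Rightarrow> ('g, 'v::ab_group_add) yd_module \<Rightarrow>
     ('v weyl_elem \<Rightarrow> 'v weyl_elem \<Rightarrow> 'v weyl_elem) \<Rightarrow> bool"
  where "is_weyl_mult G Y m \<longleftrightarrow> (let W = weyl_with G Y m in
    complex_algebra W \<and>
    (\<forall>a\<in>carrier (nichols_Y G Y). \<forall>a'\<in>carrier (nichols_Y G Y).
      weyl_left G Y a \<otimes>\<^bsub>W\<^esub> weyl_left G Y a' = weyl_left G Y (a \<otimes>\<^bsub>nichols_Y G Y\<^esub> a')) \<and>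
    (\<forall>b\<in>carrier (nichols_D G Y). \<forall>b'\<in>carrier (nichols_D G Y).
      weyl_right G Y b \<otimes>\<^bsub>W\<^esub> weyl_right G Y b' = weyl_right G Y (b \<otimes>\<^bsub>nichols_D G Y\<^esub> b')) \<and>
    (\<forall>a\<in>carrier (nichols_Y G Y). \<forall>b\<in>carrier (nichols_D G Y).
      weyl_left G Y a \<otimes>\<^bsub>W\<^esub> weyl_right G Y b = tensor (nichols_Y G Y) (nichols_D G Y) a b) \<and>
    (\<forall>g\<in>carrier G. \<forall>f\<in>grade (dual G Y) g. \<forall>v\<in>vspace Y.
      weyl_covec G Y f \<otimes>\<^bsub>W\<^esub> weyl_vec G Y v
        \<ominus>\<^bsub>W\<^esub> weyl_vec G Y (act Y g v) \<otimes>\<^bsub>W\<^esub> weyl_covec G Y f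
      = f v \<odot>\<^bsub>W\<^esub> \<one>\<^bsub>W\<^esub>))"

text \<open>
  The conditions determine the multiplication on the carrier, and likewise an algebra automorphism
  on the generators determines it on the carrier; the choice only concerns values outside it.
\<close>

definition weyl_algebra ::
    "'g monoid \<Rightarrow> ('g, 'v::ab_group_add) yd_module \<Rightarrow> (complex, 'v weyl_elem) module"
  where "weyl_algebra G Y = weyl_with G Y (SOME m. is_weyl_mult G Y m)"

definition weyl_act ::
    "'g monoid \<Rightarrow> ('g, 'v::ab_group_add) yd_module \<Rightarrow> 'g \<Rightarrow> 'v weyl_elem \<Rightarrow> 'v weyl_elem"
  where "weyl_act G Y g = (SOME \<alpha>. algebra_iso (weyl_algebra G Y) (weyl_algebra G Y) \<alpha> \<and>
    (\<forall>v\<in>vspace Y. \<alpha> (weyl_vec G Y v) = weyl_vec G Y (act Y g v)) \<and>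
    (\<forall>f\<in>vspace (dual G Y). \<alpha> (weyl_covec G Y f) = weyl_covec G Y (act (dual G Y) g f)))"

definition weyl_crossed ::
    "'g monoid \<Rightarrow> ('g, 'v::ab_group_add) yd_module \<Rightarrow> (complex, 'g \<Rightarrow> 'v weyl_elem) module"
  where "weyl_crossed G Y = crossed_product (weyl_algebra G Y) G (weyl_act G Y)"

end

theory Submission
  imports Defs "HOL-Combinatorics.Multiset_Permutations"
begin

text \<open>
Let \<open>x\<close> be the degree of \<open>f \<in> Y\<^sup>*\<close>. Multiplying the relation \<open>f v = v f + \<langle>f, v\<^sup>(\<^sup>0\<^sup>)\<rangle> v\<^sup>(\<^sup>1\<^sup>)\<close> of the Heisenberg double by \<open>x\<close>
 from the left gives \<open>(x f) v = (x \<triangleright> v) (x f) + \<langle>f, v\<rangle>\<close>, because \<open>f\<close> pairs only with vectors of degree \<open>x\<inverse>\<close>, and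
 for these \<open>x v\<^sup>(\<^sup>1\<^sup>) = 1\<close>. This is the cross relation of the braided Weyl algebra. So the substitution
 \<open>f \<mapsto> x f\<close>, which \<open>x \<in> G\<close> makes invertible, should exchange two presentations by \<open>Y\<close>, \<open>G\<close> and \<open>Y\<^sup>*\<close>. It
 must also exchange the relations within \<open>Y\<^sup>*\<close>. One has \<open>x\<^sub>1f\<^sub>1 \<dots> x\<^sub>nf\<^sub>n = x\<^sub>1 \<dots> x\<^sub>n \<Theta>(f\<^sub>1 \<otimes> \<dots> \<otimes> f\<^sub>n)\<close>
 for a bijective operator \<open>\<Theta>\<close> on tensors (\<open>untwist\<close> below) that carries \<open>\<Psi>\<^sup>*\<close> to \<open>\<tau>\<Psi>\<^sup>*\<tau>\<close> (\<open>untwist_braid\<close>),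
 hence the Nichols ideal of the one to that of the other (\<open>nichols_ideal_flip\<close>). Therefore
 \<open>heisenberg_to_weyl\<close> and \<open>weyl_to_heisenberg\<close> turn realizations of one presentation into
 realizations of the other. As both algebras are universal for their presentations
 (\<open>heisenberg_universal\<close>, \<open>weyl_crossed_universal\<close>), this gives homomorphisms in both directions, which are
 mutually inverse because they are so on generators.

 For the Heisenberg double universality is immediate. The braided Weyl algebra is given as a
 vector space \<open>V = \<B>(Y) \<otimes> \<B>(Y\<^sup>*)\<close> with a multiplication that has to be shown to exist. Its regular representation
 can be written down: \<open>v\<close> multiplies the first factor, and \<open>f\<close> of degree \<open>x\<close> acts by
 \<open>f (a \<otimes> c) = x \<triangleright> \<partial>\<^sub>fa \<otimes> c + (x \<triangleright> a) \<otimes> f c\<close> with a skew derivation \<open>\<partial>\<^sub>f\<close> of \<open>\<B>(Y)\<close>. Every module over the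
 relations receives a unique map from \<open>V\<close> that sends \<open>1 \<otimes> 1\<close> to a prescribed vector
 (\<open>regular_universal\<close>, \<open>regular_unique\<close>); for \<open>V\<close> itself these maps are the right multiplications, and
 this gives existence (\<open>weyl_ok_exists\<close>), uniqueness, and the universal property (\<open>weyl_lift\<close>).

 Two facts about Nichols algebras enter: the skew derivations must preserve the Nichols ideal of
 \<open>Y\<close>, and the Nichols ideal of \<open>Y\<^sup>*\<close> must act on \<open>V\<close> by zero. Both follow once \<open>[n]!\<close> is written as a
 product of creation operators, \<open>[n]! (v\<^sub>1 \<otimes> \<dots> \<otimes> v\<^sub>n) = L(v\<^sub>1) \<dots> L(v\<^sub>n) 1\<close>, where \<open>L(v)\<close> inserts \<open>v\<close> at all
 positions of a tensor and lets its degree act on the factors that it jumps over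
 (\<open>nichols_ideal_kern\<close>): the operator that deletes the last letter satisfies a simple commutation
 relation with \<open>L(v)\<close> (\<open>create_snoc\<close>). The defining formula, a sum over reduced expressions, reduces to this
 one because a reduced expression never interchanges the same two factors twice
 (\<open>braid_word_strand\<close>).

 Everything is computed in coordinates with respect to a basis of homogeneous vectors.
\<close>

section \<open>Linear algebra over the complex numbers on records\<close>

abbreviation vspc :: "(complex, 'a) module => bool"
 where "vspc A \<equiv> module CC A"

lemma carrier_CC [simp]: "carrier CC = UNIV"
 and add_CC [simp]: "a \<oplus>\<^bsub>CC\<^esub> b = a + b"
 and mult_CC [simp]: "a \<otimes>\<^bsub>CC\<^esub> b = a * b"
 and zero_CC [simp]: "\<zero>\<^bsub>CC\<^esub> = 0"
 and one_CC [simp]: "\<one>\<^bsub>CC\<^esub> = 1"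
 by (simp_all add: ring_of_type_algebra_def)

lemma vspcI:
 fixes A (structure)
 assumes "abelian_group A"
  and "!!c x. x \<in> carrier A ==> c \<odot> x \<in> carrier A"
  and "!!c d x. x \<in> carrier A ==> (c + d) \<odot> x = c \<odot> x \<oplus> d \<odot> x"
  and "!!c x y. x \<in> carrier A ==> y \<in> carrier A ==>
      c \<odot> (x \<oplus> y) = c \<odot> x \<oplus> c \<odot> y"
  and "!!c d x. x \<in> carrier A ==> (c * d) \<odot> x = c \<odot> (d \<odot> x)"
  and "!!x. x \<in> carrier A ==> 1 \<odot> x = x"
 shows "vspc A"
 by (rule moduleI) (use assms in \<open>auto intro: cring_from_type_algebra\<close>)

lemma vspc_abelian: "vspc A ==> abelian_group A"
 by (simp add: module_def)

lemma vspc_simps [simp]: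
 fixes A (structure)
 assumes "vspc A"
 shows "\<zero> \<in> carrier A"
  and "x \<in> carrier A ==> y \<in> carrier A ==> x \<oplus> y \<in> carrier A"
  and "x \<in> carrier A ==> c \<odot> x \<in> carrier A"
  and "x \<in> carrier A ==> \<ominus> x \<in> carrier A"
  and "x \<in> carrier A ==> y \<in> carrier A ==> x \<ominus> y \<in> carrier A"
  and "x \<in> carrier A ==> \<zero> \<oplus> x = x"
  and "x \<in> carrier A ==> x \<oplus> \<zero> = x"
  and "x \<in> carrier A ==> 0 \<odot> x = \<zero>"
  and "c \<odot> \<zero> = \<zero>"
  and "x \<in> carrier A ==> 1 \<odot> x = x"
  and "x \<in> carrier A ==> x \<oplus> \<ominus> x = \<zero>"
  and "x \<in> carrier A ==> \<ominus> x \<oplus> x = \<zero>"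
  and "x \<in> carrier A ==> x \<ominus> x = \<zero>"
  and "x \<in> carrier A ==> c \<odot> (d \<odot> x) = (c * d) \<odot> x"
proof -
 interpret A: module CC A by (fact assms)
 show "\<zero> \<in> carrier A"
  and "x \<in> carrier A ==> y \<in> carrier A ==> x \<oplus> y \<in> carrier A"
  and "x \<in> carrier A ==> c \<odot> x \<in> carrier A"
  and "x \<in> carrier A ==> \<ominus> x \<in> carrier A"
  and "x \<in> carrier A ==> y \<in> carrier A ==> x \<ominus> y \<in> carrier A"
  and "x \<in> carrier A ==> \<zero> \<oplus> x = x"
  and "x \<in> carrier A ==> x \<oplus> \<zero> = x"
  and "x \<in> carrier A ==> x \<oplus> \<ominus> x = \<zero>"
  and "x \<in> carrier A ==> \<ominus> x \<oplus> x = \<zero>"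
  and "x \<in> carrier A ==> x \<ominus> x = \<zero>"
  by (simp_all add: A.M.r_neg A.M.l_neg A.M.minus_eq)
 show "x \<in> carrier A ==> 0 \<odot> x = \<zero>"
  using A.smult_l_null by simp
 show "c \<odot> \<zero> = \<zero>"
  using A.smult_r_null by simp
 show "x \<in> carrier A ==> 1 \<odot> x = x"
  using A.smult_one by simp
 show "x \<in> carrier A ==> c \<odot> (d \<odot> x) = (c * d) \<odot> x"
  using A.smult_assoc1 by simp
qed

lemma
 fixes A (structure)
 assumes "vspc A"
 shows vspc_comm: "x \<in> carrier A ==> y \<in> carrier A ==> x \<oplus> y = y \<oplus> x"
  and vspc_assoc: "x \<in> carrier A ==> y \<in> carrier A ==> z \<in> carrier A ==>
     x \<oplus> y \<oplus> z = x \<oplus> (y \<oplus> z)"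
  and vspc_left_comm: "x \<in> carrier A ==> y \<in> carrier A ==> z \<in> carrier A ==>
     x \<oplus> (y \<oplus> z) = y \<oplus> (x \<oplus> z)"
  and vspc_distl: "x \<in> carrier A ==> (c + d) \<odot> x = c \<odot> x \<oplus> d \<odot> x"
  and vspc_distr: "x \<in> carrier A ==> y \<in> carrier A ==>
     c \<odot> (x \<oplus> y) = c \<odot> x \<oplus> c \<odot> y"
  and vspc_neg: "x \<in> carrier A ==> \<ominus> x = (- 1) \<odot> x"
  and vspc_minus: "x \<in> carrier A ==> y \<in> carrier A ==> x \<ominus> y = x \<oplus> (- 1) \<odot> y"
  and vspc_eqI: "x \<in> carrier A ==> y \<in> carrier A ==> x \<ominus> y = \<zero> ==> x = y"
proof -
 interpret A: module CC A by (fact assms)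
 show "x \<in> carrier A ==> y \<in> carrier A ==> x \<oplus> y = y \<oplus> x"
  and "x \<in> carrier A ==> y \<in> carrier A ==> z \<in> carrier A ==>
     x \<oplus> y \<oplus> z = x \<oplus> (y \<oplus> z)"
  and "x \<in> carrier A ==> y \<in> carrier A ==> z \<in> carrier A ==>
     x \<oplus> (y \<oplus> z) = y \<oplus> (x \<oplus> z)"
  by (simp_all add: A.M.a_ac)
 show "x \<in> carrier A ==> (c + d) \<odot> x = c \<odot> x \<oplus> d \<odot> x"
  using A.smult_l_distr by simp
 show "x \<in> carrier A ==> y \<in> carrier A ==>
     c \<odot> (x \<oplus> y) = c \<odot> x \<oplus> c \<odot> y"
  using A.smult_r_distr by simp
 show neg: "x \<in> carrier A ==> \<ominus> x = (- 1) \<odot> x" for x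
 proof -
  assume x: "x \<in> carrier A"
  have "x \<oplus> (- 1) \<odot> x = (1 + (- 1)) \<odot> x"
   using A.smult_l_distr[of 1 "- 1" x] A.smult_one[OF x] x by simp
  then have "x \<oplus> (- 1) \<odot> x = \<zero>"
   using vspc_simps(8)[OF assms x] by simp
  then show ?thesis
   using x vspc_simps(3)[OF assms x] by (metis A.M.add.inv_comm A.M.minus_equality)
 qed
 show "x \<in> carrier A ==> y \<in> carrier A ==> x \<ominus> y = x \<oplus> (- 1) \<odot> y"
  by (simp add: A.M.minus_eq neg)
 show "x \<in> carrier A ==> y \<in> carrier A ==> x \<ominus> y = \<zero> ==> x = y"
  by (metis A.M.minus_eq A.M.minus_equality A.M.minus_minus A.M.a_inv_closed)
qed

lemma finsum_closed' [simp]: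
 assumes "vspc A" "!!x. x \<in> E ==> f x \<in> carrier A"
 shows "finsum A f E \<in> carrier A"
proof -
 interpret A: module CC A by (fact assms)
 show ?thesis using assms(2) by (intro A.M.finsum_closed) auto
qed

subsection \<open>Linear maps and algebra homomorphisms\<close>

definition lin :: "(complex, 'a) module => (complex, 'b) module => ('a => 'b) => bool"
 where "lin A B h \<longleftrightarrow> (\<forall>x\<in>carrier A. h x \<in> carrier B) \<and>
  (\<forall>x\<in>carrier A. \<forall>y\<in>carrier A. h (x \<oplus>\<^bsub>A\<^esub> y) = h x \<oplus>\<^bsub>B\<^esub> h y) \<and>
  (\<forall>c. \<forall>x\<in>carrier A. h (c \<odot>\<^bsub>A\<^esub> x) = c \<odot>\<^bsub>B\<^esub> h x)"

definition alg_hom :: "(complex, 'a) module => (complex, 'b) module => ('a => 'b) => bool"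
 where "alg_hom A B h \<longleftrightarrow> lin A B h \<and> h \<one>\<^bsub>A\<^esub> = \<one>\<^bsub>B\<^esub> \<and>
  (\<forall>x\<in>carrier A. \<forall>y\<in>carrier A. h (x \<otimes>\<^bsub>A\<^esub> y) = h x \<otimes>\<^bsub>B\<^esub> h y)"

lemma linD:
 assumes "lin A B h"
 shows "x \<in> carrier A ==> h x \<in> carrier B"
  and "x \<in> carrier A ==> y \<in> carrier A ==> h (x \<oplus>\<^bsub>A\<^esub> y) = h x \<oplus>\<^bsub>B\<^esub> h y"
  and "x \<in> carrier A ==> h (c \<odot>\<^bsub>A\<^esub> x) = c \<odot>\<^bsub>B\<^esub> h x"
 using assms by (auto simp: lin_def)

lemma lin_zero: "lin A B h ==> vspc A ==> vspc B ==> h \<zero>\<^bsub>A\<^esub> = \<zero>\<^bsub>B\<^esub>"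
 using linD(3)[of A B h "\<zero>\<^bsub>A\<^esub>" 0] linD(1)[of A B h "\<zero>\<^bsub>A\<^esub>"] by simp

lemma lin_minus:
 assumes "lin A B h" "vspc A" "vspc B" "x \<in> carrier A" "y \<in> carrier A"
 shows "h (x \<ominus>\<^bsub>A\<^esub> y) = h x \<ominus>\<^bsub>B\<^esub> h y"
 using assms by (simp add: vspc_minus linD[of A B h])

lemma lin_comp: "lin A B h ==> lin B C k ==> lin A C (%x. k (h x))"
 by (simp add: lin_def)

lemma alg_homD:
 assumes "alg_hom A B h"
 shows "lin A B h"
  and "h \<one>\<^bsub>A\<^esub> = \<one>\<^bsub>B\<^esub>"
  and "x \<in> carrier A ==> y \<in> carrier A ==> h (x \<otimes>\<^bsub>A\<^esub> y) = h x \<otimes>\<^bsub>B\<^esub> h y"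
 using assms by (auto simp: alg_hom_def)

lemma alg_hom_comp: "alg_hom A B h ==> alg_hom B C k ==> alg_hom A C (%x. k (h x))"
 by (auto simp: alg_hom_def linD intro: lin_comp)

lemma lin_finsum:
 assumes "lin A B h" "vspc A" "vspc B" "!!x. x \<in> E ==> f x \<in> carrier A"
 shows "h (finsum A f E) = finsum B (%x. h (f x)) E"
proof (cases "finite E")
 case True
 interpret A: module CC A by (fact assms)
 interpret B: module CC B by (fact assms)
 show ?thesis
  using True assms(4)
 proof (induction E)
  case empty then show ?case by (simp add: lin_zero[OF assms(1-3)])
 next
  case (insert x F)
  then show ?case
   using linD[OF assms(1)] by (simp add: Pi_def)
 qed
next
 case False
 then show ?thesis
  by (simp add: finsum_def finprod_def lin_zero[OF assms(1-3), symmetric])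
qed

lemma finsum_add:
 assumes "vspc A" "!!x. x \<in> E ==> f x \<in> carrier A" "!!x. x \<in> E ==> g x \<in> carrier A"
 shows "finsum A (%x. f x \<oplus>\<^bsub>A\<^esub> g x) E = finsum A f E \<oplus>\<^bsub>A\<^esub> finsum A g E"
proof -
 interpret A: module CC A by (fact assms)
 show ?thesis using assms by (intro A.M.finsum_addf) auto
qed

lemma finsum_smult:
 fixes A (structure)
 assumes "vspc A" "!!x. x \<in> E ==> f x \<in> carrier A"
 shows "finsum A (%x. c \<odot> f x) E = c \<odot> finsum A f E"
proof -
 have "lin A A (%x. c \<odot> x)"
  using assms(1) by (simp add: lin_def vspc_distr mult.commute)
 from lin_finsum[OF this assms(1,1), of E f] show ?thesis using assms(2) by simp
qed

lemma finsum_cong_set: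
 assumes "vspc A" "finite E'" "E \<subseteq> E'" "!!x. x \<in> E' ==> x \<notin> E ==> f x = \<zero>\<^bsub>A\<^esub>"
  "!!x. x \<in> E ==> f x \<in> carrier A"
 shows "finsum A f E = finsum A f E'"
proof -
 interpret A: module CC A by (fact assms)
 have "f x \<in> carrier A" if "x \<in> E'" for x
  using assms(4)[OF that] assms(5) by (cases "x \<in> E") auto
 then show ?thesis using assms by (intro A.M.add.finprod_mono_neutral_cong_left) auto
qed

lemma finsum_cong1:
 assumes "vspc A" "!!x. x \<in> E ==> f x \<in> carrier A" "!!x. x \<in> E ==> f x = g x"
 shows "finsum A f E = finsum A g E"
proof -
 interpret A: module CC A by (fact assms)
 show ?thesis using assms by (intro A.M.finsum_cong') auto
qed

lemma finsum_single:
 assumes "vspc A" "finite E" "x \<in> E" "!!y. y \<in> E ==> y ~= x ==> f y = \<zero>\<^bsub>A\<^esub>" "f x \<in> carrier A"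
 shows "finsum A f E = f x"
proof -
 interpret A: module CC A by (fact assms)
 have "finsum A f {x} = finsum A f E"
  using assms by (intro finsum_cong_set) auto
 then show ?thesis using assms by simp
qed

lemma finsum_empty': "vspc A ==> finsum A f {} = \<zero>\<^bsub>A\<^esub>"
 using abelian_monoid.finsum_empty vspc_abelian abelian_group_def by blast

subsection \<open>Quotients\<close>

locale subsp =
 fixes A :: "(complex, 'a) module" (structure) and N :: "'a set"
 assumes vs [simp]: "vspc A" and sub: "submodule N CC A"
begin

sublocale A: module CC A by (rule vs)
sublocale N: submodule N CC A by (rule sub)
sublocale abelian_subgroup N A
 by (rule abelian_subgroupI3[OF additive_subgroup.intro[OF N.subgroup_axioms] vspc_abelian[OF vs]])

abbreviation cs ("\<lbrakk>_\<rbrakk>") where "\<lbrakk>x\<rbrakk> \<equiv> N +> x"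

lemma carrier_quotient: "carrier (quotient A N) = (%x. \<lbrakk>x\<rbrakk>) ` carrier A"
 by (auto simp: quotient_def FactRing_def A_RCOSETS_def')

lemma add_quotient: "x \<in> carrier A ==> y \<in> carrier A ==> \<lbrakk>x\<rbrakk> \<oplus>\<^bsub>quotient A N\<^esub> \<lbrakk>y\<rbrakk> = \<lbrakk>x \<oplus> y\<rbrakk>"
 by (simp add: quotient_def FactRing_def a_rcos_sum)

lemma zero_quotient: "\<zero>\<^bsub>quotient A N\<^esub> = \<lbrakk>\<zero>\<rbrakk>"
 using A.M.a_coset_add_zero[OF a_subset] by (simp add: quotient_def FactRing_def)

lemma coset_eq_iff:
 assumes "x \<in> carrier A" "y \<in> carrier A"
 shows "\<lbrakk>x\<rbrakk> = \<lbrakk>y\<rbrakk> \<longleftrightarrow> x \<ominus> y \<in> N"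
proof
 assume "\<lbrakk>x\<rbrakk> = \<lbrakk>y\<rbrakk>"
 then have "x \<in> \<lbrakk>y\<rbrakk>"
  using a_rcos_self[OF assms(1)] by simp
 then show "x \<ominus> y \<in> N"
  using a_rcos_module_imp[OF assms(2)] by (simp add: A.M.minus_eq)
next
 assume "x \<ominus> y \<in> N"
 then have "x \<in> \<lbrakk>y\<rbrakk>"
  using assms by (intro a_rcos_module_rev) (auto simp: A.M.minus_eq)
 then show "\<lbrakk>x\<rbrakk> = \<lbrakk>y\<rbrakk>"
  using a_repr_independence'[of x y] assms by simp
qed

lemma coset_zero_iff: "x \<in> carrier A ==> \<lbrakk>x\<rbrakk> = \<zero>\<^bsub>quotient A N\<^esub> \<longleftrightarrow> x \<in> N"
 by (simp add: zero_quotient coset_eq_iff vspc_minus)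

lemma smult_quotient:
 assumes "x \<in> carrier A"
 shows "c \<odot>\<^bsub>quotient A N\<^esub> \<lbrakk>x\<rbrakk> = \<lbrakk>c \<odot> x\<rbrakk>"
proof -
 have "\<lbrakk>c \<odot> y\<rbrakk> = \<lbrakk>c \<odot> x\<rbrakk>" if "y \<in> \<lbrakk>x\<rbrakk>" for y
 proof -
  have y: "y \<in> carrier A"
   using that assms a_elemrcos_carrier by blast
  have "y \<ominus> x \<in> N"
   using a_rcos_module_imp[OF assms that] by (simp add: A.M.minus_eq)
  then have "c \<odot> (y \<ominus> x) \<in> N"
   by simp
  moreover have "c \<odot> (y \<ominus> x) = c \<odot> y \<ominus> c \<odot> x"
   using y assms by (simp add: vspc_minus vspc_distr mult.commute)
  ultimately show ?thesis
   using y assms by (simp add: coset_eq_iff)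
 qed
 moreover have "\<lbrakk>x\<rbrakk> ~= {}" using a_rcos_self[OF assms] by blast
 ultimately have "(\<Union>y\<in>\<lbrakk>x\<rbrakk>. \<lbrakk>c \<odot> y\<rbrakk>) = \<lbrakk>c \<odot> x\<rbrakk>"
  by (intro SUP_eq_const) auto
 then show ?thesis by (simp add: quotient_def)
qed

lemma vspc_quotient: "vspc (quotient A N)"
proof (rule vspcI)
 show "abelian_group (quotient A N)"
 proof (rule abelian_groupI)
  fix S assume "S \<in> carrier (quotient A N)"
  then obtain x where "x \<in> carrier A" "S = \<lbrakk>x\<rbrakk>" by (auto simp: carrier_quotient)
  then show "\<exists>S'\<in>carrier (quotient A N). S' \<oplus>\<^bsub>quotient A N\<^esub> S = \<zero>\<^bsub>quotient A N\<^esub>"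
   by (intro bexI[of _ "\<lbrakk>\<ominus> x\<rbrakk>"])
    (auto simp: carrier_quotient add_quotient zero_quotient A.M.l_neg)
 qed (auto simp: carrier_quotient add_quotient zero_quotient vspc_assoc vspc_comm vspc_left_comm)
qed (auto simp: carrier_quotient add_quotient smult_quotient vspc_distl vspc_distr)

lemma lin_coset: "lin A (quotient A N) (%x. \<lbrakk>x\<rbrakk>)"
 by (auto simp: lin_def carrier_quotient add_quotient smult_quotient)

text \<open>The universal property of a quotient: the value on a coset is read off from any representative.\<close>

lemma descend:
 assumes "vspc B" "lin A B h" "!!x. x \<in> N ==> h x = \<zero>\<^bsub>B\<^esub>"
 shows "\<exists>h'. lin (quotient A N) B h' \<and> (\<forall>x\<in>carrier A. h' \<lbrakk>x\<rbrakk> = h x)"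
proof -
 define h' where "h' S = h (SOME x. x \<in> carrier A \<and> \<lbrakk>x\<rbrakk> = S)" for S
 have h': "h' \<lbrakk>x\<rbrakk> = h x" if x: "x \<in> carrier A" for x
 proof -
  define y where "y = (SOME y. y \<in> carrier A \<and> \<lbrakk>y\<rbrakk> = \<lbrakk>x\<rbrakk>)"
  have y: "y \<in> carrier A" "\<lbrakk>y\<rbrakk> = \<lbrakk>x\<rbrakk>"
   unfolding y_def using someI[of "%y. y \<in> carrier A \<and> \<lbrakk>y\<rbrakk> = \<lbrakk>x\<rbrakk>" x] x by auto
  then have "h (y \<ominus> x) = \<zero>\<^bsub>B\<^esub>"
   using x assms(3) by (simp add: coset_eq_iff)
  then have "h y \<ominus>\<^bsub>B\<^esub> h x = \<zero>\<^bsub>B\<^esub>"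
   using lin_minus[OF assms(2) vs assms(1) y(1) x] by simp
  then have "h y = h x"
   using vspc_eqI[OF assms(1)] linD[OF assms(2)] x y by auto
  then show ?thesis by (simp add: h'_def y_def)
 qed
 then have "lin (quotient A N) B h'"
  using linD[OF assms(2)]
  by (auto simp: lin_def carrier_quotient add_quotient smult_quotient)
 with h' show ?thesis by blast
qed

end

subsection \<open>Complex algebras\<close>

lemma complex_algebra_ring: "complex_algebra A ==> ring A"
 unfolding complex_algebra_def by blast

lemma complex_algebra_vspc [simp]: "complex_algebra A ==> vspc A"
 unfolding complex_algebra_def by blast

lemma complex_algebra_simps [simp]:
 fixes A (structure)
 assumes "complex_algebra A"
 shows "\<one> \<in> carrier A"
  and "x \<in> carrier A ==> y \<in> carrier A ==> x \<otimes> y \<in> carrier A"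
  and "x \<in> carrier A ==> \<one> \<otimes> x = x"
  and "x \<in> carrier A ==> x \<otimes> \<one> = x"
  and "x \<in> carrier A ==> \<zero> \<otimes> x = \<zero>"
  and "x \<in> carrier A ==> x \<otimes> \<zero> = \<zero>"
  and "x \<in> carrier A ==> y \<in> carrier A ==> (c \<odot> x) \<otimes> y = c \<odot> (x \<otimes> y)"
  and "x \<in> carrier A ==> y \<in> carrier A ==> x \<otimes> (c \<odot> y) = c \<odot> (x \<otimes> y)"
proof -
 interpret A: ring A by (rule complex_algebra_ring[OF assms])
 show "\<one> \<in> carrier A"
  and "x \<in> carrier A ==> y \<in> carrier A ==> x \<otimes> y \<in> carrier A"
  and "x \<in> carrier A ==> \<one> \<otimes> x = x"
  and "x \<in> carrier A ==> x \<otimes> \<one> = x"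
  and "x \<in> carrier A ==> \<zero> \<otimes> x = \<zero>"
  and "x \<in> carrier A ==> x \<otimes> \<zero> = \<zero>"
  by simp_all
 show "x \<in> carrier A ==> y \<in> carrier A ==> (c \<odot> x) \<otimes> y = c \<odot> (x \<otimes> y)"
  and "x \<in> carrier A ==> y \<in> carrier A ==> x \<otimes> (c \<odot> y) = c \<odot> (x \<otimes> y)"
  using assms unfolding complex_algebra_def by blast+
qed

lemma
 fixes A (structure)
 assumes "complex_algebra A"
 shows algebra_assoc: "x \<in> carrier A ==> y \<in> carrier A ==> z \<in> carrier A ==>
     x \<otimes> y \<otimes> z = x \<otimes> (y \<otimes> z)"
  and algebra_distl: "x \<in> carrier A ==> y \<in> carrier A ==> z \<in> carrier A ==>
     (x \<oplus> y) \<otimes> z = x \<otimes> z \<oplus> y \<otimes> z"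
  and algebra_distr: "x \<in> carrier A ==> y \<in> carrier A ==> z \<in> carrier A ==>
     x \<otimes> (y \<oplus> z) = x \<otimes> y \<oplus> x \<otimes> z"
proof -
 interpret A: ring A by (rule complex_algebra_ring[OF assms])
 show "x \<in> carrier A ==> y \<in> carrier A ==> z \<in> carrier A ==>
     x \<otimes> y \<otimes> z = x \<otimes> (y \<otimes> z)"
  and "x \<in> carrier A ==> y \<in> carrier A ==> z \<in> carrier A ==>
     (x \<oplus> y) \<otimes> z = x \<otimes> z \<oplus> y \<otimes> z"
  and "x \<in> carrier A ==> y \<in> carrier A ==> z \<in> carrier A ==>
     x \<otimes> (y \<oplus> z) = x \<otimes> y \<oplus> x \<otimes> z"
  by (simp_all add: A.m_assoc A.l_distr A.r_distr)
qed

lemma complex_algebraI: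
 fixes A (structure)
 assumes "vspc A"
  and "\<one> \<in> carrier A"
  and "!!x y. x \<in> carrier A ==> y \<in> carrier A ==> x \<otimes> y \<in> carrier A"
  and "!!x. x \<in> carrier A ==> \<one> \<otimes> x = x"
  and "!!x. x \<in> carrier A ==> x \<otimes> \<one> = x"
  and "!!x. x \<in> carrier A ==> lin A A (%y. x \<otimes> y)"
  and "!!x. x \<in> carrier A ==> lin A A (%y. y \<otimes> x)"
  and "!!x y z. x \<in> carrier A ==> y \<in> carrier A ==> z \<in> carrier A ==>
     x \<otimes> y \<otimes> z = x \<otimes> (y \<otimes> z)"
 shows "complex_algebra A"
 unfolding complex_algebra_def
proof (intro conjI)
 show "ring A"
  using assms linD(2)[OF assms(6)] linD(2)[OF assms(7)]
  by (intro ringI vspc_abelian monoidI) auto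
qed (use assms linD(3)[OF assms(6)] linD(3)[OF assms(7)] in auto)

lemma lin_mult:
 assumes "complex_algebra A" "x \<in> carrier A"
 shows lin_mult_left: "lin A A (%y. x \<otimes>\<^bsub>A\<^esub> y)" and lin_mult_right: "lin A A (%y. y \<otimes>\<^bsub>A\<^esub> x)"
 using assms by (auto simp: lin_def algebra_distl algebra_distr)

lemma ideal_submodule:
 fixes A (structure)
 assumes "complex_algebra A" "ideal I A"
 shows "submodule I CC A"
proof -
 interpret ideal I A by (fact assms)
 interpret A: module CC A using assms by simp
 show ?thesis
 proof (rule A.submoduleI)
  fix c x assume x: "x \<in> I"
  then have "c \<odot> x = (c \<odot> \<one>) \<otimes> x"
   using assms(1) by simp
  then show "c \<odot> x \<in> I"
   using I_l_closed[OF x, of "c \<odot> \<one>"] assms(1) by simp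
 qed auto
qed

locale algebra_ideal =
 fixes A :: "(complex, 'a) module" (structure) and N :: "'a set"
 assumes alg [simp]: "complex_algebra A" and idl: "ideal N A"
begin

sublocale subsp A N
 by (rule subsp.intro[OF complex_algebra_vspc[OF alg] ideal_submodule[OF alg idl]])

lemma mult_quotient:
 "x \<in> carrier A ==> y \<in> carrier A ==> \<lbrakk>x\<rbrakk> \<otimes>\<^bsub>quotient A N\<^esub> \<lbrakk>y\<rbrakk> = \<lbrakk>x \<otimes> y\<rbrakk>"
 using ideal.rcoset_mult_add[OF idl] by (simp add: quotient_def FactRing_def)

lemma one_quotient: "\<one>\<^bsub>quotient A N\<^esub> = \<lbrakk>\<one>\<rbrakk>"
 by (simp add: quotient_def FactRing_def)

lemma complex_algebra_quotient: "complex_algebra (quotient A N)"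
 by (rule complex_algebraI[OF vspc_quotient])
  (auto simp: carrier_quotient mult_quotient one_quotient add_quotient smult_quotient lin_def
   algebra_assoc algebra_distl algebra_distr)

lemma alg_hom_coset: "alg_hom A (quotient A N) (%x. \<lbrakk>x\<rbrakk>)"
 by (simp add: alg_hom_def lin_coset mult_quotient one_quotient)

lemma alg_descend:
 assumes "complex_algebra B" "alg_hom A B h" "!!x. x \<in> N ==> h x = \<zero>\<^bsub>B\<^esub>"
 shows "\<exists>h'. alg_hom (quotient A N) B h' \<and> (\<forall>x\<in>carrier A. h' \<lbrakk>x\<rbrakk> = h x)"
proof -
 obtain h' where h': "lin (quotient A N) B h'" "\<forall>x\<in>carrier A. h' \<lbrakk>x\<rbrakk> = h x"
  using descend[of B h] assms alg_homD(1) by (metis complex_algebra_vspc)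
 then have "alg_hom (quotient A N) B h'"
  using alg_homD[OF assms(2)]
  by (auto simp: alg_hom_def carrier_quotient mult_quotient one_quotient)
 with h' show ?thesis by blast
qed

end

lemma hom_kernel_ideal:
 assumes "complex_algebra A" "complex_algebra B" "alg_hom A B h"
 shows "ideal {x \<in> carrier A. h x = \<zero>\<^bsub>B\<^esub>} A"
proof (rule idealI)
 note h = alg_homD[OF assms(3)]
 interpret A: module CC A using assms by simp
 show "ring A" by (rule complex_algebra_ring[OF assms(1)])
 have "submodule {x \<in> carrier A. h x = \<zero>\<^bsub>B\<^esub>} CC A"
  using assms(1,2) linD[OF h(1)] lin_zero[OF h(1)]
  by (intro A.submoduleI) (auto simp: vspc_neg)
 then show "subgroup {x \<in> carrier A. h x = \<zero>\<^bsub>B\<^esub>} (add_monoid A)"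
  by (simp add: submodule_def)
 fix a x assume "a \<in> {x \<in> carrier A. h x = \<zero>\<^bsub>B\<^esub>}" "x \<in> carrier A"
 then show "x \<otimes>\<^bsub>A\<^esub> a \<in> {x \<in> carrier A. h x = \<zero>\<^bsub>B\<^esub>}" "a \<otimes>\<^bsub>A\<^esub> x \<in> {x \<in> carrier A. h x = \<zero>\<^bsub>B\<^esub>}"
  using assms(1,2) h(3) linD[OF h(1)] by auto
qed

section \<open>Free spaces and tensor products\<close>

lemma free_space_simps [simp]:
 shows "p \<in> carrier (free_space E) \<longleftrightarrow> finite {x. p x ~= 0} \<and> {x. p x ~= 0} \<subseteq> E"
  and "\<zero>\<^bsub>free_space E\<^esub> = (%_. 0)"
  and "p \<oplus>\<^bsub>free_space E\<^esub> q = (%x. p x + q x)"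
  and "c \<odot>\<^bsub>free_space E\<^esub> p = (%x. c * p x)"
 by (simp_all add: free_space_def)

lemma finite_support_add:
 fixes p q :: "'x => complex"
 assumes "finite {x. p x ~= 0}" "finite {x. q x ~= 0}"
 shows "finite {x. p x + q x ~= 0}"
 by (rule finite_subset[OF _ finite_UnI[OF assms]]) auto

lemma finite_support_scale:
 fixes p :: "'x => complex"
 shows "finite {x. p x ~= 0} ==> finite {x. c * p x ~= 0}"
 by (erule rev_finite_subset) auto

lemma vspc_free_space [simp]: "vspc (free_space E)"
proof (rule vspcI)
 show "abelian_group (free_space E)"
 proof (rule abelian_groupI)
  fix p :: "'a => complex" assume "p \<in> carrier (free_space E)"
  then show "\<exists>q\<in>carrier (free_space E). q \<oplus>\<^bsub>free_space E\<^esub> p = \<zero>\<^bsub>free_space E\<^esub>"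
   by (intro bexI[of _ "%x. - p x"]) auto
 next
  fix p q :: "'a => complex" assume "p \<in> carrier (free_space E)" "q \<in> carrier (free_space E)"
  then show "p \<oplus>\<^bsub>free_space E\<^esub> q \<in> carrier (free_space E)"
   using finite_support_add[of p q] by (simp add: subset_iff) (metis add.right_neutral)
 qed (auto simp: add.assoc add.commute)
 fix c :: complex and p :: "'a => complex" assume "p \<in> carrier (free_space E)"
 then show "c \<odot>\<^bsub>free_space E\<^esub> p \<in> carrier (free_space E)"
  by (auto intro: finite_support_scale simp del: mult_eq_0_iff)
qed (auto simp: algebra_simps)

lemma minus_free_space [simp]:
 assumes "p \<in> carrier (free_space E)" "q \<in> carrier (free_space E)"
 shows "p \<ominus>\<^bsub>free_space E\<^esub> q = (%x. p x - q x)"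
 using vspc_minus[OF vspc_free_space assms] by auto

lemma delta_self [simp]: "delta x x = 1" and delta_other [simp]: "y ~= x ==> delta x y = 0"
 by (simp_all add: delta_def)

lemma delta_neq_0 [simp]: "delta x y ~= 0 \<longleftrightarrow> y = x"
 by (simp add: delta_def)

lemma delta_in_free_space: "x \<in> E ==> delta x \<in> carrier (free_space E)"
 by simp

lemma free_space_closed:
 shows "p \<in> carrier (free_space E) ==> q \<in> carrier (free_space E) ==>
      (%x. p x + q x) \<in> carrier (free_space E)"
  and "p \<in> carrier (free_space E) ==> q \<in> carrier (free_space E) ==>
      (%x. p x - q x) \<in> carrier (free_space E)"
  and "p \<in> carrier (free_space E) ==> (%x. c * p x) \<in> carrier (free_space E)"
 using vspc_simps(2)[OF vspc_free_space, of p E q] vspc_simps(5)[OF vspc_free_space, of p E q]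
  vspc_simps(3)[OF vspc_free_space, of p E c] minus_free_space[of p E q]
 by (simp_all del: free_space_simps(1))

lemma free_space_induct [consumes 1, case_names zero add smult delta]:
 assumes "p \<in> carrier (free_space E)"
  and "P (%_. 0)"
  and "!!p q. p \<in> carrier (free_space E) ==> q \<in> carrier (free_space E) ==> P p ==> P q ==>
      P (%x. p x + q x)"
  and "!!c p. p \<in> carrier (free_space E) ==> P p ==> P (%x. c * p x)"
  and "!!x. x \<in> E ==> P (delta x)"
 shows "P p"
proof -
 have "\<forall>p. {x. p x ~= 0} = S --> S \<subseteq> E --> P p" if "finite S" for S
  using that
 proof (induction S)
  case empty
  have "p = (%_. 0)" if "{x. p x ~= 0} = {}" for p :: "'a => complex" using that by auto
  then show ?case using assms(2) by metis
 next
  case (insert y S)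
  show ?case
  proof (intro allI impI)
   fix p :: "'a => complex" assume p: "{x. p x ~= 0} = insert y S" "insert y S \<subseteq> E"
   define q where "q = (%x. if x = y then 0 else p x)"
   have q: "{x. q x ~= 0} = S"
    using p(1) insert.hyps(2) by (auto simp: q_def)
   then have "P q" "q \<in> carrier (free_space E)"
    using insert p by (auto simp: q_def)
   moreover have "P (%x. p y * delta y x)"
    using p(2) by (intro assms(4,5)) auto
   moreover have "(%x. p y * delta y x) \<in> carrier (free_space E)"
    using p(2) finite_subset[of "{x. p y * delta y x ~= 0}" "{y}"] by auto
   ultimately have "P (%x. q x + p y * delta y x)"
    using assms(3) by blast
   moreover have "(%x. q x + p y * delta y x) = p"
    by (auto simp: q_def delta_def)
   ultimately show "P p" by simp
  qed
 qed
 with assms(1) show ?thesis by auto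
qed

definition lin_ext :: "(complex, 'a) module => ('x => 'a) => ('x => complex) => 'a"
 where "lin_ext A F p = finsum A (%x. p x \<odot>\<^bsub>A\<^esub> F x) {x. p x ~= 0}"

lemma lin_ext_superset:
 assumes "vspc A" "finite E" "{x. p x ~= 0} \<subseteq> E" "!!x. x \<in> E ==> F x \<in> carrier A"
 shows "lin_ext A F p = finsum A (%x. p x \<odot>\<^bsub>A\<^esub> F x) E"
 unfolding lin_ext_def using assms by (intro finsum_cong_set) auto

lemma lin_lin_ext:
 fixes A (structure)
 assumes "vspc A" "!!x. x \<in> E ==> F x \<in> carrier A"
 shows "lin (free_space E) A (lin_ext A F)"
 unfolding lin_def
proof (intro conjI ballI allI)
 fix p assume p: "p \<in> carrier (free_space E)"
 then have F: "F x \<in> carrier A" if "p x ~= 0" for x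
  using that assms(2) by auto
 then show "lin_ext A F p \<in> carrier A"
  unfolding lin_ext_def using assms(1) by (intro finsum_closed') auto
 fix c
 have "lin_ext A F (%x. c * p x) = finsum A (%x. (c * p x) \<odot> F x) {x. p x ~= 0}"
  using p assms(1) F by (intro lin_ext_superset) auto
 also have "\<dots> = finsum A (%x. c \<odot> (p x \<odot> F x)) {x. p x ~= 0}"
  using assms(1) F by (intro finsum_cong1) auto
 also have "\<dots> = c \<odot> lin_ext A F p"
  unfolding lin_ext_def using assms(1) F by (intro finsum_smult) auto
 finally show "lin_ext A F (c \<odot>\<^bsub>free_space E\<^esub> p) = c \<odot> lin_ext A F p"
  by simp
next
 fix p q assume pq: "p \<in> carrier (free_space E)" "q \<in> carrier (free_space E)"
 define S where "S = {x. p x ~= 0} \<union> {x. q x ~= 0}"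
 have S: "finite S" "!!x. x \<in> S ==> F x \<in> carrier A"
  using pq assms(2) by (auto simp: S_def)
 have "lin_ext A F (%x. p x + q x) = finsum A (%x. (p x + q x) \<odot> F x) S"
  using S assms(1) by (intro lin_ext_superset) (auto simp: S_def)
 also have "\<dots> = finsum A (%x. p x \<odot> F x \<oplus> q x \<odot> F x) S"
  using assms(1) S by (intro finsum_cong1) (auto simp: vspc_distl)
 also have "\<dots> = finsum A (%x. p x \<odot> F x) S \<oplus> finsum A (%x. q x \<odot> F x) S"
  using assms(1) S by (intro finsum_add) auto
 also have "\<dots> = lin_ext A F p \<oplus> lin_ext A F q"
  using S assms(1) by (intro arg_cong2[where f = "add A"] lin_ext_superset[symmetric])
   (auto simp: S_def)
 finally show "lin_ext A F (p \<oplus>\<^bsub>free_space E\<^esub> q) = lin_ext A F p \<oplus> lin_ext A F q"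
  by simp
qed

lemma lin_ext_delta [simp]: "vspc A ==> F x \<in> carrier A ==> lin_ext A F (delta x) = F x"
 unfolding lin_ext_def by (subst finsum_single[of _ _ x]) auto

lemma lin_ext_zero [simp]: "vspc A ==> lin_ext A F (%_. 0) = \<zero>\<^bsub>A\<^esub>"
 by (simp add: lin_ext_def finsum_empty')

lemma lin_eq_on_free:
 assumes "lin (free_space E) A h" "lin (free_space E) A k" "vspc A"
  and "!!x. x \<in> E ==> h (delta x) = k (delta x)" "p \<in> carrier (free_space E)"
 shows "h p = k p"
 using assms(5)
proof (induction p rule: free_space_induct)
 case zero
 then show ?case
  using lin_zero[OF assms(1) vspc_free_space assms(3)] lin_zero[OF assms(2) vspc_free_space assms(3)]
  by simp
next
 case (add p q)
 then show ?case using linD(2)[OF assms(1), of p q] linD(2)[OF assms(2), of p q] by simp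
next
 case (smult c p)
 then show ?case using linD(3)[OF assms(1), of p c] linD(3)[OF assms(2), of p c] by simp
qed (rule assms(4))

subsection \<open>Tensor products\<close>

locale tensor_pair =
 fixes U :: "(complex, 'u) module" and W :: "(complex, 'w) module"
 assumes U [simp]: "vspc U" and W [simp]: "vspc W"
begin

abbreviation "F \<equiv> free_space (carrier U \<times> carrier W)"
abbreviation "V \<equiv> tensor_space U W"
abbreviation tcs ("\<lbrakk>_\<rbrakk>") where "\<lbrakk>p\<rbrakk> \<equiv> bilinear_subspace U W +>\<^bsub>F\<^esub> p"

lemma bilinear_relations_carrier: "bilinear_relations U W \<subseteq> carrier F"
proof -
 have d: "delta (u, w) \<in> carrier F" if "u \<in> carrier U" "w \<in> carrier W" for u w
  using that by simp
 have m: "(%z. p z - q z) \<in> carrier F" if "p \<in> carrier F" "q \<in> carrier F" for p q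
  using minus_free_space[OF that] vspc_simps(5)[OF vspc_free_space that] by metis
 have s: "(%z. c * p z) \<in> carrier F" if "p \<in> carrier F" for p c
  using vspc_simps(3)[OF vspc_free_space that, of c] by simp
 show ?thesis
  unfolding bilinear_relations_def
  by (intro Un_least subsetI; clarsimp simp del: free_space_simps(1))
   (intro m s d; simp del: free_space_simps)+
qed

lemma submodule_bilinear: "submodule (bilinear_subspace U W) CC F"
proof -
 interpret F: module CC F by simp
 have "submodule (carrier F) CC F" by (rule F.carrier_is_submodule)
 then have ne: "carrier F \<in> {N. submodule N CC F \<and> bilinear_relations U W \<subseteq> N}"
  using bilinear_relations_carrier by simp
 show ?thesis
  unfolding bilinear_subspace_def
 proof (rule F.submoduleI)
  let ?S = "{N. submodule N CC F \<and> bilinear_relations U W \<subseteq> N}"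
  show "\<Inter>?S \<subseteq> carrier F" using ne by blast
  have "\<zero>\<^bsub>F\<^esub> \<in> N" if "submodule N CC F" for N
   using subgroup.one_closed[OF submodule.axioms(1)[OF that]] by simp
  then show "\<zero>\<^bsub>F\<^esub> \<in> \<Inter>?S" by blast
  show "\<ominus>\<^bsub>F\<^esub> a \<in> \<Inter>?S" if "a \<in> \<Inter>?S" for a
   using that F.submoduleE(3) by blast
  show "a \<oplus>\<^bsub>F\<^esub> b \<in> \<Inter>?S" if "a \<in> \<Inter>?S" "b \<in> \<Inter>?S" for a b
   using that F.submoduleE(5) by blast
  show "c \<odot>\<^bsub>F\<^esub> a \<in> \<Inter>?S" if "c \<in> carrier CC" "a \<in> \<Inter>?S" for c a
   using that F.submoduleE(4) by blast
 qed
qed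

sublocale subsp F "bilinear_subspace U W"
 by (rule subsp.intro[OF vspc_free_space submodule_bilinear])

lemma vspc_tensor [simp]: "vspc V"
 using vspc_quotient by (simp add: tensor_space_def)

lemma relations_in: "bilinear_relations U W \<subseteq> bilinear_subspace U W"
 by (auto simp: bilinear_subspace_def)

lemma tensor_closed [simp]: "u \<in> carrier U ==> w \<in> carrier W ==> tensor U W u w \<in> carrier V"
 using linD(1)[OF lin_coset, of "delta (u, w)"] by (simp add: tensor_space_def tensor_def)

lemma tensor_relation:
 assumes "p \<in> carrier F" "q \<in> carrier F" "(%z. p z - q z) \<in> bilinear_relations U W"
 shows "\<lbrakk>p\<rbrakk> = \<lbrakk>q\<rbrakk>"
 using assms relations_in by (simp add: coset_eq_iff del: free_space_simps(1)) blast

lemma coset_ops: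
 assumes "p \<in> carrier F" "q \<in> carrier F"
 shows "\<lbrakk>p\<rbrakk> \<oplus>\<^bsub>V\<^esub> \<lbrakk>q\<rbrakk> = \<lbrakk>%z. p z + q z\<rbrakk>" and "c \<odot>\<^bsub>V\<^esub> \<lbrakk>p\<rbrakk> = \<lbrakk>%z. c * p z\<rbrakk>"
 using add_quotient[OF assms] smult_quotient[OF assms(1)] by (simp_all add: tensor_space_def)

lemma tensor_add_left:
 assumes "u \<in> carrier U" "u' \<in> carrier U" "w \<in> carrier W"
 shows "tensor U W (u \<oplus>\<^bsub>U\<^esub> u') w = tensor U W u w \<oplus>\<^bsub>V\<^esub> tensor U W u' w"
proof -
 have "(%z. delta (u \<oplus>\<^bsub>U\<^esub> u', w) z - delta (u, w) z - delta (u', w) z) \<in> bilinear_relations U W"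
  using assms unfolding bilinear_relations_def by blast
 then show ?thesis
  unfolding tensor_def using assms
  by (subst coset_ops; (intro tensor_relation free_space_closed delta_in_free_space)?)
   (auto simp: diff_diff_eq)
qed

lemma tensor_add_right:
 assumes "u \<in> carrier U" "w \<in> carrier W" "w' \<in> carrier W"
 shows "tensor U W u (w \<oplus>\<^bsub>W\<^esub> w') = tensor U W u w \<oplus>\<^bsub>V\<^esub> tensor U W u w'"
proof -
 have "(%z. delta (u, w \<oplus>\<^bsub>W\<^esub> w') z - delta (u, w) z - delta (u, w') z) \<in> bilinear_relations U W"
  using assms unfolding bilinear_relations_def by blast
 then show ?thesis
  unfolding tensor_def using assms
  by (subst coset_ops; (intro tensor_relation free_space_closed delta_in_free_space)?)
   (auto simp: diff_diff_eq)
qed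

lemma tensor_smult_left:
 assumes "u \<in> carrier U" "w \<in> carrier W"
 shows "tensor U W (c \<odot>\<^bsub>U\<^esub> u) w = c \<odot>\<^bsub>V\<^esub> tensor U W u w"
proof -
 have "(%z. delta (c \<odot>\<^bsub>U\<^esub> u, w) z - c * delta (u, w) z) \<in> bilinear_relations U W"
  using assms unfolding bilinear_relations_def by blast
 then show ?thesis
  unfolding tensor_def using assms
  by (subst coset_ops(2)[of _ "%_. 0"]; (intro tensor_relation free_space_closed delta_in_free_space)?)
   auto
qed

lemma tensor_smult_right:
 assumes "u \<in> carrier U" "w \<in> carrier W"
 shows "tensor U W u (c \<odot>\<^bsub>W\<^esub> w) = c \<odot>\<^bsub>V\<^esub> tensor U W u w"
proof -
 have "(%z. delta (u, c \<odot>\<^bsub>W\<^esub> w) z - c * delta (u, w) z) \<in> bilinear_relations U W"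
  using assms unfolding bilinear_relations_def by blast
 then show ?thesis
  unfolding tensor_def using assms
  by (subst coset_ops(2)[of _ "%_. 0"]; (intro tensor_relation free_space_closed delta_in_free_space)?)
   auto
qed

lemma lin_tensor_left: "w \<in> carrier W ==> lin U V (%u. tensor U W u w)"
 by (simp add: lin_def tensor_add_left tensor_smult_left)

lemma lin_tensor_right: "u \<in> carrier U ==> lin W V (tensor U W u)"
 by (simp add: lin_def tensor_add_right tensor_smult_right)

text \<open>Every element is a sum of pure tensors, because scalars can be absorbed into the first factor.\<close>

lemma tensor_induct [consumes 1, case_names add tensor]:
 assumes "t \<in> carrier V"
  and "!!s t. s \<in> carrier V ==> t \<in> carrier V ==> P s ==> P t ==> P (s \<oplus>\<^bsub>V\<^esub> t)"
  and "!!u w. u \<in> carrier U ==> w \<in> carrier W ==> P (tensor U W u w)"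
 shows "P t"
proof -
 obtain p where p: "p \<in> carrier F" and t: "t = \<lbrakk>p\<rbrakk>"
  using assms(1) by (auto simp: tensor_space_def carrier_quotient)
 have "\<forall>c. P \<lbrakk>%z. c * p z\<rbrakk>"
  using p
 proof (induction p rule: free_space_induct)
  case zero
  have "tensor U W \<zero>\<^bsub>U\<^esub> \<zero>\<^bsub>W\<^esub> = \<zero>\<^bsub>V\<^esub>"
   using lin_zero[OF lin_tensor_left] by simp
  then show ?case
   using assms(3)[of "\<zero>\<^bsub>U\<^esub>" "\<zero>\<^bsub>W\<^esub>"] zero_quotient by (simp add: tensor_space_def)
 next
  case (add p q)
  show ?case
  proof
   fix c
   have c: "(%z. c * p z) \<in> carrier F" "(%z. c * q z) \<in> carrier F"
    using vspc_simps(3)[OF vspc_free_space add(1), of c]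
     vspc_simps(3)[OF vspc_free_space add(2), of c] by simp_all
   then have "P (\<lbrakk>%z. c * p z\<rbrakk> \<oplus>\<^bsub>V\<^esub> \<lbrakk>%z. c * q z\<rbrakk>)"
    using add linD(1)[OF lin_coset] by (intro assms(2)) (auto simp: tensor_space_def simp del: free_space_simps(1))
   then show "P \<lbrakk>%z. c * (p z + q z)\<rbrakk>"
    using add_quotient[OF c] by (simp add: tensor_space_def distrib_left)
  qed
 next
  case (smult c p)
  then show ?case by (simp add: mult.assoc[symmetric])
 next
  case (delta x)
  obtain u w where x: "x = (u, w)" "u \<in> carrier U" "w \<in> carrier W"
   using delta by auto
  show ?case
  proof
   fix c
   have "\<lbrakk>%z. c * delta x z\<rbrakk> = tensor U W (c \<odot>\<^bsub>U\<^esub> u) w"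
    using x coset_ops(2)[of "delta x" "%_. 0" c] tensor_smult_left[of u w c] by (simp add: tensor_def)
   then show "P \<lbrakk>%z. c * delta x z\<rbrakk>"
    using assms(3) x by simp
  qed
 qed
 then have "P \<lbrakk>%z. 1 * p z\<rbrakk>" by (rule spec)
 then show ?thesis by (simp add: t)
qed

text \<open>The universal property of the tensor product.\<close>

lemma tensor_lift:
 fixes A (structure)
 assumes "vspc A" "!!w. w \<in> carrier W ==> lin U A (%u. \<beta> u w)"
  "!!u. u \<in> carrier U ==> lin W A (\<beta> u)"
 shows "\<exists>h. lin V A h \<and> (\<forall>u\<in>carrier U. \<forall>w\<in>carrier W. h (tensor U W u w) = \<beta> u w)"
proof -
 define k where "k = lin_ext A (%(u, w). \<beta> u w)"
 have k: "lin F A k"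
  unfolding k_def using assms(1) linD(1)[OF assms(3)] by (intro lin_lin_ext) auto
 have kd: "k (delta (u, w)) = \<beta> u w" if "u \<in> carrier U" "w \<in> carrier W" for u w
  unfolding k_def using assms(1) linD(1)[OF assms(3)] that by simp
 let ?K = "{p \<in> carrier F. k p = \<zero>}"
 have K: "submodule ?K CC F"
 proof (rule A.submoduleI)
  show "\<ominus>\<^bsub>F\<^esub> a \<in> ?K" if "a \<in> ?K" for a
   using that vspc_neg[OF vspc_free_space, of a] vspc_simps(4)[OF vspc_free_space, of a]
    linD(3)[OF k, of a "- 1"] assms(1) by (simp del: free_space_simps)
 qed (use assms(1) linD[OF k] lin_zero[OF k vspc_free_space assms(1)] vspc_simps[OF vspc_free_space]
   in \<open>auto simp del: free_space_simps\<close>)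
 have min: "k (%z. p z - q z) = k p \<ominus> k q \<and> (%z. p z - q z) \<in> carrier F"
  if "p \<in> carrier F" "q \<in> carrier F" for p q
  using lin_minus[OF k vspc_free_space assms(1) that] minus_free_space[OF that]
   vspc_simps(5)[OF vspc_free_space that] by metis
 have sc: "k (%z. c * p z) = c \<odot> k p \<and> (%z. c * p z) \<in> carrier F" if "p \<in> carrier F" for c p
  using linD(3)[OF k that, of c] vspc_simps(3)[OF vspc_free_space that, of c] by simp
 have d: "delta (u, w) \<in> carrier F" if "u \<in> carrier U" "w \<in> carrier W" for u w
  using that by simp
 have ar: "(x \<oplus> y) \<ominus> x \<ominus> y = \<zero>" if "x \<in> carrier A" "y \<in> carrier A" for x y
 proof -
  interpret AG: abelian_group A by (rule vspc_abelian[OF assms(1)])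
  show ?thesis
   using that assms(1) vspc_left_comm[OF assms(1), of y "\<ominus> x" "\<ominus> y"]
   by (simp add: AG.minus_eq AG.a_assoc)
 qed
 have "bilinear_relations U W \<subseteq> ?K"
  unfolding bilinear_relations_def
  using linD[OF assms(2)] linD[OF assms(3)] assms(1)
  by (intro Un_least subsetI; clarsimp simp del: free_space_simps)
   (simp_all add: min sc d kd ar del: free_space_simps)
 then have "bilinear_subspace U W \<subseteq> ?K"
  using K unfolding bilinear_subspace_def by blast
 then obtain h where "lin (quotient F (bilinear_subspace U W)) A h" "\<forall>x\<in>carrier F. h \<lbrakk>x\<rbrakk> = k x"
  using descend[OF assms(1) k] by blast
 then show ?thesis
  using kd d by (auto simp: tensor_space_def tensor_def simp del: free_space_simps)
qed

lemma lin_eq_on_tensors: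
 assumes "vspc A" "lin V A h" "lin V A k"
  and "!!u w. u \<in> carrier U ==> w \<in> carrier W ==> h (tensor U W u w) = k (tensor U W u w)"
  and "t \<in> carrier V"
 shows "h t = k t"
 using assms(5) by (induction rule: tensor_induct) (simp_all add: assms linD[OF assms(2)] linD[OF assms(3)])

end

section \<open>Tensor algebras\<close>

abbreviation foldm :: "(complex, 'a) module => ('b => 'a) => 'b list => 'a"
 where "foldm A h w \<equiv> foldr (%b x. h b \<otimes>\<^bsub>A\<^esub> x) w \<one>\<^bsub>A\<^esub>"

lemma extend_hom_lin_ext: "extend_hom A h = lin_ext A (foldm A h)"
 by (rule ext) (simp add: extend_hom_def lin_ext_def)

lemma tensor_algebra_simps [simp]:
 shows "carrier (tensor_algebra B) = carrier (free_space (lists B))"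
  and "\<zero>\<^bsub>tensor_algebra B\<^esub> = (%_. 0)"
  and "p \<oplus>\<^bsub>tensor_algebra B\<^esub> q = (%x. p x + q x)"
  and "c \<odot>\<^bsub>tensor_algebra B\<^esub> p = (%x. c * p x)"
  and "p \<otimes>\<^bsub>tensor_algebra B\<^esub> q = (%w. \<Sum>k\<le>length w. p (take k w) * q (drop k w))"
  and "\<one>\<^bsub>tensor_algebra B\<^esub> = delta []"
 by (simp_all add: tensor_algebra_def free_space_def)

lemmas tensor_opaque = tensor_algebra_simps(1,5) free_space_simps(1)

lemma vspc_tensor_algebra [simp]: "vspc (tensor_algebra B)"
proof (rule vspcI)
 show "abelian_group (tensor_algebra B)"
  using vspc_abelian[OF vspc_free_space[of "lists B"]]
  by (simp add: abelian_group_def abelian_monoid_def abelian_group_axioms_def tensor_algebra_def free_space_def)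
 fix c :: complex and p :: "'a list => complex" assume "p \<in> carrier (tensor_algebra B)"
 then show "c \<odot>\<^bsub>tensor_algebra B\<^esub> p \<in> carrier (tensor_algebra B)"
  using vspc_simps(3)[OF vspc_free_space, of p "lists B" c] by simp
qed (auto simp: algebra_simps)

lemma lin_tensor_algebra [simp]: "lin (tensor_algebra B) A h \<longleftrightarrow> lin (free_space (lists B)) A h"
 "lin A (tensor_algebra B) h' \<longleftrightarrow> lin A (free_space (lists B)) h'"
 by (simp_all add: lin_def)

lemma delta_mult: "delta u \<otimes>\<^bsub>tensor_algebra B\<^esub> delta v = delta (u @ v)"
proof
 fix w
 have "(\<Sum>k\<le>length w. delta u (take k w) * delta v (drop k w)) =
   (\<Sum>k\<le>length w. if k = length u then delta (u @ v) w else 0)"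
 proof (rule sum.cong[OF refl])
  fix k assume "k \<in> {..length w}"
  then have "take k w = u \<and> drop k w = v \<longleftrightarrow> k = length u \<and> w = u @ v"
   by (metis append_eq_conv_conj append_take_drop_id length_take min.absorb2 atMost_iff)
  then have "(if take k w = u \<and> drop k w = v then 1 else 0 :: complex) =
    (if k = length u \<and> w = u @ v then 1 else 0)"
   by (simp only:)
  moreover have "delta u (take k w) * delta v (drop k w) =
    (if take k w = u \<and> drop k w = v then 1 else 0)"
   by (simp add: delta_def)
  ultimately show "delta u (take k w) * delta v (drop k w) = (if k = length u then delta (u @ v) w else 0)"
   by (simp add: delta_def)
 qed
 also have "\<dots> = delta (u @ v) w"
  by (auto simp: delta_def)
 finally show "(delta u \<otimes>\<^bsub>tensor_algebra B\<^esub> delta v) w = delta (u @ v) w" by simp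
qed

lemma tensor_mult_closed:
 assumes "p \<in> carrier (tensor_algebra B)" "q \<in> carrier (tensor_algebra B)"
 shows "p \<otimes>\<^bsub>tensor_algebra B\<^esub> q \<in> carrier (tensor_algebra B)"
proof -
 let ?S = "(%(u, v). u @ v) ` ({w. p w ~= 0} \<times> {w. q w ~= 0})"
 have "{w. (p \<otimes>\<^bsub>tensor_algebra B\<^esub> q) w ~= 0} \<subseteq> ?S"
 proof
  fix w assume "w \<in> {w. (p \<otimes>\<^bsub>tensor_algebra B\<^esub> q) w ~= 0}"
  then have "(\<Sum>k\<le>length w. p (take k w) * q (drop k w)) ~= 0" by simp
  then obtain k where "p (take k w) * q (drop k w) ~= 0"
   by (elim sum.not_neutral_contains_not_neutral) blast
  then have "(take k w, drop k w) \<in> {w. p w ~= 0} \<times> {w. q w ~= 0}" by auto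
  then have "(%(u, v). u @ v) (take k w, drop k w) \<in> ?S" by (rule imageI)
  then show "w \<in> ?S" by simp
 qed
 moreover have "finite ?S" using assms by auto
 moreover have "?S \<subseteq> lists B"
 proof
  fix w assume "w \<in> ?S"
  then obtain u v where w: "w = u @ v" "p u ~= 0" "q v ~= 0" by auto
  then have "u \<in> lists B" "v \<in> lists B" using assms by auto
  then show "w \<in> lists B" using w by simp
 qed
 ultimately show ?thesis
  by (auto intro: finite_subset)
qed

lemma lin_tensor_mult:
 assumes "p \<in> carrier (tensor_algebra B)"
 shows "lin (tensor_algebra B) (tensor_algebra B) (%q. p \<otimes>\<^bsub>tensor_algebra B\<^esub> q)"
  and "lin (tensor_algebra B) (tensor_algebra B) (%q. q \<otimes>\<^bsub>tensor_algebra B\<^esub> p)"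
 using tensor_mult_closed[OF assms] tensor_mult_closed[OF _ assms] unfolding lin_def
 by (auto simp: algebra_simps sum.distrib sum_distrib_left simp del: free_space_simps(1) lin_tensor_algebra)

lemma complex_algebra_tensor_algebra [simp]: "complex_algebra (tensor_algebra B)"
proof (rule complex_algebraI)
 let ?T = "tensor_algebra B"
 note [simp del] = tensor_algebra_simps(5) free_space_simps(1)
 have d: "delta w \<in> carrier ?T" if "w \<in> lists B" for w
  using that by (simp add: delta_in_free_space)
 have closed: "p \<otimes>\<^bsub>?T\<^esub> q \<in> carrier ?T" if "p \<in> carrier ?T" "q \<in> carrier ?T" for p q
  using that by (rule tensor_mult_closed)
 note R = lin_tensor_mult(2) and L = lin_tensor_mult(1)
 have one: "delta [] \<in> carrier ?T" by (rule d) simp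
 then show "\<one>\<^bsub>?T\<^esub> \<in> carrier ?T" by simp
 fix p q s assume p: "p \<in> carrier ?T" and q: "q \<in> carrier ?T" and s: "s \<in> carrier ?T"
 have "delta [] \<otimes>\<^bsub>?T\<^esub> p = p"
  by (rule lin_eq_on_free[OF _ _ _ _ p[simplified], where k = "%x. x" and A = ?T])
   (use L[OF one] in \<open>auto simp: lin_def delta_mult\<close>)
 then show "\<one>\<^bsub>?T\<^esub> \<otimes>\<^bsub>?T\<^esub> p = p" by simp
 have "p \<otimes>\<^bsub>?T\<^esub> delta [] = p"
  by (rule lin_eq_on_free[OF _ _ _ _ p[simplified], where k = "%x. x" and A = ?T])
   (use R[OF one] in \<open>auto simp: lin_def delta_mult\<close>)
 then show "p \<otimes>\<^bsub>?T\<^esub> \<one>\<^bsub>?T\<^esub> = p" by simp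
 show "p \<otimes>\<^bsub>?T\<^esub> q \<otimes>\<^bsub>?T\<^esub> s = p \<otimes>\<^bsub>?T\<^esub> (q \<otimes>\<^bsub>?T\<^esub> s)"
 proof (rule lin_eq_on_free[OF _ _ _ _ p[simplified]])
  show "lin (free_space (lists B)) ?T (%p. p \<otimes>\<^bsub>?T\<^esub> q \<otimes>\<^bsub>?T\<^esub> s)"
   using lin_comp[OF R[OF q] R[OF s]] by simp
  show "lin (free_space (lists B)) ?T (%p. p \<otimes>\<^bsub>?T\<^esub> (q \<otimes>\<^bsub>?T\<^esub> s))"
   using R[OF closed[OF q s]] by simp
  fix u assume u: "u \<in> lists B"
  show "delta u \<otimes>\<^bsub>?T\<^esub> q \<otimes>\<^bsub>?T\<^esub> s = delta u \<otimes>\<^bsub>?T\<^esub> (q \<otimes>\<^bsub>?T\<^esub> s)"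
  proof (rule lin_eq_on_free[OF _ _ _ _ q[simplified]])
   show "lin (free_space (lists B)) ?T (%q. delta u \<otimes>\<^bsub>?T\<^esub> q \<otimes>\<^bsub>?T\<^esub> s)"
    using lin_comp[OF L[OF d[OF u]] R[OF s]] by simp
   show "lin (free_space (lists B)) ?T (%q. delta u \<otimes>\<^bsub>?T\<^esub> (q \<otimes>\<^bsub>?T\<^esub> s))"
    using lin_comp[OF R[OF s] L[OF d[OF u]]] by simp
   fix v assume v: "v \<in> lists B"
   show "delta u \<otimes>\<^bsub>?T\<^esub> delta v \<otimes>\<^bsub>?T\<^esub> s = delta u \<otimes>\<^bsub>?T\<^esub> (delta v \<otimes>\<^bsub>?T\<^esub> s)"
   proof (rule lin_eq_on_free[OF _ _ _ _ s[simplified]])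
    show "lin (free_space (lists B)) ?T (%s. delta u \<otimes>\<^bsub>?T\<^esub> delta v \<otimes>\<^bsub>?T\<^esub> s)"
     using L[OF closed[OF d[OF u] d[OF v]]] by simp
    show "lin (free_space (lists B)) ?T (%s. delta u \<otimes>\<^bsub>?T\<^esub> (delta v \<otimes>\<^bsub>?T\<^esub> s))"
     using lin_comp[OF L[OF d[OF v]] L[OF d[OF u]]] by simp
   qed (simp_all add: delta_mult)
  qed simp
 qed simp
qed (fact vspc_tensor_algebra | rule lin_tensor_mult tensor_mult_closed; assumption)+

lemma foldm_closed:
 "complex_algebra A ==> (!!b. b \<in> set w ==> h b \<in> carrier A) ==> foldm A h w \<in> carrier A"
 by (induction w) auto

lemma foldm_append:
 "complex_algebra A ==> (!!b. b \<in> set u \<union> set v ==> h b \<in> carrier A) ==>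
   foldm A h (u @ v) = foldm A h u \<otimes>\<^bsub>A\<^esub> foldm A h v"
proof (induction u)
 case Nil
 then show ?case using foldm_closed[of A v h] by simp
next
 case (Cons b u)
 then show ?case using foldm_closed[of A v h] foldm_closed[of A u h] by (simp add: algebra_assoc)
qed

context
 fixes A :: "(complex, 'a) module" (structure) and h :: "'b => 'a" and B
 assumes A [simp]: "complex_algebra A" and h: "!!b. b \<in> B ==> h b \<in> carrier A"
begin

lemma lin_extend_hom: "lin (tensor_algebra B) A (extend_hom A h)"
 unfolding extend_hom_lin_ext using h by (simp, intro lin_lin_ext) (auto intro!: foldm_closed)

lemma extend_hom_word: "w \<in> lists B ==> extend_hom A h (delta w) = foldm A h w"
 unfolding extend_hom_lin_ext using h by (subst lin_ext_delta) (auto intro!: foldm_closed)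

lemma extend_hom_letter: "b \<in> B ==> extend_hom A h (delta [b]) = h b"
 by (subst extend_hom_word) (auto simp: h)

lemma alg_hom_extend_hom: "alg_hom (tensor_algebra B) A (extend_hom A h)"
 unfolding alg_hom_def
proof (intro conjI ballI)
 let ?T = "tensor_algebra B" and ?h = "extend_hom A h"
 note [simp del] = tensor_algebra_simps(5) free_space_simps(1)
 show H: "lin ?T A ?h" by (rule lin_extend_hom)
 show "?h \<one>\<^bsub>?T\<^esub> = \<one>" using extend_hom_word[of "[]"] by simp
 have d: "delta w \<in> carrier ?T" if "w \<in> lists B" for w
  using that by (simp add: delta_in_free_space)
 note R = lin_tensor_mult(2) and L = lin_tensor_mult(1)
 fix p q assume p: "p \<in> carrier ?T" and q: "q \<in> carrier ?T"
 show "?h (p \<otimes>\<^bsub>?T\<^esub> q) = ?h p \<otimes> ?h q"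
 proof (rule lin_eq_on_free[OF _ _ _ _ p[simplified]])
  show "lin (free_space (lists B)) A (%p. ?h (p \<otimes>\<^bsub>?T\<^esub> q))"
   using lin_comp[OF R[OF q] H] by simp
  show "lin (free_space (lists B)) A (%p. ?h p \<otimes> ?h q)"
   using lin_comp[OF H lin_mult_right[OF A linD(1)[OF H q]]] by simp
  fix u assume u: "u \<in> lists B"
  show "?h (delta u \<otimes>\<^bsub>?T\<^esub> q) = ?h (delta u) \<otimes> ?h q"
  proof (rule lin_eq_on_free[OF _ _ _ _ q[simplified]])
   show "lin (free_space (lists B)) A (%q. ?h (delta u \<otimes>\<^bsub>?T\<^esub> q))"
    using lin_comp[OF L[OF d[OF u]] H] by simp
   show "lin (free_space (lists B)) A (%q. ?h (delta u) \<otimes> ?h q)"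
    using lin_comp[OF H lin_mult_left[OF A linD(1)[OF H d[OF u]]]] by simp
     fix v assume v: "v \<in> lists B"
   show "?h (delta u \<otimes>\<^bsub>?T\<^esub> delta v) = ?h (delta u) \<otimes> ?h (delta v)"
    using u v foldm_append[OF A, of u v h] h extend_hom_word[of "u @ v"]
    by (auto simp: delta_mult extend_hom_word)
  qed simp
 qed simp
qed

end

lemma alg_hom_tensor_unique:
 assumes "complex_algebra A" "alg_hom (tensor_algebra B) A h" "alg_hom (tensor_algebra B) A k"
  "!!b. b \<in> B ==> h (delta [b]) = k (delta [b])" "p \<in> carrier (tensor_algebra B)"
 shows "h p = k p"
proof (rule lin_eq_on_free[of "lists B" A])
 note [simp del] = tensor_algebra_simps(5) free_space_simps(1)
 note H = alg_homD[OF assms(2)] and K = alg_homD[OF assms(3)]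
 show "lin (free_space (lists B)) A h" "lin (free_space (lists B)) A k" "vspc A"
  "p \<in> carrier (free_space (lists B))"
  using H(1) K(1) assms by simp_all
 fix w assume "w \<in> lists B"
 then show "h (delta w) = k (delta w)"
 proof (induction w)
  case Nil
  then show ?case using H(2) K(2) by simp
 next
  case (Cons b w)
  then have "delta [b] \<in> carrier (tensor_algebra B)" "delta w \<in> carrier (tensor_algebra B)"
   by (auto intro: delta_in_free_space)
  then show ?case
   using Cons H(3) K(3) assms(4) delta_mult[where u = "[b]" and v = w and B = B] by (metis append_Cons append_Nil)
 qed
qed

section \<open>Crossed products\<close>

definition action :: "'g monoid => (complex, 'a) module => ('g => 'a => 'a) => bool"
 where "action G A \<alpha> \<longleftrightarrow> (\<forall>g\<in>carrier G. alg_hom A A (\<alpha> g)) \<and> (\<forall>x\<in>carrier A. \<alpha> \<one>\<^bsub>G\<^esub> x = x) \<and>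
  (\<forall>g\<in>carrier G. \<forall>h\<in>carrier G. \<forall>x\<in>carrier A. \<alpha> (g \<otimes>\<^bsub>G\<^esub> h) x = \<alpha> g (\<alpha> h x))"

locale crossed_alg =
 fixes A :: "(complex, 'a) module" (structure) and G :: "'g monoid" and \<alpha> :: "'g => 'a => 'a"
 assumes A [simp]: "complex_algebra A" and G: "group G" and act: "action G A \<alpha>"
begin

sublocale G: group G by (rule G)

abbreviation "C \<equiv> crossed_product A G \<alpha>"

lemma act_alg_hom: "g \<in> carrier G ==> alg_hom A A (\<alpha> g)"
 and act_one [simp]: "x \<in> carrier A ==> \<alpha> \<one>\<^bsub>G\<^esub> x = x"
 and act_act: "g \<in> carrier G ==> h \<in> carrier G ==> x \<in> carrier A ==> \<alpha> g (\<alpha> h x) = \<alpha> (g \<otimes>\<^bsub>G\<^esub> h) x"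
 using act by (auto simp: action_def)

lemma act_simps [simp]:
 assumes "g \<in> carrier G"
 shows "x \<in> carrier A ==> \<alpha> g x \<in> carrier A"
  and "x \<in> carrier A ==> y \<in> carrier A ==> \<alpha> g (x \<oplus> y) = \<alpha> g x \<oplus> \<alpha> g y"
  and "x \<in> carrier A ==> \<alpha> g (c \<odot> x) = c \<odot> \<alpha> g x"
  and "x \<in> carrier A ==> y \<in> carrier A ==> \<alpha> g (x \<otimes> y) = \<alpha> g x \<otimes> \<alpha> g y"
  and "\<alpha> g \<one> = \<one>" and "\<alpha> g \<zero> = \<zero>"
 using act_alg_hom[OF assms] linD lin_zero[of A A "\<alpha> g"] by (auto simp: alg_hom_def)

lemma C_simps [simp]:
 shows "\<zero>\<^bsub>C\<^esub> = (%k. \<zero>)" and "F \<oplus>\<^bsub>C\<^esub> H = (%k. F k \<oplus> H k)" and "c \<odot>\<^bsub>C\<^esub> F = (%k. c \<odot> F k)"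
  and "\<one>\<^bsub>C\<^esub> = crossed A \<one> \<one>\<^bsub>G\<^esub>"
 by (simp_all add: crossed_product_def crossed_def)

lemma mult_C: "F \<otimes>\<^bsub>C\<^esub> H = (%k. if k \<in> carrier G
  then finsum A (%g. F g \<otimes> \<alpha> g (H (inv\<^bsub>G\<^esub> g \<otimes>\<^bsub>G\<^esub> k))) {g \<in> carrier G. F g ~= \<zero>}
  else \<zero>)"
 by (simp add: crossed_product_def)

lemma carrier_C: "F \<in> carrier C \<longleftrightarrow> (\<forall>g. F g \<in> carrier A) \<and> finite {g. F g ~= \<zero>} \<and>
  {g. F g ~= \<zero>} \<subseteq> carrier G"
proof -
 have "F g \<in> carrier A" if "\<forall>g\<in>carrier G. F g \<in> carrier A" "\<forall>g. g \<notin> carrier G --> F g = \<zero>" for g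
  using that by (cases "g \<in> carrier G") auto
 then show ?thesis by (auto simp: crossed_product_def)
qed

lemma value_C [simp]: "F \<in> carrier C ==> F g \<in> carrier A"
 by (simp add: carrier_C)

lemma crossed_closed [simp]: "a \<in> carrier A ==> g \<in> carrier G ==> crossed A a g \<in> carrier C"
 by (auto simp: carrier_C crossed_def intro: finite_subset[of _ "{g}"])

lemma add_closed_C: "F \<in> carrier C ==> H \<in> carrier C ==> F \<oplus>\<^bsub>C\<^esub> H \<in> carrier C"
proof -
 assume FH: "F \<in> carrier C" "H \<in> carrier C"
 have "{k. F k \<oplus> H k ~= \<zero>} \<subseteq> {k. F k ~= \<zero>} \<union> {k. H k ~= \<zero>}"
  by auto
 then show "F \<oplus>\<^bsub>C\<^esub> H \<in> carrier C"
  using FH by (auto simp: carrier_C intro: finite_subset)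
qed

lemma vspc_C [simp]: "vspc C"
proof (rule vspcI)
 have neg: "(%k. \<ominus> F k) \<in> carrier C" if "F \<in> carrier C" for F
 proof -
  have "{k. \<ominus> F k ~= \<zero>} \<subseteq> {k. F k ~= \<zero>}"
   by (auto simp: vspc_neg)
  then show ?thesis using that by (auto simp: carrier_C intro: finite_subset)
 qed
 show "abelian_group C"
 proof (rule abelian_groupI)
  fix F assume "F \<in> carrier C"
  then show "\<exists>H\<in>carrier C. H \<oplus>\<^bsub>C\<^esub> F = \<zero>\<^bsub>C\<^esub>"
   using neg by (intro bexI[of _ "%k. \<ominus> F k"]) auto
 qed (use add_closed_C in \<open>auto simp: carrier_C fun_eq_iff vspc_assoc vspc_comm vspc_left_comm\<close>)
 fix c F assume F: "F \<in> carrier C"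
 have "{k. c \<odot> F k ~= \<zero>} \<subseteq> {k. F k ~= \<zero>}"
  by auto
 then show "c \<odot>\<^bsub>C\<^esub> F \<in> carrier C"
  using F by (auto simp: carrier_C intro: finite_subset)
qed (auto simp: fun_eq_iff vspc_distl vspc_distr)

lemma crossed_add: "a \<in> carrier A ==> b \<in> carrier A ==>
  crossed A (a \<oplus> b) g = crossed A a g \<oplus>\<^bsub>C\<^esub> crossed A b g"
 by (auto simp: crossed_def fun_eq_iff)

lemma crossed_smult: "a \<in> carrier A ==> crossed A (c \<odot> a) g = c \<odot>\<^bsub>C\<^esub> crossed A a g"
 by (auto simp: crossed_def fun_eq_iff)

lemma lin_crossed: "g \<in> carrier G ==> lin A C (%a. crossed A a g)"
 unfolding lin_def using crossed_add crossed_smult crossed_closed by blast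

text \<open>Induction on the number of group elements that occur.\<close>

lemma crossed_induct [consumes 1, case_names add crossed]:
 assumes "F \<in> carrier C"
  and "!!F H. F \<in> carrier C ==> H \<in> carrier C ==> P F ==> P H ==> P (F \<oplus>\<^bsub>C\<^esub> H)"
  and "!!a g. a \<in> carrier A ==> g \<in> carrier G ==> P (crossed A a g)"
 shows "P F"
proof -
 have "\<forall>F\<in>carrier C. {g. F g ~= \<zero>} = S --> P F" if "finite S" for S
  using that
 proof (induction S)
  case empty
  show ?case
  proof (intro ballI impI)
   fix F :: "'g => 'a" assume "{g. F g ~= \<zero>} = {}"
   then have "F = crossed A \<zero> \<one>\<^bsub>G\<^esub>" by (auto simp: crossed_def fun_eq_iff)
   then show "P F" using assms(3) by simp
  qed
 next
  case (insert h S)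
  show ?case
  proof (intro ballI impI)
   fix F assume F: "F \<in> carrier C" "{g. F g ~= \<zero>} = insert h S"
   define H where "H = (%g. if g = h then \<zero> else F g)"
   have H: "{g. H g ~= \<zero>} = S"
    using F(2) insert.hyps(2) by (auto simp: H_def)
   then have "H \<in> carrier C"
    using F insert.hyps(1) unfolding carrier_C by (auto simp: H_def)
   moreover from this have "P H" using insert.IH H by blast
   moreover have h: "h \<in> carrier G" using F by (auto simp: carrier_C)
   ultimately have "P (H \<oplus>\<^bsub>C\<^esub> crossed A (F h) h)"
    using F(1) by (intro assms(2,3) crossed_closed) auto
   moreover have "H \<oplus>\<^bsub>C\<^esub> crossed A (F h) h = F"
    using F(1) by (auto simp: H_def crossed_def fun_eq_iff)
   ultimately show "P F" by simp
  qed
 qed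
 then show ?thesis using assms(1) by (auto simp: carrier_C)
qed

lemma mult_C_superset:
 assumes "F \<in> carrier C" "H \<in> carrier C" "finite S" "{g. F g ~= \<zero>} \<subseteq> S" "S \<subseteq> carrier G" "k \<in> carrier G"
 shows "(F \<otimes>\<^bsub>C\<^esub> H) k = finsum A (%g. F g \<otimes> \<alpha> g (H (inv\<^bsub>G\<^esub> g \<otimes>\<^bsub>G\<^esub> k))) S"
proof -
 have "(F \<otimes>\<^bsub>C\<^esub> H) k = finsum A (%g. F g \<otimes> \<alpha> g (H (inv\<^bsub>G\<^esub> g \<otimes>\<^bsub>G\<^esub> k))) {g \<in> carrier G. F g ~= \<zero>}"
  by (simp only: mult_C assms(6) if_True)
 also have "\<dots> = finsum A (%g. F g \<otimes> \<alpha> g (H (inv\<^bsub>G\<^esub> g \<otimes>\<^bsub>G\<^esub> k))) S"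
 proof (rule finsum_cong_set)
  have val: "\<alpha> g (H (inv\<^bsub>G\<^esub> g \<otimes>\<^bsub>G\<^esub> k)) \<in> carrier A" if "g \<in> carrier G" for g
   using that value_C[OF assms(2)] by (rule act_simps(1))
  show "F g \<otimes> \<alpha> g (H (inv\<^bsub>G\<^esub> g \<otimes>\<^bsub>G\<^esub> k)) = \<zero>"
   if "g \<in> S" "g \<notin> {g \<in> carrier G. F g ~= \<zero>}" for g
   using that assms(5) val[of g] complex_algebra_simps(5)[OF A] by auto
  show "F g \<otimes> \<alpha> g (H (inv\<^bsub>G\<^esub> g \<otimes>\<^bsub>G\<^esub> k)) \<in> carrier A"
   if "g \<in> {g \<in> carrier G. F g ~= \<zero>}" for g
   using that val[of g] complex_algebra_simps(2)[OF A value_C[OF assms(1)]] by blast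
 qed (use assms(3,4) in auto)
 finally show ?thesis .
qed

lemma mult_C_outside: "k \<notin> carrier G ==> (F \<otimes>\<^bsub>C\<^esub> H) k = \<zero>"
 by (simp only: mult_C if_False)

lemma mult_C_add_left:
 assumes "F \<in> carrier C" "F' \<in> carrier C" "H \<in> carrier C"
 shows "(F \<oplus>\<^bsub>C\<^esub> F') \<otimes>\<^bsub>C\<^esub> H = F \<otimes>\<^bsub>C\<^esub> H \<oplus>\<^bsub>C\<^esub> F' \<otimes>\<^bsub>C\<^esub> H"
proof
 fix k
 define S where "S = {g. F g ~= \<zero>} \<union> {g. F' g ~= \<zero>}"
 have S: "finite S" "S \<subseteq> carrier G" "{g. F g ~= \<zero>} \<subseteq> S" "{g. F' g ~= \<zero>} \<subseteq> S"
  "{g. (F \<oplus>\<^bsub>C\<^esub> F') g ~= \<zero>} \<subseteq> S"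
  using assms by (auto simp: carrier_C S_def)
 show "((F \<oplus>\<^bsub>C\<^esub> F') \<otimes>\<^bsub>C\<^esub> H) k = (F \<otimes>\<^bsub>C\<^esub> H \<oplus>\<^bsub>C\<^esub> F' \<otimes>\<^bsub>C\<^esub> H) k"
 proof (cases "k \<in> carrier G")
  case True
  have "((F \<oplus>\<^bsub>C\<^esub> F') \<otimes>\<^bsub>C\<^esub> H) k =
    finsum A (%g. F g \<otimes> \<alpha> g (H (inv\<^bsub>G\<^esub> g \<otimes>\<^bsub>G\<^esub> k)) \<oplus> F' g \<otimes> \<alpha> g (H (inv\<^bsub>G\<^esub> g \<otimes>\<^bsub>G\<^esub> k))) S"
   unfolding mult_C_superset[OF add_closed_C[OF assms(1,2)] assms(3) S(1,5,2) True]
   using assms S(2) by (intro finsum_cong1) (auto simp: algebra_distl subset_iff)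
  then show ?thesis
   using mult_C_superset[OF assms(1,3) S(1,3,2) True] mult_C_superset[OF assms(2,3) S(1,4,2) True] assms S(2)
   by (subst (asm) finsum_add) auto
 qed (simp add: mult_C_outside)
qed

lemma mult_C_add_right:
 assumes "F \<in> carrier C" "H \<in> carrier C" "H' \<in> carrier C"
 shows "F \<otimes>\<^bsub>C\<^esub> (H \<oplus>\<^bsub>C\<^esub> H') = F \<otimes>\<^bsub>C\<^esub> H \<oplus>\<^bsub>C\<^esub> F \<otimes>\<^bsub>C\<^esub> H'"
proof
 fix k
 define S where "S = {g. F g ~= \<zero>}"
 have S: "finite S" "S \<subseteq> carrier G" "{g. F g ~= \<zero>} \<subseteq> S"
  using assms by (auto simp: carrier_C S_def)
 show "(F \<otimes>\<^bsub>C\<^esub> (H \<oplus>\<^bsub>C\<^esub> H')) k = (F \<otimes>\<^bsub>C\<^esub> H \<oplus>\<^bsub>C\<^esub> F \<otimes>\<^bsub>C\<^esub> H') k"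
 proof (cases "k \<in> carrier G")
  case True
  have "(F \<otimes>\<^bsub>C\<^esub> (H \<oplus>\<^bsub>C\<^esub> H')) k =
    finsum A (%g. F g \<otimes> \<alpha> g (H (inv\<^bsub>G\<^esub> g \<otimes>\<^bsub>G\<^esub> k)) \<oplus> F g \<otimes> \<alpha> g (H' (inv\<^bsub>G\<^esub> g \<otimes>\<^bsub>G\<^esub> k))) S"
   unfolding mult_C_superset[OF assms(1) add_closed_C[OF assms(2,3)] S(1,3,2) True]
   using assms S(2) by (intro finsum_cong1) (auto simp: algebra_distr subset_iff)
  then show ?thesis
   using mult_C_superset[OF assms(1,2) S(1,3,2) True] mult_C_superset[OF assms(1,3) S(1,3,2) True] assms S(2)
   by (subst (asm) finsum_add) auto
 qed (simp add: mult_C_outside)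
qed

lemma crossed_mult:
 assumes "a \<in> carrier A" "b \<in> carrier A" "g \<in> carrier G" "h \<in> carrier G"
 shows "crossed A a g \<otimes>\<^bsub>C\<^esub> crossed A b h = crossed A (a \<otimes> \<alpha> g b) (g \<otimes>\<^bsub>G\<^esub> h)"
proof
 fix k
 show "(crossed A a g \<otimes>\<^bsub>C\<^esub> crossed A b h) k = crossed A (a \<otimes> \<alpha> g b) (g \<otimes>\<^bsub>G\<^esub> h) k"
 proof (cases "k \<in> carrier G")
  case True
  have "(crossed A a g \<otimes>\<^bsub>C\<^esub> crossed A b h) k =
    finsum A (%g'. crossed A a g g' \<otimes> \<alpha> g' (crossed A b h (inv\<^bsub>G\<^esub> g' \<otimes>\<^bsub>G\<^esub> k))) {g}"
   by (rule mult_C_superset[OF crossed_closed[OF assms(1,3)] crossed_closed[OF assms(2,4)]])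
    (use assms True in \<open>auto simp: crossed_def\<close>)
  also have "\<dots> = crossed A a g g \<otimes> \<alpha> g (crossed A b h (inv\<^bsub>G\<^esub> g \<otimes>\<^bsub>G\<^esub> k))"
   using assms by (intro finsum_single) (auto simp: crossed_def)
  also have "\<dots> = crossed A (a \<otimes> \<alpha> g b) (g \<otimes>\<^bsub>G\<^esub> h) k"
  proof -
   have "inv\<^bsub>G\<^esub> g \<otimes>\<^bsub>G\<^esub> k = h \<longleftrightarrow> k = g \<otimes>\<^bsub>G\<^esub> h"
    using assms(3,4) True G.inv_solve_left by metis
   then show ?thesis using assms by (simp add: crossed_def)
  qed
  finally show ?thesis .
 next
  case False
  then have "k ~= g \<otimes>\<^bsub>G\<^esub> h" using assms by auto
  then show ?thesis using False by (simp add: mult_C_outside crossed_def)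
 qed
qed

lemma mult_C_closed: "F \<in> carrier C ==> H \<in> carrier C ==> F \<otimes>\<^bsub>C\<^esub> H \<in> carrier C"
proof (induction F rule: crossed_induct)
 case (add F F')
 then show ?case by (simp only: mult_C_add_left add_closed_C)
next
 case (crossed a g)
 show ?case using crossed(3)
 proof (induction H rule: crossed_induct)
  case (add H H')
  then show ?case using crossed by (simp only: mult_C_add_right add_closed_C crossed_closed)
 next
  case (crossed b h)
  then show ?case using \<open>a \<in> carrier A\<close> \<open>g \<in> carrier G\<close> by (simp add: crossed_mult)
 qed
qed

lemma lin_mult_C:
 assumes "F \<in> carrier C"
 shows "lin C C (%H. F \<otimes>\<^bsub>C\<^esub> H)" and "lin C C (%H. H \<otimes>\<^bsub>C\<^esub> F)"
proof -
 have 1: "F \<otimes>\<^bsub>C\<^esub> (c \<odot>\<^bsub>C\<^esub> H) = c \<odot>\<^bsub>C\<^esub> (F \<otimes>\<^bsub>C\<^esub> H) \<and> (c \<odot>\<^bsub>C\<^esub> F) \<otimes>\<^bsub>C\<^esub> H = c \<odot>\<^bsub>C\<^esub> (F \<otimes>\<^bsub>C\<^esub> H)"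
  if "F \<in> carrier C" "H \<in> carrier C" for F H c
  using that(1)
 proof (induction F rule: crossed_induct)
  case (add F F')
  then show ?case using that(2)
   by (simp only: mult_C_add_left mult_C_closed add_closed_C vspc_distr[OF vspc_C] vspc_simps(3)[OF vspc_C])
 next
  case (crossed a g)
  show ?case using that(2)
  proof (induction H rule: crossed_induct)
   case (add H H')
   then show ?case using crossed
    by (simp only: mult_C_add_right mult_C_closed crossed_closed add_closed_C vspc_distr[OF vspc_C] vspc_simps(3)[OF vspc_C])
  next
   case (crossed b h)
   then show ?case using \<open>a \<in> carrier A\<close> \<open>g \<in> carrier G\<close>
    by (simp del: C_simps add: crossed_mult crossed_smult[symmetric])
  qed
 qed
 show "lin C C (%H. F \<otimes>\<^bsub>C\<^esub> H)" and "lin C C (%H. H \<otimes>\<^bsub>C\<^esub> F)"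
  using assms by (simp_all del: C_simps add: lin_def mult_C_closed mult_C_add_left mult_C_add_right 1)
qed

lemma complex_algebra_C [simp]: "complex_algebra C"
proof (rule complex_algebraI)
 note [simp del] = C_simps(2,3)
 show "\<one>\<^bsub>C\<^esub> \<in> carrier C" by simp
 fix F H K assume F: "F \<in> carrier C" and H: "H \<in> carrier C" and K: "K \<in> carrier C"
 show "\<one>\<^bsub>C\<^esub> \<otimes>\<^bsub>C\<^esub> F = F"
  using F by (induction rule: crossed_induct) (simp_all add: mult_C_add_right crossed_mult)
 show "F \<otimes>\<^bsub>C\<^esub> \<one>\<^bsub>C\<^esub> = F"
  using F by (induction rule: crossed_induct) (simp_all add: mult_C_add_left crossed_mult)
 show "F \<otimes>\<^bsub>C\<^esub> H \<otimes>\<^bsub>C\<^esub> K = F \<otimes>\<^bsub>C\<^esub> (H \<otimes>\<^bsub>C\<^esub> K)"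
  using F
 proof (induction rule: crossed_induct)
  case (add F F')
  then show ?case using H K by (simp add: mult_C_add_left mult_C_closed)
 next
  case (crossed a g)
  show ?case using H
  proof (induction rule: crossed_induct)
   case (add H H')
   then show ?case using crossed K by (simp add: mult_C_add_left mult_C_add_right mult_C_closed)
  next
   case (crossed b h)
   show ?case using K
   proof (induction rule: crossed_induct)
    case (add K K')
    then show ?case using crossed \<open>a \<in> carrier A\<close> \<open>g \<in> carrier G\<close>
     by (simp add: mult_C_add_left mult_C_add_right mult_C_closed)
   next
    case (crossed c k)
    then show ?case using \<open>a \<in> carrier A\<close> \<open>g \<in> carrier G\<close> \<open>b \<in> carrier A\<close> \<open>h \<in> carrier G\<close>
     by (simp add: crossed_mult act_act algebra_assoc G.m_assoc)
   qed
  qed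
 qed
qed (use lin_mult_C mult_C_closed in \<open>simp_all del: C_simps\<close>)

lemma crossed_factor: "a \<in> carrier A ==> g \<in> carrier G ==>
  crossed A a g = crossed A a \<one>\<^bsub>G\<^esub> \<otimes>\<^bsub>C\<^esub> crossed A \<one> g"
 by (simp add: crossed_mult)

lemma alg_hom_crossed: "alg_hom A C (%a. crossed A a \<one>\<^bsub>G\<^esub>)"
 using lin_crossed[of "\<one>\<^bsub>G\<^esub>"] by (simp add: alg_hom_def crossed_mult)

text \<open>The universal property of the crossed product.\<close>

lemma crossed_lift:
 assumes R: "complex_algebra R" and j: "alg_hom A R j"
  and u: "!!g. g \<in> carrier G ==> u g \<in> carrier R" "u \<one>\<^bsub>G\<^esub> = \<one>\<^bsub>R\<^esub>"
   "!!g h. g \<in> carrier G ==> h \<in> carrier G ==> u (g \<otimes>\<^bsub>G\<^esub> h) = u g \<otimes>\<^bsub>R\<^esub> u h"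
  and cov: "!!g a. g \<in> carrier G ==> a \<in> carrier A ==> u g \<otimes>\<^bsub>R\<^esub> j a = j (\<alpha> g a) \<otimes>\<^bsub>R\<^esub> u g"
 shows "\<exists>\<psi>. alg_hom C R \<psi> \<and> (\<forall>a\<in>carrier A. \<forall>g\<in>carrier G. \<psi> (crossed A a g) = j a \<otimes>\<^bsub>R\<^esub> u g)"
proof -
 note J = alg_homD[OF j] and JD = linD[OF alg_homD(1)[OF j]]
 have j0: "j \<zero> = \<zero>\<^bsub>R\<^esub>" using lin_zero[OF J(1)] R by simp
 define \<psi> where "\<psi> F = finsum R (%g. j (F g) \<otimes>\<^bsub>R\<^esub> u g) {g. F g ~= \<zero>}" for F
 have closed: "j (F g) \<otimes>\<^bsub>R\<^esub> u g \<in> carrier R" if "F \<in> carrier C" "g \<in> carrier G" for F g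
  using that R JD(1) u(1) by simp
 have sup: "\<psi> F = finsum R (%g. j (F g) \<otimes>\<^bsub>R\<^esub> u g) S"
  if "F \<in> carrier C" "finite S" "{g. F g ~= \<zero>} \<subseteq> S" "S \<subseteq> carrier G" for F S
  unfolding \<psi>_def using that closed[OF that(1)] R j0 u(1) by (intro finsum_cong_set) (auto simp: subset_iff)
 have supp: "finite {g. F g ~= \<zero>}" "{g. F g ~= \<zero>} \<subseteq> carrier G" if "F \<in> carrier C" for F
  using that by (auto simp: carrier_C)
 have \<psi>c: "\<psi> F \<in> carrier R" if "F \<in> carrier C" for F
  unfolding \<psi>_def using R closed[OF that] supp(2)[OF that] by (intro finsum_closed') auto
 have add: "\<psi> (F \<oplus>\<^bsub>C\<^esub> H) = \<psi> F \<oplus>\<^bsub>R\<^esub> \<psi> H" if FH: "F \<in> carrier C" "H \<in> carrier C" for F H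
 proof -
  define S where "S = {g. F g ~= \<zero>} \<union> {g. H g ~= \<zero>}"
  have S: "finite S" "{g. F g ~= \<zero>} \<subseteq> S" "{g. H g ~= \<zero>} \<subseteq> S" "S \<subseteq> carrier G"
   "{g. (F \<oplus>\<^bsub>C\<^esub> H) g ~= \<zero>} \<subseteq> S"
   using supp FH by (auto simp: S_def)
  have "\<psi> (F \<oplus>\<^bsub>C\<^esub> H) = finsum R (%g. j ((F \<oplus>\<^bsub>C\<^esub> H) g) \<otimes>\<^bsub>R\<^esub> u g) S"
   by (rule sup[OF add_closed_C[OF FH] S(1,5,4)])
  also have "\<dots> = finsum R (%g. j (F g) \<otimes>\<^bsub>R\<^esub> u g \<oplus>\<^bsub>R\<^esub> j (H g) \<otimes>\<^bsub>R\<^esub> u g) S"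
   using R FH S(4) u(1) JD by (intro finsum_cong1) (auto simp: algebra_distl subset_iff)
  also have "\<dots> = \<psi> F \<oplus>\<^bsub>R\<^esub> \<psi> H"
   using R FH S(4) closed by (subst finsum_add) (auto simp: sup[OF FH(1) S(1,2,4)] sup[OF FH(2) S(1,3,4)])
  finally show ?thesis .
 qed
 have cr: "\<psi> (crossed A a g) = j a \<otimes>\<^bsub>R\<^esub> u g" if "a \<in> carrier A" "g \<in> carrier G" for a g
 proof -
  have "\<psi> (crossed A a g) = finsum R (%h. j (crossed A a g h) \<otimes>\<^bsub>R\<^esub> u h) {g}"
   by (rule sup[OF crossed_closed[OF that]]) (use that in \<open>auto simp: crossed_def\<close>)
  also have "\<dots> = j a \<otimes>\<^bsub>R\<^esub> u g"
   using that R JD(1) u(1) by (subst finsum_single[where x = g]) (auto simp: crossed_def)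
  finally show ?thesis .
 qed
 have sc: "\<psi> (c \<odot>\<^bsub>C\<^esub> F) = c \<odot>\<^bsub>R\<^esub> \<psi> F" if "F \<in> carrier C" for c F
  using that
 proof (induction rule: crossed_induct)
  case (add F H)
  then show ?case using R
   by (simp del: C_simps add: vspc_distr \<open>!!H F. F \<in> carrier C ==> H \<in> carrier C ==> \<psi> (F \<oplus>\<^bsub>C\<^esub> H) = \<psi> F \<oplus>\<^bsub>R\<^esub> \<psi> H\<close> \<psi>c)
 next
  case (crossed a g)
  then show ?case using R JD u(1) by (simp del: C_simps add: crossed_smult[symmetric] cr)
 qed
 have lin: "lin C R \<psi>"
  unfolding lin_def using \<psi>c add sc by blast
 have mult: "\<psi> (F \<otimes>\<^bsub>C\<^esub> H) = \<psi> F \<otimes>\<^bsub>R\<^esub> \<psi> H" if "F \<in> carrier C" "H \<in> carrier C" for F H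
  using that
 proof (induction F rule: crossed_induct)
  case (add F F')
  then show ?case using R
   by (simp del: C_simps add: mult_C_add_left mult_C_closed linD[OF lin] algebra_distl)
 next
  case (crossed a g)
  show ?case using crossed(3)
  proof (induction H rule: crossed_induct)
   case (add H H')
   then show ?case using R crossed
    by (simp del: C_simps add: mult_C_add_right mult_C_closed linD[OF lin] algebra_distr)
  next
   case (crossed b h)
   note ag = \<open>a \<in> carrier A\<close> \<open>g \<in> carrier G\<close>
   have "\<psi> (crossed A a g \<otimes>\<^bsub>C\<^esub> crossed A b h) = j a \<otimes>\<^bsub>R\<^esub> (j (\<alpha> g b) \<otimes>\<^bsub>R\<^esub> u g) \<otimes>\<^bsub>R\<^esub> u h"
    using crossed ag R JD(1) u(1) by (simp add: crossed_mult cr J(3) u(3) algebra_assoc)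
   also have "\<dots> = j a \<otimes>\<^bsub>R\<^esub> (u g \<otimes>\<^bsub>R\<^esub> j b) \<otimes>\<^bsub>R\<^esub> u h"
    using crossed ag by (simp add: cov)
   finally show ?case
    using crossed ag R JD(1) u(1) by (simp add: cr algebra_assoc)
  qed
 qed
 have "\<psi> \<one>\<^bsub>C\<^esub> = \<one>\<^bsub>R\<^esub>"
  using R J(2) u(2) by (simp add: cr)
 then have "alg_hom C R \<psi>"
  using lin mult by (simp add: alg_hom_def del: C_simps)
 then show ?thesis using cr by blast
qed

lemma crossed_unique:
 assumes R: "complex_algebra R" and h: "alg_hom C R h" and k: "alg_hom C R k"
  and "!!a. a \<in> carrier A ==> h (crossed A a \<one>\<^bsub>G\<^esub>) = k (crossed A a \<one>\<^bsub>G\<^esub>)"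
  and "!!g. g \<in> carrier G ==> h (crossed A \<one> g) = k (crossed A \<one> g)"
  and "F \<in> carrier C"
 shows "h F = k F"
 using assms(6)
proof (induction rule: crossed_induct)
 case (add F H)
 then show ?case using linD(2)[OF alg_homD(1)[OF h]] linD(2)[OF alg_homD(1)[OF k]] by (simp del: C_simps)
next
 case (crossed a g)
 then show ?case
  using alg_homD(3)[OF h] alg_homD(3)[OF k] assms(4,5) by (subst (1 2) crossed_factor) auto
qed

end

section \<open>The Fock representation of a braided vector space of group type\<close>

text \<open>
 A Yetter--Drinfeld module in coordinates: \<open>B\<close> is a basis of homogeneous vectors, and \<open>r g c
 d\<close> is the coefficient of \<open>c\<close> in \<open>g \<triangleright> d\<close>.
\<close>

locale yd_matrix =
 fixes G :: "'g monoid" (structure) and B :: "'b set" and deg :: "'b => 'g" and r :: "'g => 'b => 'b => complex"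
 assumes group: "group G" and fin [simp]: "finite B"
  and deg_closed [simp]: "b \<in> B ==> deg b \<in> carrier G"
  and r_one: "c \<in> B ==> d \<in> B ==> r \<one> c d = (if c = d then 1 else 0)"
  and r_mult: "g \<in> carrier G ==> h \<in> carrier G ==> d \<in> B ==>
   r (g \<otimes> h) c d = (\<Sum>e\<in>B. r g c e * r h e d)"
  and r_deg: "g \<in> carrier G ==> c \<in> B ==> d \<in> B ==> r g c d ~= 0 ==>
   deg c = g \<otimes> deg d \<otimes> inv g"
  and r_outside: "g \<in> carrier G ==> d \<in> B ==> c \<notin> B ==> r g c d = 0"
begin

sublocale G: group G by (rule group)

abbreviation unit :: "'b list => complex" ("\<epsilon>") where "\<epsilon> \<equiv> delta []"

text \<open>
 The action of \<open>g\<close> on all tensor factors, for arbitrary functions of words as coefficients; the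
 recursion treats the first factor separately.
\<close>

fun gact :: "'g => ('b list => complex) => 'b list => complex" where
 "gact g s [] = s []"
| "gact g s (c # u) = (\<Sum>d\<in>B. r g c d * gact g (%w. s (d # w)) u)"

text \<open>
 The insertion of \<open>v\<close> at all positions of a tensor. If \<open>v\<close> does not become the first
 letter, it passes to the right of the first letter, on which its degree then acts.
\<close>

fun create :: "'b => ('b list => complex) => 'b list => complex" where
 "create v s [] = 0"
| "create v s (c # u) = (if c = v then s u else 0) + (\<Sum>d\<in>B. r (deg v) c d * create v (%w. s (d # w)) u)"

definition sym :: "'b list => 'b list => complex"
 where "sym w = foldr create w \<epsilon>"

lemma sym_simps [simp]: "sym [] = \<epsilon>" "sym (b # w) = create b (sym w)"
 by (simp_all add: sym_def)

lemma gact_sum: "gact g (%w. \<Sum>i\<in>I. k i * s i w) u = (\<Sum>i\<in>I. k i * gact g (s i) u)"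
proof (induction u arbitrary: s)
 case (Cons c u)
 have "gact g (%w. \<Sum>i\<in>I. k i * s i w) (c # u) = (\<Sum>d\<in>B. \<Sum>i\<in>I. r g c d * (k i * gact g (%w. s i (d # w)) u))"
  by (simp add: Cons.IH sum_distrib_left)
 also have "\<dots> = (\<Sum>i\<in>I. k i * gact g (s i) (c # u))"
  by (subst sum.swap) (simp add: sum_distrib_left mult.left_commute)
 finally show ?case .
qed simp

lemma create_sum: "create v (%w. \<Sum>i\<in>I. k i * s i w) u = (\<Sum>i\<in>I. k i * create v (s i) u)"
proof (induction u arbitrary: s)
 case (Cons c u)
 have "create v (%w. \<Sum>i\<in>I. k i * s i w) (c # u) = (if c = v then \<Sum>i\<in>I. k i * s i u else 0) +
   (\<Sum>d\<in>B. \<Sum>i\<in>I. r (deg v) c d * (k i * create v (%w. s i (d # w)) u))"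
  by (simp add: Cons.IH sum_distrib_left)
 also have "\<dots> = (\<Sum>i\<in>I. k i * create v (s i) (c # u))"
  by (subst sum.swap) (simp add: sum_distrib_left mult.left_commute distrib_left sum.distrib)
 finally show ?case .
qed simp

lemma create_add: "create v (%w. s w + t w) u = create v s u + create v t u"
 and create_scale: "create v (%w. c * s w) u = c * create v s u"
 and create_zero [simp]: "create v (%_. 0) u = 0"
 and gact_add: "gact g (%w. s w + t w) u = gact g s u + gact g t u"
 and gact_scale: "gact g (%w. c * s w) u = c * gact g s u"
 and gact_zero [simp]: "gact g (%_. 0) u = 0"
 using create_sum[of v "%_. 1" "%i. if i then s else t" UNIV u] create_sum[of v "%_. c" "%_. s" "{()}" u]
  create_sum[of v _ _ "{}" u]
  gact_sum[of g "%_. 1" "%i. if i then s else t" UNIV u] gact_sum[of g "%_. c" "%_. s" "{()}" u]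
  gact_sum[of g _ _ "{}" u]
 by (simp_all add: UNIV_bool add.commute)

lemma gact_mult:
 assumes "g \<in> carrier G" "h \<in> carrier G"
 shows "gact g (gact h s) u = gact (g \<otimes> h) s u"
proof (induction u arbitrary: s)
 case (Cons c u)
 have "gact g (gact h s) (c # u) = (\<Sum>d\<in>B. r g c d * (\<Sum>f\<in>B. r h d f * gact g (gact h (%w. s (f # w))) u))"
  by (simp add: gact_sum)
 also have "\<dots> = (\<Sum>d\<in>B. \<Sum>f\<in>B. r g c d * r h d f * gact (g \<otimes> h) (%w. s (f # w)) u)"
  by (simp only: Cons.IH sum_distrib_left mult.assoc)
 also have "\<dots> = gact (g \<otimes> h) s (c # u)"
  by (subst sum.swap) (simp add: r_mult assms sum_distrib_right)
 finally show ?case .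
qed simp

lemma gact_one:
 assumes "!!w. w \<notin> lists B ==> s w = 0"
 shows "gact \<one> s u = s u"
 using assms
proof (induction u arbitrary: s)
 case (Cons c u)
 have "gact \<one> s (c # u) = (\<Sum>d\<in>B. r \<one> c d * s (d # u))"
  using Cons.prems by (simp add: Cons.IH)
 also have "\<dots> = s (c # u)"
 proof (cases "c \<in> B")
  case True
  have "(\<Sum>d\<in>B. r \<one> c d * s (d # u)) = (\<Sum>d\<in>B. if d = c then s (d # u) else 0)"
   by (intro sum.cong) (auto simp: r_one True)
  then show ?thesis using True by simp
 next
  case False
  then show ?thesis using Cons.prems[of "c # u"] by (simp add: r_outside)
 qed
 finally show ?case .
qed simp

lemma gact_unit [simp]: "gact g \<epsilon> = \<epsilon>"
proof
 fix u show "gact g \<epsilon> u = \<epsilon> u"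
  by (cases u) (simp_all add: delta_def)
qed

lemma gact_outside:
 assumes "g \<in> carrier G" "!!w. w \<notin> lists B ==> s w = 0" "u \<notin> lists B"
 shows "gact g s u = 0"
 using assms(2,3)
proof (induction u arbitrary: s)
 case (Cons c u)
 show ?case
 proof (cases "c \<in> B")
  case True
  then have "gact g (%w. s (d # w)) u = 0" if "d \<in> B" for d
   using Cons.prems that by (intro Cons.IH) auto
  then show ?thesis by simp
 qed (simp add: r_outside assms(1))
qed simp

lemma create_outside:
 assumes "v \<in> B" "!!w. w \<notin> lists B ==> s w = 0" "u \<notin> lists B"
 shows "create v s u = 0"
 using assms(2,3)
proof (induction u arbitrary: s)
 case (Cons c u)
 show ?case
 proof (cases "c \<in> B")
  case True
  then have "create v (%w. s (d # w)) u = 0" if "d \<in> B" for d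
   using Cons.prems that by (intro Cons.IH) auto
  moreover have "s u = 0" using Cons.prems True by simp
  ultimately show ?thesis by simp
 next
  case False
  then show ?thesis using assms(1) by (auto simp add: r_outside)
 qed
qed simp

lemma sym_outside: "w \<in> lists B ==> u \<notin> lists B ==> sym w u = 0"
proof (induction w arbitrary: u)
 case Nil then show ?case by (auto simp: delta_def)
next
 case (Cons b w) then show ?case by (simp add: create_outside)
qed

lemma gact_snoc: "gact g s (u @ [c]) = (\<Sum>d\<in>B. r g c d * gact g (%w. s (w @ [d])) u)"
proof (induction u arbitrary: s)
 case (Cons e u)
 show ?case
  by (simp add: Cons.IH sum_distrib_left mult.left_commute) (subst sum.swap, simp)
qed simp

text \<open>
 Deleting the last letter of an insertion: either \<open>v\<close> was inserted further to the left, or it is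
 the last letter itself and its degree has acted on the whole tensor. This commutation relation is the source
 of the skew derivations.
\<close>

lemma create_snoc:
 "create v s (u @ [c]) = create v (%w. s (w @ [c])) u + (if c = v then gact (deg v) s u else 0)"
proof (induction u arbitrary: s)
 case (Cons e u)
 show ?case
  by (simp add: Cons.IH distrib_left sum.distrib)
qed simp

text \<open>The insertion operators are equivariant, since \<open>deg (g \<triangleright> v) g = g deg v\<close>.\<close>

lemma gact_create:
 assumes g: "g \<in> carrier G" and v: "v \<in> B"
 shows "gact g (create v s) u = (\<Sum>c\<in>B. r g c v * create c (gact g s) u)"
proof (induction u arbitrary: s)
 case (Cons e u)
 have hv: "deg v \<in> carrier G" using v by simp
 have 1: "(\<Sum>d\<in>B. r g e d * (if d = v then k else 0)) = r g e v * k" for k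
  using v by (simp add: sum.delta' if_distrib[of "%x. r g e _ * x"] cong: if_cong)
 have 2: "(\<Sum>c\<in>B. r g c v * (if e = c then k else 0)) = r g e v * k" for k
  using v g r_outside[of g v e] by (simp add: sum.delta if_distrib[of "%x. r g _ v * x"] cong: if_cong)
 have conj: "r g c v * r (deg c \<otimes> g) e f = r g c v * r (g \<otimes> deg v) e f" if "c \<in> B" for c f
 proof (cases "r g c v = 0")
  case False
  then have "deg c \<otimes> g = g \<otimes> deg v"
   using r_deg[OF g that v] hv g by (simp add: G.m_assoc)
  then show ?thesis by simp
 qed simp
 let ?X = "%c f. create c (gact g (%w. s (f # w))) u"
 have "gact g (create v s) (e # u) = (\<Sum>d\<in>B. r g e d * ((if d = v then gact g s u else 0) +
   (\<Sum>f\<in>B. r (deg v) d f * gact g (create v (%w. s (f # w))) u)))"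
 proof -
  have "gact g (%w. (if d = v then s w else 0) + (\<Sum>f\<in>B. r (deg v) d f * create v (%w. s (f # w)) w)) u =
   (if d = v then gact g s u else 0) + (\<Sum>f\<in>B. r (deg v) d f * gact g (create v (%w. s (f # w))) u)" for d
   by (simp add: gact_add gact_sum)
  then show ?thesis by simp
 qed
 also have "\<dots> = r g e v * gact g s u +
   (\<Sum>d\<in>B. \<Sum>f\<in>B. r g e d * r (deg v) d f * gact g (create v (%w. s (f # w))) u)"
  by (simp only: distrib_left sum.distrib 1 sum_distrib_left mult.assoc)
 also have "(\<Sum>d\<in>B. \<Sum>f\<in>B. r g e d * r (deg v) d f * gact g (create v (%w. s (f # w))) u) =
   (\<Sum>f\<in>B. r (g \<otimes> deg v) e f * gact g (create v (%w. s (f # w))) u)"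
  by (subst sum.swap) (simp add: r_mult g hv sum_distrib_right)
 also have "\<dots> = (\<Sum>c\<in>B. \<Sum>f\<in>B. r g c v * r (g \<otimes> deg v) e f * ?X c f)"
  by (subst sum.swap) (simp add: Cons.IH sum_distrib_left mult.assoc mult.left_commute)
 also have "\<dots> = (\<Sum>c\<in>B. \<Sum>f\<in>B. r g c v * r (deg c \<otimes> g) e f * ?X c f)"
  by (simp add: conj)
 also have "\<dots> = (\<Sum>c\<in>B. r g c v * (\<Sum>d\<in>B. r (deg c) e d * create c (%w. gact g s (d # w)) u))"
 proof (rule sum.cong[OF refl])
  fix c assume c: "c \<in> B"
  have "(\<Sum>f\<in>B. r (deg c \<otimes> g) e f * ?X c f) = (\<Sum>f\<in>B. \<Sum>d\<in>B. r (deg c) e d * (r g d f * ?X c f))"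
   using c by (simp add: r_mult g sum_distrib_right mult.assoc)
  also have "\<dots> = (\<Sum>d\<in>B. r (deg c) e d * create c (%w. gact g s (d # w)) u)"
   by (subst sum.swap) (simp add: create_sum sum_distrib_left)
  finally show "(\<Sum>f\<in>B. r g c v * r (deg c \<otimes> g) e f * ?X c f) =
    r g c v * (\<Sum>d\<in>B. r (deg c) e d * create c (%w. gact g s (d # w)) u)"
   by (simp add: mult.assoc sum_distrib_left[symmetric])
 qed
 also have "r g e v * gact g s u + \<dots> = (\<Sum>c\<in>B. r g c v * create c (gact g s) (e # u))"
  by (simp add: distrib_left sum.distrib 2 del: gact.simps)
 finally show ?case .
qed simp

subsection \<open>The group grading\<close>

definition Deg :: "'b list => 'g"
 where "Deg w = foldr (%b x. deg b \<otimes> x) w \<one>"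

lemma Deg_simps [simp]: "Deg [] = \<one>" "Deg (b # w) = deg b \<otimes> Deg w"
 by (simp_all add: Deg_def)

lemma Deg_closed [simp]: "w \<in> lists B ==> Deg w \<in> carrier G"
 by (induction w) auto

lemma create_graded:
 assumes v: "v \<in> B" and x: "x \<in> carrier G"
  and "!!u. u \<in> lists B ==> s u ~= 0 ==> Deg u = x" "u \<in> lists B" "create v s u ~= 0"
 shows "Deg u = deg v \<otimes> x"
 using x assms(3-)
proof (induction u arbitrary: s x)
 case (Cons c u)
 then have c: "c \<in> B" and u: "u \<in> lists B" by auto
 show ?case
 proof (cases "c = v \<and> s u ~= 0")
  case True
  then show ?thesis using Cons.prems u by simp
 next
  case False
  then have "(\<Sum>d\<in>B. r (deg v) c d * create v (%w. s (d # w)) u) ~= 0"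
   using Cons.prems(4) by (auto split: if_splits)
  then obtain d where d: "d \<in> B" "r (deg v) c d ~= 0" "create v (%w. s (d # w)) u ~= 0"
   by (elim sum.not_neutral_contains_not_neutral) auto
  have "Deg w = inv (deg d) \<otimes> x" if "w \<in> lists B" "s (d # w) ~= 0" for w
  proof -
   have "deg d \<otimes> Deg w = x" using Cons.prems(2)[of "d # w"] that d(1) by simp
   then show ?thesis using d(1) that(1) Cons.prems(1) by (metis Deg_closed G.inv_solve_left deg_closed)
  qed
  then have "Deg u = deg v \<otimes> (inv (deg d) \<otimes> x)"
   using d(1,3) u Cons.prems(1) by (intro Cons.IH[of _ "%w. s (d # w)"]) auto
  moreover have "deg c = deg v \<otimes> deg d \<otimes> inv (deg v)"
   using r_deg[of "deg v" c d] v c d by simp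
  ultimately show ?thesis
   using v d(1) Cons.prems(1) by (simp add: G.m_assoc[symmetric]) (simp add: G.m_assoc)
 qed
qed simp

lemma sym_graded: "w \<in> lists B ==> u \<in> lists B ==> sym w u ~= 0 ==> Deg u = Deg w"
proof (induction w arbitrary: u)
 case Nil then show ?case by (auto simp: delta_def split: if_splits)
next
 case (Cons b w)
 then show ?case using create_graded[of b "Deg w" "sym w" u] by auto
qed

subsection \<open>The symmetrizer on tensors\<close>

abbreviation "T \<equiv> tensor_algebra B"

text \<open>
 \<open>Lop p\<close> is the operator by which the tensor \<open>p\<close> acts when its letters act by
 insertion.
\<close>

definition Lop :: "('b list => complex) => ('b list => complex) => 'b list => complex"
 where "Lop p s u = (\<Sum>w | p w ~= 0. p w * foldr create w s u)"

definition Sym :: "('b list => complex) => 'b list => complex"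
 where "Sym p u = (\<Sum>w | p w ~= 0. p w * sym w u)"

lemma Sym_Lop: "Sym p = Lop p \<epsilon>"
 by (simp add: fun_eq_iff Sym_def Lop_def sym_def)

lemma support_sum:
 fixes p :: "'x => complex"
 assumes "finite E" "{x. p x ~= 0} \<subseteq> E"
 shows "(\<Sum>x | p x ~= 0. p x * f x) = (\<Sum>x\<in>E. p x * f x)"
 using assms by (intro sum.mono_neutral_left) auto

lemma Lop_add:
 assumes "finite {x. p x ~= 0}" "finite {x. q x ~= 0}"
 shows "Lop (%x. p x + q x) s u = Lop p s u + Lop q s u"
proof -
 let ?E = "{x. p x ~= 0} \<union> {x. q x ~= 0}"
 have E: "finite ?E" using assms by simp
 show ?thesis
  unfolding Lop_def
  by (subst (1 2 3) support_sum[OF E]) (auto simp: distrib_right sum.distrib)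
qed

lemma Lop_scale: "Lop (%x. c * p x) s u = c * Lop p s u"
 by (cases "c = 0") (simp_all add: Lop_def sum_distrib_left mult.assoc)

lemma Lop_delta [simp]: "Lop (delta w) s u = foldr create w s u"
 by (simp add: Lop_def)

lemma Lop_zero [simp]: "Lop (%_. 0) s u = 0"
 by (simp add: Lop_def)

lemma Sym_add: "p \<in> carrier T ==> q \<in> carrier T ==> Sym (%x. p x + q x) = (%u. Sym p u + Sym q u)"
 by (simp add: fun_eq_iff Sym_Lop Lop_add)

lemma Sym_scale: "Sym (%x. c * p x) = (%u. c * Sym p u)"
 by (simp add: fun_eq_iff Sym_Lop Lop_scale)

lemma Sym_delta [simp]: "Sym (delta w) = sym w"
 by (simp add: fun_eq_iff Sym_Lop sym_def)

lemma Sym_zero [simp]: "Sym (%_. 0) = (%_. 0)"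
 by (simp add: fun_eq_iff Sym_Lop)

lemma foldr_create_add: "foldr create w (%x. s x + t x) u = foldr create w s u + foldr create w t u"
proof (induction w arbitrary: u)
 case (Cons b w)
 then have "foldr create w (%x. s x + t x) = (%u. foldr create w s u + foldr create w t u)" by (simp add: fun_eq_iff)
 then show ?case by (simp add: create_add)
qed simp

lemma foldr_create_scale: "foldr create w (%x. c * s x) u = c * foldr create w s u"
proof (induction w arbitrary: u)
 case (Cons b w)
 then have "foldr create w (%x. c * s x) = (%u. c * foldr create w s u)" by (simp add: fun_eq_iff)
 then show ?case by (simp add: create_scale)
qed simp

lemma foldr_create_zero [simp]: "foldr create w (%x. 0) u = 0"
 using foldr_create_scale[of w 0 "%_. 0" u] by simp

lemma Lop_zero_right [simp]: "Lop p (%x. 0) u = 0"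
 by (simp add: Lop_def)

lemma Lop_mult:
 assumes "p \<in> carrier T" "q \<in> carrier T"
 shows "Lop (p \<otimes>\<^bsub>T\<^esub> q) s u = Lop p (Lop q s) u"
proof -
 note [simp del] = tensor_algebra_simps(5) free_space_simps(1)
 note TS = free_space_closed[of _ "lists B"]
 have fs: "finite {x. p x ~= 0}" if "p \<in> carrier T" for p
  using that by (simp add: free_space_simps(1))
 have 1: "Lop (delta w \<otimes>\<^bsub>T\<^esub> q) s u = foldr create w (Lop q s) u" if w: "w \<in> lists B" for w
 proof -
  have d: "delta w \<in> carrier T" using w by (simp add: delta_in_free_space)
  note M = linD[OF lin_tensor_mult(1)[OF d]]
  have "q \<in> carrier (free_space (lists B))" using assms(2) by simp
  then show ?thesis
  proof (induction q rule: free_space_induct)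
   case zero
   have "delta w \<otimes>\<^bsub>T\<^esub> (%_. 0) = (%_. 0)" by (simp add: tensor_algebra_simps(5))
   then show ?case by simp
  next
   case (add p q)
   have "delta w \<otimes>\<^bsub>T\<^esub> (%x. p x + q x) = (%x. (delta w \<otimes>\<^bsub>T\<^esub> p) x + (delta w \<otimes>\<^bsub>T\<^esub> q) x)"
    using M(2)[of p q] add by simp
   moreover have "Lop (%x. p x + q x) s = (%u. Lop p s u + Lop q s u)"
    using add fs by (simp add: fun_eq_iff Lop_add)
   moreover have "delta w \<otimes>\<^bsub>T\<^esub> p \<in> carrier T" "delta w \<otimes>\<^bsub>T\<^esub> q \<in> carrier T"
    using M(1)[of p] M(1)[of q] add by simp_all
   ultimately show ?case using add fs by (simp add: Lop_add foldr_create_add)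
  next
   case (smult c p)
   have "delta w \<otimes>\<^bsub>T\<^esub> (%x. c * p x) = (%x. c * (delta w \<otimes>\<^bsub>T\<^esub> p) x)"
    using M(3)[of p c] smult by simp
   moreover have "Lop (%x. c * p x) s = (%u. c * Lop p s u)"
    by (simp add: fun_eq_iff Lop_scale)
   ultimately show ?case using smult by (simp add: Lop_scale foldr_create_scale)
  next
   case (delta v)
   have "Lop (delta v) s = foldr create v s" by (simp add: fun_eq_iff)
   then show ?case by (simp add: delta_mult)
  qed
 qed
 note M = linD[OF lin_tensor_mult(2)[OF assms(2)]]
 have "p \<in> carrier (free_space (lists B))" using assms(1) by simp
 then show ?thesis
 proof (induction p rule: free_space_induct)
  case zero
  have "(%_. 0) \<otimes>\<^bsub>T\<^esub> q = (%_. 0)" by (simp add: tensor_algebra_simps(5))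
  then show ?case by simp
 next
  case (add p p')
  have "(%x. p x + p' x) \<otimes>\<^bsub>T\<^esub> q = (%x. (p \<otimes>\<^bsub>T\<^esub> q) x + (p' \<otimes>\<^bsub>T\<^esub> q) x)"
   using M(2)[of p p'] add by simp
  moreover have "p \<otimes>\<^bsub>T\<^esub> q \<in> carrier T" "p' \<otimes>\<^bsub>T\<^esub> q \<in> carrier T"
   using M(1)[of p] M(1)[of p'] add by simp_all
  ultimately show ?case using add fs by (simp add: Lop_add)
 next
  case (smult c p)
  have "(%x. c * p x) \<otimes>\<^bsub>T\<^esub> q = (%x. c * (p \<otimes>\<^bsub>T\<^esub> q) x)"
   using M(3)[of p c] smult by simp
  then show ?case using smult by (simp add: Lop_scale)
 next
  case (delta v)
  then show ?case using 1 by simp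
 qed
qed

lemma Sym_mult: "p \<in> carrier T ==> q \<in> carrier T ==> Sym (p \<otimes>\<^bsub>T\<^esub> q) = Lop p (Sym q)"
 by (simp add: fun_eq_iff Sym_Lop Lop_mult del: tensor_algebra_simps)

lemma Sym_outside: "p \<in> carrier T ==> u \<notin> lists B ==> Sym p u = 0"
 unfolding Sym_def by (intro sum.neutral) (auto simp: sym_outside subset_iff)

text \<open>The vector \<open>g \<triangleright> b\<close> as a tensor of degree one.\<close>

definition letter_act :: "'g => 'b => 'b list => complex"
 where "letter_act g b = (%w. case w of [c] => r g c b | _ => 0)"

lemma letter_act_support:
 assumes "g \<in> carrier G" "b \<in> B"
 shows "{w. letter_act g b w ~= 0} \<subseteq> (%c. [c]) ` B"
proof
 fix w assume w: "w \<in> {w. letter_act g b w ~= 0}"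
 then obtain c where "w = [c]"
  by (cases w; cases "tl w") (auto simp: letter_act_def)
 then show "w \<in> (%c. [c]) ` B"
  using w r_outside[OF assms, of c] by (auto simp: letter_act_def)
qed

lemma letter_act_closed: "g \<in> carrier G ==> b \<in> B ==> letter_act g b \<in> carrier T"
proof -
 assume gb: "g \<in> carrier G" "b \<in> B"
 show ?thesis
  using letter_act_support[OF gb] by (auto intro: finite_subset)
qed

lemma Lop_letter_act:
 assumes "g \<in> carrier G" "b \<in> B"
 shows "Lop (letter_act g b) s u = (\<Sum>c\<in>B. r g c b * create c s u)"
proof -
 have "Lop (letter_act g b) s u = (\<Sum>w\<in>(%c. [c]) ` B. letter_act g b w * foldr create w s u)"
  unfolding Lop_def using letter_act_support[OF assms] by (intro support_sum) auto
 also have "\<dots> = (\<Sum>c\<in>B. r g c b * create c s u)"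
  by (subst sum.reindex) (auto simp: inj_on_def letter_act_def)
 finally show ?thesis .
qed

definition tact :: "'g => ('b list => complex) => 'b list => complex"
 where "tact g = extend_hom T (letter_act g)"

lemma alg_hom_tact: "g \<in> carrier G ==> alg_hom T T (tact g)"
 unfolding tact_def by (rule alg_hom_extend_hom) (use letter_act_closed in auto)

lemma tact_letter: "g \<in> carrier G ==> b \<in> B ==> tact g (delta [b]) = letter_act g b"
 unfolding tact_def by (rule extend_hom_letter) (use letter_act_closed in auto)

lemma Sym_tact:
 assumes g: "g \<in> carrier G" and p: "p \<in> carrier T"
 shows "Sym (tact g p) = gact g (Sym p)"
proof -
 note [simp del] = tensor_algebra_simps(5) free_space_simps(1)
 note H = alg_homD[OF alg_hom_tact[OF g]] and HL = linD[OF alg_homD(1)[OF alg_hom_tact[OF g]]]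
 have "p \<in> carrier (free_space (lists B))" using p by simp
 then show ?thesis
 proof (induction p rule: free_space_induct)
  case zero
  have "tact g (%_. 0) = (%_. 0)" using lin_zero[OF H(1)] by simp
  then show ?case by (simp add: fun_eq_iff)
 next
  case (add p q)
  then show ?case using HL(1)[of p] HL(1)[of q] HL(2)[of p q]
   by (simp add: Sym_add gact_add fun_eq_iff)
 next
  case (smult c p)
  then show ?case using HL(3)[of p c] by (simp add: Sym_scale gact_scale fun_eq_iff)
 next
  case (delta w)
  then show ?case
  proof (induction w)
   case Nil
   then show ?case using H(2) by simp
  next
   case (Cons b w)
   then have d: "delta [b] \<in> carrier T" "delta w \<in> carrier T" "b \<in> B"
    by (auto intro: delta_in_free_space)
   have "tact g (delta (b # w)) = letter_act g b \<otimes>\<^bsub>T\<^esub> tact g (delta w)"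
    using H(3)[OF d(1,2)] delta_mult[where u = "[b]" and v = w and B = B] tact_letter[OF g d(3)] by simp
   then have "Sym (tact g (delta (b # w))) = Lop (letter_act g b) (gact g (sym w))"
    using Cons d letter_act_closed[OF g d(3)] HL(1)[OF d(2)] by (simp add: Sym_mult)
   then show ?case
    using d by (simp add: fun_eq_iff Lop_letter_act g gact_create)
  qed
 qed
qed

subsection \<open>The kernel of the symmetrizer\<close>

definition kern :: "('b list => complex) set"
 where "kern = {p \<in> carrier T. Sym p = (%_. 0)}"

text \<open>
 Deleting the last letter is a skew derivation: letters of \<open>p\<close> commute with it up to terms in
 which the degree of the deleted letter acts on everything to the right. The tensor \<open>p'\<close> does not
 depend on \<open>s\<close>.
\<close>

lemma Lop_snoc:
 assumes p: "p \<in> carrier T" and c: "c \<in> B"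
 shows "\<exists>p'\<in>carrier T. \<forall>s u. Lop p s (u @ [c]) = Lop p (%w. s (w @ [c])) u + Lop p' (gact (deg c) s) u"
proof -
 note [simp del] = tensor_algebra_simps(5) free_space_simps(1)
 have fs: "finite {x. p x ~= 0}" if "p \<in> carrier (free_space (lists B))" for p :: "'b list => complex"
  using that by (simp add: free_space_simps(1))
 have "p \<in> carrier (free_space (lists B))" using p by simp
 then have "\<exists>p'\<in>carrier (free_space (lists B)). \<forall>s u. Lop p s (u @ [c]) =
   Lop p (%w. s (w @ [c])) u + Lop p' (gact (deg c) s) u"
 proof (induction p rule: free_space_induct)
  case zero
  show ?case by (rule bexI[of _ "%_. 0"]) (simp_all add: free_space_simps(1))
 next
  case (add p q)
  then obtain p' q' where "p' \<in> carrier (free_space (lists B))" "q' \<in> carrier (free_space (lists B))"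
   "\<forall>s u. Lop p s (u @ [c]) = Lop p (%w. s (w @ [c])) u + Lop p' (gact (deg c) s) u"
   "\<forall>s u. Lop q s (u @ [c]) = Lop q (%w. s (w @ [c])) u + Lop q' (gact (deg c) s) u"
   by blast
  then show ?case
   using add fs by (intro bexI[of _ "%x. p' x + q' x"]) (simp_all add: Lop_add free_space_closed)
 next
  case (smult k p)
  then obtain p' where "p' \<in> carrier (free_space (lists B))"
   "\<forall>s u. Lop p s (u @ [c]) = Lop p (%w. s (w @ [c])) u + Lop p' (gact (deg c) s) u"
   by blast
  then show ?case
   by (intro bexI[of _ "%x. k * p' x"]) (simp_all add: Lop_scale free_space_closed distrib_left)
 next
  case (delta w)
  then show ?case
  proof (induction w)
   case Nil
   show ?case by (rule bexI[of _ "%_. 0"]) (simp_all add: free_space_simps(1))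
  next
   case (Cons b w)
   then obtain q where q: "q \<in> carrier T"
    "!!s u. foldr create w s (u @ [c]) = foldr create w (%w. s (w @ [c])) u + Lop q (gact (deg c) s) u"
    by auto
   have b: "b \<in> B" and w: "w \<in> lists B" using Cons(1,2) by auto
   note H = alg_homD[OF alg_hom_tact[OF deg_closed[OF b]]]
   let ?q1 = "delta [b] \<otimes>\<^bsub>T\<^esub> q" and ?q2 = "tact (deg b) (delta w)"
   have d: "delta [b] \<in> carrier T" "delta w \<in> carrier T" using b w by (auto intro: delta_in_free_space)
   have q1: "?q1 \<in> carrier T" using d(1) q(1) by (rule tensor_mult_closed)
   have q2: "?q2 \<in> carrier T" using linD(1)[OF H(1) d(2)] .
   have gc: "gact (deg b) (foldr create w s) u = Lop ?q2 (gact (deg b) s) u" for s u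
    using w
   proof (induction w arbitrary: u)
    case Nil
    then show ?case using H(2) by simp
   next
    case (Cons e w)
    then have e: "e \<in> B" "delta [e] \<in> carrier T" "delta w \<in> carrier T" by (auto intro: delta_in_free_space)
    have "tact (deg b) (delta (e # w)) = letter_act (deg b) e \<otimes>\<^bsub>T\<^esub> tact (deg b) (delta w)"
     using H(3)[OF e(2,3)] delta_mult[where u = "[e]" and v = w and B = B] tact_letter[OF deg_closed[OF b] e(1)] by simp
    moreover have "gact (deg b) (foldr create w s) = Lop (tact (deg b) (delta w)) (gact (deg b) s)"
     using Cons by (simp add: fun_eq_iff)
    ultimately show ?case
     using e b letter_act_closed[OF deg_closed[OF b] e(1)] linD(1)[OF H(1) e(3)]
     by (simp add: Lop_mult Lop_letter_act gact_create)
   qed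
   have step: "foldr create (b # w) s (u @ [c]) = foldr create (b # w) (%w. s (w @ [c])) u +
     (Lop ?q1 (gact (deg c) s) u + (if c = b then Lop ?q2 (gact (deg c) s) u else 0))" for s u
   proof -
    have "create b (Lop q t) u = Lop ?q1 t u" for t
     using Lop_mult[OF d(1) q(1), of t u] by simp
    then show ?thesis
     using q(2) by (simp add: create_snoc create_add gc)
   qed
   show ?case
   proof (cases "c = b")
    case True
    then show ?thesis
     using step q1 q2 fs by (intro bexI[of _ "%x. ?q1 x + ?q2 x"])
      (simp_all add: Lop_add free_space_closed del: foldr.simps)
   next
    case False
    then show ?thesis using step q1 by (intro bexI[of _ ?q1]) (simp_all del: foldr.simps)
   qed
  qed
 qed
 then show ?thesis by simp
qed

lemma Sym_snoc:
 assumes "p \<in> carrier T" "c \<in> B"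
 shows "\<exists>q\<in>carrier T. \<forall>u. Sym p (u @ [c]) = Sym q u"
proof -
 obtain q where "q \<in> carrier T"
  "\<forall>s u. Lop p s (u @ [c]) = Lop p (%w. s (w @ [c])) u + Lop q (gact (deg c) s) u"
  using Lop_snoc[OF assms] by blast
 moreover have "(%w. \<epsilon> (w @ [c])) = (%_. 0)" by (simp add: delta_def)
 ultimately show ?thesis by (auto simp: Sym_Lop)
qed

text \<open>
 A tensor that annihilates the empty tensor annihilates everything that can be created from it. The values at
 the words \<open>u c\<close> are controlled by \<open>Lop_snoc\<close>: deleting \<open>c\<close> leads either
 to the same \<open>p\<close>, or to some \<open>p'\<close>, again in the kernel, applied to tensors which can
 still be created; so induction on the length applies. This makes the kernel a right ideal.
\<close>

lemma kern_kills:
 assumes "p \<in> kern" "q \<in> carrier T"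
 shows "Lop p (Sym q) u = 0"
 using assms
proof (induction u arbitrary: p q rule: rev_induct)
 case Nil
 have "foldr create w (Sym q) [] = foldr create w \<epsilon> [] * Sym q []" for w
  by (cases w) simp_all
 then have "Lop p (Sym q) [] = Sym p [] * Sym q []"
  by (simp add: Sym_Lop[of p] Lop_def sum_distrib_right mult.assoc)
 then show ?case using Nil by (simp add: kern_def)
next
 case (snoc c u)
 have pT: "p \<in> carrier T" and p0: "Sym p = (%_. 0)" using snoc.prems by (auto simp: kern_def)
 show ?case
 proof (cases "c \<in> B")
  case True
  obtain p' where p': "p' \<in> carrier T"
   "!!s u. Lop p s (u @ [c]) = Lop p (%w. s (w @ [c])) u + Lop p' (gact (deg c) s) u"
   using Lop_snoc[OF pT True] by blast
  have "(%w. \<epsilon> (w @ [c])) = (%_. 0)" by (simp add: delta_def)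
  then have "Sym p' u = Sym p (u @ [c])" for u
   using p'(2)[of \<epsilon> u] by (simp add: Sym_Lop)
  \<comment> \<open>Evaluated at the empty tensor, the first term vanishes, so that \<open>p'\<close> inherits from \<open>p\<close> the property of annihilating it.\<close>
  then have p'k: "p' \<in> kern" using p'(1) p0 by (simp add: kern_def fun_eq_iff)
  obtain q' where q': "q' \<in> carrier T" "\<forall>u. Sym q (u @ [c]) = Sym q' u"
   using Sym_snoc[OF snoc.prems(2) True] by blast
  have tq: "tact (deg c) q \<in> carrier T"
   using linD(1)[OF alg_homD(1)[OF alg_hom_tact[OF deg_closed[OF True]]] snoc.prems(2)] .
  have "Lop p (Sym q) (u @ [c]) = Lop p (Sym q') u + Lop p' (Sym (tact (deg c) q)) u"
   using p'(2)[of "Sym q" u] q' Sym_tact[OF deg_closed[OF True] snoc.prems(2)] by simp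
  then show ?thesis
   using snoc.IH[OF snoc.prems(1) q'(1)] snoc.IH[OF p'k tq] by simp
 next
  case False
  have "p \<otimes>\<^bsub>T\<^esub> q \<in> carrier T" using pT snoc.prems(2) by (rule tensor_mult_closed)
  then show ?thesis
   using Sym_outside[of "p \<otimes>\<^bsub>T\<^esub> q" "u @ [c]"] False
   by (simp add: Sym_mult pT snoc.prems(2) del: tensor_algebra_simps)
 qed
qed

lemma ideal_kern: "ideal kern T"
proof -
 note [simp del] = tensor_algebra_simps(5) free_space_simps(1)
 interpret T: module CC T by simp
 have "submodule kern CC T"
 proof (rule T.submoduleI)
  show "\<ominus>\<^bsub>T\<^esub> a \<in> kern" if "a \<in> kern" for a
   using that vspc_neg[OF vspc_tensor_algebra, of a] vspc_simps(4)[OF vspc_tensor_algebra, of a]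
   by (simp add: kern_def) (simp add: Sym_scale[of "- 1", simplified] fun_eq_iff)
 qed (auto simp: kern_def Sym_add Sym_scale free_space_closed free_space_simps(1)[of "%_. 0"])
 then have sg: "subgroup kern (add_monoid T)" by (simp add: submodule_def)
 show ?thesis
 proof (rule idealI)
  show "ring T" by (rule complex_algebra_ring) simp
  show "subgroup kern (add_monoid T)" by (rule sg)
  fix a x assume ax: "a \<in> kern" "x \<in> carrier T"
  then have a: "a \<in> carrier T" "Sym a = (%_. 0)" by (auto simp: kern_def)
  show "x \<otimes>\<^bsub>T\<^esub> a \<in> kern"
   using tensor_mult_closed[OF ax(2) a(1)] Sym_mult[OF ax(2) a(1)] a(2)
   by (simp add: kern_def fun_eq_iff)
  show "a \<otimes>\<^bsub>T\<^esub> x \<in> kern"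
   using tensor_mult_closed[OF a(1) ax(2)] Sym_mult[OF a(1) ax(2)] kern_kills[OF ax]
   by (simp add: kern_def fun_eq_iff)
 qed
qed

lemma tact_kern: "g \<in> carrier G ==> p \<in> kern ==> tact g p \<in> kern"
 using Sym_tact linD(1)[OF alg_homD(1)[OF alg_hom_tact]] by (auto simp: kern_def)

text \<open>The kernel is graded by \<open>G\<close> because the symmetrizer preserves degrees.\<close>

lemma kern_graded:
 assumes "p \<in> kern"
 shows "(%w. if w \<in> lists B then f (Deg w) * p w else 0) \<in> kern"
proof -
 let ?q = "%w. if w \<in> lists B then f (Deg w) * p w else 0"
 have p: "finite {w. p w ~= 0}" "{w. p w ~= 0} \<subseteq> lists B" "Sym p = (%_. 0)"
  using assms by (auto simp: kern_def)
 have qp: "{w. ?q w ~= 0} \<subseteq> {w. p w ~= 0}" by (auto split: if_splits)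
 then have q: "?q \<in> carrier T" using p finite_subset[OF qp p(1)] by auto
 have "Sym ?q u = 0" for u
 proof (cases "u \<in> lists B")
  case True
  have "Sym ?q u = (\<Sum>w | p w ~= 0. ?q w * sym w u)"
   unfolding Sym_def using p(1) qp by (intro support_sum) auto
  also have "\<dots> = (\<Sum>w | p w ~= 0. f (Deg u) * (p w * sym w u))"
  proof (rule sum.cong[OF refl])
   fix w assume "w \<in> {w. p w ~= 0}"
   then have w: "w \<in> lists B" using p by auto
   then show "?q w * sym w u = f (Deg u) * (p w * sym w u)"
    using sym_graded[OF w True] by (cases "sym w u = 0") auto
  qed
  also have "\<dots> = f (Deg u) * Sym p u" by (simp add: Sym_def sum_distrib_left)
  finally show ?thesis using p(3) by simp
 next
  case False
  then show ?thesis using Sym_outside[OF q] by simp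
 qed
 then show ?thesis using q by (simp add: kern_def fun_eq_iff)
qed

end

section \<open>Reduced words and inversions\<close>

text \<open>
 The lists of interest contain \<open>{0..<n}\<close> in some order: the entry at place \<open>i\<close> is the
 original place of the factor that has been moved to place \<open>i\<close>. The number of inversions is the
 length of a reduced word, as each adjacent transposition changes it by one.
\<close>

fun inversions :: "nat list => nat" where
 "inversions [] = 0"
| "inversions (k # ks) = card {j \<in> set ks. j < k} + inversions ks"

definition arrangement :: "nat => (nat => nat) => nat list"
 where "arrangement n \<sigma> = map (Hilbert_Choice.inv \<sigma>) [0..<n]"

definition swap_adj :: "nat => 'a list => 'a list"
 where "swap_adj i ks = ks[i := ks ! Suc i, Suc i := ks ! i]"

lemma split_adj:
 assumes "Suc i < length ks"
 shows "ks = take i ks @ ks ! i # ks ! Suc i # drop (Suc (Suc i)) ks"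
  and "swap_adj i ks = take i ks @ ks ! Suc i # ks ! i # drop (Suc (Suc i)) ks"
proof -
 show "ks = take i ks @ ks ! i # ks ! Suc i # drop (Suc (Suc i)) ks"
  using assms by (simp add: Cons_nth_drop_Suc)
 show "swap_adj i ks = take i ks @ ks ! Suc i # ks ! i # drop (Suc (Suc i)) ks"
  using assms by (intro nth_equalityI)
   (auto simp: swap_adj_def nth_list_update nth_append nth_Cons split: nat.splits,
    intro arg_cong[of _ _ "(!) ks"], linarith)
qed

lemma inversions_swap:
 assumes "a < b" "distinct (xs @ a # b # ys)"
 shows "inversions (xs @ b # a # ys) = Suc (inversions (xs @ a # b # ys))"
 using assms(2)
proof (induction xs)
 case Nil
 have "{j \<in> set (a # ys). j < b} = insert a {j \<in> set ys. j < b}"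
  using assms(1) by auto
 moreover have "{j \<in> set (b # ys). j < a} = {j \<in> set ys. j < a}"
  using assms(1) by auto
 ultimately show ?case using Nil by simp
next
 case (Cons k xs)
 have "set (xs @ b # a # ys) = set (xs @ a # b # ys)" by auto
 with Cons show ?case by (simp del: set_append set_simps)
qed

context
 fixes n :: nat
begin

abbreviation "ok is \<equiv> \<forall>i\<in>set is. Suc i < n"

lemma perm_of_word_simps [simp]:
 "perm_of_word [] = id" "perm_of_word (i # is) = transpose i (Suc i) \<circ> perm_of_word is"
 by (simp_all add: perm_of_word_def)

lemma perm_of_word_permutes: "ok is ==> perm_of_word is permutes {..<n}"
proof (induction "is")
 case (Cons i "is")
 then have "perm_of_word is permutes {..<n}" "transpose i (Suc i) permutes {..<n}"
  by (auto intro!: permutes_swap_id)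
 then show ?case unfolding perm_of_word_simps by (rule permutes_compose)
qed (simp add: permutes_id)

lemma length_arrangement [simp]: "length (arrangement n \<sigma>) = n"
 by (simp add: arrangement_def)

lemma set_arrangement: "\<sigma> permutes {..<n} ==> set (arrangement n \<sigma>) = {..<n}"
 using permutes_image[OF permutes_inv, of \<sigma> "{..<n}"] by (simp add: arrangement_def atLeast0LessThan)

lemma distinct_arrangement: "\<sigma> permutes {..<n} ==> distinct (arrangement n \<sigma>)"
 using permutes_inj[OF permutes_inv, of \<sigma> "{..<n}"] by (auto simp: arrangement_def distinct_map intro: inj_on_subset)

lemma arrangement_swap:
 assumes "\<sigma> permutes {..<n}" "Suc i < n"
 shows "arrangement n (transpose i (Suc i) \<circ> \<sigma>) = swap_adj i (arrangement n \<sigma>)"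
proof -
 have "Hilbert_Choice.inv (transpose i (Suc i) \<circ> \<sigma>) = Hilbert_Choice.inv \<sigma> \<circ> transpose i (Suc i)"
  using permutes_bij[OF assms(1)] by (subst o_inv_distrib) (auto simp: bij_def)
 then show ?thesis
  using assms(2) by (intro nth_equalityI)
   (auto simp: arrangement_def swap_adj_def nth_list_update transpose_def)
qed

lemma inversions_arrangement_swap:
 assumes "\<sigma> permutes {..<n}" "Suc i < n"
 defines "ks \<equiv> arrangement n \<sigma>"
 shows "ks ! i < ks ! Suc i ==> inversions (arrangement n (transpose i (Suc i) \<circ> \<sigma>)) = Suc (inversions ks)"
  and "\<not> ks ! i < ks ! Suc i ==> Suc (inversions (arrangement n (transpose i (Suc i) \<circ> \<sigma>))) = inversions ks"
proof -
 let ?A = "take i ks" and ?C = "drop (Suc (Suc i)) ks"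
 have len: "Suc i < length ks" using assms(2) by (simp add: ks_def)
 have d: "distinct ks" using distinct_arrangement[OF assms(1)] by (simp add: ks_def)
 note s = split_adj[OF len]
 have ds: "distinct (?A @ ks ! i # ks ! Suc i # ?C)" using d s(1) by metis
 then have ds': "distinct (?A @ ks ! Suc i # ks ! i # ?C)" by auto
 have sw: "arrangement n (transpose i (Suc i) \<circ> \<sigma>) = ?A @ ks ! Suc i # ks ! i # ?C"
  using arrangement_swap[OF assms(1,2)] s(2) by (simp add: ks_def)
 show "ks ! i < ks ! Suc i ==> inversions (arrangement n (transpose i (Suc i) \<circ> \<sigma>)) = Suc (inversions ks)"
  using inversions_swap[OF _ ds] s(1) sw by metis
 assume "\<not> ks ! i < ks ! Suc i"
 moreover have "ks ! i ~= ks ! Suc i" using d len by (simp add: nth_eq_iff_index_eq)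
 ultimately have "ks ! Suc i < ks ! i" by simp
 then show "Suc (inversions (arrangement n (transpose i (Suc i) \<circ> \<sigma>))) = inversions ks"
  using inversions_swap[OF _ ds'] s(1) sw by metis
qed

lemma inversions_upt: "inversions [m..<m'] = 0"
proof (induction "m' - m" arbitrary: m)
 case (Suc d)
 then have "[m..<m'] = m # [Suc m..<m']" by (simp add: upt_conv_Cons)
 moreover have "{j \<in> set [Suc m..<m']. j < m} = {}" by auto
 ultimately show ?case using Suc by simp
qed simp

lemma arrangement_id: "arrangement n id = [0..<n]"
 by (simp add: arrangement_def)

text \<open>Each letter creates at most one inversion.\<close>

lemma inversions_le_length: "ok is ==> inversions (arrangement n (perm_of_word is)) \<le> length is"
proof (induction "is")
 case Nil
 then show ?case by (simp add: arrangement_id inversions_upt del: id_apply)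
next
 case (Cons i "is")
 then have p: "perm_of_word is permutes {..<n}" "Suc i < n" by (auto intro: perm_of_word_permutes)
 have "inversions (arrangement n (perm_of_word (i # is))) \<le> Suc (inversions (arrangement n (perm_of_word is)))"
  using inversions_arrangement_swap[OF p] unfolding perm_of_word_simps by linarith
 also have "\<dots> \<le> length (i # is)" using Cons by simp
 finally show ?case .
qed

text \<open>As in bubble sort, a descent can be removed by one letter, which lowers the number of inversions by one.\<close>

lemma word_of_inversions_exists:
 "\<sigma> permutes {..<n} ==> \<exists>is. ok is \<and> perm_of_word is = \<sigma> \<and> length is = inversions (arrangement n \<sigma>)"
proof (induction "inversions (arrangement n \<sigma>)" arbitrary: \<sigma> rule: less_induct)
 case less
 let ?ks = "arrangement n \<sigma>"
 show ?case
 proof (cases "\<exists>i. Suc i < n \<and> \<not> ?ks ! i < ?ks ! Suc i")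
  case True
  then obtain i where i: "Suc i < n" "\<not> ?ks ! i < ?ks ! Suc i" by blast
  let ?\<tau> = "transpose i (Suc i) \<circ> \<sigma>"
  have \<tau>: "?\<tau> permutes {..<n}"
   using less.prems i(1) by (intro permutes_compose permutes_swap_id) auto
  note inv = inversions_arrangement_swap(2)[OF less.prems i]
  obtain ws where ws: "ok ws" "perm_of_word ws = ?\<tau>" "length ws = inversions (arrangement n ?\<tau>)"
   using less.hyps[OF _ \<tau>] inv by auto
  have "perm_of_word (i # ws) = \<sigma>"
   using ws(2) by (simp add: comp_assoc[symmetric])
  then show ?thesis
   using ws i(1) inv by (intro exI[of _ "i # ws"]) auto
 next
  case False
  then have "sorted_wrt (<) ?ks"
   by (subst sorted_wrt_iff_nth_Suc_transp) auto
  then have "sorted ?ks" "distinct ?ks"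
   by (auto simp: strict_sorted_iff)
  then have ks: "?ks = [0..<n]"
   using set_arrangement[OF less.prems] by (intro sorted_distinct_set_unique) (auto simp: atLeast0LessThan)
  have "Hilbert_Choice.inv \<sigma> = id"
  proof
   fix k show "Hilbert_Choice.inv \<sigma> k = id k"
   proof (cases "k < n")
    case True
    then have "?ks ! k = Hilbert_Choice.inv \<sigma> k" by (simp add: arrangement_def)
    then show ?thesis using ks True by simp
   next
    case False
    then show ?thesis using permutes_inv[OF less.prems] by (simp add: permutes_def)
   qed
  qed
  then have "\<sigma> = id"
   using permutes_bij[OF less.prems] by (metis bij_imp_bij_inv inv_id inv_inv_eq)
  then show ?thesis using ks by (intro exI[of _ "[]"]) (simp add: inversions_upt)
 qed
qed

lemma reduced_word_exists: "\<sigma> permutes {..<n} ==> \<exists>is. reduced_word n \<sigma> is"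
 using word_of_inversions_exists inversions_le_length unfolding reduced_word_def by metis

lemma reduced_word_length:
 assumes "reduced_word n \<sigma> is"
 shows "length is = inversions (arrangement n \<sigma>)"
proof -
 have \<sigma>: "\<sigma> permutes {..<n}"
  using assms perm_of_word_permutes by (auto simp: reduced_word_def)
 then show ?thesis
  using assms word_of_inversions_exists[OF \<sigma>] inversions_le_length
  unfolding reduced_word_def by (metis order_antisym)
qed

text \<open>
 The first letter of a reduced word is applied last; it interchanges two neighbours that have been in their
 original order until then, as otherwise it would destroy an inversion.
\<close>

lemma reduced_word_Cons:
 assumes "reduced_word n \<sigma> (i # is)"
 shows "reduced_word n (perm_of_word is) is"
  and "arrangement n (perm_of_word is) ! i < arrangement n (perm_of_word is) ! Suc i"
proof -
 have ok: "ok is" "Suc i < n" and \<sigma>: "\<sigma> = perm_of_word (i # is)"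
  and min: "!!js. ok js ==> perm_of_word js = \<sigma> ==> length (i # is) \<le> length js"
  using assms by (auto simp: reduced_word_def)
 have "length is \<le> length js" if "ok js" "perm_of_word js = perm_of_word is" for js
  using min[of "i # js"] that ok(2) \<sigma> by simp
 then show red: "reduced_word n (perm_of_word is) is"
  using ok by (simp add: reduced_word_def)
 note p = perm_of_word_permutes[OF ok(1)]
 show "arrangement n (perm_of_word is) ! i < arrangement n (perm_of_word is) ! Suc i"
 proof (rule ccontr)
  assume "\<not> ?thesis"
  from inversions_arrangement_swap(2)[OF p ok(2) this] show False
   using reduced_word_length[OF red] reduced_word_length[OF assms] \<sigma> by simp
 qed
qed

lemma bij_arrangement:
 "bij_betw (arrangement n) {\<sigma>. \<sigma> permutes {..<n}} (permutations_of_set {..<n})"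
proof (rule bij_betwI')
 fix \<sigma> \<tau> assume "\<sigma> \<in> {\<sigma>. \<sigma> permutes {..<n}}" "\<tau> \<in> {\<sigma>. \<sigma> permutes {..<n}}"
 then have p: "\<sigma> permutes {..<n}" "\<tau> permutes {..<n}" by auto
 show "arrangement n \<sigma> = arrangement n \<tau> \<longleftrightarrow> \<sigma> = \<tau>"
 proof
  assume eq: "arrangement n \<sigma> = arrangement n \<tau>"
  have "Hilbert_Choice.inv \<sigma> = Hilbert_Choice.inv \<tau>"
  proof
   fix k show "Hilbert_Choice.inv \<sigma> k = Hilbert_Choice.inv \<tau> k"
    using eq permutes_inv[OF p(1)] permutes_inv[OF p(2)]
    by (cases "k < n") (auto simp: arrangement_def permutes_def)
  qed
  then show "\<sigma> = \<tau>"
   using p by (metis permutes_inv_inv)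
 qed simp
next
 fix \<sigma> assume "\<sigma> \<in> {\<sigma>. \<sigma> permutes {..<n}}"
 then show "arrangement n \<sigma> \<in> permutations_of_set {..<n}"
  by (auto simp: permutations_of_set_def set_arrangement distinct_arrangement)
next
 fix ks assume "ks \<in> permutations_of_set {..<n}"
 then have ks: "set ks = {..<n}" "distinct ks" by (auto simp: permutations_of_set_def)
 then have len: "length ks = n" by (metis card_lessThan distinct_card)
 define \<pi> where "\<pi> k = (if k < n then ks ! k else k)" for k
 have nth: "bij_betw ((!) ks) {..<n} {..<n}"
  by (rule bij_betw_nth[OF ks(2)]) (simp_all only: ks(1) len)
 have "bij_betw \<pi> {..<n} {..<n}"
  by (rule bij_betw_cong[THEN iffD1, OF _ nth]) (simp add: \<pi>_def)
 then have "\<pi> permutes {..<n}"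
  by (intro bij_imp_permutes) (auto simp: \<pi>_def)
 moreover from this have "arrangement n (Hilbert_Choice.inv \<pi>) = ks"
  using len by (intro nth_equalityI) (auto simp: arrangement_def permutes_inv_inv \<pi>_def)
 ultimately show "\<exists>\<sigma>\<in>{\<sigma>. \<sigma> permutes {..<n}}. ks = arrangement n \<sigma>"
  using permutes_inv by blast
qed

end

section \<open>The Nichols ideal as the kernel of the symmetrizer\<close>

lemma braid_at_sum:
 "braid_at B \<Psi> i (%u. \<Sum>w\<in>E. k w * f w u) = (%u. \<Sum>w\<in>E. k w * braid_at B \<Psi> i (f w) u)"
proof
 fix u
 have "(\<Sum>b\<in>B. \<Sum>c\<in>B. (\<Sum>w\<in>E. k w * f w (u[i := b, Suc i := c])) * \<Psi> b c [u ! i, u ! Suc i]) =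
  (\<Sum>w\<in>E. \<Sum>b\<in>B. \<Sum>c\<in>B. k w * f w (u[i := b, Suc i := c]) * \<Psi> b c [u ! i, u ! Suc i])"
  by (simp add: sum_distrib_right sum.swap[of _ E])
 then show "braid_at B \<Psi> i (%u. \<Sum>w\<in>E. k w * f w u) u = (\<Sum>w\<in>E. k w * braid_at B \<Psi> i (f w) u)"
  by (simp add: braid_at_def sum_distrib_left mult.assoc)
qed

lemma braid_at_scale: "braid_at B \<Psi> i (%u. k * f u) = (%u. k * braid_at B \<Psi> i f u)"
 using braid_at_sum[of B \<Psi> i "%_. k" "%_. f" "{()}"] by simp

lemma braid_at_Suc_Cons: "braid_at B \<Psi> (Suc i) p (c # u) = braid_at B \<Psi> i (%v. p (c # v)) u"
 by (simp add: braid_at_def)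

abbreviation braid_word where "braid_word B \<Psi> is \<equiv> foldr (%i T. braid_at B \<Psi> i \<circ> T) is id"

lemma braid_word_sum:
 "braid_word B \<Psi> is (%u. \<Sum>w\<in>E. k w * f w u) = (%u. \<Sum>w\<in>E. k w * braid_word B \<Psi> is (f w) u)"
 by (induction "is") (simp_all add: braid_at_sum)

lemma braided_factorial_sum:
 "braided_factorial B \<Psi> n (%u. \<Sum>w\<in>E. k w * f w u) = (%u. \<Sum>w\<in>E. k w * braided_factorial B \<Psi> n (f w) u)"
 unfolding braided_factorial_def braid_perm_def braid_word_sum
 by (simp add: sum_distrib_left sum.swap[of _ E])

context yd_matrix
begin

definition degs :: "'b list => nat set => 'g"
 where "degs w K = Deg (map ((!) w) (sorted_list_of_set K))"

lemma Deg_append: "u \<in> lists B ==> v \<in> lists B ==> Deg (u @ v) = Deg u \<otimes> Deg v"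
 by (induction u) (auto simp: G.m_assoc)

lemma nth_lists: "w \<in> lists B ==> K \<subseteq> {..<length w} ==> map ((!) w) (sorted_list_of_set K) \<in> lists B"
 using finite_subset[of K "{..<length w}"] by (auto simp: subset_iff)

lemma degs_closed [simp]: "w \<in> lists B ==> K \<subseteq> {..<length w} ==> degs w K \<in> carrier G"
 unfolding degs_def by (rule Deg_closed[OF nth_lists])

lemma degs_empty [simp]: "degs w {} = \<one>"
 by (simp add: degs_def)

lemma degs_Un:
 assumes "w \<in> lists B" "K \<union> K' \<subseteq> {..<length w}" "!!i j. i \<in> K ==> j \<in> K' ==> i < j"
 shows "degs w (K \<union> K') = degs w K \<otimes> degs w K'"
proof -
 have f: "finite K" "finite K'" using assms(2) finite_subset[of _ "{..<length w}"] by auto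
 have "sorted_list_of_set (K \<union> K') = sorted_list_of_set K @ sorted_list_of_set K'"
 proof -
  let ?l = "sorted_list_of_set K @ sorted_list_of_set K'"
  have "sorted ?l" "distinct ?l" "set ?l = K \<union> K'"
   using f assms(3) by (fastforce simp: sorted_append)+
  then show ?thesis using sorted_list_of_set.idem_if_sorted_distinct by metis
 qed
 then show ?thesis
  using nth_lists[OF assms(1)] assms(2) by (simp add: degs_def Deg_append del: in_lists_conv_set)
qed

lemma degs_insert_min:
 assumes "w \<in> lists B" "insert k K \<subseteq> {..<length w}" "!!j. j \<in> K ==> k < j"
 shows "degs w (insert k K) = deg (w ! k) \<otimes> degs w K"
proof -
 have "w ! k \<in> set w" using assms(2) by simp
 then have "w ! k \<in> B" using assms(1) by auto
 then have "degs w {k} = deg (w ! k)" by (simp add: degs_def)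
 then show ?thesis using degs_Un[of w "{k}" K] assms by simp
qed

text \<open>
 The term of \<open>[n]!\<close> in which the tensor factors of \<open>w\<close> arrive in the order \<open>ks\<close>: a factor is moved
 to the left across the factors before it in \<open>w\<close> and after it in \<open>ks\<close>, and these act on it.
\<close>

fun strand :: "'b list => nat list => 'b list => complex" where
 "strand w [] u = (if u = [] then 1 else 0)"
| "strand w (k # ks) [] = 0"
| "strand w (k # ks) (c # u) = r (degs w {j \<in> set ks. j < k}) c (w ! k) * strand w ks u"

context
 fixes \<Psi> :: "'b => 'b => 'b list => complex"
 assumes \<Psi>: "!!b c e f. b \<in> B ==> c \<in> B ==> \<Psi> b c [e, f] = (if f = b then r (deg b) e c else 0)"
begin

text \<open>
 If the neighbours \<open>a < b\<close> have not been interchanged yet, then \<open>b\<close> jumps over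
 \<open>a\<close>: the degree of \<open>a\<close> joins the degrees that act on \<open>b\<close>, and the other
 factors do not change.
\<close>

lemma braid_strand:
 assumes w: "w \<in> lists B" and ab: "a < b"
  and "distinct (xs @ a # b # ys)" "set (xs @ a # b # ys) \<subseteq> {..<length w}"
 shows "braid_at B \<Psi> (length xs) (strand w (xs @ a # b # ys)) u = strand w (xs @ b # a # ys) u"
 using assms(3,4)
proof (induction xs arbitrary: u)
 case Nil
 show ?case
 proof (cases u)
  case (Cons e v)
  note u = this
  show ?thesis
  proof (cases v)
   case Nil
   then show ?thesis using u by (simp add: braid_at_def)
  next
   case (Cons f u')
   let ?C = "set ys"
   let ?Ha = "degs w {j \<in> ?C. j < a}" and ?Hb = "degs w {j \<in> ?C. j < b}"
   let ?H = "degs w {j \<in> ?C. a < j \<and> j < b}"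
   have wab: "w ! a \<in> B" "w ! b \<in> B" "a < length w" "b < length w" "?C \<subseteq> {..<length w}"
    using Nil w by (auto simp: subset_iff)
   have cl: "?Ha \<in> carrier G" "?Hb \<in> carrier G" "?H \<in> carrier G"
    using wab by (auto intro!: degs_closed[OF w])
   have s1: "{j \<in> set (b # ys). j < a} = {j \<in> ?C. j < a}"
    using ab by auto
   have "{j \<in> ?C. j < b} = {j \<in> ?C. j < a} \<union> {j \<in> ?C. a < j \<and> j < b}"
    using ab Nil by (auto; metis linorder_neqE_nat)
   then have Hb: "?Hb = ?Ha \<otimes> ?H"
    using wab by (simp only:) (intro degs_Un[OF w], auto)
   have "{j \<in> set (a # ys). j < b} = {j \<in> ?C. j < a} \<union> insert a {j \<in> ?C. a < j \<and> j < b}"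
    using ab Nil by (auto; metis linorder_neqE_nat)
   moreover have "degs w ({j \<in> ?C. j < a} \<union> insert a {j \<in> ?C. a < j \<and> j < b}) =
     ?Ha \<otimes> (deg (w ! a) \<otimes> ?H)"
   proof -
    have "degs w (insert a {j \<in> ?C. a < j \<and> j < b}) = deg (w ! a) \<otimes> ?H"
     using wab by (intro degs_insert_min[OF w]) auto
    then show ?thesis using wab by (subst degs_Un[OF w]) auto
   qed
   ultimately have Hba: "degs w {j \<in> set (a # ys). j < b} = ?Ha \<otimes> (deg (w ! a) \<otimes> ?H)"
    by simp
   have "braid_at B \<Psi> 0 (strand w (a # b # ys)) u =
     (\<Sum>x\<in>B. \<Sum>y\<in>B. r ?Ha x (w ! a) * (r ?Hb y (w ! b) * strand w ys u') *
      (if f = x then r (deg x) e y else 0))"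
    unfolding u Cons using s1 by (simp add: braid_at_def \<Psi>)
   also have "\<dots> = (\<Sum>x\<in>B. if x = f then \<Sum>y\<in>B. r ?Ha x (w ! a) * (r ?Hb y (w ! b) * strand w ys u') *
      r (deg x) e y else 0)"
    by (intro sum.cong) auto
   also have "\<dots> = (if f \<in> B then r ?Ha f (w ! a) * (\<Sum>y\<in>B. r (deg f) e y * r ?Hb y (w ! b)) * strand w ys u' else 0)"
    by (simp add: sum_distrib_left sum_distrib_right mult_ac)
   also have "\<dots> = r (?Ha \<otimes> (deg (w ! a) \<otimes> ?H)) e (w ! b) * (r ?Ha f (w ! a) * strand w ys u')"
   proof (cases "f \<in> B \<and> r ?Ha f (w ! a) ~= 0")
    case True
    then have "deg f = ?Ha \<otimes> deg (w ! a) \<otimes> inv ?Ha"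
     using r_deg[OF cl(1), of f "w ! a"] wab by simp
    then have "deg f \<otimes> ?Hb = ?Ha \<otimes> (deg (w ! a) \<otimes> ?H)"
     using cl wab by (simp add: Hb G.m_assoc) (simp add: G.m_assoc[symmetric])
    moreover have "(\<Sum>y\<in>B. r (deg f) e y * r ?Hb y (w ! b)) = r (deg f \<otimes> ?Hb) e (w ! b)"
     using True cl wab by (simp add: r_mult)
    ultimately show ?thesis using True by simp
   next
    case False
    then show ?thesis using r_outside[OF cl(1) wab(1)] by auto
   qed
   also have "\<dots> = strand w (b # a # ys) u"
    unfolding u Cons using Hba by simp
   finally show ?thesis by simp
  qed
 qed (simp add: braid_at_def)
next
 case (Cons k xs)
 have same: "set (xs @ b # a # ys) = set (xs @ a # b # ys)" by auto
 show ?case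
 proof (cases u)
  case (Cons c v)
  have "braid_at B \<Psi> (length (k # xs)) (strand w ((k # xs) @ a # b # ys)) u =
    braid_at B \<Psi> (length xs) (%v. r (degs w {j \<in> set (xs @ a # b # ys). j < k}) c (w ! k) * strand w (xs @ a # b # ys) v) v"
   unfolding Cons by (simp add: braid_at_Suc_Cons)
  also have "\<dots> = r (degs w {j \<in> set (xs @ b # a # ys). j < k}) c (w ! k) * strand w (xs @ b # a # ys) v"
   using Cons.IH[of v] Cons.prems unfolding braid_at_scale same by simp
  finally show ?thesis by (simp add: Cons)
 qed (simp add: braid_at_def)
qed

lemma strand_upt:
 assumes w: "w \<in> lists B"
 shows "m \<le> length w ==> strand w [m..<length w] u = delta (drop m w) u"
proof (induction "length w - m" arbitrary: m u)
 case 0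
 then show ?case by (auto simp: delta_def)
next
 case (Suc d)
 then have m: "m < length w" by simp
 then have e: "[m..<length w] = m # [Suc m..<length w]" "drop m w = w ! m # drop (Suc m) w"
  by (simp_all add: upt_conv_Cons Cons_nth_drop_Suc)
 have wm: "w ! m \<in> B" using w m by auto
 show ?case
 proof (cases u)
  case (Cons c v)
  have "{j \<in> set [Suc m..<length w]. j < m} = {}" by auto
  then have "degs w {j \<in> set [Suc m..<length w]. j < m} = \<one>" by (simp only: degs_empty)
  then have "strand w [m..<length w] u = r \<one> c (w ! m) * delta (drop (Suc m) w) v"
   using Suc.hyps(1)[of "Suc m" v] Suc.hyps(2) m unfolding e Cons by (simp del: set_upt)
  also have "\<dots> = delta (drop m w) u"
   unfolding e Cons using r_one[of c "w ! m"] r_outside[of "\<one>" "w ! m" c] wm by (cases "c \<in> B") (auto simp: delta_def)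
  finally show ?thesis .
 qed (simp add: e)
qed

text \<open>
 In a reduced word two factors change their order at most once, so the result depends on the final arrangement
 only.
\<close>

lemma braid_word_strand:
 assumes w: "w \<in> lists B" "length w = n" and "reduced_word n \<sigma> is"
 shows "braid_word B \<Psi> is (delta w) = strand w (arrangement n \<sigma>)"
 using assms(3)
proof (induction "is" arbitrary: \<sigma>)
 case Nil
 then have "\<sigma> = id" by (simp add: reduced_word_def)
 then have "arrangement n \<sigma> = [0..<n]" by (simp only: arrangement_id)
 then show ?case using strand_upt[OF w(1), of 0] w(2) by (simp add: fun_eq_iff)
next
 case (Cons i "is")
 note red = reduced_word_Cons[OF Cons.prems]
 let ?ks = "arrangement n (perm_of_word is)"
 have ok: "\<forall>i\<in>set is. Suc i < n" "Suc i < n" and \<sigma>: "\<sigma> = transpose i (Suc i) \<circ> perm_of_word is"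
  using Cons.prems by (auto simp: reduced_word_def)
 note p = perm_of_word_permutes[OF ok(1)]
 have len: "Suc i < length ?ks" using ok by simp
 note s = split_adj[OF len]
 have "braid_word B \<Psi> (i # is) (delta w) = braid_at B \<Psi> i (strand w ?ks)"
  by (simp only: foldr.simps comp_apply Cons.IH[OF red(1)])
 also have "\<dots> = strand w (swap_adj i ?ks)"
 proof -
  have "length (take i ?ks) = i" using len by simp
  moreover have "distinct (take i ?ks @ ?ks ! i # ?ks ! Suc i # drop (Suc (Suc i)) ?ks)"
   using distinct_arrangement[OF p] s(1) by simp
  moreover have "set (take i ?ks @ ?ks ! i # ?ks ! Suc i # drop (Suc (Suc i)) ?ks) \<subseteq> {..<length w}"
   using set_arrangement[OF p] s(1) w(2) by simp
  ultimately show ?thesis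
   using braid_strand[OF w(1) red(2), of "take i ?ks" "drop (Suc (Suc i)) ?ks"] s
   by (simp add: fun_eq_iff)
 qed
 also have "swap_adj i ?ks = arrangement n \<sigma>"
  using arrangement_swap[OF p ok(2)] \<sigma> by simp
 finally show ?case .
qed

text \<open>
 The sum of the terms of \<open>[n]!\<close>, restricted to the factors of \<open>w\<close> at the places in
 \<open>K\<close>.
\<close>

definition strand_sum :: "'b list => nat set => 'b list => complex"
 where "strand_sum w K u = (\<Sum>ks\<in>permutations_of_set K. strand w ks u)"

lemma strand_sum_empty: "strand_sum w {} = \<epsilon>"
 by (auto simp: strand_sum_def delta_def fun_eq_iff)

lemma strand_sum_Nil: "K ~= {} ==> finite K ==> strand_sum w K [] = 0"
 unfolding strand_sum_def by (intro sum.neutral) (auto simp: permutations_of_set_nonempty)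

lemma strand_sum_Cons:
 assumes "finite K"
 shows "strand_sum w K (c # u) = (\<Sum>k\<in>K. r (degs w {j \<in> K. j < k}) c (w ! k) * strand_sum w (K - {k}) u)"
proof (cases "K = {}")
 case False
 have "strand_sum w K (c # u) = (\<Sum>k\<in>K. \<Sum>ks\<in>(#) k ` permutations_of_set (K - {k}). strand w ks (c # u))"
  unfolding strand_sum_def permutations_of_set_nonempty[OF False]
  using assms by (subst sum.UNION_disjoint) auto
 also have "\<dots> = (\<Sum>k\<in>K. r (degs w {j \<in> K. j < k}) c (w ! k) * strand_sum w (K - {k}) u)"
 proof (rule sum.cong[OF refl])
  fix k assume "k \<in> K"
  have "strand w (k # ks) (c # u) = r (degs w {j \<in> K. j < k}) c (w ! k) * strand w ks u"
   if "ks \<in> permutations_of_set (K - {k})" for ks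
  proof -
   have "{j \<in> set ks. j < k} = {j \<in> K. j < k}" using that by (auto simp: permutations_of_set_def)
   then show ?thesis by simp
  qed
  then show "(\<Sum>ks\<in>(#) k ` permutations_of_set (K - {k}). strand w ks (c # u)) =
    r (degs w {j \<in> K. j < k}) c (w ! k) * strand_sum w (K - {k}) u"
   by (subst sum.reindex) (simp_all add: strand_sum_def sum_distrib_left del: strand.simps)
 qed
 finally show ?thesis .
qed (simp add: strand_sum_empty)

text \<open>
 The factor with the least index jumps over no other one, whereas each factor that ends up to the left of it
 has jumped over it, so that its degree acts there. Summing over its possible places is therefore insertion.
\<close>

lemma strand_sum_insert_min:
 assumes w: "w \<in> lists B"
 shows "insert k0 K \<subseteq> {..<length w} ==> (!!j. j \<in> K ==> k0 < j) ==>
  strand_sum w (insert k0 K) u = create (w ! k0) (strand_sum w K) u"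
proof (induction u arbitrary: K)
 case Nil
 then have "finite K" using finite_subset[of K "{..<length w}"] by auto
 then show ?case by (simp add: strand_sum_Nil)
next
 case (Cons c u)
 have f: "finite K" using Cons.prems finite_subset[of K "{..<length w}"] by auto
 have k0: "k0 \<notin> K" using Cons.prems(2) by blast
 let ?v = "w ! k0"
 have v: "?v \<in> B" using w Cons.prems by auto
 let ?H = "%k. degs w {j \<in> K. j < k}"
 have "strand_sum w (insert k0 K) (c # u) = r (degs w {j \<in> insert k0 K. j < k0}) c ?v * strand_sum w (insert k0 K - {k0}) u +
   (\<Sum>k\<in>K. r (degs w {j \<in> insert k0 K. j < k}) c (w ! k) * strand_sum w (insert k0 K - {k}) u)"
  using f k0 by (simp add: strand_sum_Cons)
 also have "r (degs w {j \<in> insert k0 K. j < k0}) c ?v * strand_sum w (insert k0 K - {k0}) u =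
   (if c = ?v then strand_sum w K u else 0)"
 proof -
  have "{j \<in> insert k0 K. j < k0} = {}" using Cons.prems(2) by fastforce
  then have "degs w {j \<in> insert k0 K. j < k0} = \<one>" by (simp only: degs_empty)
  moreover have "insert k0 K - {k0} = K" using k0 by simp
  ultimately show ?thesis
   using r_one[of c ?v] r_outside[of "\<one>" ?v c] v by (simp only:) (cases "c \<in> B", auto)
 qed
 also have "(\<Sum>k\<in>K. r (degs w {j \<in> insert k0 K. j < k}) c (w ! k) * strand_sum w (insert k0 K - {k}) u) =
   (\<Sum>k\<in>K. \<Sum>d\<in>B. r (deg ?v) c d * (r (?H k) d (w ! k) * create ?v (strand_sum w (K - {k})) u))"
 proof (rule sum.cong[OF refl])
  fix k assume k: "k \<in> K"
  have "{j \<in> insert k0 K. j < k} = insert k0 {j \<in> K. j < k}"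
   using Cons.prems(2) k by auto
  moreover have "degs w (insert k0 {j \<in> K. j < k}) = deg ?v \<otimes> ?H k"
   using Cons.prems by (intro degs_insert_min[OF w]) auto
  moreover have "insert k0 K - {k} = insert k0 (K - {k})" using k k0 by auto
  moreover have "strand_sum w (insert k0 (K - {k})) u = create ?v (strand_sum w (K - {k})) u"
   using Cons.prems by (intro Cons.IH) auto
  moreover have "?H k \<in> carrier G" using Cons.prems(1) by (intro degs_closed[OF w]) auto
  moreover have "w ! k \<in> B" using w Cons.prems(1) k by auto
  ultimately show "r (degs w {j \<in> insert k0 K. j < k}) c (w ! k) * strand_sum w (insert k0 K - {k}) u =
    (\<Sum>d\<in>B. r (deg ?v) c d * (r (?H k) d (w ! k) * create ?v (strand_sum w (K - {k})) u))"
   using v by (simp add: r_mult sum_distrib_right mult.assoc)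
 qed
 also have "\<dots> = (\<Sum>d\<in>B. r (deg ?v) c d * (\<Sum>k\<in>K. r (?H k) d (w ! k) * create ?v (strand_sum w (K - {k})) u))"
  by (subst sum.swap) (simp add: sum_distrib_left)
 also have "\<dots> = (\<Sum>d\<in>B. r (deg ?v) c d * create ?v (%x. strand_sum w K (d # x)) u)"
  by (simp add: strand_sum_Cons[OF f] create_sum)
 finally show ?case by simp
qed

lemma strand_sum_sym:
 assumes w: "w \<in> lists B" and "K \<subseteq> {..<length w}"
 shows "strand_sum w K = sym (map ((!) w) (sorted_list_of_set K))"
proof -
 have "finite K" using assms(2) finite_subset by auto
 then show ?thesis
  using assms(2)
 proof (induction K rule: finite_linorder_min_induct)
  case empty
  then show ?case by (simp add: strand_sum_empty)
 next
  case (insert k K)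
  have "sorted_list_of_set (insert k K) = k # sorted_list_of_set K"
  proof -
   have "sorted (k # sorted_list_of_set K)" "distinct (k # sorted_list_of_set K)"
    "set (k # sorted_list_of_set K) = insert k K"
    using insert.hyps by (auto simp: less_imp_le)
   then show ?thesis using sorted_list_of_set.idem_if_sorted_distinct by metis
  qed
  moreover have "strand_sum w (insert k K) = create (w ! k) (strand_sum w K)"
   using insert.prems insert.hyps(2) by (intro ext strand_sum_insert_min[OF w]) auto
  ultimately show ?case using insert by simp
 qed
qed

lemma braided_factorial_word:
 assumes w: "w \<in> lists B" "length w = n"
 shows "braided_factorial B \<Psi> n (delta w) = sym w"
proof
 fix u
 have "braid_perm B \<Psi> n \<sigma> (delta w) = strand w (arrangement n \<sigma>)" if "\<sigma> permutes {..<n}" for \<sigma>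
  unfolding braid_perm_def
  by (rule braid_word_strand[OF w someI_ex[OF reduced_word_exists[OF that]]])
 then have "braided_factorial B \<Psi> n (delta w) u = (\<Sum>\<sigma> | \<sigma> permutes {..<n}. strand w (arrangement n \<sigma>) u)"
  by (simp add: braided_factorial_def)
 also have "\<dots> = strand_sum w {..<n} u"
  unfolding strand_sum_def by (rule sum.reindex_bij_betw[OF bij_arrangement])
 also have "\<dots> = sym w u"
  using strand_sum_sym[OF w(1), of "{..<n}"] map_nth[of w] w(2) by (simp add: lessThan_atLeast0)
 finally show "braided_factorial B \<Psi> n (delta w) u = sym w u" .
qed

lemma create_length:
 "(!!u. s u ~= 0 ==> length u = m) ==> create v s u ~= 0 ==> length u = Suc m"
proof (induction u arbitrary: s m)
 case (Cons c u)
 show ?case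
 proof (cases "c = v \<and> s u ~= 0")
  case True
  then show ?thesis using Cons.prems by simp
 next
  case False
  then have "(\<Sum>d\<in>B. r (deg v) c d * create v (%w. s (d # w)) u) ~= 0"
   using Cons.prems(2) by (auto split: if_splits)
  then obtain d where d: "create v (%w. s (d # w)) u ~= 0"
   by (elim sum.not_neutral_contains_not_neutral) auto
  moreover have m: "Suc (length w) = m" if "s (d # w) ~= 0" for w
   using Cons.prems(1)[OF that] by simp
  moreover have "m ~= 0"
  proof
   assume "m = 0"
   then have "(%w. s (d # w)) = (%_. 0)" using m by fastforce
   then show False using d by simp
  qed
  ultimately have "length u = Suc (m - 1)"
   by (intro Cons.IH[of "%w. s (d # w)" "m - 1"]) (fastforce, assumption)
  then show ?thesis using \<open>m ~= 0\<close> by simp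
 qed
qed simp

lemma sym_length: "sym w u ~= 0 ==> length u = length w"
proof (induction w arbitrary: u)
 case Nil
 then show ?case by simp
next
 case (Cons b w)
 then show ?case using create_length[of "sym w" "length w" b u] by simp
qed

text \<open>
 The value of \<open>[n]!\<close> at a word involves words of the same length only, so it may be compared with
 the symmetrizer degree by degree.
\<close>

lemma braided_factorial_homogeneous:
 assumes p: "p \<in> carrier T"
 shows "braided_factorial B \<Psi> n (homogeneous_part n p) u = (if n = length u then Sym p u else 0)"
proof -
 let ?E = "{w. p w ~= 0 \<and> length w = n}"
 have E: "finite ?E" "!!w. w \<in> ?E ==> w \<in> lists B" using p by (auto intro: rev_finite_subset)
 have "homogeneous_part n p = (%u. \<Sum>w\<in>?E. p w * delta w u)"
 proof
  fix u
  have "(\<Sum>w\<in>?E. p w * delta w u) = (\<Sum>w\<in>?E. if w = u then p w else 0)"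
   by (intro sum.cong) (auto simp: delta_def)
  then show "homogeneous_part n p u = (\<Sum>w\<in>?E. p w * delta w u)"
   using E(1) by (simp add: homogeneous_part_def)
 qed
 then have "braided_factorial B \<Psi> n (homogeneous_part n p) u = (\<Sum>w\<in>?E. p w * sym w u)"
  using E(2) braided_factorial_word by (simp add: braided_factorial_sum)
 also have "\<dots> = (if n = length u then Sym p u else 0)"
 proof (cases "n = length u")
  case True
  have "(\<Sum>w\<in>?E. p w * sym w u) = Sym p u"
   unfolding Sym_def using p sym_length[of _ u] True by (intro sum.mono_neutral_left) auto
  then show ?thesis using True by simp
 next
  case False
  then have "(\<Sum>w\<in>?E. p w * sym w u) = 0" using sym_length[of _ u] by (intro sum.neutral ballI) (metis (mono_tags, lifting) mem_Collect_eq mult_zero_right)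
  then show ?thesis using False by simp
 qed
 finally show ?thesis .
qed

lemma nichols_ideal_kern: "nichols_ideal B \<Psi> = kern"
proof -
 have "(\<forall>n. braided_factorial B \<Psi> n (homogeneous_part n p) = (%_. 0)) \<longleftrightarrow> Sym p = (%_. 0)"
  if p: "p \<in> carrier T" for p
 proof
  assume "\<forall>n. braided_factorial B \<Psi> n (homogeneous_part n p) = (%_. 0)"
  then have "Sym p u = 0" for u
   using braided_factorial_homogeneous[OF p, of "length u" u] by simp
  then show "Sym p = (%_. 0)" by blast
 next
  assume "Sym p = (%_. 0)"
  then show "\<forall>n. braided_factorial B \<Psi> n (homogeneous_part n p) = (%_. 0)"
   by (intro allI ext) (simp only: braided_factorial_homogeneous[OF p] if_cancel)
 qed
 then show ?thesis
  unfolding nichols_ideal_def kern_def by blast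
qed

end

end

section \<open>The Nichols algebra and its skew derivations\<close>

context yd_matrix
begin

sublocale NI: algebra_ideal T kern
 by (rule algebra_ideal.intro[OF complex_algebra_tensor_algebra ideal_kern])

abbreviation "N \<equiv> quotient T kern"
abbreviation "cl p \<equiv> kern +>\<^bsub>T\<^esub> p"

lemma complex_algebra_N [simp]: "complex_algebra N"
 by (rule NI.complex_algebra_quotient)

lemma word_closed [simp]: "w \<in> lists B ==> delta w \<in> carrier T"
 by (simp add: delta_in_free_space del: free_space_simps(1))

lemma letter_closed [simp]: "b \<in> B ==> delta [b] \<in> carrier T"
 by (rule word_closed) simp

lemma cl_closed [simp]: "p \<in> carrier T ==> cl p \<in> carrier N"
 by (rule linD(1)[OF NI.lin_coset])

lemma N_cases: "a \<in> carrier N ==> \<exists>p\<in>carrier T. a = cl p"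
 by (auto simp: NI.carrier_quotient)

lemma cl_mult: "p \<in> carrier T ==> q \<in> carrier T ==> cl p \<otimes>\<^bsub>N\<^esub> cl q = cl (p \<otimes>\<^bsub>T\<^esub> q)"
 by (rule NI.mult_quotient)

lemma cl_one: "\<one>\<^bsub>N\<^esub> = cl \<epsilon>"
 by (simp add: NI.one_quotient)

text \<open>
 The symmetrizer embeds the Nichols algebra into tensors, where equations can be checked. The choice of the
 representative is immaterial.
\<close>

definition nsym :: "('b list => complex) set => 'b list => complex"
 where "nsym a = Sym (SOME p. p \<in> carrier T \<and> cl p = a)"

lemma cl_eq_iff:
 assumes "p \<in> carrier T" "q \<in> carrier T"
 shows "cl p = cl q \<longleftrightarrow> Sym p = Sym q"
proof -
 note [simp del] = tensor_algebra_simps(5) free_space_simps(1)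
 have "p \<ominus>\<^bsub>T\<^esub> q = (%w. p w + - 1 * q w)"
  using vspc_minus[OF vspc_tensor_algebra assms] by simp
 then have "Sym (p \<ominus>\<^bsub>T\<^esub> q) = (%u. Sym p u + - 1 * Sym q u)"
  using Sym_add[OF assms(1), of "%w. - 1 * q w"] free_space_closed(3)[of q "lists B" "- 1"] assms(2) Sym_scale[of "- 1" q]
  by simp
 moreover have "p \<ominus>\<^bsub>T\<^esub> q \<in> carrier T" using assms by (simp del: tensor_algebra_simps)
 ultimately have "p \<ominus>\<^bsub>T\<^esub> q \<in> kern \<longleftrightarrow> Sym p = Sym q"
  by (auto simp: kern_def fun_eq_iff)
 then show ?thesis by (simp only: NI.coset_eq_iff[OF assms])
qed

lemma nsym_cl [simp]:
 assumes "p \<in> carrier T"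
 shows "nsym (cl p) = Sym p"
proof -
 define q where "q = (SOME q. q \<in> carrier T \<and> cl q = cl p)"
 have "q \<in> carrier T \<and> cl q = cl p"
  unfolding q_def by (rule someI[of _ p]) (use assms in blast)
 then show ?thesis
  unfolding nsym_def q_def[symmetric] using cl_eq_iff assms by blast
qed

lemma nsym_inj: "a \<in> carrier N ==> a' \<in> carrier N ==> nsym a = nsym a' ==> a = a'"
 using N_cases cl_eq_iff nsym_cl by metis

lemma nsym_add: "a \<in> carrier N ==> a' \<in> carrier N ==> nsym (a \<oplus>\<^bsub>N\<^esub> a') = (%u. nsym a u + nsym a' u)"
proof -
 assume "a \<in> carrier N" "a' \<in> carrier N"
 then obtain p p' where p: "p \<in> carrier T" "a = cl p" "p' \<in> carrier T" "a' = cl p'" using N_cases by blast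
 have "p \<oplus>\<^bsub>T\<^esub> p' \<in> carrier T" using p by (simp del: tensor_algebra_simps)
 then have "nsym (cl (p \<oplus>\<^bsub>T\<^esub> p')) = Sym (p \<oplus>\<^bsub>T\<^esub> p')" by (rule nsym_cl)
 then show ?thesis using p Sym_add[OF p(1,3)] NI.add_quotient[OF p(1,3)] nsym_cl by simp
qed

lemma nsym_smult: "a \<in> carrier N ==> nsym (c \<odot>\<^bsub>N\<^esub> a) = (%u. c * nsym a u)"
proof -
 assume "a \<in> carrier N"
 then obtain p where p: "p \<in> carrier T" "a = cl p" using N_cases by blast
 have "c \<odot>\<^bsub>T\<^esub> p \<in> carrier T" using p by (simp del: tensor_algebra_simps)
 then have "nsym (cl (c \<odot>\<^bsub>T\<^esub> p)) = Sym (c \<odot>\<^bsub>T\<^esub> p)" by (rule nsym_cl)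
 then show ?thesis using p Sym_scale NI.smult_quotient[OF p(1)] nsym_cl by simp
qed

lemma nsym_mult: "p \<in> carrier T ==> a \<in> carrier N ==> nsym (cl p \<otimes>\<^bsub>N\<^esub> a) = Lop p (nsym a)"
proof -
 assume p: "p \<in> carrier T" and "a \<in> carrier N"
 then obtain q where q: "q \<in> carrier T" "a = cl q" using N_cases by blast
 then show ?thesis
  using p tensor_mult_closed[OF p q(1)] by (simp add: cl_mult Sym_mult del: tensor_algebra_simps)
qed

text \<open>
 An operation on tensors that preserves the image of the symmetrizer induces one on the Nichols algebra, the
 image being a copy of it.
\<close>

lemma induced_operator:
 assumes ex: "!!p. p \<in> carrier T ==> \<exists>q\<in>carrier T. Sym q = Z (Sym p)"
  and add: "!!s t. Z (%u. s u + t u) = (%u. Z s u + Z t u)"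
  and scale: "!!c s. Z (%u. c * s u) = (%u. c * Z s u)"
 shows "\<exists>h. lin N N h \<and> (\<forall>a\<in>carrier N. nsym (h a) = Z (nsym a))"
proof -
 have "\<exists>a'\<in>carrier N. nsym a' = Z (nsym a)" if "a \<in> carrier N" for a
  using N_cases[OF that] ex cl_closed nsym_cl by metis
 then obtain h where h: "!!a. a \<in> carrier N ==> h a \<in> carrier N" "!!a. a \<in> carrier N ==> nsym (h a) = Z (nsym a)"
  by metis
 have N: "vspc N" by simp
 have "lin N N h"
  unfolding lin_def
 proof (intro conjI ballI allI)
  fix a a' c assume a: "a \<in> carrier N" "a' \<in> carrier N"
  show "h (a \<oplus>\<^bsub>N\<^esub> a') = h a \<oplus>\<^bsub>N\<^esub> h a'"
   by (rule nsym_inj) (use a N h in \<open>simp_all add: nsym_add add\<close>)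
  show "h (c \<odot>\<^bsub>N\<^esub> a) = c \<odot>\<^bsub>N\<^esub> h a"
   by (rule nsym_inj) (use a N h in \<open>simp_all add: nsym_smult scale\<close>)
 qed (rule h(1))
 then show ?thesis using h(2) by blast
qed

text \<open>The group action, and the skew derivations given by deletion of the last letter.\<close>

definition nact :: "'g => ('b list => complex) set => ('b list => complex) set"
 where "nact g = (SOME h. lin N N h \<and> (\<forall>a\<in>carrier N. nsym (h a) = gact g (nsym a)))"

definition ndel :: "'b => ('b list => complex) set => ('b list => complex) set"
 where "ndel c = (SOME h. lin N N h \<and> (\<forall>a\<in>carrier N. nsym (h a) = (%u. nsym a (u @ [c]))))"

lemma nact:
 assumes "g \<in> carrier G"
 shows "lin N N (nact g)" and "a \<in> carrier N ==> nsym (nact g a) = gact g (nsym a)"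
proof -
 have "\<exists>h. lin N N h \<and> (\<forall>a\<in>carrier N. nsym (h a) = gact g (nsym a))"
 proof (rule induced_operator)
  show "\<exists>q\<in>carrier T. Sym q = gact g (Sym p)" if "p \<in> carrier T" for p
   using Sym_tact[OF assms that] linD(1)[OF alg_homD(1)[OF alg_hom_tact[OF assms]] that] by blast
 qed (simp_all add: fun_eq_iff gact_add gact_scale)
 from someI_ex[OF this]
 show "lin N N (nact g)" and "a \<in> carrier N ==> nsym (nact g a) = gact g (nsym a)"
  unfolding nact_def by blast+
qed

lemma ndel:
 assumes "c \<in> B"
 shows "lin N N (ndel c)" and "a \<in> carrier N ==> nsym (ndel c a) = (%u. nsym a (u @ [c]))"
proof -
 have "\<exists>h. lin N N h \<and> (\<forall>a\<in>carrier N. nsym (h a) = (%s u. s (u @ [c])) (nsym a))"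
 proof (rule induced_operator)
  show "\<exists>q\<in>carrier T. Sym q = (%u. Sym p (u @ [c]))" if "p \<in> carrier T" for p
   using Sym_snoc[OF that assms] by (metis ext)
 qed simp_all
 from someI_ex[OF this]
 show "lin N N (ndel c)" and "a \<in> carrier N ==> nsym (ndel c a) = (%u. nsym a (u @ [c]))"
  unfolding ndel_def by simp_all
qed

lemma nact_mult_letter:
 assumes "g \<in> carrier G" "v \<in> B" "a \<in> carrier N"
 shows "nact g (cl (delta [v]) \<otimes>\<^bsub>N\<^esub> a) = cl (letter_act g v) \<otimes>\<^bsub>N\<^esub> nact g a"
proof (rule nsym_inj)
 note l = letter_act_closed[OF assms(1,2)]
 note c = linD(1)[OF nact(1)[OF assms(1)]]
 show "nact g (cl (delta [v]) \<otimes>\<^bsub>N\<^esub> a) \<in> carrier N" "cl (letter_act g v) \<otimes>\<^bsub>N\<^esub> nact g a \<in> carrier N"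
  using assms l c by simp_all
 have L: "Lop (delta [v]) s = create v s" for s by (simp add: fun_eq_iff)
 show "nsym (nact g (cl (delta [v]) \<otimes>\<^bsub>N\<^esub> a)) = nsym (cl (letter_act g v) \<otimes>\<^bsub>N\<^esub> nact g a)"
  using assms l c
  by (simp add: nact nsym_mult L fun_eq_iff Lop_letter_act gact_create del: tensor_algebra_simps)
qed

text \<open>This is \<open>create_snoc\<close>, transported to the Nichols algebra.\<close>

lemma ndel_mult_letter:
 assumes "c \<in> B" "v \<in> B" "a \<in> carrier N"
 shows "ndel c (cl (delta [v]) \<otimes>\<^bsub>N\<^esub> a) =
  (cl (delta [v]) \<otimes>\<^bsub>N\<^esub> ndel c a) \<oplus>\<^bsub>N\<^esub> (if c = v then nact (deg v) a else \<zero>\<^bsub>N\<^esub>)"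
proof (rule nsym_inj)
 note c = linD(1)[OF ndel(1)[OF assms(1)]] and d = linD(1)[OF nact(1)[OF deg_closed[OF assms(2)]]]
 have z: "nsym \<zero>\<^bsub>N\<^esub> = (%_. 0)"
  using nsym_smult[of "\<zero>\<^bsub>N\<^esub>" 0] by simp
 show "ndel c (cl (delta [v]) \<otimes>\<^bsub>N\<^esub> a) \<in> carrier N"
  "(cl (delta [v]) \<otimes>\<^bsub>N\<^esub> ndel c a) \<oplus>\<^bsub>N\<^esub> (if c = v then nact (deg v) a else \<zero>\<^bsub>N\<^esub>) \<in> carrier N"
  using assms c d by simp_all
 have L: "Lop (delta [v]) s = create v s" for s by (simp add: fun_eq_iff)
 show "nsym (ndel c (cl (delta [v]) \<otimes>\<^bsub>N\<^esub> a)) =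
   nsym ((cl (delta [v]) \<otimes>\<^bsub>N\<^esub> ndel c a) \<oplus>\<^bsub>N\<^esub> (if c = v then nact (deg v) a else \<zero>\<^bsub>N\<^esub>))"
  using assms c d by (simp add: ndel nact nsym_mult nsym_add L create_snoc z fun_eq_iff del: tensor_algebra_simps)
qed

lemma ndel_one: "c \<in> B ==> ndel c \<one>\<^bsub>N\<^esub> = \<zero>\<^bsub>N\<^esub>"
proof -
 assume c: "c \<in> B"
 have e: "\<epsilon> \<in> carrier T" by simp
 have z: "nsym \<zero>\<^bsub>N\<^esub> = (%_. 0)"
  using nsym_smult[of "\<zero>\<^bsub>N\<^esub>" 0] by simp
 have "nsym (ndel c \<one>\<^bsub>N\<^esub>) = nsym \<zero>\<^bsub>N\<^esub>"
  unfolding z using c e by (simp add: ndel cl_one fun_eq_iff del: tensor_algebra_simps)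
 then show ?thesis using linD(1)[OF ndel(1)[OF c]] by (intro nsym_inj) simp_all
qed

lemma nact_one: "g \<in> carrier G ==> nact g \<one>\<^bsub>N\<^esub> = \<one>\<^bsub>N\<^esub>"
proof -
 assume g: "g \<in> carrier G"
 have e: "\<epsilon> \<in> carrier T" by simp
 have "nsym (nact g \<one>\<^bsub>N\<^esub>) = nsym \<one>\<^bsub>N\<^esub>"
  using g e by (simp add: nact cl_one del: tensor_algebra_simps)
 then show ?thesis using linD(1)[OF nact(1)[OF g]] by (intro nsym_inj) simp_all
qed

lemma nact_inverse: "g \<in> carrier G ==> a \<in> carrier N ==> nact (inv g) (nact g a) = a"
proof -
 assume g: "g \<in> carrier G" and a: "a \<in> carrier N"
 obtain p where p: "p \<in> carrier T" "a = cl p" using N_cases[OF a] by blast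
 have "nsym (nact (inv g) (nact g a)) = gact \<one> (nsym a)"
  using g a linD(1)[OF nact(1)[OF g] a] by (simp add: nact gact_mult fun_eq_iff)
 also have "\<dots> = nsym a"
  using p gact_one[of "Sym p"] Sym_outside[OF p(1)] by (simp add: fun_eq_iff)
 finally show ?thesis
  using g a linD(1)[OF nact(1)] by (intro nsym_inj) simp_all
qed

lemma letter_act_free: "g \<in> carrier G ==> b \<in> B ==> letter_act g b \<in> carrier (free_space ((%c. [c]) ` B))"
 using letter_act_support letter_act_closed by simp

lemma tact_degree_one:
 assumes g: "g \<in> carrier G" and "p \<in> carrier (free_space ((%c. [c]) ` B))"
 shows "tact g p = (%w. case w of [c] => \<Sum>d\<in>B. r g c d * p [d] | _ => 0)"
proof -
 note H = linD[OF alg_homD(1)[OF alg_hom_tact[OF g]]]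
 have T: "p \<in> carrier T" if "p \<in> carrier (free_space ((%c. [c]) ` B))" for p :: "'b list => complex"
  using that by auto
 show ?thesis
  using assms(2)
 proof (induction p rule: free_space_induct)
  case zero
  have "tact g (%_. 0) = (%_. 0)"
   using lin_zero[OF alg_homD(1)[OF alg_hom_tact[OF g]]] by simp
  then show ?case by (auto split: list.splits simp: fun_eq_iff)
 next
  case (add p q)
  then show ?case using H(2)[OF T T, of p q]
   by (auto split: list.splits simp: fun_eq_iff distrib_left sum.distrib)
 next
  case (smult c p)
  then show ?case using H(3)[OF T, of p c]
   by (auto split: list.splits simp: fun_eq_iff sum_distrib_left mult.left_commute)
 next
  case (delta x)
  then obtain b where b: "x = [b]" "b \<in> B" by auto
  have "(\<Sum>d\<in>B. r g c d * delta [b] [d]) = r g c b" for c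
  proof -
   have "(\<Sum>d\<in>B. r g c d * delta [b] [d]) = (\<Sum>d\<in>B. if d = b then r g c d else 0)"
    by (intro sum.cong) (auto simp: delta_def)
   then show ?thesis using b by simp
  qed
  then show ?case using tact_letter[OF g b(2)] b(1) by (simp add: letter_act_def fun_eq_iff split: list.splits)
 qed
qed

lemma tact_letter_act:
 assumes "g \<in> carrier G" "h \<in> carrier G" "v \<in> B"
 shows "tact g (letter_act h v) = letter_act (g \<otimes> h) v"
 using assms tact_degree_one[OF assms(1) letter_act_free[OF assms(2,3)]]
 by (auto simp: letter_act_def r_mult fun_eq_iff split: list.splits)

lemma letter_act_one: "v \<in> B ==> letter_act \<one> v = delta [v]"
proof
 fix w assume v: "v \<in> B"
 then show "letter_act \<one> v w = delta [v] w"
 proof (cases "\<exists>c. w = [c]")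
  case True
  then obtain c where "w = [c]" by blast
  then show ?thesis
   using v r_one[of c v] r_outside[of "\<one>" v c] by (cases "c \<in> B") (auto simp: letter_act_def delta_def)
 qed (auto simp: letter_act_def delta_def split: list.splits)
qed

end

section \<open>Representations of tensor algebras\<close>

definition rep :: "(complex, 'a) module => (complex, 'm) module => ('a => 'm => 'm) => bool"
 where "rep A M h \<longleftrightarrow> (\<forall>p\<in>carrier A. lin M M (h p)) \<and> (\<forall>n\<in>carrier M. lin A M (%p. h p n)) \<and>
  (\<forall>n\<in>carrier M. h \<one>\<^bsub>A\<^esub> n = n) \<and>
  (\<forall>p\<in>carrier A. \<forall>q\<in>carrier A. \<forall>n\<in>carrier M. h (p \<otimes>\<^bsub>A\<^esub> q) n = h p (h q n))"

lemma repD: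
 assumes "rep A M h"
 shows "p \<in> carrier A ==> lin M M (h p)"
  and "n \<in> carrier M ==> lin A M (%p. h p n)"
  and "n \<in> carrier M ==> h \<one>\<^bsub>A\<^esub> n = n"
  and "p \<in> carrier A ==> q \<in> carrier A ==> n \<in> carrier M ==> h (p \<otimes>\<^bsub>A\<^esub> q) n = h p (h q n)"
 using assms by (auto simp: rep_def)

lemma rep_of_alg_hom:
 assumes "complex_algebra A" "complex_algebra R" "alg_hom A R h"
 shows "rep A R (%p n. h p \<otimes>\<^bsub>R\<^esub> n)"
 unfolding rep_def
proof (intro conjI ballI)
 note H = alg_homD[OF assms(3)] and HL = linD[OF alg_homD(1)[OF assms(3)]]
 show "lin R R (%n. h p \<otimes>\<^bsub>R\<^esub> n)" if "p \<in> carrier A" for p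
  by (rule lin_mult_left[OF assms(2) HL(1)[OF that]])
 show "lin A R (%p. h p \<otimes>\<^bsub>R\<^esub> n)" if "n \<in> carrier R" for n
  by (rule lin_comp[OF H(1) lin_mult_right[OF assms(2) that]])
 show "h \<one>\<^bsub>A\<^esub> \<otimes>\<^bsub>R\<^esub> n = n" if "n \<in> carrier R" for n
  using H(2) that assms(2) by simp
 show "h (p \<otimes>\<^bsub>A\<^esub> q) \<otimes>\<^bsub>R\<^esub> n = h p \<otimes>\<^bsub>R\<^esub> (h q \<otimes>\<^bsub>R\<^esub> n)"
  if "p \<in> carrier A" "q \<in> carrier A" "n \<in> carrier R" for p q n
  using H(3) HL(1) that assms(2) by (simp add: algebra_assoc)
qed

lemma foldr_lin:
 assumes "!!c. c \<in> B ==> lin M M (f c)" "w \<in> lists B"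
 shows "lin M M (foldr f w)"
 using assms(2)
proof (induction w)
 case Nil
 then show ?case by (simp add: lin_def)
next
 case (Cons c w)
 then show ?case using lin_comp[of M M "foldr f w" M "f c"] assms(1) by (simp add: comp_def)
qed

text \<open>A tensor algebra is free, so its letters may act by arbitrary operators.\<close>

lemma rep_of_letters:
 assumes M: "vspc M" and f: "!!c. c \<in> B ==> lin M M (f c)"
 defines "h \<equiv> %q n. lin_ext M (%w. foldr f w n) q"
 shows "rep (tensor_algebra B) M h" and "c \<in> B ==> n \<in> carrier M ==> h (delta [c]) n = f c n"
proof -
 let ?T = "tensor_algebra B"
 note [simp del] = tensor_algebra_simps(5) free_space_simps(1)
 have fl: "lin M M (foldr f w)" if "w \<in> lists B" for w using foldr_lin[OF f that] .
 have L: "lin (free_space (lists B)) M (%q. h q n)" if n: "n \<in> carrier M" for n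
  unfolding h_def using linD(1)[OF fl n] by (intro lin_lin_ext[OF M])
 have hw: "h (delta w) n = foldr f w n" if "w \<in> lists B" "n \<in> carrier M" for w n
  unfolding h_def using linD(1)[OF fl[OF that(1)] that(2)] M by simp
 have R: "lin M M (h q)" if q: "q \<in> carrier ?T" for q
  using q[simplified]
 proof (induction q rule: free_space_induct)
  case zero
  have "h (%_. 0) n = \<zero>\<^bsub>M\<^esub>" for n unfolding h_def using M by simp
  then show ?case using M by (simp add: lin_def)
 next
  case (add p q)
  have e: "h (%x. p x + q x) n = h p n \<oplus>\<^bsub>M\<^esub> h q n" if "n \<in> carrier M" for n
   using linD(2)[OF L[OF that] add(1,2)] by simp
  show ?case
   unfolding lin_def using M linD[OF add(3)] linD[OF add(4)]
   by (auto simp: e vspc_assoc vspc_left_comm vspc_distr)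
 next
  case (smult c p)
  have e: "h (%x. c * p x) n = c \<odot>\<^bsub>M\<^esub> h p n" if "n \<in> carrier M" for n
   using linD(3)[OF L[OF that] smult(1)] by simp
  show ?case
   unfolding lin_def using M linD[OF smult(2)]
   by (auto simp: e vspc_distr mult.commute)
 next
  case (delta w)
  have e: "h (delta w) n = foldr f w n" if "n \<in> carrier M" for n using hw[OF delta that] .
  show ?case unfolding lin_def using M linD[OF fl[OF delta]] by (auto simp: e)
 qed
 have mult: "h (p \<otimes>\<^bsub>?T\<^esub> q) n = h p (h q n)" if p: "p \<in> carrier ?T" and q: "q \<in> carrier ?T" and n: "n \<in> carrier M" for p q n
 proof (rule lin_eq_on_free[OF _ _ M _ p[simplified]])
  have hq: "h q n \<in> carrier M" using linD(1)[OF R[OF q] n] .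
  show "lin (free_space (lists B)) M (%p. h p (h q n))" by (rule L[OF hq])
  show "lin (free_space (lists B)) M (%p. h (p \<otimes>\<^bsub>?T\<^esub> q) n)"
   using lin_comp[OF lin_tensor_mult(2)[OF q], of M "%q. h q n"] L[OF n] by simp
  fix u assume u: "u \<in> lists B"
  then have du: "delta u \<in> carrier ?T" by (simp add: delta_in_free_space)
  show "h (delta u \<otimes>\<^bsub>?T\<^esub> q) n = h (delta u) (h q n)"
  proof (rule lin_eq_on_free[OF _ _ M _ q[simplified]])
   show "lin (free_space (lists B)) M (%q. h (delta u \<otimes>\<^bsub>?T\<^esub> q) n)"
    using lin_comp[OF lin_tensor_mult(1)[OF du], of M "%q. h q n"] L[OF n] by simp
   show "lin (free_space (lists B)) M (%q. h (delta u) (h q n))"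
    by (rule lin_comp[OF L[OF n] R[OF du]])
   fix v assume v: "v \<in> lists B"
   show "h (delta u \<otimes>\<^bsub>?T\<^esub> delta v) n = h (delta u) (h (delta v) n)"
    using u v n linD(1)[OF fl[OF v] n] by (simp add: delta_mult hw)
  qed
 qed
 show "rep ?T M h"
  unfolding rep_def using L R mult hw[of "[]"] by simp
 show "c \<in> B ==> n \<in> carrier M ==> h (delta [c]) n = f c n"
  using hw[of "[c]" n] by simp
qed

section \<open>The braided Weyl algebra\<close>

lemma lin_add:
 assumes "vspc B" "lin A B h" "lin A B k"
 shows "lin A B (%x. h x \<oplus>\<^bsub>B\<^esub> k x)"
 unfolding lin_def using assms(1) linD[OF assms(2)] linD[OF assms(3)]
 by (simp add: vspc_assoc vspc_left_comm vspc_distr)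

lemma lin_scale: "vspc B ==> lin A B h ==> lin A B (%x. c \<odot>\<^bsub>B\<^esub> h x)"
 using linD[of A B h] by (simp add: lin_def[of A B "%x. c \<odot>\<^bsub>B\<^esub> h x"] vspc_distr mult.commute)

lemma lin_scalar:
 assumes "vspc B" "n \<in> carrier B"
 shows "lin (free_space E) B (%p. p x \<odot>\<^bsub>B\<^esub> n)"
 using assms by (auto simp: lin_def vspc_distl)

lemma lin_subspace: "E \<subseteq> E' ==> lin (free_space E') B h ==> lin (free_space E) B h"
 unfolding lin_def free_space_simps by auto

context yd_matrix
begin

text \<open>
 Since the kernel is graded, an element of it is the sum of its homogeneous components, and these lie in the
 kernel.
\<close>

lemma kern_induct [consumes 1, case_names add homogeneous]:
 assumes "q \<in> kern"
  and add: "!!p q. p \<in> kern ==> q \<in> kern ==> P p ==> P q ==> P (%w. p w + q w)"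
  and hom: "!!x q. x \<in> carrier G ==> q \<in> kern ==> q \<in> carrier (free_space {w \<in> lists B. Deg w = x}) ==> P q"
 shows "P q"
proof -
 define part where "part S w = (if w \<in> lists B then (if Deg w \<in> S then 1 else 0) * q w else 0)" for S w
 have k: "part S \<in> kern" for S
 proof -
  have "part S = (%w. if w \<in> lists B then (if Deg w \<in> S then 1 else 0) * q w else 0)"
   by (simp add: fun_eq_iff part_def)
  then show ?thesis using kern_graded[OF assms(1), of "%x. if x \<in> S then 1 else 0"] by simp
 qed
 have qT: "finite {w. q w ~= 0}" "{w. q w ~= 0} \<subseteq> lists B"
  using assms(1) by (auto simp: kern_def)
 have "P (part S)" if "finite S" "S \<subseteq> carrier G" for S
  using that
 proof (induction S)
  case empty
  have "part {} = (%_. 0)" by (simp add: part_def fun_eq_iff)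
  then show ?case using hom[of "\<one>" "%_. 0"] k[of "{}"] by simp
 next
  case (insert x S)
  have "part {x} \<in> carrier (free_space {w \<in> lists B. Deg w = x})"
   using qT by (auto simp: part_def intro: rev_finite_subset)
  then have "P (part {x})" using insert k by (intro hom[of x]) auto
  moreover have "part (insert x S) = (%w. part {x} w + part S w)"
   using insert.hyps(2) by (auto simp: part_def fun_eq_iff)
  ultimately show ?case using add[OF k k, of "{x}" S] insert by simp
 qed
 moreover have "q = part (Deg ` {w. q w ~= 0})"
 proof
  fix w show "q w = part (Deg ` {w. q w ~= 0}) w"
   using qT(2) by (cases "q w = 0") (auto simp: part_def)
 qed
 moreover have "Deg ` {w. q w ~= 0} \<subseteq> carrier G"
  using qT(2) by (intro image_subsetI Deg_closed) blast
 ultimately show ?thesis using qT(1) by (metis finite_imageI)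
qed

end

text \<open>
 A module and its dual in coordinates; \<open>\<beta>\<close> maps a basis to the dual basis. The dual degree
 is \<open>x b\<close>, the inverse of the degree of \<open>b\<close>.
\<close>

locale yd_pair = Y: yd_matrix G B deg r + D: yd_matrix G B' deg' r'
 for G :: "'g monoid" (structure) and B :: "'b set" and deg r and B' :: "'c set" and deg' r' +
 fixes \<beta> :: "'b => 'c"
 assumes bij: "bij_betw \<beta> B B'"
  and deg_dual: "b \<in> B ==> deg' (\<beta> b) = inv (deg b)"
  and r_dual: "g \<in> carrier G ==> c \<in> B ==> d \<in> B ==> r' g (\<beta> c) (\<beta> d) = r (inv g) d c"
begin

sublocale TP: tensor_pair Y.N D.N
 by (rule tensor_pair.intro) simp_all

abbreviation "V \<equiv> tensor_space Y.N D.N"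
abbreviation "tens \<equiv> tensor Y.N D.N"
abbreviation "left_in a \<equiv> tens a \<one>\<^bsub>D.N\<^esub>"
abbreviation "right_in c \<equiv> tens \<one>\<^bsub>Y.N\<^esub> c"
abbreviation "x b \<equiv> inv (deg b)"
abbreviation "E1 \<equiv> free_space ((%c. [c]) ` B)"

lemma beta_in [simp]: "b \<in> B ==> \<beta> b \<in> B'"
 using bij by (auto simp: bij_betw_def)

lemma beta_eq [simp]: "b \<in> B ==> c \<in> B ==> \<beta> b = \<beta> c \<longleftrightarrow> b = c"
 using bij by (auto simp: bij_betw_def inj_on_def)

lemma beta_cases: "c \<in> B' ==> \<exists>b\<in>B. c = \<beta> b"
 using bij by (auto simp: bij_betw_def)

lemma x_closed [simp]: "b \<in> B ==> x b \<in> carrier G"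
 by simp

definition unbeta where "unbeta = the_inv_into B \<beta>"

lemma unbeta_beta [simp]: "b \<in> B ==> unbeta (\<beta> b) = b"
 using bij by (simp add: unbeta_def bij_betw_def the_inv_into_f_f)

lemma unbeta_in [simp]: "c \<in> B' ==> unbeta c \<in> B"
 using beta_cases by fastforce

lemma beta_unbeta [simp]: "c \<in> B' ==> \<beta> (unbeta c) = c"
 using beta_cases by fastforce

subsection \<open>The left regular representation\<close>

text \<open>
 Left multiplication by a tensor over \<open>Y\<close>, and the operator by which the letter \<open>\<beta>
 b\<close> acts; the latter is forced by \<open>f a = (x \<triangleright> a) f + x \<triangleright>
 \<partial>\<^sub>fa\<close>. Both are obtained from the universal property of the tensor product.
\<close>

definition pm :: "('b list => complex) => _ => _"
 where "pm p = (SOME h. lin V V h \<and>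
  (\<forall>a\<in>carrier Y.N. \<forall>c\<in>carrier D.N. h (tens a c) = tens (Y.cl p \<otimes>\<^bsub>Y.N\<^esub> a) c))"

definition fo :: "'b => _ => _"
 where "fo b = (SOME h. lin V V h \<and>
  (\<forall>a\<in>carrier Y.N. \<forall>c\<in>carrier D.N. h (tens a c) =
   tens (Y.nact (x b) (Y.ndel b a)) c \<oplus>\<^bsub>V\<^esub> tens (Y.nact (x b) a) (D.cl (delta [\<beta> b]) \<otimes>\<^bsub>D.N\<^esub> c)))"

lemma lin_tens:
 assumes "lin Y.N Y.N S" "lin D.N D.N R"
 shows "c \<in> carrier D.N ==> lin Y.N V (%a. tens (S a) (R c))"
  and "a \<in> carrier Y.N ==> lin D.N V (%c. tens (S a) (R c))"
 using lin_comp[OF assms(1) TP.lin_tensor_left] lin_comp[OF assms(2) TP.lin_tensor_right]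
  linD(1)[OF assms(1)] linD(1)[OF assms(2)] by simp_all

lemma lin_id: "lin A A (%a. a)"
 by (simp add: lin_def)

lemma pm:
 assumes "p \<in> carrier Y.T"
 shows "lin V V (pm p)"
  and "a \<in> carrier Y.N ==> c \<in> carrier D.N ==> pm p (tens a c) = tens (Y.cl p \<otimes>\<^bsub>Y.N\<^esub> a) c"
proof -
 have S: "lin Y.N Y.N (%a. Y.cl p \<otimes>\<^bsub>Y.N\<^esub> a)"
  using assms by (intro lin_mult_left) (simp_all del: tensor_algebra_simps)
 have "\<exists>h. lin V V h \<and> (\<forall>a\<in>carrier Y.N. \<forall>c\<in>carrier D.N. h (tens a c) = tens (Y.cl p \<otimes>\<^bsub>Y.N\<^esub> a) c)"
  by (rule TP.tensor_lift[OF TP.vspc_tensor lin_tens[OF S lin_id]])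
 from someI_ex[OF this]
 show "lin V V (pm p)"
  and "a \<in> carrier Y.N ==> c \<in> carrier D.N ==> pm p (tens a c) = tens (Y.cl p \<otimes>\<^bsub>Y.N\<^esub> a) c"
  unfolding pm_def by blast+
qed

lemma fo:
 assumes b: "b \<in> B"
 shows "lin V V (fo b)"
  and "a \<in> carrier Y.N ==> c \<in> carrier D.N ==> fo b (tens a c) =
   tens (Y.nact (x b) (Y.ndel b a)) c \<oplus>\<^bsub>V\<^esub> tens (Y.nact (x b) a) (D.cl (delta [\<beta> b]) \<otimes>\<^bsub>D.N\<^esub> c)"
proof -
 note S2 = Y.nact(1)[OF x_closed[OF b]]
 note S1 = lin_comp[OF Y.ndel(1)[OF b] S2]
 have R: "lin D.N D.N (%c. D.cl (delta [\<beta> b]) \<otimes>\<^bsub>D.N\<^esub> c)"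
  using b by (intro lin_mult_left) (simp_all del: tensor_algebra_simps)
 have "\<exists>h. lin V V h \<and> (\<forall>a\<in>carrier Y.N. \<forall>c\<in>carrier D.N. h (tens a c) =
   tens (Y.nact (x b) (Y.ndel b a)) c \<oplus>\<^bsub>V\<^esub> tens (Y.nact (x b) a) (D.cl (delta [\<beta> b]) \<otimes>\<^bsub>D.N\<^esub> c))"
  by (rule TP.tensor_lift[OF TP.vspc_tensor])
   (intro lin_add TP.vspc_tensor lin_tens(1)[OF S1 lin_id] lin_tens(1)[OF S2 R] lin_tens(2)[OF S1 lin_id] lin_tens(2)[OF S2 R];
    assumption)+
 from someI_ex[OF this]
 show "lin V V (fo b)"
  and "a \<in> carrier Y.N ==> c \<in> carrier D.N ==> fo b (tens a c) =
   tens (Y.nact (x b) (Y.ndel b a)) c \<oplus>\<^bsub>V\<^esub> tens (Y.nact (x b) a) (D.cl (delta [\<beta> b]) \<otimes>\<^bsub>D.N\<^esub> c)"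
  unfolding fo_def by blast+
qed

lemma tens_lin_left:
 "c \<in> carrier D.N ==> tens \<zero>\<^bsub>Y.N\<^esub> c = \<zero>\<^bsub>V\<^esub>"
 "a \<in> carrier Y.N ==> tens a \<zero>\<^bsub>D.N\<^esub> = \<zero>\<^bsub>V\<^esub>"
 using lin_zero[OF TP.lin_tensor_left] lin_zero[OF TP.lin_tensor_right] by simp_all

lemma rep_pm: "rep Y.T V pm"
 unfolding rep_def
proof (intro conjI ballI)
 note [simp del] = tensor_algebra_simps(5) free_space_simps(1)
 have VV: "vspc V" by simp
 show "lin V V (pm p)" if "p \<in> carrier Y.T" for p by (rule pm(1)[OF that])
 have add: "pm (%w. p w + q w) t = pm p t \<oplus>\<^bsub>V\<^esub> pm q t" if "p \<in> carrier Y.T" "q \<in> carrier Y.T" "t \<in> carrier V" for p q t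
 proof (rule TP.lin_eq_on_tensors[OF VV pm(1) lin_add[OF VV pm(1)[OF that(1)] pm(1)[OF that(2)]] _ that(3)])
  show pq: "(%w. p w + q w) \<in> carrier Y.T" using that free_space_closed(1)[of p "lists B" q] by simp
  fix a c assume ac: "a \<in> carrier Y.N" "c \<in> carrier D.N"
  have "Y.cl (%w. p w + q w) = Y.cl p \<oplus>\<^bsub>Y.N\<^esub> Y.cl q"
   using Y.NI.add_quotient[OF that(1,2)] by simp
  then show "pm (%w. p w + q w) (tens a c) = pm p (tens a c) \<oplus>\<^bsub>V\<^esub> pm q (tens a c)"
   using ac that pq by (simp add: pm algebra_distl TP.tensor_add_left del: tensor_algebra_simps)
 qed
 have smult: "pm (%w. k * p w) t = k \<odot>\<^bsub>V\<^esub> pm p t" if "p \<in> carrier Y.T" "t \<in> carrier V" for p k t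
 proof (rule TP.lin_eq_on_tensors[OF VV pm(1) lin_scale[OF VV pm(1)[OF that(1)]] _ that(2)])
  show kp: "(%w. k * p w) \<in> carrier Y.T" using that free_space_closed(3)[of p "lists B" k] by simp
  fix a c assume ac: "a \<in> carrier Y.N" "c \<in> carrier D.N"
  have "Y.cl (%w. k * p w) = k \<odot>\<^bsub>Y.N\<^esub> Y.cl p"
   using Y.NI.smult_quotient[OF that(1)] by simp
  then show "pm (%w. k * p w) (tens a c) = k \<odot>\<^bsub>V\<^esub> pm p (tens a c)"
   using ac that kp by (simp add: pm TP.tensor_smult_left del: tensor_algebra_simps)
 qed
 show "lin Y.T V (%p. pm p t)" if "t \<in> carrier V" for t
  using that add smult linD(1)[OF pm(1)] by (simp add: lin_def)
 show "pm \<one>\<^bsub>Y.T\<^esub> t = t" if "t \<in> carrier V" for t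
 proof (rule TP.lin_eq_on_tensors[OF VV pm(1) lin_id _ that])
  show "\<one>\<^bsub>Y.T\<^esub> \<in> carrier Y.T" using Y.word_closed[of "[]"] by simp
  then show "pm \<one>\<^bsub>Y.T\<^esub> (tens a c) = tens a c" if "a \<in> carrier Y.N" "c \<in> carrier D.N" for a c
   using that complex_algebra_simps(3)[OF Y.complex_algebra_N] by (subst pm) (auto simp: Y.NI.one_quotient)
 qed
 show "pm (p \<otimes>\<^bsub>Y.T\<^esub> q) t = pm p (pm q t)" if "p \<in> carrier Y.T" "q \<in> carrier Y.T" "t \<in> carrier V" for p q t
 proof (rule TP.lin_eq_on_tensors[OF VV pm(1) lin_comp[OF pm(1)[OF that(2)] pm(1)[OF that(1)]] _ that(3)])
  show pq: "p \<otimes>\<^bsub>Y.T\<^esub> q \<in> carrier Y.T" using that by (intro tensor_mult_closed)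
  fix a c assume ac: "a \<in> carrier Y.N" "c \<in> carrier D.N"
  then show "pm (p \<otimes>\<^bsub>Y.T\<^esub> q) (tens a c) = pm p (pm q (tens a c))"
   using that pq by (simp add: pm Y.cl_mult[symmetric] algebra_assoc del: tensor_algebra_simps)
 qed
qed

text \<open>
 The cross relation of the braided Weyl algebra: the first two terms come from the twisted Leibniz rule
 \<open>ndel_mult_letter\<close>, and the group element in its last term is cancelled by the action of \<open>x
 b\<close>.
\<close>

lemma fo_pm_letter:
 assumes b: "b \<in> B" and v: "v \<in> B" and t: "t \<in> carrier V"
 shows "fo b (pm (delta [v]) t) = pm (Y.letter_act (x b) v) (fo b t) \<oplus>\<^bsub>V\<^esub> (if b = v then t else \<zero>\<^bsub>V\<^esub>)"
proof -
 note [simp del] = tensor_opaque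
 have VV: "vspc V" by simp
 note l = Y.letter_act_closed[OF x_closed[OF b] v]
 note dv = Y.letter_closed[OF v]
 have lz: "lin V V (%t. if b = v then t else \<zero>\<^bsub>V\<^esub>)"
  using VV by (auto simp: lin_def)
 show ?thesis
 proof (rule TP.lin_eq_on_tensors[OF VV lin_comp[OF pm(1)[OF dv] fo(1)[OF b]] lin_add[OF VV lin_comp[OF fo(1)[OF b] pm(1)[OF l]] lz] _ t])
  fix a c assume a: "a \<in> carrier Y.N" and c: "c \<in> carrier D.N"
  let ?n = "Y.nact (x b)" and ?f = "D.cl (delta [\<beta> b]) \<otimes>\<^bsub>D.N\<^esub> c"
  note nl = linD[OF Y.nact(1)[OF x_closed[OF b]]]
  note da = linD(1)[OF Y.ndel(1)[OF b] a]
  have f: "?f \<in> carrier D.N" using b c by (simp add: D.letter_closed)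
  have cv: "Y.cl (delta [v]) \<in> carrier Y.N" and cll: "Y.cl (Y.letter_act (x b) v) \<in> carrier Y.N"
   using dv l by simp_all
  have z: "?n \<zero>\<^bsub>Y.N\<^esub> = \<zero>\<^bsub>Y.N\<^esub>"
   using lin_zero[OF Y.nact(1)[OF x_closed[OF b]]] by simp
  have e: "?n (if b = v then Y.nact (deg v) a else \<zero>\<^bsub>Y.N\<^esub>) = (if b = v then a else \<zero>\<^bsub>Y.N\<^esub>)"
   using Y.nact_inverse[OF Y.deg_closed[OF v] a] z by auto
  have ec: "(if b = v then Y.nact (deg v) a else \<zero>\<^bsub>Y.N\<^esub>) \<in> carrier Y.N"
   using linD(1)[OF Y.nact(1)[OF Y.deg_closed[OF v]] a] by simp
  have "?n (Y.ndel b (Y.cl (delta [v]) \<otimes>\<^bsub>Y.N\<^esub> a)) =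
    (Y.cl (Y.letter_act (x b) v) \<otimes>\<^bsub>Y.N\<^esub> ?n (Y.ndel b a)) \<oplus>\<^bsub>Y.N\<^esub> (if b = v then a else \<zero>\<^bsub>Y.N\<^esub>)"
   using a b v da ec cv by (simp only: Y.ndel_mult_letter nl(2) complex_algebra_simps(2) Y.complex_algebra_N
     Y.nact_mult_letter x_closed e)
  moreover have "?n (Y.cl (delta [v]) \<otimes>\<^bsub>Y.N\<^esub> a) = Y.cl (Y.letter_act (x b) v) \<otimes>\<^bsub>Y.N\<^esub> ?n a"
   using a b v by (simp only: Y.nact_mult_letter x_closed)
  moreover have "tens (if b = v then a else \<zero>\<^bsub>Y.N\<^esub>) c = (if b = v then tens a c else \<zero>\<^bsub>V\<^esub>)"
   using c tens_lin_left(1) by simp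
  ultimately have "fo b (pm (delta [v]) (tens a c)) =
    tens (Y.cl (Y.letter_act (x b) v) \<otimes>\<^bsub>Y.N\<^esub> ?n (Y.ndel b a)) c \<oplus>\<^bsub>V\<^esub> (if b = v then tens a c else \<zero>\<^bsub>V\<^esub>)
    \<oplus>\<^bsub>V\<^esub> tens (Y.cl (Y.letter_act (x b) v) \<otimes>\<^bsub>Y.N\<^esub> ?n a) ?f"
   using a b c da dv cv cll nl(1) by (simp add: pm fo TP.tensor_add_left)
  moreover have "pm (Y.letter_act (x b) v) (fo b (tens a c)) =
    tens (Y.cl (Y.letter_act (x b) v) \<otimes>\<^bsub>Y.N\<^esub> ?n (Y.ndel b a)) c \<oplus>\<^bsub>V\<^esub>
    tens (Y.cl (Y.letter_act (x b) v) \<otimes>\<^bsub>Y.N\<^esub> ?n a) ?f"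
   using a b c da f l nl(1) by (simp add: pm fo linD(2)[OF pm(1)[OF l]])
  ultimately show "fo b (pm (delta [v]) (tens a c)) =
    pm (Y.letter_act (x b) v) (fo b (tens a c)) \<oplus>\<^bsub>V\<^esub> (if b = v then tens a c else \<zero>\<^bsub>V\<^esub>)"
   using a c f cll da nl(1) by (auto simp: vspc_assoc vspc_comm vspc_left_comm)
 qed
qed

lemma fo_pm:
 assumes b: "b \<in> B" and p: "p \<in> carrier E1" and t: "t \<in> carrier V"
 shows "fo b (pm p t) = pm (Y.tact (x b) p) (fo b t) \<oplus>\<^bsub>V\<^esub> p [b] \<odot>\<^bsub>V\<^esub> t"
proof (rule lin_eq_on_free[OF _ _ TP.vspc_tensor _ p])
 note ft = linD(1)[OF fo(1)[OF b] t]
 have sub: "(%c. [c]) ` B \<subseteq> lists B" by auto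
 have 1: "lin E1 V (%p. pm p t')" if "t' \<in> carrier V" for t'
  using lin_subspace[OF sub] repD(2)[OF rep_pm that] by simp
 show "lin E1 V (%p. fo b (pm p t))"
  by (rule lin_comp[OF 1[OF t] fo(1)[OF b]])
 have "lin Y.T V (%p. pm (Y.tact (x b) p) (fo b t))"
  by (rule lin_comp[OF alg_homD(1)[OF Y.alg_hom_tact[OF x_closed[OF b]]] repD(2)[OF rep_pm ft]])
 then have "lin E1 V (%p. pm (Y.tact (x b) p) (fo b t))"
  using lin_subspace[OF sub] by simp
 then show "lin E1 V (%p. pm (Y.tact (x b) p) (fo b t) \<oplus>\<^bsub>V\<^esub> p [b] \<odot>\<^bsub>V\<^esub> t)"
  by (rule lin_add[OF TP.vspc_tensor _ lin_scalar[OF TP.vspc_tensor t]])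
 fix w assume "w \<in> (%c. [c]) ` B"
 then obtain v where v: "w = [v]" "v \<in> B" by blast
 show "fo b (pm (delta w) t) = pm (Y.tact (x b) (delta w)) (fo b t) \<oplus>\<^bsub>V\<^esub> delta w [b] \<odot>\<^bsub>V\<^esub> t"
  using fo_pm_letter[OF b v(2) t] t TP.vspc_tensor unfolding v(1) Y.tact_letter[OF x_closed[OF b] v(2)]
  by (auto simp: delta_def)
qed

text \<open>The action of tensors over the dual that extends the operators \<open>fo\<close>.\<close>

definition phi :: "('c list => complex) => _ => _"
 where "phi q t = lin_ext V (%w. foldr (%c. fo (unbeta c)) w t) q"

lemma rep_phi: "rep D.T V phi"
 and phi_letter: "b \<in> B ==> t \<in> carrier V ==> phi (delta [\<beta> b]) t = fo b t"
proof -
 have f: "lin V V (fo (unbeta c))" if "c \<in> B'" for c using fo(1) that by simp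
 have "phi = (%q t. lin_ext V (%w. foldr (%c. fo (unbeta c)) w t) q)"
  by (simp add: phi_def fun_eq_iff)
 then show "rep D.T V phi"
  and "b \<in> B ==> t \<in> carrier V ==> phi (delta [\<beta> b]) t = fo b t"
  using rep_of_letters[where B = B' and f = "%c. fo (unbeta c)" and M = V, OF TP.vspc_tensor f] by simp_all
qed

lemma phi_closed [simp]: "q \<in> carrier D.T ==> t \<in> carrier V ==> phi q t \<in> carrier V"
 using linD(1)[OF repD(1)[OF rep_phi]] .

lemma phi_Cons:
 assumes "c \<in> B'" "w \<in> lists B'" "t \<in> carrier V"
 shows "phi (delta (c # w)) t = fo (unbeta c) (phi (delta w) t)"
proof -
 note [simp del] = tensor_opaque
 have "phi (delta (c # w)) t = phi (delta [c]) (phi (delta w) t)"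
  using repD(4)[OF rep_phi D.letter_closed[OF assms(1)] D.word_closed[OF assms(2)] assms(3)]
  by (simp add: delta_mult)
 moreover have "phi (delta [\<beta> (unbeta c)]) (phi (delta w) t) = fo (unbeta c) (phi (delta w) t)"
  using assms by (intro phi_letter) simp_all
 ultimately show ?thesis using assms(1) by simp
qed

lemma phi_unit:
 assumes q: "q \<in> carrier D.T" and c: "c \<in> carrier D.N"
 shows "phi q (right_in c) = right_in (D.cl q \<otimes>\<^bsub>D.N\<^esub> c)"
proof (rule lin_eq_on_free[OF _ _ TP.vspc_tensor _ q[unfolded tensor_algebra_simps(1)]])
 note [simp del] = tensor_opaque
 have t: "right_in c \<in> carrier V" using c by simp
 show "lin (free_space (lists B')) V (%q. phi q (right_in c))"
  using repD(2)[OF rep_phi t] by simp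
 show "lin (free_space (lists B')) V (%q. right_in (D.cl q \<otimes>\<^bsub>D.N\<^esub> c))"
  using lin_comp[OF lin_comp[OF D.NI.lin_coset lin_mult_right[OF D.complex_algebra_N c]] TP.lin_tensor_right[of "\<one>\<^bsub>Y.N\<^esub>"]]
  by simp
 fix w assume "w \<in> lists B'"
 then show "phi (delta w) (right_in c) = right_in (D.cl (delta w) \<otimes>\<^bsub>D.N\<^esub> c)"
 proof (induction w)
  case Nil
  then show ?case using repD(3)[OF rep_phi t] c by (simp add: D.cl_one[symmetric])
 next
  case (Cons f w)
  let ?b = "unbeta f"
  have b: "?b \<in> B" using Cons by simp
  have cw: "D.cl (delta w) \<otimes>\<^bsub>D.N\<^esub> c \<in> carrier D.N" using Cons c by (simp add: D.word_closed)
  have "Y.nact (x ?b) \<zero>\<^bsub>Y.N\<^esub> = \<zero>\<^bsub>Y.N\<^esub>"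
   using lin_zero[OF Y.nact(1)[OF x_closed[OF b]]] by simp
  then have "fo ?b (right_in (D.cl (delta w) \<otimes>\<^bsub>D.N\<^esub> c)) =
    right_in (D.cl (delta [f]) \<otimes>\<^bsub>D.N\<^esub> (D.cl (delta w) \<otimes>\<^bsub>D.N\<^esub> c))"
   using b cw Cons by (simp add: fo Y.ndel_one Y.nact_one tens_lin_left D.letter_closed)
  also have "\<dots> = right_in (D.cl (delta [f] \<otimes>\<^bsub>D.T\<^esub> delta w) \<otimes>\<^bsub>D.N\<^esub> c)"
   using Cons c by (simp add: D.cl_mult[symmetric] algebra_assoc D.letter_closed D.word_closed)
  finally show ?case
   using Cons t by (simp add: phi_Cons delta_mult)
 qed
qed

subsection \<open>The dual Nichols ideal acts by zero\<close>

text \<open>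
 The correction term when a word \<open>z\<close> over the dual is moved to the right across \<open>v\<close>:
 each letter \<open>f\<close> of \<open>z\<close> in turn is paired with the image of \<open>v\<close> under
 the letters to its right, and is deleted.
\<close>

fun dv :: "'b => 'c list => 'c list => complex" where
 "dv v [] = (%_. 0)"
| "dv v (f # z) = (%w. r (D.Deg z) (unbeta f) v * delta z w + (delta [f] \<otimes>\<^bsub>D.T\<^esub> dv v z) w)"

lemma dv_closed: "z \<in> lists B' ==> dv v z \<in> carrier D.T"
proof (induction z)
 case Nil
 then show ?case by simp
next
 case (Cons f z)
 then have 1: "(%w. r (D.Deg z) (unbeta f) v * delta z w) \<in> carrier (free_space (lists B'))"
  using D.word_closed[of z] by (intro free_space_closed) (simp del: free_space_simps)
 have "delta [f] \<otimes>\<^bsub>D.T\<^esub> dv v z \<in> carrier D.T"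
  using Cons by (intro tensor_mult_closed D.letter_closed) auto
 then show ?case
  using free_space_closed(1)[OF 1, of "delta [f] \<otimes>\<^bsub>D.T\<^esub> dv v z"] by (simp only: dv.simps tensor_algebra_simps(1))
qed

lemma phi_pm_word:
 assumes v: "v \<in> B" and t: "t \<in> carrier V"
 shows "z \<in> lists B' ==> phi (delta z) (pm (delta [v]) t) =
  pm (Y.letter_act (D.Deg z) v) (phi (delta z) t) \<oplus>\<^bsub>V\<^esub> phi (dv v z) t"
proof (induction z)
 note [simp del] = tensor_opaque
 have pt: "pm (delta [v]) t \<in> carrier V" using linD(1)[OF pm(1)[OF Y.letter_closed[OF v]] t] .
 {
  case Nil
  have "phi (%_. 0) t = \<zero>\<^bsub>V\<^esub>" by (simp add: phi_def)
  then show ?case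
   using v t pt repD(3)[OF rep_phi] by (simp add: Y.letter_act_one)
 next
  case (Cons f z)
  then have f: "f \<in> B'" and z: "z \<in> lists B'" and ub: "unbeta f \<in> B" by auto
  let ?b = "unbeta f" and ?X = "D.Deg z"
  have X: "?X \<in> carrier G" using z by simp
  note pz = phi_closed[OF D.word_closed[OF z] t] and pd = phi_closed[OF dv_closed[OF z] t]
  note l = Y.letter_act_closed[OF X v]
  have degf: "deg' f = x ?b" using deg_dual[OF ub] f by simp
  have m: "delta [f] \<otimes>\<^bsub>D.T\<^esub> dv v z \<in> carrier D.T"
   using f dv_closed[OF z] by (intro tensor_mult_closed D.letter_closed)
  have dz: "(%w. k * delta z w) \<in> carrier D.T" for k
   using free_space_closed(3)[of "delta z" "lists B'" k] D.word_closed[OF z] by (simp add: tensor_algebra_simps)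
  have phidv: "phi (dv v (f # z)) t = r ?X ?b v \<odot>\<^bsub>V\<^esub> phi (delta z) t \<oplus>\<^bsub>V\<^esub> fo ?b (phi (dv v z) t)"
  proof -
   note L = linD[OF repD(2)[OF rep_phi t]]
   have "phi (dv v (f # z)) t = phi (%w. r ?X ?b v * delta z w) t \<oplus>\<^bsub>V\<^esub> phi (delta [f] \<otimes>\<^bsub>D.T\<^esub> dv v z) t"
    using L(2)[OF dz m] by (simp only: dv.simps tensor_algebra_simps(3))
   also have "phi (%w. r ?X ?b v * delta z w) t = r ?X ?b v \<odot>\<^bsub>V\<^esub> phi (delta z) t"
    using L(3)[OF D.word_closed[OF z]] by (simp only: tensor_algebra_simps(4))
   also have "phi (delta [f] \<otimes>\<^bsub>D.T\<^esub> dv v z) t = fo ?b (phi (dv v z) t)"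
    using repD(4)[OF rep_phi D.letter_closed[OF f] dv_closed[OF z] t] phi_letter[OF ub pd] f by simp
   finally show ?thesis .
  qed
  have "phi (delta (f # z)) (pm (delta [v]) t) =
    fo ?b (pm (Y.letter_act ?X v) (phi (delta z) t) \<oplus>\<^bsub>V\<^esub> phi (dv v z) t)"
   using Cons.IH z f pt by (simp add: phi_Cons)
  also have "\<dots> = fo ?b (pm (Y.letter_act ?X v) (phi (delta z) t)) \<oplus>\<^bsub>V\<^esub> fo ?b (phi (dv v z) t)"
   using linD(2)[OF fo(1)[OF ub] linD(1)[OF pm(1)[OF l] pz] pd] .
  also have "fo ?b (pm (Y.letter_act ?X v) (phi (delta z) t)) =
    pm (Y.letter_act (D.Deg (f # z)) v) (phi (delta (f # z)) t) \<oplus>\<^bsub>V\<^esub> r ?X ?b v \<odot>\<^bsub>V\<^esub> phi (delta z) t"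
  proof -
   have "Y.letter_act ?X v [?b] = r ?X ?b v" by (simp add: Y.letter_act_def)
   then show ?thesis
    using fo_pm[OF ub Y.letter_act_free[OF X v] pz] Y.tact_letter_act[OF x_closed[OF ub] X v] degf f z t
    by (simp add: phi_Cons)
  qed
  finally show ?case
   unfolding phidv
  proof -
   have fz: "f # z \<in> lists B'" using f z by simp
   have 1: "pm (Y.letter_act (D.Deg (f # z)) v) (phi (delta (f # z)) t) \<in> carrier V"
    by (rule linD(1)[OF pm(1)[OF Y.letter_act_closed[OF D.Deg_closed[OF fz] v]] phi_closed[OF D.word_closed[OF fz] t]])
   have 2: "r ?X ?b v \<odot>\<^bsub>V\<^esub> phi (delta z) t \<in> carrier V" using pz by simp
   show "phi (delta (f # z)) (pm (delta [v]) t) = pm (Y.letter_act (D.Deg (f # z)) v) (phi (delta (f # z)) t) \<oplus>\<^bsub>V\<^esub>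
     (r ?X ?b v \<odot>\<^bsub>V\<^esub> phi (delta z) t \<oplus>\<^bsub>V\<^esub> fo ?b (phi (dv v z) t))"
    if "phi (delta (f # z)) (pm (delta [v]) t) = pm (Y.letter_act (D.Deg (f # z)) v) (phi (delta (f # z)) t) \<oplus>\<^bsub>V\<^esub>
     r ?X ?b v \<odot>\<^bsub>V\<^esub> phi (delta z) t \<oplus>\<^bsub>V\<^esub> fo ?b (phi (dv v z) t)"
    unfolding that by (rule vspc_assoc[OF TP.vspc_tensor 1 2 linD(1)[OF fo(1)[OF ub] pd]])
  qed
 }
qed

text \<open>
 Up to the action on \<open>v\<close>, the correction term is deletion of the first letter on symmetrized
 tensors. This is why it preserves the Nichols ideal.
\<close>

lemma Sym_dv:
 assumes v: "v \<in> B"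
 shows "z \<in> lists B' ==> D.Sym (dv v z) u = (\<Sum>e\<in>B. r (D.Deg z \<otimes> deg v) e v * D.sym z (\<beta> e # u))"
proof (induction z arbitrary: u)
 case Nil
 have "D.Sym (dv v []) u = 0" by simp
 also have "0 = (\<Sum>e\<in>B. r (D.Deg [] \<otimes> deg v) e v * D.sym [] (\<beta> e # u))"
  by (simp add: delta_def)
 finally show ?case .
next
 case (Cons f z)
 note [simp del] = tensor_opaque
 have f: "f \<in> B'" and z: "z \<in> lists B'" and b: "unbeta f \<in> B" using Cons(1,2) by auto
 let ?b = "unbeta f" and ?X = "D.Deg z"
 have X: "?X \<in> carrier G" and h: "deg v \<in> carrier G" and xf: "deg' f = x ?b" "x ?b \<in> carrier G"
  using z v f b deg_dual[OF b] by simp_all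
 have D1: "D.Lop (delta [f]) s = D.create f s" for s by (simp add: fun_eq_iff)
 have "D.Sym (dv v (f # z)) u = r ?X ?b v * D.sym z u + D.create f (D.Sym (dv v z)) u"
 proof -
  have 1: "(%w. r ?X ?b v * delta z w) \<in> carrier D.T"
   using free_space_closed(3)[of "delta z" "lists B'" "r ?X ?b v"] D.word_closed[OF z] by (simp add: tensor_algebra_simps)
  have 2: "delta [f] \<otimes>\<^bsub>D.T\<^esub> dv v z \<in> carrier D.T"
   using f dv_closed[OF z] by (intro tensor_mult_closed D.letter_closed)
  show ?thesis
   using D.Sym_add[OF 1 2] D.Sym_scale[of "r ?X ?b v" "delta z"] D.Sym_mult[OF D.letter_closed[OF f] dv_closed[OF z]]
   by (simp add: D1)
 qed
 also have "D.create f (D.Sym (dv v z)) u = (\<Sum>e\<in>B. r (?X \<otimes> deg v) e v * D.create f (%u. D.sym z (\<beta> e # u)) u)"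
 proof -
  have "D.Sym (dv v z) = (%u. \<Sum>e\<in>B. r (?X \<otimes> deg v) e v * D.sym z (\<beta> e # u))"
   using Cons by (simp add: fun_eq_iff)
  then show ?thesis by (simp add: D.create_sum)
 qed
 also have "r ?X ?b v * D.sym z u = r (D.Deg (f # z) \<otimes> deg v) ?b v * D.sym z u"
 proof -
  let ?A = "?X \<otimes> deg v \<otimes> inv ?X"
  let ?Z = "x ?b \<otimes> ?X \<otimes> deg v"
  have Z: "?Z \<in> carrier G" and A: "?A \<in> carrier G" using X h xf by simp_all
  have "r ?X ?b v = r ?Z ?b v"
  proof (cases "deg ?b = ?A")
   case True
   have "x ?b \<otimes> ?A \<otimes> ?X = ?X" using True X h b by simp
   then have "?Z = ?X" using X h xf(2) by (simp add: Y.G.m_assoc)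
   then show ?thesis by simp
  next
   case False
   have "r ?X ?b v = 0" using Y.r_deg[OF X b v] False by blast
   moreover have "r ?Z ?b v = 0"
   proof (rule ccontr)
    assume "r ?Z ?b v ~= 0"
    then have "deg ?b = ?Z \<otimes> deg v \<otimes> inv ?Z" using Y.r_deg[OF Z b v] by blast
    also have "\<dots> = x ?b \<otimes> ?A \<otimes> deg ?b"
     using X h b by (simp add: Y.G.m_assoc Y.G.inv_mult_group) (simp add: Y.G.m_assoc[symmetric])
    finally have "x ?b \<otimes> ?A = \<one>"
     using A b xf(2) by (metis Y.G.m_closed Y.G.r_cancel_one Y.deg_closed)
    then have "?A = deg ?b" using A b by (metis Y.G.inv_equality Y.G.inv_inv Y.G.inv_closed Y.G.inv_solve_left Y.G.one_closed Y.G.r_one Y.deg_closed)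
    then show False using False by simp
   qed
   ultimately show ?thesis by simp
  qed
  then show ?thesis using xf by (simp add: Y.G.m_assoc X h)
 qed
 also have "r (D.Deg (f # z) \<otimes> deg v) ?b v * D.sym z u +
   (\<Sum>e\<in>B. r (?X \<otimes> deg v) e v * D.create f (%u. D.sym z (\<beta> e # u)) u) =
   (\<Sum>e\<in>B. r (D.Deg (f # z) \<otimes> deg v) e v * D.sym (f # z) (\<beta> e # u))"
 proof -
  let ?K = "%d. D.create f (%u. D.sym z (\<beta> d # u)) u"
  let ?Z = "D.Deg (f # z) \<otimes> deg v"
  have Z: "?Z \<in> carrier G" using f z h by simp
  have "D.sym (f # z) (\<beta> e # u) = (if e = ?b then D.sym z u else 0) + (\<Sum>d\<in>B. r (deg ?b) d e * ?K d)" if e: "e \<in> B" for e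
  proof -
   have "(\<Sum>d\<in>B'. r' (deg' f) (\<beta> e) d * D.create f (%w. D.sym z (d # w)) u) =
     (\<Sum>d\<in>B. r' (deg' f) (\<beta> e) (\<beta> d) * ?K d)"
    by (rule sum.reindex_bij_betw[OF bij, symmetric])
   also have "\<dots> = (\<Sum>d\<in>B. r (deg ?b) d e * ?K d)"
    using e xf b by (intro sum.cong) (auto simp: r_dual)
   finally show ?thesis using e f b by (auto simp: unbeta_beta)
  qed
  then have "(\<Sum>e\<in>B. r ?Z e v * D.sym (f # z) (\<beta> e # u)) =
    (\<Sum>e\<in>B. r ?Z e v * (if e = ?b then D.sym z u else 0)) + (\<Sum>e\<in>B. \<Sum>d\<in>B. r ?Z e v * (r (deg ?b) d e * ?K d))"
   by (simp add: distrib_left sum.distrib sum_distrib_left)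
  also have "(\<Sum>e\<in>B. r ?Z e v * (if e = ?b then D.sym z u else 0)) = r ?Z ?b v * D.sym z u"
   using b by (simp add: if_distrib[of "%k. _ * k"] sum.delta cong: if_cong)
  also have "(\<Sum>e\<in>B. \<Sum>d\<in>B. r ?Z e v * (r (deg ?b) d e * ?K d)) = (\<Sum>d\<in>B. r (deg ?b \<otimes> ?Z) d v * ?K d)"
   using b Z v by (subst sum.swap) (simp add: Y.r_mult sum_distrib_right mult.assoc mult.left_commute)
  also have "deg ?b \<otimes> ?Z = ?X \<otimes> deg v"
   using xf X h b by (simp add: Y.G.m_assoc[symmetric])
  finally show ?thesis by simp
 qed
 finally show ?case .
qed

text \<open>
 The linear extension of \<open>dv\<close>; it corrects the commutation of \<open>v\<close> with tensors that
 are homogeneous for \<open>G\<close>.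
\<close>

definition dvx :: "'b => ('c list => complex) => 'c list => complex"
 where "dvx v = lin_ext D.T (dv v)"

lemma dvx_word: "z \<in> lists B' ==> dvx v (delta z) = dv v z"
 unfolding dvx_def by (intro lin_ext_delta vspc_tensor_algebra dv_closed)

lemma lin_dvx: "lin (free_space (lists B')) D.T (dvx v)"
 unfolding dvx_def using dv_closed by (intro lin_lin_ext) simp_all

abbreviation "homog y \<equiv> free_space {w \<in> lists B'. D.Deg w = y}"

lemma homog_T: "q \<in> carrier (homog y) ==> q \<in> carrier D.T"
 by auto

lemma phi_pm_homogeneous:
 assumes y: "y \<in> carrier G" and v: "v \<in> B" and q: "q \<in> carrier (homog y)" and t: "t \<in> carrier V"
 shows "phi q (pm (delta [v]) t) = pm (Y.letter_act y v) (phi q t) \<oplus>\<^bsub>V\<^esub> phi (dvx v q) t"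
proof (rule lin_eq_on_free[OF _ _ TP.vspc_tensor _ q])
 have sub: "{w \<in> lists B'. D.Deg w = y} \<subseteq> lists B'" by auto
 have pt: "pm (delta [v]) t \<in> carrier V" using linD(1)[OF pm(1)[OF Y.letter_closed[OF v]] t] .
 have P: "lin (homog y) V (%q. phi q s)" if "s \<in> carrier V" for s
  using lin_subspace[OF sub] repD(2)[OF rep_phi that] by simp
 show "lin (homog y) V (%q. phi q (pm (delta [v]) t))" by (rule P[OF pt])
 show "lin (homog y) V (%q. pm (Y.letter_act y v) (phi q t) \<oplus>\<^bsub>V\<^esub> phi (dvx v q) t)"
  by (intro lin_add TP.vspc_tensor lin_comp[OF P[OF t] pm(1)[OF Y.letter_act_closed[OF y v]]]
    lin_comp[OF lin_subspace[OF sub lin_dvx] repD(2)[OF rep_phi t]])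
 fix z assume z: "z \<in> {w \<in> lists B'. D.Deg w = y}"
 then have "dvx v (delta z) = dv v z" by (intro dvx_word) simp
 then show "phi (delta z) (pm (delta [v]) t) = pm (Y.letter_act y v) (phi (delta z) t) \<oplus>\<^bsub>V\<^esub> phi (dvx v (delta z)) t"
  using phi_pm_word[OF v t, of z] z by simp
qed

lemma dvx_kern:
 assumes y: "y \<in> carrier G" and v: "v \<in> B" and q: "q \<in> carrier (homog y)" and "q \<in> D.kern"
 shows "dvx v q \<in> D.kern"
proof -
 note T = linD[OF lin_dvx]
 have c: "dvx v q \<in> carrier D.T" if "q \<in> carrier (homog y)" for q
  using T(1)[of q] homog_T[OF that] by (simp del: free_space_simps)
 have "\<forall>u. D.Sym (dvx v q) u = (\<Sum>e\<in>B. r (y \<otimes> deg v) e v * D.Sym q (\<beta> e # u))"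
  using q
 proof (induction q rule: free_space_induct)
  case zero
  have "dvx v (%_. 0) = (%_. 0)" by (simp add: dvx_def)
  then show ?case by simp
 next
  case (add p q)
  have "dvx v (%w. p w + q w) = (%w. dvx v p w + dvx v q w)"
   using T(2)[of p q] homog_T[OF add(1)] homog_T[OF add(2)] by (simp del: free_space_simps(1))
  then show ?case
   using D.Sym_add[OF c[OF add(1)] c[OF add(2)]] D.Sym_add[OF homog_T[OF add(1)] homog_T[OF add(2)]] add
   by (simp add: distrib_left sum.distrib)
 next
  case (smult k p)
  have "dvx v (%w. k * p w) = (%w. k * dvx v p w)"
   using T(3)[where x = p and c = k] homog_T[OF smult(1)] by (simp del: free_space_simps(1))
  then show ?case using smult by (simp add: D.Sym_scale sum_distrib_left mult.left_commute)
 next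
  case (delta z)
  then have "dvx v (delta z) = dv v z" by (intro dvx_word) simp
  then show ?case using Sym_dv[OF v, of z] delta by simp
 qed
 then show ?thesis
  using assms c[OF q] by (simp add: D.kern_def fun_eq_iff)
qed

text \<open>
 Moving \<open>q\<close> to the right across a letter \<open>v\<close> changes it into \<open>dvx v q\<close>,
 which also lies in the Nichols ideal. So \<open>q\<close> can be moved past all of the first tensor factor,
 and on \<open>1 \<otimes> c\<close> it acts by left multiplication, which is zero. By
 \<open>kern_induct\<close> it suffices to do this for homogeneous \<open>q\<close>.
\<close>

lemma phi_kern:
 assumes "q \<in> D.kern" and t: "t \<in> carrier V"
 shows "phi q t = \<zero>\<^bsub>V\<^esub>"
proof -
 note [simp del] = tensor_opaque
 have kT: "q \<in> carrier D.T" if "q \<in> D.kern" for q using that unfolding D.kern_def by blast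
 have word: "\<forall>q\<in>D.kern. phi q (tens (Y.cl (delta w)) c) = \<zero>\<^bsub>V\<^esub>" if "w \<in> lists B" "c \<in> carrier D.N" for w c
  using that(1)
 proof (induction w)
  case Nil
  show ?case
  proof
   fix q assume q: "q \<in> D.kern"
   then have "D.cl q = \<zero>\<^bsub>D.N\<^esub>" using D.NI.coset_zero_iff[OF kT[OF q]] by simp
   then show "phi q (tens (Y.cl (delta [])) c) = \<zero>\<^bsub>V\<^esub>"
    using phi_unit[OF kT[OF q] that(2)] that(2) by (simp add: Y.cl_one tens_lin_left Y.word_closed)
  qed
 next
  case (Cons v w)
  then have v: "v \<in> B" and w: "w \<in> lists B" by auto
  let ?t = "tens (Y.cl (delta w)) c"
  have t: "?t \<in> carrier V" using w that(2) by (simp add: Y.word_closed)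
  have e: "tens (Y.cl (delta (v # w))) c = pm (delta [v]) ?t"
   using v w that(2) Y.cl_mult[OF Y.letter_closed[OF v] Y.word_closed[OF w]]
   by (simp add: pm Y.letter_closed Y.word_closed delta_mult)
  show ?case
  proof
   fix q assume "q \<in> D.kern"
   then show "phi q (tens (Y.cl (delta (v # w))) c) = \<zero>\<^bsub>V\<^esub>"
    unfolding e
   proof (induction q rule: D.kern_induct)
    case (add p q)
    have "pm (delta [v]) ?t \<in> carrier V" using linD(1)[OF pm(1)[OF Y.letter_closed[OF v]] t] .
    then show ?case
     using linD(2)[OF repD(2)[OF rep_phi] kT[OF add(1)] kT[OF add(2)]] add by simp
   next
    case (homogeneous y q)
    have "phi q ?t = \<zero>\<^bsub>V\<^esub>" "phi (dvx v q) ?t = \<zero>\<^bsub>V\<^esub>"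
     using Cons homogeneous(2) dvx_kern[OF homogeneous(1) v homogeneous(3,2)] by auto
    then show ?case
     using phi_pm_homogeneous[OF homogeneous(1) v homogeneous(3) t]
      lin_zero[OF pm(1)[OF Y.letter_act_closed[OF homogeneous(1) v]]] by simp
   qed
  qed
 qed
 note qT = kT[OF assms(1)]
 have lz: "lin A V (%_. \<zero>\<^bsub>V\<^esub>)" for A :: "(complex, 'z) module" by (simp add: lin_def)
 show ?thesis
 proof (rule TP.lin_eq_on_tensors[OF TP.vspc_tensor repD(1)[OF rep_phi qT] lz _ t])
  fix a c assume "a \<in> carrier Y.N" and c: "c \<in> carrier D.N"
  then obtain p where p: "p \<in> carrier Y.T" "a = Y.cl p" using Y.N_cases by blast
  show "phi q (tens a c) = \<zero>\<^bsub>V\<^esub>"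
   unfolding p(2)
  proof (rule lin_eq_on_free[OF _ lz TP.vspc_tensor _ p(1)[simplified tensor_algebra_simps]])
   show "lin (free_space (lists B)) V (%p. phi q (tens (Y.cl p) c))"
    using lin_comp[OF lin_comp[OF Y.NI.lin_coset TP.lin_tensor_left[OF c]] repD(1)[OF rep_phi qT]] by simp
   show "phi q (tens (Y.cl (delta w)) c) = \<zero>\<^bsub>V\<^esub>" if "w \<in> lists B" for w
    using word[OF that c] assms(1) by blast
  qed
 qed
qed

end

text \<open>A representation that kills an ideal factors through the quotient.\<close>

lemma rep_quotient:
 assumes "algebra_ideal A I" "vspc M" "rep A M h" "!!p n. p \<in> I ==> n \<in> carrier M ==> h p n = \<zero>\<^bsub>M\<^esub>"
 shows "\<exists>k. \<forall>n\<in>carrier M. lin (quotient A I) M (k n) \<and> (\<forall>p\<in>carrier A. k n (I +>\<^bsub>A\<^esub> p) = h p n)"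
proof -
 interpret algebra_ideal A I by (rule assms(1))
 have "\<exists>k. lin (quotient A I) M k \<and> (\<forall>p\<in>carrier A. k (I +>\<^bsub>A\<^esub> p) = h p n)" if "n \<in> carrier M" for n
  using descend[OF assms(2) repD(2)[OF assms(3) that]] assms(4) that by blast
 then show ?thesis by metis
qed

context yd_pair
begin

abbreviation "one_V \<equiv> tens \<one>\<^bsub>Y.N\<^esub> \<one>\<^bsub>D.N\<^esub>"

lemma one_V [simp]: "one_V \<in> carrier V"
 by simp

lemma tens_word: "p \<in> carrier Y.T ==> c \<in> carrier D.N ==> tens (Y.cl p) c = pm p (right_in c)"
 using complex_algebra_simps(1,4)[OF Y.complex_algebra_N] by (simp add: pm del: tensor_algebra_simps)

lemma tens_right: "q \<in> carrier D.T ==> right_in (D.cl q) = phi q one_V"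
 using complex_algebra_simps(4)[OF D.complex_algebra_N D.cl_closed] by (simp add: phi_unit del: tensor_algebra_simps)

lemma pm_Cons:
 assumes "v \<in> B" "w \<in> lists B" "t \<in> carrier V"
 shows "pm (delta (v # w)) t = pm (delta [v]) (pm (delta w) t)"
 using repD(4)[OF rep_pm Y.letter_closed[OF assms(1)] Y.word_closed[OF assms(2)] assms(3)]
 by (simp only: delta_mult append_Cons append_Nil)

text \<open>The space \<open>V\<close> is generated from \<open>1 \<otimes> 1\<close> by the operators of left multiplication by the letters.\<close>

lemma V_induct [consumes 1, case_names one add smult left right]:
 assumes "t \<in> carrier V" and one: "P one_V"
  and add: "!!s t. s \<in> carrier V ==> t \<in> carrier V ==> P s ==> P t ==> P (s \<oplus>\<^bsub>V\<^esub> t)"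
  and smult: "!!c t. t \<in> carrier V ==> P t ==> P (c \<odot>\<^bsub>V\<^esub> t)"
  and left: "!!v t. v \<in> B ==> t \<in> carrier V ==> P t ==> P (pm (delta [v]) t)"
  and right: "!!b t. b \<in> B ==> t \<in> carrier V ==> P t ==> P (fo b t)"
 shows "P t"
proof -
 note [simp del] = tensor_opaque
 have zero: "P \<zero>\<^bsub>V\<^esub>" using smult[OF one_V one, of 0] by simp
 have 1: "P (phi q one_V)" if "q \<in> carrier D.T" for q
  using that[unfolded tensor_algebra_simps(1)]
 proof (induction q rule: free_space_induct)
  case zero
  then show ?case using \<open>P \<zero>\<^bsub>V\<^esub>\<close> by (simp add: phi_def)
 next
  case (add p q)
  then have pq: "p \<in> carrier D.T" "q \<in> carrier D.T" by (simp_all add: tensor_algebra_simps(1))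
  have "phi (%w. p w + q w) one_V = phi p one_V \<oplus>\<^bsub>V\<^esub> phi q one_V"
   using linD(2)[OF repD(2)[OF rep_phi one_V] pq] by simp
  then show ?case using assms(3)[OF phi_closed phi_closed] pq add by simp
 next
  case (smult c p)
  then have p: "p \<in> carrier D.T" by (simp add: tensor_algebra_simps(1))
  have "phi (%w. c * p w) one_V = c \<odot>\<^bsub>V\<^esub> phi p one_V"
   using linD(3)[OF repD(2)[OF rep_phi one_V] p] by simp
  then show ?case using assms(4)[OF phi_closed] p smult by simp
 next
  case (delta w)
  then show ?case
  proof (induction w)
   case Nil
   then show ?case using repD(3)[OF rep_phi one_V] one by simp
  next
   case (Cons f w)
   then show ?case using right[of "unbeta f" "phi (delta w) one_V"] by (simp add: phi_Cons D.word_closed)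
  qed
 qed
 have 2: "P (pm p s)" if "p \<in> carrier Y.T" "s \<in> carrier V" "P s" for p s
  using that(1)[unfolded tensor_algebra_simps(1)]
 proof (induction p rule: free_space_induct)
  case zero
  have "pm (%_. 0) s = \<zero>\<^bsub>V\<^esub>"
   using lin_zero[OF repD(2)[OF rep_pm that(2)]] by simp
  then show ?case using \<open>P \<zero>\<^bsub>V\<^esub>\<close> by simp
 next
  case (add p q)
  then have pq: "p \<in> carrier Y.T" "q \<in> carrier Y.T" by (simp_all add: tensor_algebra_simps(1))
  have "pm (%w. p w + q w) s = pm p s \<oplus>\<^bsub>V\<^esub> pm q s"
   using linD(2)[OF repD(2)[OF rep_pm that(2)] pq] by simp
  then show ?case
   using assms(3)[OF linD(1)[OF pm(1)[OF pq(1)] that(2)] linD(1)[OF pm(1)[OF pq(2)] that(2)]] add by simp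
 next
  case (smult c p)
  then have p: "p \<in> carrier Y.T" by (simp add: tensor_algebra_simps(1))
  have "pm (%w. c * p w) s = c \<odot>\<^bsub>V\<^esub> pm p s"
   using linD(3)[OF repD(2)[OF rep_pm that(2)] p] by simp
  then show ?case using assms(4)[OF linD(1)[OF pm(1)[OF p] that(2)]] smult by simp
 next
  case (delta w)
  then show ?case
  proof (induction w)
   case Nil
   then show ?case using repD(3)[OF rep_pm that(2)] that(3) by simp
  next
   case (Cons v w)
   then show ?case
    using left[of v "pm (delta w) s"] linD(1)[OF pm(1)[OF Y.word_closed] that(2)]
    by (simp add: pm_Cons that(2))
  qed
 qed
 show ?thesis
  using assms(1)
 proof (induction rule: TP.tensor_induct)
  case (add s t)
  then show ?case by (rule assms(3))
 next
  case (tensor a c)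
  then obtain p q where pq: "p \<in> carrier Y.T" "a = Y.cl p" "q \<in> carrier D.T" "c = D.cl q"
   using Y.N_cases D.N_cases by metis
  then show ?case
   using 2[OF pq(1) phi_closed[OF pq(3) one_V] 1[OF pq(3)]] by (simp add: tens_word tens_right)
 qed
qed

text \<open>
 \<open>V\<close> is the free cyclic module over the relations: a vector \<open>n\<close> of any module
 determines the map \<open>a \<otimes> c \<mapsto> a (c n)\<close>. It commutes with the operators
 \<open>fo\<close>, because the same cross relation holds on both sides.
\<close>

lemma regular_universal:
 assumes M: "vspc M" and hv: "rep Y.T M hv" "!!p n. p \<in> Y.kern ==> n \<in> carrier M ==> hv p n = \<zero>\<^bsub>M\<^esub>"
  and hf: "rep D.T M hf" "!!q n. q \<in> D.kern ==> n \<in> carrier M ==> hf q n = \<zero>\<^bsub>M\<^esub>"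
  and rel: "!!b v n. b \<in> B ==> v \<in> B ==> n \<in> carrier M ==> hf (delta [\<beta> b]) (hv (delta [v]) n) =
   hv (Y.letter_act (x b) v) (hf (delta [\<beta> b]) n) \<oplus>\<^bsub>M\<^esub> (if b = v then n else \<zero>\<^bsub>M\<^esub>)"
  and n: "n \<in> carrier M"
 shows "\<exists>R. lin V M R \<and> R one_V = n \<and>
  (\<forall>p\<in>carrier Y.T. \<forall>q\<in>carrier D.T. R (tens (Y.cl p) (D.cl q)) = hv p (hf q n)) \<and>
  (\<forall>p\<in>carrier Y.T. \<forall>t\<in>carrier V. R (pm p t) = hv p (R t)) \<and>
  (\<forall>b\<in>B. \<forall>t\<in>carrier V. R (fo b t) = hf (delta [\<beta> b]) (R t))"
proof -
 note [simp del] = tensor_opaque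
 obtain KV where KV: "!!n. n \<in> carrier M ==> lin Y.N M (KV n)"
  "!!n p. n \<in> carrier M ==> p \<in> carrier Y.T ==> KV n (Y.cl p) = hv p n"
  using rep_quotient[OF Y.NI.algebra_ideal_axioms M hv] by blast
 obtain KF where KF: "lin D.N M KF" "!!q. q \<in> carrier D.T ==> KF (D.cl q) = hf q n"
  using rep_quotient[OF D.NI.algebra_ideal_axioms M hf] n by blast
 obtain R where R: "lin V M R" "!!a c. a \<in> carrier Y.N ==> c \<in> carrier D.N ==> R (tens a c) = KV (KF c) a"
 proof -
  have "\<exists>R. lin V M R \<and> (\<forall>a\<in>carrier Y.N. \<forall>c\<in>carrier D.N. R (tens a c) = KV (KF c) a)"
  proof (rule TP.tensor_lift[OF M])
   show "lin Y.N M (%a. KV (KF c) a)" if "c \<in> carrier D.N" for c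
    by (rule KV(1)[OF linD(1)[OF KF(1) that]])
   show "lin D.N M (%c. KV (KF c) a)" if a: "a \<in> carrier Y.N" for a
   proof -
    obtain p where p: "p \<in> carrier Y.T" "a = Y.cl p" using Y.N_cases[OF a] by blast
    have "lin D.N M (%c. hv p (KF c))" by (rule lin_comp[OF KF(1) repD(1)[OF hv(1) p(1)]])
    then show ?thesis
     using KV(2) p linD(1)[OF KF(1)] by (simp add: lin_def)
   qed
  qed
  then show ?thesis using that by blast
 qed
 have Rt: "R (tens (Y.cl p) (D.cl q)) = hv p (hf q n)" if "p \<in> carrier Y.T" "q \<in> carrier D.T" for p q
  using R(2)[of "Y.cl p" "D.cl q"] that KF KV(2)[of "hf q n" p] linD(1)[OF repD(1)[OF hf(1) that(2)] n] by simp
 have Rpm: "R (pm p t) = hv p (R t)" if p: "p \<in> carrier Y.T" and t: "t \<in> carrier V" for p t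
 proof (rule TP.lin_eq_on_tensors[OF M lin_comp[OF pm(1)[OF p] R(1)] lin_comp[OF R(1) repD(1)[OF hv(1) p]] _ t])
  fix a c assume "a \<in> carrier Y.N" "c \<in> carrier D.N"
  then obtain p' q where pq: "p' \<in> carrier Y.T" "a = Y.cl p'" "q \<in> carrier D.T" "c = D.cl q"
   using Y.N_cases D.N_cases by metis
  have hq: "hf q n \<in> carrier M" using linD(1)[OF repD(1)[OF hf(1) pq(3)] n] .
  have "p \<otimes>\<^bsub>Y.T\<^esub> p' \<in> carrier Y.T" using p pq(1) by (rule tensor_mult_closed)
  then show "R (pm p (tens a c)) = hv p (R (tens a c))"
   using p pq repD(4)[OF hv(1) p pq(1) hq] by (simp add: pm Y.cl_mult Rt)
 qed
 have Rfo: "R (fo b t) = hf (delta [\<beta> b]) (R t)" if b: "b \<in> B" and t: "t \<in> carrier V" for b t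
 proof -
  have db: "delta [\<beta> b] \<in> carrier D.T" using b by (simp add: D.letter_closed)
  note F = lin_comp[OF fo(1)[OF b] R(1)] and F' = lin_comp[OF R(1) repD(1)[OF hf(1) db]]
  have word: "R (fo b (tens (Y.cl (delta w)) (D.cl q))) = hf (delta [\<beta> b]) (R (tens (Y.cl (delta w)) (D.cl q)))"
   if "w \<in> lists B" "q \<in> carrier D.T" for w q
   using that(1)
  proof (induction w)
   case Nil
   have "fo b (phi q one_V) = phi (delta [\<beta> b] \<otimes>\<^bsub>D.T\<^esub> q) one_V"
    using phi_letter[OF b phi_closed[OF that(2) one_V]] repD(4)[OF rep_phi db that(2) one_V] by simp
   moreover have "R (phi q one_V) = hf q n" if "q \<in> carrier D.T" for q
    using Rt[OF Y.word_closed[of "[]"] that] tens_right[OF that] repD(3)[OF hv(1), of "hf q n"]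
     linD(1)[OF repD(1)[OF hf(1) that] n] by (simp add: Y.cl_one)
   ultimately show ?case
    using that(2) tensor_mult_closed[OF db that(2)] repD(4)[OF hf(1) db that(2) n]
    by (simp add: tens_right Y.cl_one[symmetric])
  next
   case (Cons v w)
   then have v: "v \<in> B" and w: "w \<in> lists B" by auto
   let ?t = "tens (Y.cl (delta w)) (D.cl q)"
   have t: "?t \<in> carrier V" using w that(2) by (simp add: Y.word_closed)
   note l = Y.letter_act_closed[OF x_closed[OF b] v] and dv = Y.letter_closed[OF v]
   have e: "tens (Y.cl (delta (v # w))) (D.cl q) = pm (delta [v]) ?t"
    using v w that(2) Y.cl_mult[OF dv Y.word_closed[OF w]]
    by (simp add: pm Y.letter_closed Y.word_closed delta_mult)
   have fot: "fo b ?t \<in> carrier V" by (rule linD(1)[OF fo(1)[OF b] t])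
   have "R (fo b (pm (delta [v]) ?t)) = R (pm (Y.letter_act (x b) v) (fo b ?t)) \<oplus>\<^bsub>M\<^esub> R (if b = v then ?t else \<zero>\<^bsub>V\<^esub>)"
    using linD(2)[OF R(1) linD(1)[OF pm(1)[OF l] fot], of "if b = v then ?t else \<zero>\<^bsub>V\<^esub>"] t
    by (simp only: fo_pm_letter[OF b v t]) simp
   also have "\<dots> = hv (Y.letter_act (x b) v) (hf (delta [\<beta> b]) (R ?t)) \<oplus>\<^bsub>M\<^esub> (if b = v then R ?t else \<zero>\<^bsub>M\<^esub>)"
    using Rpm[OF l fot] Cons.IH lin_zero[OF R(1) TP.vspc_tensor M] by simp
   also have "\<dots> = hf (delta [\<beta> b]) (R (pm (delta [v]) ?t))"
    using rel[OF b v linD(1)[OF R(1) t]] Rpm[OF dv t] by simp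
   finally show ?case unfolding e .
  qed
  show ?thesis
  proof (rule TP.lin_eq_on_tensors[OF M F F' _ t])
   fix a c assume "a \<in> carrier Y.N" and c: "c \<in> carrier D.N"
   then obtain p q where pq: "p \<in> carrier Y.T" "a = Y.cl p" "q \<in> carrier D.T" "c = D.cl q"
    using Y.N_cases D.N_cases by metis
   have L: "lin (free_space (lists B)) V (%p. tens (Y.cl p) c)"
    using lin_comp[OF Y.NI.lin_coset TP.lin_tensor_left[OF c]] by simp
   show "R (fo b (tens a c)) = hf (delta [\<beta> b]) (R (tens a c))"
    unfolding pq(2)
    by (rule lin_eq_on_free[OF lin_comp[OF L F] lin_comp[OF L F'] M _ pq(1)[unfolded tensor_algebra_simps(1)]])
     (use word pq(3,4) in simp)
  qed
 qed
 have "R one_V = n"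
  using Rt[OF Y.word_closed[of "[]"] D.word_closed[of "[]"]] repD(3)[OF hf(1) n] repD(3)[OF hv(1) n]
  by (simp add: Y.cl_one D.cl_one)
 then show ?thesis using R(1) Rt Rpm Rfo by blast
qed

text \<open>The module \<open>V\<close> is generated by \<open>1 \<otimes> 1\<close>.\<close>

lemma regular_unique:
 assumes "vspc M" "lin V M R" "lin V M R'" "R one_V = R' one_V"
  and "!!v t. v \<in> B ==> t \<in> carrier V ==> R t = R' t ==> R (pm (delta [v]) t) = R' (pm (delta [v]) t)"
  and "!!b t. b \<in> B ==> t \<in> carrier V ==> R t = R' t ==> R (fo b t) = R' (fo b t)"
  and "t \<in> carrier V"
 shows "R t = R' t"
 using assms(7)
 by (induction rule: V_induct) (simp_all add: assms linD[OF assms(2)] linD[OF assms(3)])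

lemma pm_kern: "p \<in> Y.kern ==> t \<in> carrier V ==> pm p t = \<zero>\<^bsub>V\<^esub>"
proof -
 note [simp del] = tensor_opaque
 assume pk: "p \<in> Y.kern" and t: "t \<in> carrier V"
 then have p: "p \<in> carrier Y.T" unfolding Y.kern_def by blast
 have "Y.cl p = \<zero>\<^bsub>Y.N\<^esub>" using Y.NI.coset_zero_iff[OF p] pk by simp
 moreover have "lin V V (%_. \<zero>\<^bsub>V\<^esub>)" by (simp add: lin_def)
 ultimately show ?thesis
  using p by (intro TP.lin_eq_on_tensors[OF TP.vspc_tensor pm(1)[OF p] _ _ t])
   (simp_all add: pm tens_lin_left)
qed

subsection \<open>The multiplication\<close>

definition weyl_rec :: "(_ => _ => _) => (complex, _) module"
 where "weyl_rec m = V\<lparr>monoid.mult := m, one := one_V\<rparr>"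

lemma weyl_rec_simps [simp]:
 "carrier (weyl_rec m) = carrier V" "\<zero>\<^bsub>weyl_rec m\<^esub> = \<zero>\<^bsub>V\<^esub>" "a \<oplus>\<^bsub>weyl_rec m\<^esub> a' = a \<oplus>\<^bsub>V\<^esub> a'"
 "c \<odot>\<^bsub>weyl_rec m\<^esub> a = c \<odot>\<^bsub>V\<^esub> a" "a \<otimes>\<^bsub>weyl_rec m\<^esub> a' = m a a'" "\<one>\<^bsub>weyl_rec m\<^esub> = one_V"
 by (simp_all add: weyl_rec_def)

lemma lin_weyl_rec [simp]: "lin (weyl_rec m) A h \<longleftrightarrow> lin V A h" "lin A (weyl_rec m) h' \<longleftrightarrow> lin A V h'"
 by (simp_all add: lin_def)

lemma vspc_weyl_rec: "vspc (weyl_rec m)"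
proof (rule vspcI)
 show "abelian_group (weyl_rec m)"
 proof (rule abelian_groupI)
  fix t assume "t \<in> carrier (weyl_rec m)"
  then show "\<exists>s\<in>carrier (weyl_rec m). s \<oplus>\<^bsub>weyl_rec m\<^esub> t = \<zero>\<^bsub>weyl_rec m\<^esub>"
   by (intro bexI[of _ "\<ominus>\<^bsub>V\<^esub> t"]) simp_all
 qed (simp_all add: vspc_assoc vspc_comm vspc_left_comm)
qed (simp_all add: vspc_distl vspc_distr)

text \<open>The conditions on the multiplication, with the cross relation stated for basis vectors only.\<close>

definition weyl_ok :: "(_ => _ => _) => bool"
 where "weyl_ok m \<longleftrightarrow> complex_algebra (weyl_rec m) \<and>
  (\<forall>a\<in>carrier Y.N. \<forall>a'\<in>carrier Y.N. m (left_in a) (left_in a') = left_in (a \<otimes>\<^bsub>Y.N\<^esub> a')) \<and>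
  (\<forall>c\<in>carrier D.N. \<forall>c'\<in>carrier D.N. m (right_in c) (right_in c') = right_in (c \<otimes>\<^bsub>D.N\<^esub> c')) \<and>
  (\<forall>a\<in>carrier Y.N. \<forall>c\<in>carrier D.N. m (left_in a) (right_in c) = tens a c) \<and>
  (\<forall>b\<in>B. \<forall>v\<in>B. m (right_in (D.cl (delta [\<beta> b]))) (left_in (Y.cl (delta [v]))) =
   m (left_in (Y.cl (Y.letter_act (x b) v))) (right_in (D.cl (delta [\<beta> b])))
    \<oplus>\<^bsub>V\<^esub> (if b = v then one_V else \<zero>\<^bsub>V\<^esub>))"

text \<open>
 The product \<open>t n\<close> is the image of \<open>t\<close> under the map from \<open>V\<close> to itself
 that sends \<open>1 \<otimes> 1\<close> to \<open>n\<close>. All laws are equations between linear maps in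
 \<open>t\<close> that commute with left multiplication by letters, so they have to be checked for \<open>t = 1
 \<otimes> 1\<close> only.
\<close>

lemma weyl_ok_exists: "\<exists>m. weyl_ok m"
proof -
 note [simp del] = tensor_opaque
 note VV = TP.vspc_tensor
 have rel: "phi (delta [\<beta> b]) (pm (delta [v]) n) =
   pm (Y.letter_act (x b) v) (phi (delta [\<beta> b]) n) \<oplus>\<^bsub>V\<^esub> (if b = v then n else \<zero>\<^bsub>V\<^esub>)"
  if "b \<in> B" "v \<in> B" "n \<in> carrier V" for b v n
  using fo_pm_letter[OF that] phi_letter[OF that(1)] that linD(1)[OF pm(1)[OF Y.letter_closed]] by simp
 define P where "P n R \<longleftrightarrow> lin V V R \<and> R one_V = n \<and>
  (\<forall>p\<in>carrier Y.T. \<forall>q\<in>carrier D.T. R (tens (Y.cl p) (D.cl q)) = pm p (phi q n)) \<and>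
  (\<forall>p\<in>carrier Y.T. \<forall>t\<in>carrier V. R (pm p t) = pm p (R t)) \<and>
  (\<forall>b\<in>B. \<forall>t\<in>carrier V. R (fo b t) = phi (delta [\<beta> b]) (R t))" for n R
 have ex: "\<exists>R. P n R" if "n \<in> carrier V" for n
  unfolding P_def by (rule regular_universal[OF VV rep_pm pm_kern rep_phi phi_kern rel that])
 define m where "m t n = (SOME R. P n R) t" for t n
 have "P n (%t. m t n)" if "n \<in> carrier V" for n
  unfolding m_def using someI_ex[OF ex[OF that]] by simp
 then have lin1: "lin V V (%t. m t n)" and one: "m one_V n = n"
  and mt: "!!p q. p \<in> carrier Y.T ==> q \<in> carrier D.T ==> m (tens (Y.cl p) (D.cl q)) n = pm p (phi q n)"
  and mpm: "!!p t. p \<in> carrier Y.T ==> t \<in> carrier V ==> m (pm p t) n = pm p (m t n)"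
  and mphi: "!!b t. b \<in> B ==> t \<in> carrier V ==> m (fo b t) n = phi (delta [\<beta> b]) (m t n)"
  if "n \<in> carrier V" for n
  using that unfolding P_def by blast+
 have mc: "m t n \<in> carrier V" if "t \<in> carrier V" "n \<in> carrier V" for t n
  using linD(1)[OF lin1[OF that(2)] that(1)] .
 have mfo: "m (fo b t) n = fo b (m t n)" if "b \<in> B" "t \<in> carrier V" "n \<in> carrier V" for b t n
  using mphi[OF that(3,1,2)] phi_letter[OF that(1) mc[OF that(2,3)]] by simp
 have lin2: "lin V V (m t)" if t: "t \<in> carrier V" for t
 proof -
  have "m t (n \<oplus>\<^bsub>V\<^esub> n') = m t n \<oplus>\<^bsub>V\<^esub> m t n'" if n: "n \<in> carrier V" "n' \<in> carrier V" for n n'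
  proof (rule regular_unique[OF VV lin1 lin_add[OF VV lin1[OF n(1)] lin1[OF n(2)]] _ _ _ t])
   show nn: "n \<oplus>\<^bsub>V\<^esub> n' \<in> carrier V" using n by simp
   show "m one_V (n \<oplus>\<^bsub>V\<^esub> n') = m one_V n \<oplus>\<^bsub>V\<^esub> m one_V n'" using one n nn by simp
   fix t assume t: "t \<in> carrier V" "m t (n \<oplus>\<^bsub>V\<^esub> n') = m t n \<oplus>\<^bsub>V\<^esub> m t n'"
   show "m (pm (delta [v]) t) (n \<oplus>\<^bsub>V\<^esub> n') = m (pm (delta [v]) t) n \<oplus>\<^bsub>V\<^esub> m (pm (delta [v]) t) n'" if "v \<in> B" for v
    using linD(2)[OF pm(1)[OF Y.letter_closed[OF that]]] t n nn that by (simp add: mpm mc Y.letter_closed)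
   show "m (fo b t) (n \<oplus>\<^bsub>V\<^esub> n') = m (fo b t) n \<oplus>\<^bsub>V\<^esub> m (fo b t) n'" if "b \<in> B" for b
    using linD(2)[OF fo(1)[OF that]] t n nn that by (simp add: mfo mc)
  qed
  moreover have "m t (c \<odot>\<^bsub>V\<^esub> n) = c \<odot>\<^bsub>V\<^esub> m t n" if n: "n \<in> carrier V" for c n
  proof (rule regular_unique[OF VV lin1 lin_scale[OF VV lin1[OF n]] _ _ _ t])
   show nn: "c \<odot>\<^bsub>V\<^esub> n \<in> carrier V" using n by simp
   show "m one_V (c \<odot>\<^bsub>V\<^esub> n) = c \<odot>\<^bsub>V\<^esub> m one_V n" using one n nn by simp
   fix t assume t: "t \<in> carrier V" "m t (c \<odot>\<^bsub>V\<^esub> n) = c \<odot>\<^bsub>V\<^esub> m t n"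
   show "m (pm (delta [v]) t) (c \<odot>\<^bsub>V\<^esub> n) = c \<odot>\<^bsub>V\<^esub> m (pm (delta [v]) t) n" if "v \<in> B" for v
    using linD(3)[OF pm(1)[OF Y.letter_closed[OF that]]] t n nn that by (simp add: mpm mc Y.letter_closed)
   show "m (fo b t) (c \<odot>\<^bsub>V\<^esub> n) = c \<odot>\<^bsub>V\<^esub> m (fo b t) n" if "b \<in> B" for b
    using linD(3)[OF fo(1)[OF that]] t n nn that by (simp add: mfo mc)
  qed
  ultimately show ?thesis using mc t by (simp add: lin_def)
 qed
 have assoc: "m (m t n) k = m t (m n k)" if t: "t \<in> carrier V" and n: "n \<in> carrier V" and k: "k \<in> carrier V" for t n k
 proof (rule regular_unique[OF VV lin_comp[OF lin1[OF n] lin1[OF k]] lin1 _ _ _ t])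
  show nk: "m n k \<in> carrier V" using mc n k by simp
  show "m (m one_V n) k = m one_V (m n k)" using one n nk by simp
  fix t assume t: "t \<in> carrier V" "m (m t n) k = m t (m n k)"
  show "m (m (pm (delta [v]) t) n) k = m (pm (delta [v]) t) (m n k)" if "v \<in> B" for v
   using t n k nk that by (simp add: mpm mc Y.letter_closed)
  show "m (m (fo b t) n) k = m (fo b t) (m n k)" if "b \<in> B" for b
   using t n k nk that by (simp add: mfo mc)
 qed
 have r_one: "m t one_V = t" if t: "t \<in> carrier V" for t
  by (rule regular_unique[OF VV lin1[OF one_V] lin_id _ _ _ t]) (simp_all add: one mpm mfo Y.letter_closed)
 have VW: "vspc (weyl_rec m)" by (rule vspc_weyl_rec)
 have CA: "complex_algebra (weyl_rec m)"
  using VW mc one r_one lin1 lin2 assoc by (intro complex_algebraI) (simp_all del: TP.vspc_tensor)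
 have e: "delta [] \<in> carrier Y.T" "delta [] \<in> carrier D.T" by (simp_all add: Y.word_closed D.word_closed)
 have left: "m (left_in (Y.cl p)) n = pm p n" if "p \<in> carrier Y.T" "n \<in> carrier V" for p n
  using mt[OF that(2,1) e(2)] repD(3)[OF rep_phi that(2)] by (simp add: D.cl_one)
 have right: "m (right_in (D.cl q)) n = phi q n" if "q \<in> carrier D.T" "n \<in> carrier V" for q n
  using mt[OF that(2) e(1) that(1)] repD(3)[OF rep_pm, of "phi q n"] that by (simp add: Y.cl_one)
 have "weyl_ok m"
  unfolding weyl_ok_def
 proof (intro conjI ballI CA)
  fix a a' assume a: "a \<in> carrier Y.N" "a' \<in> carrier Y.N"
  then obtain p where p: "p \<in> carrier Y.T" "a = Y.cl p" using Y.N_cases by blast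
  then show "m (left_in a) (left_in a') = left_in (a \<otimes>\<^bsub>Y.N\<^esub> a')"
   using a by (simp add: left pm)
 next
  fix c c' assume c: "c \<in> carrier D.N" "c' \<in> carrier D.N"
  then obtain q where "q \<in> carrier D.T" "c = D.cl q" using D.N_cases by blast
  then show "m (right_in c) (right_in c') = right_in (c \<otimes>\<^bsub>D.N\<^esub> c')"
   using c by (simp add: right phi_unit)
 next
  fix a c assume ac: "a \<in> carrier Y.N" "c \<in> carrier D.N"
  then obtain p where p: "p \<in> carrier Y.T" "a = Y.cl p" using Y.N_cases by blast
  then show "m (left_in a) (right_in c) = tens a c"
   using ac left[OF p(1), of "right_in c"] tens_word[OF p(1), of c] by simp
 next
  fix b v assume b: "b \<in> B" and v: "v \<in> B"
  note l = Y.letter_act_closed[OF x_closed[OF b] v]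
  have db: "delta [\<beta> b] \<in> carrier D.T" using b by (simp add: D.letter_closed)
  have "left_in (Y.cl (delta [v])) = pm (delta [v]) one_V"
   using v by (simp add: tens_word Y.letter_closed)
  then have "m (right_in (D.cl (delta [\<beta> b]))) (left_in (Y.cl (delta [v]))) =
    phi (delta [\<beta> b]) (pm (delta [v]) one_V)"
   using right[OF db] linD(1)[OF pm(1)[OF Y.letter_closed[OF v]] one_V] by simp
  also have "\<dots> = pm (Y.letter_act (x b) v) (phi (delta [\<beta> b]) one_V) \<oplus>\<^bsub>V\<^esub> (if b = v then one_V else \<zero>\<^bsub>V\<^esub>)"
   by (rule rel[OF b v one_V])
  also have "pm (Y.letter_act (x b) v) (phi (delta [\<beta> b]) one_V) =
    m (left_in (Y.cl (Y.letter_act (x b) v))) (right_in (D.cl (delta [\<beta> b])))"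
   using left[OF l] db by (simp add: tens_right)
  finally show "m (right_in (D.cl (delta [\<beta> b]))) (left_in (Y.cl (delta [v]))) =
   m (left_in (Y.cl (Y.letter_act (x b) v))) (right_in (D.cl (delta [\<beta> b])))
    \<oplus>\<^bsub>V\<^esub> (if b = v then one_V else \<zero>\<^bsub>V\<^esub>)" .
 qed
 then show ?thesis by blast
qed

subsection \<open>The universal property of the braided Weyl algebra\<close>

lemma
 assumes ok: "weyl_ok m" and t: "t \<in> carrier V"
 shows weyl_mult_left: "p \<in> carrier Y.T ==> m (left_in (Y.cl p)) t = pm p t"
  and weyl_mult_right: "b \<in> B ==> m (right_in (D.cl (delta [\<beta> b]))) t = fo b t"
proof -
 note [simp del] = tensor_opaque
 have CA: "complex_algebra (weyl_rec m)"
  and LL: "!!a a'. a \<in> carrier Y.N ==> a' \<in> carrier Y.N ==> m (left_in a) (left_in a') = left_in (a \<otimes>\<^bsub>Y.N\<^esub> a')"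
  and RR: "!!c c'. c \<in> carrier D.N ==> c' \<in> carrier D.N ==> m (right_in c) (right_in c') = right_in (c \<otimes>\<^bsub>D.N\<^esub> c')"
  and LR: "!!a c. a \<in> carrier Y.N ==> c \<in> carrier D.N ==> m (left_in a) (right_in c) = tens a c"
  and rel: "!!b v. b \<in> B ==> v \<in> B ==> m (right_in (D.cl (delta [\<beta> b]))) (left_in (Y.cl (delta [v]))) =
   m (left_in (Y.cl (Y.letter_act (x b) v))) (right_in (D.cl (delta [\<beta> b])))
    \<oplus>\<^bsub>V\<^esub> (if b = v then one_V else \<zero>\<^bsub>V\<^esub>)"
  using ok unfolding weyl_ok_def by blast+
 note assoc = algebra_assoc[OF CA, simplified] and LM = lin_mult_left[OF CA, simplified]
  and MD = algebra_distl[OF CA, simplified] and M1 = complex_algebra_simps(3,5)[OF CA, simplified]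
  and MC = complex_algebra_simps(2)[OF CA, simplified]
 have left: "m (left_in (Y.cl p)) t = pm p t" if p: "p \<in> carrier Y.T" and t: "t \<in> carrier V" for p t
 proof (rule TP.lin_eq_on_tensors[OF TP.vspc_tensor LM pm(1)[OF p] _ t])
  show "left_in (Y.cl p) \<in> carrier V" using p by simp
  fix a c assume ac: "a \<in> carrier Y.N" "c \<in> carrier D.N"
  have "m (left_in (Y.cl p)) (tens a c) = m (m (left_in (Y.cl p)) (left_in a)) (right_in c)"
   using p ac by (subst assoc) (simp_all add: LR)
  then show "m (left_in (Y.cl p)) (tens a c) = pm p (tens a c)"
   using p ac by (simp add: LL LR pm)
 qed
 then show "p \<in> carrier Y.T ==> m (left_in (Y.cl p)) t = pm p t" using t by blast
 assume b: "b \<in> B"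
 let ?f = "right_in (D.cl (delta [\<beta> b]))"
 have db: "delta [\<beta> b] \<in> carrier D.T" using b by (simp add: D.letter_closed)
 have f: "?f \<in> carrier V" using db by simp
 show "m ?f t = fo b t"
 proof (rule TP.lin_eq_on_tensors[OF TP.vspc_tensor LM[OF f] fo(1)[OF b] _ t])
  fix a c assume "a \<in> carrier Y.N" and c: "c \<in> carrier D.N"
  then obtain p q where pq: "p \<in> carrier Y.T" "a = Y.cl p" "q \<in> carrier D.T" "c = D.cl q"
   using Y.N_cases D.N_cases by metis
  have L: "lin (free_space (lists B)) V (%p. tens (Y.cl p) c)"
   using lin_comp[OF Y.NI.lin_coset TP.lin_tensor_left[OF c]] by simp
  show "m ?f (tens a c) = fo b (tens a c)"
   unfolding pq(2)
  proof (rule lin_eq_on_free[OF lin_comp[OF L LM[OF f]] lin_comp[OF L fo(1)[OF b]] TP.vspc_tensor _ pq(1)[unfolded tensor_algebra_simps(1)]])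
   fix w assume "w \<in> lists B"
   then show "m ?f (tens (Y.cl (delta w)) c) = fo b (tens (Y.cl (delta w)) c)"
   proof (induction w)
    case Nil
    have cc: "D.cl (delta [\<beta> b]) \<otimes>\<^bsub>D.N\<^esub> c \<in> carrier D.N" using db c by simp
    have "fo b (right_in c) = phi (delta [\<beta> b]) (right_in c)" using phi_letter[OF b] c by simp
    then show ?case using RR[of "D.cl (delta [\<beta> b])" c] db c by (simp add: phi_unit Y.cl_one[symmetric])
   next
    case (Cons v w)
    then have v: "v \<in> B" and w: "w \<in> lists B" by auto
    let ?t = "tens (Y.cl (delta w)) c" and ?v = "left_in (Y.cl (delta [v]))"
    note l = Y.letter_act_closed[OF x_closed[OF b] v] and dv = Y.letter_closed[OF v]
    have t: "?t \<in> carrier V" using w c by (simp add: Y.word_closed)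
    have e: "tens (Y.cl (delta (v # w))) c = pm (delta [v]) ?t"
     using v w c Y.cl_mult[OF dv Y.word_closed[OF w]]
     by (simp add: pm Y.letter_closed Y.word_closed delta_mult)
    have vV: "?v \<in> carrier V" and lV: "left_in (Y.cl (Y.letter_act (x b) v)) \<in> carrier V" using dv l by simp_all
    have "m ?f (pm (delta [v]) ?t) = m (m ?f ?v) ?t"
     using assoc[OF f vV t] left[OF dv t] by simp
    also have "\<dots> = m (m (left_in (Y.cl (Y.letter_act (x b) v))) ?f) ?t \<oplus>\<^bsub>V\<^esub> m (if b = v then one_V else \<zero>\<^bsub>V\<^esub>) ?t"
     unfolding rel[OF b v] using f lV t by (intro MD MC) simp_all
    also have "m (m (left_in (Y.cl (Y.letter_act (x b) v))) ?f) ?t = pm (Y.letter_act (x b) v) (fo b ?t)"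
     using assoc[OF lV f t] left[OF l linD(1)[OF fo(1)[OF b] t]] Cons.IH by simp
    also have "m (if b = v then one_V else \<zero>\<^bsub>V\<^esub>) ?t = (if b = v then ?t else \<zero>\<^bsub>V\<^esub>)"
     using M1[OF t] by simp
    finally show ?case
     unfolding e fo_pm_letter[OF b v t] .
   qed
  qed
 qed
qed

text \<open>
 An algebra that satisfies the relations is a module over them by left multiplication; the map \<open>h\<close>
 with \<open>h(1 \<otimes> 1) = 1\<close> is multiplicative by \<open>regular_unique\<close>.
\<close>

lemma weyl_lift:
 assumes ok: "weyl_ok m" and A: "complex_algebra A"
  and H: "alg_hom Y.T A H" "!!p. p \<in> Y.kern ==> H p = \<zero>\<^bsub>A\<^esub>"
  and H': "alg_hom D.T A H'" "!!q. q \<in> D.kern ==> H' q = \<zero>\<^bsub>A\<^esub>"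
  and rel: "!!b v. b \<in> B ==> v \<in> B ==> H' (delta [\<beta> b]) \<otimes>\<^bsub>A\<^esub> H (delta [v]) =
   H (Y.letter_act (x b) v) \<otimes>\<^bsub>A\<^esub> H' (delta [\<beta> b]) \<oplus>\<^bsub>A\<^esub> (if b = v then \<one>\<^bsub>A\<^esub> else \<zero>\<^bsub>A\<^esub>)"
 shows "\<exists>h. alg_hom (weyl_rec m) A h \<and>
  (\<forall>p\<in>carrier Y.T. \<forall>q\<in>carrier D.T. h (tens (Y.cl p) (D.cl q)) = H p \<otimes>\<^bsub>A\<^esub> H' q)"
proof -
 note [simp del] = tensor_opaque
 have CA: "complex_algebra (weyl_rec m)" using ok unfolding weyl_ok_def by blast
 note assoc = algebra_assoc[OF CA, simplified] and MR = lin_mult_right[OF CA, simplified]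
  and M1 = complex_algebra_simps(3)[OF CA, simplified] and MC = complex_algebra_simps(2)[OF CA, simplified]
 note HL = linD[OF alg_homD(1)[OF H(1)]] and HL' = linD[OF alg_homD(1)[OF H'(1)]]
 have AV: "vspc A" using A by simp
 have R: "H' (delta [\<beta> b]) \<otimes>\<^bsub>A\<^esub> (H (delta [v]) \<otimes>\<^bsub>A\<^esub> n) =
   (H (Y.letter_act (x b) v) \<otimes>\<^bsub>A\<^esub> (H' (delta [\<beta> b]) \<otimes>\<^bsub>A\<^esub> n)) \<oplus>\<^bsub>A\<^esub> (if b = v then n else \<zero>\<^bsub>A\<^esub>)"
  if b: "b \<in> B" and v: "v \<in> B" and n: "n \<in> carrier A" for b v n
 proof -
  have c: "H' (delta [\<beta> b]) \<in> carrier A" "H (delta [v]) \<in> carrier A" "H (Y.letter_act (x b) v) \<in> carrier A"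
   using b v by (auto intro!: HL(1) HL'(1) D.letter_closed Y.letter_closed Y.letter_act_closed)
  have "H' (delta [\<beta> b]) \<otimes>\<^bsub>A\<^esub> (H (delta [v]) \<otimes>\<^bsub>A\<^esub> n) =
    (H (Y.letter_act (x b) v) \<otimes>\<^bsub>A\<^esub> H' (delta [\<beta> b]) \<oplus>\<^bsub>A\<^esub> (if b = v then \<one>\<^bsub>A\<^esub> else \<zero>\<^bsub>A\<^esub>)) \<otimes>\<^bsub>A\<^esub> n"
   using algebra_assoc[OF A c(1,2) n] rel[OF b v] by simp
  also have "\<dots> = (H (Y.letter_act (x b) v) \<otimes>\<^bsub>A\<^esub> H' (delta [\<beta> b])) \<otimes>\<^bsub>A\<^esub> n \<oplus>\<^bsub>A\<^esub> (if b = v then \<one>\<^bsub>A\<^esub> else \<zero>\<^bsub>A\<^esub>) \<otimes>\<^bsub>A\<^esub> n"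
   using A c n AV by (intro algebra_distl) simp_all
  finally show ?thesis using A c n by (simp add: algebra_assoc)
 qed
 obtain h where h: "lin V A h" "h one_V = \<one>\<^bsub>A\<^esub>"
  and ht: "!!p q. p \<in> carrier Y.T ==> q \<in> carrier D.T ==> h (tens (Y.cl p) (D.cl q)) = H p \<otimes>\<^bsub>A\<^esub> (H' q \<otimes>\<^bsub>A\<^esub> \<one>\<^bsub>A\<^esub>)"
  and hpm: "!!p t. p \<in> carrier Y.T ==> t \<in> carrier V ==> h (pm p t) = H p \<otimes>\<^bsub>A\<^esub> h t"
  and hfo: "!!b t. b \<in> B ==> t \<in> carrier V ==> h (fo b t) = H' (delta [\<beta> b]) \<otimes>\<^bsub>A\<^esub> h t"
  using regular_universal[OF AV rep_of_alg_hom[OF complex_algebra_tensor_algebra A H(1)] _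
   rep_of_alg_hom[OF complex_algebra_tensor_algebra A H'(1)] _ R complex_algebra_simps(1)[OF A]]
   H(2) H'(2) A by auto
 have mult: "h (m t n) = h t \<otimes>\<^bsub>A\<^esub> h n" if t: "t \<in> carrier V" and n: "n \<in> carrier V" for t n
 proof (rule regular_unique[OF AV lin_comp[OF MR[OF n] h(1)] lin_comp[OF h(1) lin_mult_right[OF A linD(1)[OF h(1) n]]] _ _ _ t])
  show "h (m one_V n) = h one_V \<otimes>\<^bsub>A\<^esub> h n" using h n A M1 linD(1)[OF h(1) n] by simp
  fix t assume t: "t \<in> carrier V" "h (m t n) = h t \<otimes>\<^bsub>A\<^esub> h n"
  note hc = linD(1)[OF h(1) t(1)] linD(1)[OF h(1) n]
  show "h (m (pm (delta [v]) t) n) = h (pm (delta [v]) t) \<otimes>\<^bsub>A\<^esub> h n" if v: "v \<in> B" for v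
  proof -
   note dv = Y.letter_closed[OF v]
   have vV: "left_in (Y.cl (delta [v])) \<in> carrier V" using dv by simp
   have "m (pm (delta [v]) t) n = pm (delta [v]) (m t n)"
    using assoc[OF vV t(1) n] weyl_mult_left[OF ok t(1) dv] weyl_mult_left[OF ok MC[OF t(1) n] dv] by simp
   then show ?thesis
    using hpm[OF dv MC[OF t(1) n]] hpm[OF dv t(1)] t(2) A HL(1)[OF dv] hc by (simp add: algebra_assoc)
  qed
  show "h (m (fo b t) n) = h (fo b t) \<otimes>\<^bsub>A\<^esub> h n" if b: "b \<in> B" for b
  proof -
   have db: "delta [\<beta> b] \<in> carrier D.T" using b by (simp add: D.letter_closed)
   have fV: "right_in (D.cl (delta [\<beta> b])) \<in> carrier V" using db by simp
   have "m (fo b t) n = fo b (m t n)"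
    using assoc[OF fV t(1) n] weyl_mult_right[OF ok t(1) b] weyl_mult_right[OF ok MC[OF t(1) n] b] by simp
   then show ?thesis
    using hfo[OF b MC[OF t(1) n]] hfo[OF b t(1)] t(2) A HL'(1)[OF db] hc by (simp add: algebra_assoc)
  qed
 qed
 have "alg_hom (weyl_rec m) A h"
  using h mult by (simp add: alg_hom_def)
 moreover have "h (tens (Y.cl p) (D.cl q)) = H p \<otimes>\<^bsub>A\<^esub> H' q" if "p \<in> carrier Y.T" "q \<in> carrier D.T" for p q
  using ht[OF that] A HL'(1)[OF that(2)] by simp
 ultimately show ?thesis by blast
qed

lemma weyl_unique:
 assumes ok: "weyl_ok m" and A: "complex_algebra A" and h: "alg_hom (weyl_rec m) A h" and k: "alg_hom (weyl_rec m) A k"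
  and "!!v. v \<in> B ==> h (left_in (Y.cl (delta [v]))) = k (left_in (Y.cl (delta [v])))"
  and "!!b. b \<in> B ==> h (right_in (D.cl (delta [\<beta> b]))) = k (right_in (D.cl (delta [\<beta> b])))"
  and t: "t \<in> carrier V"
 shows "h t = k t"
proof (rule regular_unique[of A])
 note [simp del] = tensor_opaque
 note hm = alg_homD(3)[OF h, simplified] and km = alg_homD(3)[OF k, simplified]
 show "vspc A" "lin V A h" "lin V A k" "h one_V = k one_V"
  using A alg_homD(1,2)[OF h] alg_homD(1,2)[OF k] by simp_all
 show "h (pm (delta [v]) t) = k (pm (delta [v]) t)" if "v \<in> B" "t \<in> carrier V" "h t = k t" for v t
  using weyl_mult_left[OF ok that(2) Y.letter_closed[OF that(1)]]
   hm[of "left_in (Y.cl (delta [v]))" t] km[of "left_in (Y.cl (delta [v]))" t] assms(5)[OF that(1)] that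
  by (simp add: Y.letter_closed)
 show "h (fo b t) = k (fo b t)" if "b \<in> B" "t \<in> carrier V" "h t = k t" for b t
  using weyl_mult_right[OF ok that(2,1)]
   hm[of "right_in (D.cl (delta [\<beta> b]))" t] km[of "right_in (D.cl (delta [\<beta> b]))" t] assms(6)[OF that(1)] that
  by (simp add: D.letter_closed)
qed (rule t)

end

section \<open>Passing from the braiding to its flip\<close>

text \<open>For a finite basis, finite support means bounded length.\<close>

lemma tensor_algebra_iff:
 assumes "finite B"
 shows "p \<in> carrier (tensor_algebra B) \<longleftrightarrow>
  (\<forall>w. w \<notin> lists B --> p w = 0) \<and> (\<exists>n. \<forall>w. p w ~= 0 --> length w \<le> n)"
proof
 assume p: "p \<in> carrier (tensor_algebra B)"
 then have "finite (length ` {w. p w ~= 0})" by auto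
 then obtain n where "\<forall>k\<in>length ` {w. p w ~= 0}. k \<le> n" using finite_nat_set_iff_bounded_le by blast
 then show "(\<forall>w. w \<notin> lists B --> p w = 0) \<and> (\<exists>n. \<forall>w. p w ~= 0 --> length w \<le> n)"
  using p by auto
next
 assume R: "(\<forall>w. w \<notin> lists B --> p w = 0) \<and> (\<exists>n. \<forall>w. p w ~= 0 --> length w \<le> n)"
 then obtain n where n: "!!w. p w ~= 0 ==> length w \<le> n" by blast
 have "{w. p w ~= 0} \<subseteq> {w. set w \<subseteq> B \<and> length w \<le> n}"
  using R n by (auto simp: subset_iff)
 then have "finite {w. p w ~= 0}"
  using finite_lists_length_le[OF assms, of n] finite_subset by blast
 then show "p \<in> carrier (tensor_algebra B)" using R by auto
qed

context yd_matrix
begin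

lemma gact_cong_length: "(!!w. length w = length u ==> s w = t w) ==> gact g s u = gact g t u"
proof (induction u arbitrary: s t)
 case (Cons c u)
 then have "gact g (%w. s (d # w)) u = gact g (%w. t (d # w)) u" for d
  by (intro Cons.IH) simp
 then show ?case by simp
qed simp

text \<open>The action by algebra automorphisms is the diagonal action on tensor factors.\<close>

lemma tact_gact:
 assumes g: "g \<in> carrier G" and p: "p \<in> carrier T"
 shows "tact g p = gact g p"
proof -
 note [simp del] = tensor_opaque
 note H = alg_homD[OF alg_hom_tact[OF g]] and HL = linD[OF alg_homD(1)[OF alg_hom_tact[OF g]]]
 have word: "tact g (delta w) = gact g (delta w)" if "w \<in> lists B" for w
  using that
 proof (induction w)
  case Nil
  then show ?case using H(2) by simp
 next
  case (Cons b w)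
  then have b: "b \<in> B" and w: "w \<in> lists B" by auto
  have "tact g (delta (b # w)) = letter_act g b \<otimes>\<^bsub>T\<^esub> gact g (delta w)"
   using H(3)[OF letter_closed[OF b] word_closed[OF w]] tact_letter[OF g b] Cons
   by (simp add: delta_mult)
  moreover have "(letter_act g b \<otimes>\<^bsub>T\<^esub> gact g (delta w)) u = gact g (delta (b # w)) u" for u
  proof (cases u)
   case Nil
   then show ?thesis by (simp add: tensor_algebra_simps(5) letter_act_def delta_def)
  next
   case (Cons c v)
   have "(\<Sum>k\<le>length u. letter_act g b (take k u) * gact g (delta w) (drop k u)) =
     (\<Sum>k\<in>{1}. letter_act g b (take k u) * gact g (delta w) (drop k u))"
   proof (rule sum.mono_neutral_right)
    show "\<forall>k\<in>{..length u} - {1}. letter_act g b (take k u) * gact g (delta w) (drop k u) = 0"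
    proof
     fix k assume k: "k \<in> {..length u} - {1}"
     then have "length (take k u) ~= 1" by auto
     moreover have "letter_act g b w = 0" if "length w ~= 1" for w
      using that by (auto simp: letter_act_def split: list.splits)
     ultimately have "letter_act g b (take k u) = 0" by blast
     then show "letter_act g b (take k u) * gact g (delta w) (drop k u) = 0" by simp
    qed
   qed (use Cons in auto)
   also have "\<dots> = r g c b * gact g (delta w) v"
    by (simp add: Cons letter_act_def)
   also have "\<dots> = (\<Sum>d\<in>B. r g c d * gact g (%v. delta (b # w) (d # v)) v)"
   proof -
    have "gact g (%v. delta (b # w) (d # v)) v = (if d = b then gact g (delta w) v else 0)" for d
    proof (cases "d = b")
     case True
     have "(%v. delta (b # w) (b # v)) = delta w" by (auto simp: delta_def fun_eq_iff)
     then show ?thesis using True by simp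
    next
     case False
     then have "(%v. delta (b # w) (d # v)) = (%_. 0)" by (auto simp: delta_def fun_eq_iff)
     then show ?thesis using False by simp
    qed
    then show ?thesis using b by (simp add: if_distrib[of "%x. _ * x"] sum.delta cong: if_cong)
   qed
   finally show ?thesis by (simp add: Cons tensor_algebra_simps(5))
  qed
  ultimately show ?case by (simp add: fun_eq_iff)
 qed
 show ?thesis
  using p[unfolded tensor_algebra_simps(1)]
 proof (induction p rule: free_space_induct)
  case zero
  then show ?case using lin_zero[OF H(1)] by (simp add: fun_eq_iff)
 next
  case (add p q)
  then show ?case using HL(2)[of p q] by (simp add: fun_eq_iff gact_add tensor_algebra_simps(1))
 next
  case (smult c p)
  then show ?case using HL(3)[where x = p and c = c] by (simp add: fun_eq_iff gact_scale tensor_algebra_simps(1))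
 qed (rule word)
qed

text \<open>
 The map \<open>f\<^sub>1 \<otimes> \<dots> \<otimes> f\<^sub>n \<mapsto> g\<^sub>1 \<otimes> \<dots> \<otimes> g\<^sub>n\<close> for which \<open>x\<^sub>1f\<^sub>1 \<dots> x\<^sub>nf\<^sub>n = x\<^sub>1 \<dots> x\<^sub>n g\<^sub>1 \<dots> g\<^sub>n\<close> in a crossed product,
 where \<open>x\<^sub>i\<close> is the degree of \<open>f\<^sub>i\<close>.
\<close>

primrec untw :: "nat => ('b list => complex) => 'b list => complex" where
 "untw 0 q = (%u. q u)"
| "untw (Suc n) q = (%u. if last u \<in> B
  then gact (inv (deg (last u))) (untw n (%w. q (w @ [last u]))) (butlast u) else 0)"

definition untwist :: "('b list => complex) => 'b list => complex"
 where "untwist q u = untw (length u) q u"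

lemma untwist_Nil [simp]: "untwist q [] = q []"
 by (simp add: untwist_def)

lemma untwist_snoc: "untwist q (u @ [c]) = (if c \<in> B
  then gact (inv (deg c)) (untwist (%w. q (w @ [c]))) u else 0)"
proof -
 have "gact g (untw (length u) s) u = gact g (untwist s) u" for g s
  by (rule gact_cong_length) (simp add: untwist_def)
 then show ?thesis by (simp add: untwist_def[of q])
qed

lemma untwist_cong_length:
 "(!!w. length w = length u ==> s w = t w) ==> untwist s u = untwist t u"
proof (induction "length u" arbitrary: u s t)
 case (Suc n)
 then obtain v c where u: "u = v @ [c]" by (metis length_Suc_conv_rev)
 have "gact g (untwist (%w. s (w @ [c]))) v = gact g (untwist (%w. t (w @ [c]))) v" for g
  using Suc u by (intro gact_cong_length Suc.hyps(1)) auto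
 then show ?case by (simp add: u untwist_snoc)
qed simp

lemma untwist_sum: "untwist (%w. \<Sum>i\<in>I. k i * s i w) u = (\<Sum>i\<in>I. k i * untwist (s i) u)"
proof (induction "length u" arbitrary: u s)
 case (Suc n)
 then obtain v c where u: "u = v @ [c]" by (metis length_Suc_conv_rev)
 have "gact g (untwist (%w. \<Sum>i\<in>I. k i * s i (w @ [c]))) v =
   gact g (%x. \<Sum>i\<in>I. k i * untwist (%w. s i (w @ [c])) x) v" for g
  using Suc u by (intro gact_cong_length Suc.hyps(1)) auto
 then show ?case by (simp add: u untwist_snoc gact_sum)
qed simp

lemma untwist_add: "untwist (%w. s w + t w) u = untwist s u + untwist t u"
 and untwist_scale: "untwist (%w. c * s w) u = c * untwist s u"
 and untwist_zero [simp]: "untwist (%_. 0) u = 0"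
 using untwist_sum[of "%_. 1" "%i. if i then s else t" UNIV u] untwist_sum[of "%_. c" "%_. s" "{()}" u]
  untwist_sum[of _ _ "{}" u]
 by (simp_all add: UNIV_bool add.commute)

lemma untwist_outside:
 assumes "!!w. w \<notin> lists B ==> q w = 0" "u \<notin> lists B"
 shows "untwist q u = 0"
 using assms
proof (induction "length u" arbitrary: u q)
 case (Suc n)
 then obtain v c where u: "u = v @ [c]" by (metis length_Suc_conv_rev)
 show ?case
 proof (cases "c \<in> B")
  case True
  then have v: "v \<notin> lists B" using Suc.prems(2) u by auto
  have "gact (inv (deg c)) (untwist (%w. q (w @ [c]))) v =
    gact (inv (deg c)) (%x. if length x = n then untwist (%w. q (w @ [c])) x else 0) v"
   using Suc.hyps(2) u by (intro gact_cong_length) auto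
  also have "\<dots> = 0"
  proof (rule gact_outside[OF _ _ v])
   have "q (w @ [c]) = 0" if "w \<notin> lists B" for w using Suc.prems(1)[of "w @ [c]"] that by simp
   then show "(if length x = n then untwist (%w. q (w @ [c])) x else 0) = 0" if "x \<notin> lists B" for x
    using Suc.hyps(1)[of x "%w. q (w @ [c])"] that by simp
  qed (use True in simp)
  finally show ?thesis by (simp add: u untwist_snoc)
 qed (simp add: u untwist_snoc)
qed simp

lemma untwist_closed:
 assumes "q \<in> carrier T"
 shows "untwist q \<in> carrier T"
proof -
 obtain n where n: "!!w. q w ~= 0 ==> length w \<le> n" and out: "!!w. w \<notin> lists B ==> q w = 0"
  using assms tensor_algebra_iff[OF fin] by metis
 have "untwist q u = 0" if "length u > n" for u
 proof -
  have "untwist q u = untwist (%_. 0) u"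
   using n that by (intro untwist_cong_length) force
  then show ?thesis by simp
 qed
 then have "\<forall>w. untwist q w ~= 0 --> length w \<le> n" using not_less by blast
 moreover have "\<forall>u. u \<notin> lists B --> untwist q u = 0"
  using untwist_outside[OF out] by (intro allI impI)
 ultimately show ?thesis unfolding tensor_algebra_iff[OF fin] by (intro conjI exI[of _ n])
qed

lemma gact_inv_gact:
 assumes "g \<in> carrier G" "!!w. w \<notin> lists B ==> s w = 0"
 shows "gact g (gact (inv g) s) = s" "gact (inv g) (gact g s) = s"
 using assms gact_one[of s] by (auto simp: gact_mult fun_eq_iff)

text \<open>
 \<open>untwist\<close> acts on the tensors with a given last letter by an invertible operator, so injectivity
 and surjectivity follow by induction on the length.
\<close>

lemma untwist_inj:
 assumes "!!w. w \<notin> lists B ==> q w = 0" "!!u. untwist q u = 0"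
 shows "q u = 0"
 using assms
proof (induction u arbitrary: q rule: rev_induct)
 case Nil
 from Nil(2)[of "[]"] show ?case by simp
next
 case (snoc c u)
 show ?case
 proof (cases "c \<in> B")
  case True
  let ?q = "%w. q (w @ [c])"
  have out: "?q w = 0" if "w \<notin> lists B" for w using snoc.prems(1) that by simp
  have "gact (inv (deg c)) (untwist ?q) = (%_. 0)"
   using snoc.prems(2)[of "_ @ [c]"] True by (simp add: untwist_snoc fun_eq_iff)
  moreover have "untwist ?q w = 0" if "w \<notin> lists B" for w
   using untwist_outside[of ?q w] out that by blast
  ultimately have "untwist ?q = gact (deg c) (%_. 0)"
   using gact_inv_gact(1)[OF deg_closed[OF True], of "untwist ?q"] by simp
  then have "untwist ?q v = 0" for v by simp
  then show ?thesis using snoc.IH[of ?q] out by blast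
 next
  case False
  then show ?thesis using snoc.prems(1) by simp
 qed
qed

lemma untwist_surj:
 assumes "p \<in> carrier T"
 shows "\<exists>q\<in>carrier T. untwist q = p"
proof -
 have "\<exists>q. (\<forall>w. w \<notin> lists B --> q w = 0) \<and> (\<forall>w. q w ~= 0 --> length w \<le> n) \<and> untwist q = p"
  if "\<forall>w. w \<notin> lists B --> p w = 0" "\<forall>w. p w ~= 0 --> length w \<le> n" for n p
  using that
 proof (induction n arbitrary: p)
  case 0
  have "untwist p u = p u" for u
  proof (cases "u = []")
   case False
   have "untwist p u = untwist (%_. 0) u"
    using 0(2) False by (intro untwist_cong_length) auto
   then show ?thesis using 0(2) False by (simp, metis)
  qed simp
  then show ?case using 0 by (intro exI[of _ p]) auto
 next
  case (Suc n)
  let ?p = "%c. gact (deg c) (%w. p (w @ [c]))"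
  have "\<exists>q. (\<forall>w. w \<notin> lists B --> q w = 0) \<and> (\<forall>w. q w ~= 0 --> length w \<le> n) \<and> untwist q = ?p c"
   if c: "c \<in> B" for c
  proof (rule Suc.IH)
   show "\<forall>w. w \<notin> lists B --> ?p c w = 0"
    using gact_outside[OF deg_closed[OF c], of "%w. p (w @ [c])"] Suc.prems(1) by auto
   show "\<forall>w. ?p c w ~= 0 --> length w \<le> n"
   proof (intro allI impI, rule ccontr)
    fix w assume w: "?p c w ~= 0" "\<not> length w \<le> n"
    have "?p c w = gact (deg c) (%_. 0) w"
     using Suc.prems(2) w(2) by (intro gact_cong_length) fastforce
    then show False using w(1) by simp
   qed
  qed
  then obtain Q where Q: "!!c w. c \<in> B ==> w \<notin> lists B ==> Q c w = 0"
   "!!c w. c \<in> B ==> Q c w ~= 0 ==> length w \<le> n" "!!c. c \<in> B ==> untwist (Q c) = ?p c"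
   by metis
  define q where "q w = (if w = [] then p [] else if last w \<in> B then Q (last w) (butlast w) else 0)" for w
  have "untwist q u = p u" for u
  proof (cases u rule: rev_cases)
   case Nil
   then show ?thesis by (simp add: q_def)
  next
   case (snoc v c)
   show ?thesis
   proof (cases "c \<in> B")
    case True
    have "(%w. q (w @ [c])) = Q c" using True by (simp add: q_def fun_eq_iff)
    then have "untwist q u = gact (inv (deg c)) (?p c) v"
     using True Q(3) by (simp add: snoc untwist_snoc)
    also have "\<dots> = p u"
     using gact_inv_gact(2)[OF deg_closed[OF True], of "%w. p (w @ [c])"] Suc.prems(1) by (simp add: snoc fun_eq_iff)
    finally show ?thesis .
   next
    case False
    then show ?thesis using Suc.prems(1) by (simp add: snoc untwist_snoc)
   qed
  qed
  moreover have "q w = 0" if "w \<notin> lists B" for w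
   using that Q(1) by (cases w rule: rev_cases) (auto simp: q_def)
  moreover have "length w \<le> Suc n" if "q w ~= 0" for w
   using that Q(2) by (cases w rule: rev_cases) (auto simp: q_def split: if_splits)
  ultimately show ?case by (intro exI[of _ q]) auto
 qed
 then have key: "\<exists>q. (\<forall>w. w \<notin> lists B --> q w = 0) \<and> (\<forall>w. q w ~= 0 --> length w \<le> n) \<and> untwist q = p"
  if "\<forall>w. w \<notin> lists B --> p w = 0" "\<forall>w. p w ~= 0 --> length w \<le> n" for n using that by blast
 obtain n where "\<forall>w. w \<notin> lists B --> p w = 0" "\<forall>w. p w ~= 0 --> length w \<le> n"
  using assms unfolding tensor_algebra_iff[OF fin] by blast
 from key[OF this] obtain q where q: "\<forall>w. w \<notin> lists B --> q w = 0" "\<forall>w. q w ~= 0 --> length w \<le> n" "untwist q = p"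
  by (elim exE conjE)
 from q(1,2) have "q \<in> carrier T" unfolding tensor_algebra_iff[OF fin] by (intro conjI exI[of _ n])
 with q(3) show ?thesis by (rule bexI)
qed

lemma untwist_delta_snoc:
 assumes "w \<in> lists B" "f \<in> B"
 shows "untwist (delta (w @ [f])) = tact (inv (deg f)) (untwist (delta w)) \<otimes>\<^bsub>T\<^esub> delta [f]"
proof
 note [simp del] = tensor_algebra_simps(1)
 fix u
 let ?p = "tact (inv (deg f)) (untwist (delta w))"
 have p: "?p = gact (inv (deg f)) (untwist (delta w))"
  using assms untwist_closed[OF word_closed[OF assms(1)]] by (simp add: tact_gact)
 have R: "(\<Sum>k\<le>length u. ?p (take k u) * delta [f] (drop k u)) = (\<Sum>k\<in>{length u - 1}. ?p (take k u) * delta [f] (drop k u))"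
 proof (rule sum.mono_neutral_right)
  show "\<forall>k\<in>{..length u} - {length u - 1}. ?p (take k u) * delta [f] (drop k u) = 0"
  proof
   fix k assume k: "k \<in> {..length u} - {length u - 1}"
   then have "length (drop k u) ~= 1" by auto
   then have "drop k u ~= [f]" by (metis One_nat_def length_Cons list.size(3))
   then show "?p (take k u) * delta [f] (drop k u) = 0" by simp
  qed
 qed auto
 show "untwist (delta (w @ [f])) u = (?p \<otimes>\<^bsub>T\<^esub> delta [f]) u"
 proof (cases u rule: rev_cases)
  case Nil
  then show ?thesis by (simp add: delta_def)
 next
  case (snoc v c)
  have "(?p \<otimes>\<^bsub>T\<^esub> delta [f]) u = ?p v * delta [f] [c]"
   using R by (simp add: snoc)
  moreover have "untwist (delta (w @ [f])) u = (if c = f then ?p v else 0)"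
  proof (cases "c = f")
   case True
   have "(%v. delta (w @ [f]) (v @ [f])) = delta w" by (simp add: delta_def fun_eq_iff)
   then show ?thesis using True assms(2) by (simp add: snoc untwist_snoc p)
  next
   case False
   then have "(%v. delta (w @ [f]) (v @ [c])) = (%_. 0)" by (simp add: delta_def fun_eq_iff)
   then have "untwist (delta (w @ [f])) u = (if c \<in> B then gact (inv (deg c)) (untwist (%_. 0)) v else 0)"
    by (simp add: snoc untwist_snoc)
   moreover have "untwist (%_. 0) = (%_. 0)" by (simp add: fun_eq_iff)
   ultimately show ?thesis using False by simp
  qed
  ultimately show ?thesis by (simp add: delta_def)
 qed
qed

subsection \<open>Compatibility with the braidings\<close>

context
 fixes \<Psi> :: "'b => 'b => 'b list => complex"
 assumes \<Psi>: "!!b c e f. b \<in> B ==> c \<in> B ==> \<Psi> b c [e, f] = (if f = b then r (deg b) e c else 0)"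
begin

lemma flip_value:
 "(\<Sum>b\<in>B. \<Sum>c\<in>B. s b c * flip_conj \<Psi> b c [e, f]) = (if e \<in> B then \<Sum>b\<in>B. s b e * r (deg e) f b else 0)"
proof -
 have "(\<Sum>b\<in>B. \<Sum>c\<in>B. s b c * flip_conj \<Psi> b c [e, f]) = (\<Sum>b\<in>B. \<Sum>c\<in>B. if c = e then s b c * r (deg c) f b else 0)"
  by (intro sum.cong refl) (simp add: flip_conj_def \<Psi>)
 then show ?thesis by simp
qed

lemma braid_value:
 "(\<Sum>b\<in>B. \<Sum>c\<in>B. s b c * \<Psi> b c [e, f]) = (if f \<in> B then \<Sum>c\<in>B. s f c * r (deg f) e c else 0)"
proof -
 have "(\<Sum>b\<in>B. \<Sum>c\<in>B. s b c * \<Psi> b c [e, f]) = (\<Sum>b\<in>B. if b = f then \<Sum>c\<in>B. s b c * r (deg b) e c else 0)"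
  by (intro sum.cong refl) (auto simp: \<Psi>)
 then show ?thesis by simp
qed

text \<open>
 The flipped braiding is \<open>b \<otimes> c \<mapsto> c \<otimes> (deg c \<triangleright> b)\<close> and
 commutes with the group for the same reason as the original one.
\<close>

lemma gact_braid_flip:
 assumes g: "g \<in> carrier G"
 shows "gact g (braid_at B (flip_conj \<Psi>) i s) u = braid_at B (flip_conj \<Psi>) i (gact g s) u"
proof (induction u arbitrary: i s)
 case Nil
 then show ?case by (simp add: braid_at_def)
next
 case (Cons c1 u)
 let ?\<Phi> = "flip_conj \<Psi>"
 show ?case
 proof (cases i)
  case (Suc j)
  have "gact g (braid_at B ?\<Phi> i s) (c1 # u) = (\<Sum>d\<in>B. r g c1 d * braid_at B ?\<Phi> j (gact g (%v. s (d # v))) u)"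
   by (simp add: Suc braid_at_Suc_Cons Cons.IH)
  also have "\<dots> = braid_at B ?\<Phi> i (gact g s) (c1 # u)"
   by (simp add: Suc braid_at_Suc_Cons braid_at_sum)
  finally show ?thesis .
 next
  case 0
  show ?thesis
  proof (cases u)
   case Nil
   have "gact g (braid_at B ?\<Phi> 0 s) [c1] = gact g s [c1]"
    by (rule gact_cong_length) (simp add: braid_at_def)
   then show ?thesis using Nil 0 by (simp add: braid_at_def)
  next
   case (Cons c2 v)
   let ?K = "%b d. gact g (%v. s (b # d # v)) v"
   have 1: "(%v. braid_at B ?\<Phi> 0 s (d1 # d2 # v)) = (%v. \<Sum>b\<in>B. r (deg d1) d2 b * s (b # d1 # v))" if "d1 \<in> B" for d1 d2
    using flip_value[of "%b c. s (b # c # _)" d1 d2] that by (simp add: braid_at_def fun_eq_iff mult.commute)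
   have "gact g (braid_at B ?\<Phi> i s) (c1 # u) =
     (\<Sum>d1\<in>B. r g c1 d1 * (\<Sum>d2\<in>B. r g c2 d2 * (\<Sum>b\<in>B. r (deg d1) d2 b * ?K b d1)))"
    by (simp add: 0 Cons 1 gact_sum)
   also have "\<dots> = (\<Sum>d1\<in>B. r g c1 d1 * (\<Sum>b\<in>B. r (g \<otimes> deg d1) c2 b * ?K b d1))"
   proof (rule sum.cong[OF refl])
    fix d1 assume d1: "d1 \<in> B"
    have "(\<Sum>d2\<in>B. r g c2 d2 * (\<Sum>b\<in>B. r (deg d1) d2 b * ?K b d1)) = (\<Sum>d2\<in>B. \<Sum>b\<in>B. r g c2 d2 * r (deg d1) d2 b * ?K b d1)"
     by (simp add: sum_distrib_left mult.assoc)
    also have "\<dots> = (\<Sum>b\<in>B. r (g \<otimes> deg d1) c2 b * ?K b d1)"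
     using g d1 by (subst sum.swap) (simp add: r_mult sum_distrib_right)
    finally show "r g c1 d1 * (\<Sum>d2\<in>B. r g c2 d2 * (\<Sum>b\<in>B. r (deg d1) d2 b * ?K b d1)) = r g c1 d1 * (\<Sum>b\<in>B. r (g \<otimes> deg d1) c2 b * ?K b d1)"
     by simp
   qed
   also have "\<dots> = (if c1 \<in> B then \<Sum>d1\<in>B. r g c1 d1 * (\<Sum>b\<in>B. r (deg c1 \<otimes> g) c2 b * ?K b d1) else 0)"
   proof (cases "c1 \<in> B")
    case True
    have "r g c1 d1 * (\<Sum>b\<in>B. r (g \<otimes> deg d1) c2 b * ?K b d1) =
      r g c1 d1 * (\<Sum>b\<in>B. r (deg c1 \<otimes> g) c2 b * ?K b d1)" if "d1 \<in> B" for d1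
    proof (cases "r g c1 d1 = 0")
     case False
     then have "deg c1 \<otimes> g = g \<otimes> deg d1"
      using r_deg[OF g True that] g that by (simp add: G.m_assoc)
     then show ?thesis by simp
    qed simp
    then have "(\<Sum>d1\<in>B. r g c1 d1 * (\<Sum>b\<in>B. r (g \<otimes> deg d1) c2 b * ?K b d1)) =
      (\<Sum>d1\<in>B. r g c1 d1 * (\<Sum>b\<in>B. r (deg c1 \<otimes> g) c2 b * ?K b d1))"
     by (rule sum.cong[OF refl])
    then show ?thesis using True by (simp only: if_True)
   next
    case False
    then show ?thesis using r_outside[OF g] by simp
   qed
   also have "\<dots> = (if c1 \<in> B then \<Sum>b\<in>B. gact g s (b # c1 # v) * r (deg c1) c2 b else 0)"
   proof -
    have "(\<Sum>d1\<in>B. r g c1 d1 * (\<Sum>b\<in>B. r (deg c1 \<otimes> g) c2 b * ?K b d1)) =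
      (\<Sum>b\<in>B. gact g s (b # c1 # v) * r (deg c1) c2 b)" if c1: "c1 \<in> B"
    proof -
     have "(\<Sum>d1\<in>B. r g c1 d1 * (\<Sum>b\<in>B. r (deg c1 \<otimes> g) c2 b * ?K b d1)) =
       (\<Sum>d1\<in>B. \<Sum>b\<in>B. \<Sum>e\<in>B. r (deg c1) c2 e * (r g e b * (r g c1 d1 * ?K b d1)))"
      using c1 g by (simp add: r_mult sum_distrib_left sum_distrib_right mult.assoc mult.left_commute)
     also have "\<dots> = (\<Sum>e\<in>B. \<Sum>b\<in>B. \<Sum>d1\<in>B. r (deg c1) c2 e * (r g e b * (r g c1 d1 * ?K b d1)))"
      by (subst sum.swap, subst (2) sum.swap, subst sum.swap) (rule refl)
     also have "\<dots> = (\<Sum>b\<in>B. gact g s (b # c1 # v) * r (deg c1) c2 b)"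
      by (simp add: sum_distrib_left sum_distrib_right mult.assoc mult.commute mult.left_commute)
     finally show ?thesis .
    qed
    then show ?thesis by simp
   qed
   also have "\<dots> = braid_at B ?\<Phi> i (gact g s) (c1 # u)"
    using flip_value[of "%b c. gact g s (b # c # v)" c1 c2] by (simp add: 0 Cons braid_at_def del: gact.simps)
   finally show ?thesis .
  qed
 qed
qed

lemma braid_at_snoc: "Suc i < length u ==> braid_at B \<Phi> i q (u @ [c]) = braid_at B \<Phi> i (%w. q (w @ [c])) u"
 by (simp add: braid_at_def nth_append list_update_append)

lemma braid_at_last: "braid_at B \<Phi> (length u) q (u @ [c, d]) = (\<Sum>e\<in>B. \<Sum>f\<in>B. q (u @ [e, f]) * \<Phi> e f [c, d])"
 by (simp add: braid_at_def nth_append list_update_append)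

lemma untwist_snoc2:
 assumes "c \<in> B" "d \<in> B"
 shows "untwist q (u @ [c, d]) = (\<Sum>e\<in>B. r (inv (deg d)) c e *
  gact (inv (deg d) \<otimes> inv (deg e)) (untwist (%w. q (w @ [e, d]))) u)"
proof -
 have "untwist q (u @ [c, d]) = gact (inv (deg d)) (untwist (%w. q (w @ [d]))) (u @ [c])"
  using untwist_snoc[of q "u @ [c]" d] assms(2) by simp
 also have "\<dots> = (\<Sum>e\<in>B. r (inv (deg d)) c e * gact (inv (deg d)) (%w. untwist (%w. q (w @ [d])) (w @ [e])) u)"
  by (rule gact_snoc)
 also have "\<dots> = (\<Sum>e\<in>B. r (inv (deg d)) c e *
  gact (inv (deg d) \<otimes> inv (deg e)) (untwist (%w. q (w @ [e, d]))) u)"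
  using assms by (intro sum.cong refl) (simp add: untwist_snoc gact_mult)
 finally show ?thesis .
qed

lemma untwist_snoc2_outside: "c \<notin> B \<or> d \<notin> B ==> untwist q (u @ [c, d]) = 0"
proof -
 assume cd: "c \<notin> B \<or> d \<notin> B"
 have "untwist q (u @ [c, d]) = (if d \<in> B then gact (inv (deg d)) (untwist (%w. q (w @ [d]))) (u @ [c]) else 0)"
  using untwist_snoc[of q "u @ [c]" d] by simp
 also have "\<dots> = 0"
  using cd by (auto simp: gact_snoc r_outside)
 finally show ?thesis .
qed

text \<open>
 Away from the last two letters this follows by induction, from \<open>gact_braid_flip\<close>. For the last
 two letters both sides are computed; the group elements agree because \<open>deg (g \<triangleright> b) g = g
 deg b\<close>.
\<close>

lemma untwist_braid: "braid_at B (flip_conj \<Psi>) i (untwist q) u = untwist (braid_at B \<Psi> i q) u"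
proof (induction "length u" arbitrary: u q)
 case 0
 then show ?case by (simp add: braid_at_def)
next
 case (Suc n)
 then obtain u' d where u: "u = u' @ [d]" and len: "length u' = n" by (metis length_Suc_conv_rev length_append_singleton nat.inject)
 let ?\<Phi> = "flip_conj \<Psi>"
 consider (short) "length u \<le> Suc i" | (inner) "Suc i < length u'" | (last) "length u' = Suc i"
  using u by fastforce
 then show ?case
 proof cases
  case short
  have "untwist (braid_at B \<Psi> i q) u = untwist q u"
   using short by (intro untwist_cong_length) (simp add: braid_at_def)
  then show ?thesis using short by (simp add: braid_at_def)
 next
  case inner
  have "braid_at B ?\<Phi> i (untwist q) u = braid_at B ?\<Phi> i (%w. untwist q (w @ [d])) u'"
   unfolding u by (rule braid_at_snoc[OF inner])
  also have "\<dots> = untwist (braid_at B \<Psi> i q) u"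
  proof (cases "d \<in> B")
   case True
   let ?x = "inv (deg d)"
   have "(%w. untwist q (w @ [d])) = gact ?x (untwist (%w. q (w @ [d])))"
    using True by (simp add: untwist_snoc fun_eq_iff)
   then have "braid_at B ?\<Phi> i (%w. untwist q (w @ [d])) u' = gact ?x (braid_at B ?\<Phi> i (untwist (%w. q (w @ [d])))) u'"
    using True by (simp add: gact_braid_flip)
   also have "\<dots> = gact ?x (untwist (braid_at B \<Psi> i (%w. q (w @ [d])))) u'"
    using Suc.hyps(1) len by (intro gact_cong_length) simp
   also have "\<dots> = gact ?x (untwist (%w. braid_at B \<Psi> i q (w @ [d]))) u'"
    using inner by (intro gact_cong_length untwist_cong_length) (simp add: braid_at_snoc)
   finally show ?thesis using True by (simp add: u untwist_snoc)
  next
   case False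
   then show ?thesis
    using braid_at_scale[of B ?\<Phi> i 0 "%_. 0"] by (simp add: u untwist_snoc)
  qed
  finally show ?thesis .
 next
  case last
  then obtain v c where v: "u' = v @ [c]" and i: "length v = i" by (metis length_Suc_conv_rev length_append_singleton nat.inject)
  have uv: "u = v @ [c, d]" using u v by simp
  let ?U = "%e f. untwist (%w. q (w @ [e, f]))"
  let ?x = "%b. inv (deg b)"
  show ?thesis
  proof (cases "c \<in> B \<and> d \<in> B")
   case True
   then have c: "c \<in> B" and d: "d \<in> B" by auto
   \<comment> \<open>The matrices of \<open>g\<close> and \<open>g\<inverse>\<close> are inverse to each other.\<close>
   have kron: "(\<Sum>b\<in>B. r g e b * r (inv g) b f) = (if e = f then 1 else 0)"
    "(\<Sum>b\<in>B. r (inv g) e b * r g b f) = (if e = f then 1 else 0)"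
    if "g \<in> carrier G" "e \<in> B" "f \<in> B" for g e f
    using r_mult[of g "inv g" f e] r_mult[of "inv g" g f e] r_one[of e f] that by simp_all
   have "braid_at B ?\<Phi> i (untwist q) u = (\<Sum>b\<in>B. untwist q (v @ [b, c]) * r (deg c) d b)"
    unfolding uv i[symmetric] braid_at_last using flip_value[of "%b c. untwist q (v @ [b, c])" c d] c by simp
   also have "\<dots> = (\<Sum>b\<in>B. \<Sum>e\<in>B. r (deg c) d b * r (?x c) b e * gact (?x c \<otimes> ?x e) (?U e c) v)"
    using c by (intro sum.cong refl) (simp add: untwist_snoc2 sum_distrib_left mult_ac)
   also have "\<dots> = (\<Sum>e\<in>B. (\<Sum>b\<in>B. r (deg c) d b * r (?x c) b e) * gact (?x c \<otimes> ?x e) (?U e c) v)"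
    by (subst sum.swap) (simp add: sum_distrib_right)
   also have "\<dots> = (\<Sum>e\<in>B. if e = d then gact (?x c \<otimes> ?x e) (?U e c) v else 0)"
    using c d kron(1) by (intro sum.cong refl) auto
   also have "\<dots> = gact (?x c \<otimes> ?x d) (?U d c) v"
    using d by simp
   finally have L: "braid_at B ?\<Phi> i (untwist q) u = gact (?x c \<otimes> ?x d) (?U d c) v" .
   have B: "(untwist (%w. braid_at B \<Psi> i q (w @ [e, d]))) w = (\<Sum>b\<in>B. r (deg d) e b * ?U d b w)" if "length w = i" for e w
   proof -
    have "braid_at B \<Psi> i q (w @ [e, d]) = (\<Sum>b\<in>B. r (deg d) e b * q (w @ [d, b]))" if "length w = i" for w
     using braid_at_last[of \<Psi> w q e d] braid_value[of "%b c. q (w @ [b, c])" e d] that d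
     by (simp add: mult.commute)
    then have "(untwist (%w. braid_at B \<Psi> i q (w @ [e, d]))) w = untwist (%w. \<Sum>b\<in>B. r (deg d) e b * q (w @ [d, b])) w"
     using that by (intro untwist_cong_length) simp
    then show ?thesis by (simp add: untwist_sum)
   qed
   have "untwist (braid_at B \<Psi> i q) u = (\<Sum>e\<in>B. r (?x d) c e *
     gact (?x d \<otimes> ?x e) (untwist (%w. braid_at B \<Psi> i q (w @ [e, d]))) v)"
    unfolding uv by (rule untwist_snoc2[OF c d])
   also have "\<dots> = (\<Sum>e\<in>B. r (?x d) c e * (\<Sum>b\<in>B. r (deg d) e b * gact (?x c \<otimes> ?x d) (?U d b) v))"
   proof (rule sum.cong[OF refl])
    fix e assume e: "e \<in> B"
    have "gact g (untwist (%w. braid_at B \<Psi> i q (w @ [e, d]))) v = (\<Sum>b\<in>B. r (deg d) e b * gact g (?U d b) v)" for g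
    proof -
     have "gact g (untwist (%w. braid_at B \<Psi> i q (w @ [e, d]))) v = gact g (%w. \<Sum>b\<in>B. r (deg d) e b * ?U d b w) v"
      using B i by (intro gact_cong_length) simp
     then show ?thesis by (simp add: gact_sum)
    qed
    moreover have "?x d \<otimes> ?x e = ?x c \<otimes> ?x d" if "r (?x d) c e ~= 0"
    proof -
     have "deg c = ?x d \<otimes> deg e \<otimes> deg d" using r_deg[OF _ c e that] d by simp
     then have "deg d \<otimes> deg c = deg e \<otimes> deg d"
      using c d e by (simp add: G.m_assoc[symmetric])
     then have "inv (deg d \<otimes> deg c) = inv (deg e \<otimes> deg d)" by simp
     then show ?thesis using c d e by (simp add: G.inv_mult_group)
    qed
    ultimately show "r (?x d) c e * gact (?x d \<otimes> ?x e) (untwist (%w. braid_at B \<Psi> i q (w @ [e, d]))) v =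
      r (?x d) c e * (\<Sum>b\<in>B. r (deg d) e b * gact (?x c \<otimes> ?x d) (?U d b) v)"
     by (cases "r (?x d) c e = 0") simp_all
   qed
   also have "\<dots> = (\<Sum>b\<in>B. (\<Sum>e\<in>B. r (?x d) c e * r (deg d) e b) * gact (?x c \<otimes> ?x d) (?U d b) v)"
    unfolding sum_distrib_left sum_distrib_right by (subst sum.swap) (simp add: mult.assoc)
   also have "\<dots> = (\<Sum>b\<in>B. if b = c then gact (?x c \<otimes> ?x d) (?U d b) v else 0)"
    using c d kron(2) by (intro sum.cong refl) auto
   also have "\<dots> = gact (?x c \<otimes> ?x d) (?U d c) v"
    using c by simp
   finally show ?thesis using L by simp
  next
   case False
   have "braid_at B ?\<Phi> i (untwist q) u = (if c \<in> B then \<Sum>b\<in>B. untwist q (v @ [b, c]) * r (deg c) d b else 0)"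
    unfolding uv i[symmetric] braid_at_last using flip_value[of "%b c. untwist q (v @ [b, c])" c d] by simp
   also have "\<dots> = 0" using False r_outside by auto
   finally show ?thesis using untwist_snoc2_outside False by (simp add: uv)
  qed
 qed
qed

lemma untwist_factorial: "braided_factorial B (flip_conj \<Psi>) n (untwist q) = untwist (braided_factorial B \<Psi> n q)"
proof -
 have "braid_word B (flip_conj \<Psi>) is (untwist q) = untwist (braid_word B \<Psi> is q)" for "is"
  by (induction "is") (simp_all add: untwist_braid[abs_def])
 then show ?thesis
  unfolding braided_factorial_def braid_perm_def
  by (simp add: fun_eq_iff untwist_sum[of "%_::nat => nat. 1", simplified] del: comp_apply)
qed

lemma untwist_homogeneous: "homogeneous_part n (untwist q) = untwist (homogeneous_part n q)"
proof
 fix u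
 have "untwist (homogeneous_part n q) u = untwist (if length u = n then q else (%_. 0)) u"
  by (rule untwist_cong_length) (simp add: homogeneous_part_def)
 then show "homogeneous_part n (untwist q) u = untwist (homogeneous_part n q) u"
  by (simp add: homogeneous_part_def)
qed

text \<open>
 Since \<open>untwist\<close> intertwines the two families of operators at all places, it intertwines the two
 braided factorials; and it is injective.
\<close>

lemma nichols_ideal_flip:
 assumes q: "q \<in> carrier T"
 shows "untwist q \<in> nichols_ideal B (flip_conj \<Psi>) \<longleftrightarrow> q \<in> kern"
proof -
 have "braided_factorial B (flip_conj \<Psi>) n (homogeneous_part n (untwist q)) = (%_. 0) \<longleftrightarrow>
   braided_factorial B \<Psi> n (homogeneous_part n q) = (%_. 0)" for n
 proof -
  let ?s = "braided_factorial B \<Psi> n (homogeneous_part n q)"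
  have out: "?s w = 0" if "w \<notin> lists B" for w
   using braided_factorial_homogeneous[OF \<Psi> q] Sym_outside[OF q that] by simp
  have "untwist ?s = (%_. 0) \<longleftrightarrow> ?s = (%_. 0)"
  proof
   assume "untwist ?s = (%_. 0)"
   then have "?s u = 0" for u by (intro untwist_inj[of ?s u] out) (simp_all add: fun_eq_iff)
   then show "?s = (%_. 0)" by (simp add: fun_eq_iff)
  next
   assume "?s = (%_. 0)"
   then show "untwist ?s = (%_. 0)" by (simp only: untwist_zero[abs_def])
  qed
  then show ?thesis by (simp add: untwist_homogeneous untwist_factorial)
 qed
 then show ?thesis
  using q untwist_closed[OF q] nichols_ideal_kern[OF \<Psi>] unfolding nichols_ideal_def by blast
qed

end

subsection \<open>Twisting a covariant homomorphism\<close>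

context
 fixes A :: "(complex, 'a) module" and u :: "'g => 'a" and F :: "('b list => complex) => 'a"
 assumes A: "complex_algebra A"
  and u: "!!g. g \<in> carrier G ==> u g \<in> carrier A" "u \<one> = \<one>\<^bsub>A\<^esub>"
   "!!g h. g \<in> carrier G ==> h \<in> carrier G ==> u (g \<otimes> h) = u g \<otimes>\<^bsub>A\<^esub> u h"
  and F: "alg_hom T A F"
  and cov: "!!g b. g \<in> carrier G ==> b \<in> B ==> u g \<otimes>\<^bsub>A\<^esub> F (delta [b]) = F (letter_act g b) \<otimes>\<^bsub>A\<^esub> u g"
begin

text \<open>
 The relation \<open>u\<^sub>g F(b) = F(g \<triangleright> b) u\<^sub>g\<close> passes from letters to
 products.
\<close>

lemma covariant:
 assumes g: "g \<in> carrier G" and p: "p \<in> carrier T"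
 shows "u g \<otimes>\<^bsub>A\<^esub> F p = F (tact g p) \<otimes>\<^bsub>A\<^esub> u g"
proof (rule lin_eq_on_free[OF _ _ complex_algebra_vspc[OF A] _ p[unfolded tensor_algebra_simps(1)]])
 note [simp del] = tensor_opaque
 note H = alg_homD[OF alg_hom_tact[OF g]] and HL = linD[OF alg_homD(1)[OF alg_hom_tact[OF g]]]
 note FF = alg_homD[OF F] and FL = linD[OF alg_homD(1)[OF F]]
 show "lin (free_space (lists B)) A (%p. u g \<otimes>\<^bsub>A\<^esub> F p)"
  using lin_comp[OF FF(1) lin_mult_left[OF A u(1)[OF g]]] by simp
 show "lin (free_space (lists B)) A (%p. F (tact g p) \<otimes>\<^bsub>A\<^esub> u g)"
  using lin_comp[OF lin_comp[OF H(1) FF(1)] lin_mult_right[OF A u(1)[OF g]]] by simp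
 fix w assume "w \<in> lists B"
 then show "u g \<otimes>\<^bsub>A\<^esub> F (delta w) = F (tact g (delta w)) \<otimes>\<^bsub>A\<^esub> u g"
 proof (induction w)
  case Nil
  then show ?case using FF(2) H(2) A u(1)[OF g] by simp
 next
  case (Cons b w)
  then have b: "b \<in> B" and w: "w \<in> lists B" by auto
  note db = letter_closed[OF b] and dw = word_closed[OF w] and l = letter_act_closed[OF g b]
  have "F (delta (b # w)) = F (delta [b]) \<otimes>\<^bsub>A\<^esub> F (delta w)"
   using FF(3)[OF db dw] by (simp add: delta_mult)
  moreover have "F (tact g (delta (b # w))) = F (letter_act g b) \<otimes>\<^bsub>A\<^esub> F (tact g (delta w))"
   using H(3)[OF db dw] FF(3)[OF l HL(1)[OF dw]] tact_letter[OF g b] by (simp add: delta_mult)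
  moreover have "u g \<otimes>\<^bsub>A\<^esub> (F (delta [b]) \<otimes>\<^bsub>A\<^esub> F (delta w)) = F (letter_act g b) \<otimes>\<^bsub>A\<^esub> (u g \<otimes>\<^bsub>A\<^esub> F (delta w))"
   using algebra_assoc[OF A u(1)[OF g] FL(1)[OF db] FL(1)[OF dw]] cov[OF g b]
    algebra_assoc[OF A FL(1)[OF l] u(1)[OF g] FL(1)[OF dw]] by simp
  ultimately show ?case
   using Cons.IH algebra_assoc[OF A FL(1)[OF l] FL(1)[OF HL(1)[OF dw]] u(1)[OF g]] by simp
 qed
qed

context
 fixes Ft
 assumes Ft: "alg_hom T A Ft" and tw: "!!b. b \<in> B ==> Ft (delta [b]) = u (deg b) \<otimes>\<^bsub>A\<^esub> F (delta [b])"
begin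

text \<open>
 All group elements are collected on the left. When \<open>u\<^sub>d\<close> for the degree \<open>d\<close> of
 the last letter passes across the preceding product, \<open>d\<inverse>\<close> acts on it, as in the
 recursion for \<open>untwist\<close>.
\<close>

lemma twist_word:
 assumes "w \<in> lists B"
 shows "Ft (delta w) = u (Deg w) \<otimes>\<^bsub>A\<^esub> F (untwist (delta w))"
 using assms
proof (induction w rule: rev_induct)
 case Nil
 have "untwist (delta []) = delta []"
 proof
  fix v :: "'b list" show "untwist (delta []) v = delta [] v"
  proof (cases v rule: rev_cases)
   case (snoc v' c)
   have "(%w. delta [] (w @ [c])) = (%_. 0)" by (simp add: delta_def)
   moreover have "untwist (%_. 0) = (%_. 0)" by (simp add: fun_eq_iff)
   ultimately have "untwist (delta []) v = 0" by (simp add: snoc untwist_snoc del: delta_other)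
   then show ?thesis by (simp add: snoc)
  qed simp
 qed
 then show ?case using alg_homD(2)[OF F] alg_homD(2)[OF Ft] A u(2) by simp
next
 case (snoc f w)
 note [simp del] = tensor_opaque
 have f: "f \<in> B" and w: "w \<in> lists B" using snoc.prems by auto
 note FL = linD[OF alg_homD(1)[OF F]]
 let ?\<theta> = "untwist (delta w)" and ?x = "inv (deg f)"
 have \<theta>: "?\<theta> \<in> carrier T" by (rule untwist_closed[OF word_closed[OF w]])
 have xc: "?x \<in> carrier G" using f by simp
 have t\<theta>: "tact ?x ?\<theta> \<in> carrier T" using linD(1)[OF alg_homD(1)[OF alg_hom_tact[OF xc]] \<theta>] .
 note df = letter_closed[OF f] and D = Deg_closed[OF w] and hf = deg_closed[OF f]
 have "tact (deg f) (tact ?x ?\<theta>) = ?\<theta>"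
 proof -
  have "delta w v = 0" if "v \<notin> lists B" for v using w that by (cases "v = w") auto
  then have "?\<theta> v = 0" if "v \<notin> lists B" for v using untwist_outside[of "delta w" v] that by blast
  then show ?thesis
   using tact_gact[OF hf t\<theta>] tact_gact[OF xc \<theta>] gact_inv_gact(1)[OF hf, of ?\<theta>] by simp
 qed
 then have c: "F ?\<theta> \<otimes>\<^bsub>A\<^esub> u (deg f) = u (deg f) \<otimes>\<^bsub>A\<^esub> F (tact ?x ?\<theta>)"
  using covariant[OF hf t\<theta>] by simp
 have "Ft (delta (w @ [f])) = Ft (delta w) \<otimes>\<^bsub>A\<^esub> Ft (delta [f])"
  using alg_homD(3)[OF Ft word_closed[OF w] df] by (simp add: delta_mult)
 also have "\<dots> = u (Deg w) \<otimes>\<^bsub>A\<^esub> F ?\<theta> \<otimes>\<^bsub>A\<^esub> (u (deg f) \<otimes>\<^bsub>A\<^esub> F (delta [f]))"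
  using snoc.IH[OF w] tw[OF f] by simp
 also have "\<dots> = u (Deg w) \<otimes>\<^bsub>A\<^esub> (F ?\<theta> \<otimes>\<^bsub>A\<^esub> u (deg f)) \<otimes>\<^bsub>A\<^esub> F (delta [f])"
  using A u(1)[OF D] u(1)[OF hf] FL(1)[OF \<theta>] FL(1)[OF df] by (simp add: algebra_assoc)
 also have "\<dots> = u (Deg w) \<otimes>\<^bsub>A\<^esub> u (deg f) \<otimes>\<^bsub>A\<^esub> (F (tact ?x ?\<theta>) \<otimes>\<^bsub>A\<^esub> F (delta [f]))"
  unfolding c using A u(1)[OF D] u(1)[OF hf] FL(1)[OF t\<theta>] FL(1)[OF df] by (simp add: algebra_assoc)
 also have "\<dots> = u (Deg (w @ [f])) \<otimes>\<^bsub>A\<^esub> F (untwist (delta (w @ [f])))"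
  using alg_homD(3)[OF F t\<theta> df] untwist_delta_snoc[OF w f] u(3)[OF D hf] w f by (simp add: Deg_append)
 finally show ?case .
qed

lemma twist_homogeneous:
 assumes g: "g \<in> carrier G" and q: "q \<in> carrier (free_space {w \<in> lists B. Deg w = g})"
 shows "Ft q = u g \<otimes>\<^bsub>A\<^esub> F (untwist q)"
proof (rule lin_eq_on_free[OF _ _ complex_algebra_vspc[OF A] _ q])
 have sub: "{w \<in> lists B. Deg w = g} \<subseteq> lists B" by auto
 show "lin (free_space {w \<in> lists B. Deg w = g}) A Ft"
  using lin_subspace[OF sub] alg_homD(1)[OF Ft] by simp
 have "lin T T untwist"
  unfolding lin_def using untwist_closed by (simp add: untwist_add[abs_def] untwist_scale[abs_def] del: free_space_simps(1))
 from lin_comp[OF lin_comp[OF this alg_homD(1)[OF F]] lin_mult_left[OF A u(1)[OF g]]]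
 show "lin (free_space {w \<in> lists B. Deg w = g}) A (%q. u g \<otimes>\<^bsub>A\<^esub> F (untwist q))"
  using lin_subspace[OF sub] by simp
 fix w assume "w \<in> {w \<in> lists B. Deg w = g}"
 then show "Ft (delta w) = u g \<otimes>\<^bsub>A\<^esub> F (untwist (delta w))" using twist_word[of w] by simp
qed

text \<open>
 A group element is invertible, so that for homogeneous \<open>q\<close> the values \<open>Ft q\<close> and
 \<open>F (untwist q)\<close> vanish together.
\<close>

lemma twist_kills:
 assumes "!!q. q \<in> carrier T ==> q \<in> kern ==> F (untwist q) = \<zero>\<^bsub>A\<^esub>" "q \<in> kern"
 shows "Ft q = \<zero>\<^bsub>A\<^esub>"
proof -
 have kT: "q \<in> carrier T" if "q \<in> kern" for q using that unfolding kern_def by blast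
 show ?thesis
  using assms(2)
 proof (induction q rule: kern_induct)
  case (add p q)
  then show ?case using linD(2)[OF alg_homD(1)[OF Ft] kT kT, of p q] A by simp
 next
  case (homogeneous g q)
  then show ?case using twist_homogeneous[OF homogeneous(1,3)] assms(1)[OF kT] A u(1) by simp
 qed
qed

lemma untwist_kills:
 assumes "!!q. q \<in> kern ==> Ft q = \<zero>\<^bsub>A\<^esub>" "q \<in> kern"
 shows "F (untwist q) = \<zero>\<^bsub>A\<^esub>"
proof -
 have kT: "q \<in> carrier T" if "q \<in> kern" for q using that unfolding kern_def by blast
 note FL = linD[OF alg_homD(1)[OF F]]
 show ?thesis
  using assms(2)
 proof (induction q rule: kern_induct)
  case (add p q)
  have "untwist (%w. p w + q w) = untwist p \<oplus>\<^bsub>T\<^esub> untwist q" by (simp add: fun_eq_iff untwist_add)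
  then show ?case using FL(2)[OF untwist_closed[OF kT[OF add(1)]] untwist_closed[OF kT[OF add(2)]]] add A by simp
 next
  case (homogeneous g q)
  have Fu: "F (untwist q) \<in> carrier A" using FL(1)[OF untwist_closed[OF kT[OF homogeneous(2)]]] .
  have "F (untwist q) = u (inv g \<otimes> g) \<otimes>\<^bsub>A\<^esub> F (untwist q)"
   using homogeneous(1) u(2) A Fu by simp
  also have "\<dots> = u (inv g) \<otimes>\<^bsub>A\<^esub> (u g \<otimes>\<^bsub>A\<^esub> F (untwist q))"
   unfolding u(3)[OF G.inv_closed[OF homogeneous(1)] homogeneous(1)]
   using homogeneous(1) u(1) A Fu by (simp add: algebra_assoc)
  also have "u g \<otimes>\<^bsub>A\<^esub> F (untwist q) = \<zero>\<^bsub>A\<^esub>"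
   using twist_homogeneous[OF homogeneous(1,3)] assms(1)[OF homogeneous(2)] by simp
  also have "u (inv g) \<otimes>\<^bsub>A\<^esub> \<zero>\<^bsub>A\<^esub> = \<zero>\<^bsub>A\<^esub>"
   using A u(1) homogeneous(1) by simp
  finally show ?case .
 qed
qed

end

end

end

section \<open>Yetter--Drinfeld modules in coordinates\<close>

lemma vec_support: "vec s E v w ~= 0 ==> \<exists>b. w = [b] \<and> module.representation s E v b ~= 0"
 unfolding vec_def by (cases w) (auto split: list.splits)

text \<open>
 A Yetter--Drinfeld module is translated into the coordinates of \<open>yd_matrix\<close> and
 \<open>yd_pair\<close>, with the chosen basis of homogeneous vectors.
\<close>

locale yd_mod =
 fixes G :: "'g monoid" (structure) and Y :: "('g, 'v::ab_group_add) yd_module"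
 assumes yd: "fin_dim_yetter_drinfeld G Y"
begin

sublocale G: group G using yd unfolding fin_dim_yetter_drinfeld_def by (elim conjE)
sublocale VS: vector_space "scale Y" using yd unfolding fin_dim_yetter_drinfeld_def by (elim conjE)

abbreviation s (infixr "*s" 75) where "s \<equiv> scale Y"
abbreviation "U \<equiv> vspace Y"
abbreviation "B \<equiv> hom_basis G Y"
abbreviation "co v b \<equiv> VS.representation B v b"
abbreviation "dg \<equiv> yd_degree G Y"

lemma yd_axioms:
 shows U: "VS.subspace U"
  and fin_dim: "\<exists>S. finite S \<and> S \<subseteq> U \<and> U \<subseteq> VS.span S"
  and act_one: "\<forall>v\<in>U. act Y \<one> v = v"
  and decomposition_unique: "\<forall>v\<in>U. \<exists>!c. decomposition G Y v c"
  and act_in': "\<forall>g\<in>carrier G. \<forall>v\<in>U. act Y g v \<in> U"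
  and act_add': "\<forall>g\<in>carrier G. \<forall>v\<in>U. \<forall>w\<in>U. act Y g (v + w) = act Y g v + act Y g w"
  and act_scale': "\<forall>g\<in>carrier G. \<forall>c. \<forall>v\<in>U. act Y g (c *s v) = c *s act Y g v"
  and act_act': "\<forall>g\<in>carrier G. \<forall>h\<in>carrier G. \<forall>v\<in>U. act Y (g \<otimes> h) v = act Y g (act Y h v)"
  and grade': "\<forall>g\<in>carrier G. VS.subspace (grade Y g) \<and> grade Y g \<subseteq> U"
  and act_grade': "\<forall>g\<in>carrier G. \<forall>h\<in>carrier G. act Y g ` grade Y h = grade Y (g \<otimes> h \<otimes> inv g)"
 using yd unfolding fin_dim_yetter_drinfeld_def by - ((elim conjE, assumption)+)

lemma
 assumes "g \<in> carrier G"
 shows act_in [simp]: "v \<in> U ==> act Y g v \<in> U"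
  and act_add: "v \<in> U ==> w \<in> U ==> act Y g (v + w) = act Y g v + act Y g w"
  and act_scale: "v \<in> U ==> act Y g (c *s v) = c *s act Y g v"
  and act_act: "h \<in> carrier G ==> v \<in> U ==> act Y (g \<otimes> h) v = act Y g (act Y h v)"
  and grade_subspace: "VS.subspace (grade Y g)"
  and grade_U: "v \<in> grade Y g ==> v \<in> U"
  and act_grade: "h \<in> carrier G ==> v \<in> grade Y h ==> act Y g v \<in> grade Y (g \<otimes> h \<otimes> inv g)"
 using assms act_in' act_add' act_scale' act_act' grade' act_grade' by (simp, simp, simp, simp, simp, blast, blast)

lemma U_closed [simp]: "0 \<in> U" "v \<in> U ==> w \<in> U ==> v + w \<in> U" "v \<in> U ==> c *s v \<in> U"
 using U by (simp_all add: VS.subspace_0 VS.subspace_add VS.subspace_scale)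

text \<open>The homogeneous vectors span, so a maximal independent set of them is a basis.\<close>

lemma hom_basis: "VS.independent B" "VS.span B = U" "B \<subseteq> (\<Union>g\<in>carrier G. grade Y g)"
proof -
 let ?H = "\<Union>g\<in>carrier G. grade Y g"
 obtain E where E: "E \<subseteq> ?H" "VS.independent E" "?H \<subseteq> VS.span E"
  by (rule VS.maximal_independent_subset)
 have "VS.span E = U"
 proof
  show "VS.span E \<subseteq> U" using E(1) grade_U by (intro VS.span_minimal U) blast
  show "U \<subseteq> VS.span E"
  proof
   fix v assume "v \<in> U"
   then obtain c where c: "decomposition G Y v c" using decomposition_unique by blast
   then have v: "v = (\<Sum>g | c g ~= 0. c g)" by (simp add: decomposition_def)
   have "c g \<in> VS.span E" for g
    using c E(3) VS.span_zero[of E] by (cases "g \<in> carrier G") (auto simp: decomposition_def)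
   then show "v \<in> VS.span E" unfolding v by (intro VS.span_sum)
  qed
 qed
 then have "\<exists>B. \<not> VS.dependent B \<and> VS.span B = U \<and> B \<subseteq> ?H" using E by blast
 from someI_ex[OF this]
 show "VS.independent B" "VS.span B = U" "B \<subseteq> ?H" unfolding hom_basis_def by blast+
qed

lemma B_U [simp]: "b \<in> B ==> b \<in> U"
 using hom_basis(2) VS.span_base by blast

lemma finite_B: "finite B"
proof -
 obtain S where "finite S" "U \<subseteq> VS.span S" using fin_dim by blast
 then show ?thesis using VS.independent_span_bound[of S B] hom_basis(1) B_U by blast
qed

lemma rep_outside: "b \<notin> B ==> co v b = 0"
 using VS.representation_ne_zero by blast

lemma rep_basis: "b \<in> B ==> co b c = (if c = b then 1 else 0)"
 using VS.representation_basis[OF hom_basis(1)] by simp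

lemma rep_add: "v \<in> U ==> w \<in> U ==> co (v + w) b = co v b + co w b"
 using VS.representation_add[OF hom_basis(1), of w v] hom_basis(2) by simp

lemma rep_scale: "v \<in> U ==> co (c *s v) b = c * co v b"
 using VS.representation_scale[OF hom_basis(1)] hom_basis(2) by simp

lemma sum_rep: "v \<in> U ==> (\<Sum>b\<in>B. co v b *s b) = v"
 using VS.sum_representation_eq[OF hom_basis(1) _ finite_B subset_refl] hom_basis(2) by simp

lemma sum_U [simp]: "(!!i. i \<in> I ==> v i \<in> U) ==> (\<Sum>i\<in>I. v i) \<in> U"
 using U by (simp add: VS.subspace_sum)

lemma functional_sum:
 assumes "!!v w. v \<in> U ==> w \<in> U ==> f (v + w) = f v + f w" "!!c v. v \<in> U ==> f (c *s v) = c * (f v :: complex)"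
  and "!!i. i \<in> I ==> v i \<in> U"
 shows "f (\<Sum>i\<in>I. k i *s v i) = (\<Sum>i\<in>I. k i * f (v i))"
proof -
 have "f 0 = 0" using assms(2)[of 0 0] by simp
 then show ?thesis
  using assms(3) by (induction I rule: infinite_finite_induct) (simp_all add: assms(1,2))
qed

lemma functional_rep:
 assumes "!!v w. v \<in> U ==> w \<in> U ==> f (v + w) = f v + f w" "!!c v. v \<in> U ==> f (c *s v) = c * (f v :: complex)"
  and "v \<in> U"
 shows "f v = (\<Sum>b\<in>B. co v b * f b)"
proof -
 have "f (\<Sum>b\<in>B. co v b *s b) = (\<Sum>b\<in>B. co v b * f b)"
  by (rule functional_sum) (simp_all add: assms(1,2))
 then show ?thesis using sum_rep[OF assms(3)] by simp
qed

lemma component_grade: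
 assumes "g \<in> carrier G" "v \<in> grade Y g"
 shows "component G Y v = (%h. if h = g then v else 0)"
proof -
 have "decomposition G Y v (%h. if h = g then v else 0)"
  unfolding decomposition_def using assms VS.subspace_0[OF grade_subspace]
  by (cases "v = 0") (auto intro: finite_subset[of _ "{g}"])
 then show ?thesis
  unfolding component_def using bspec[OF decomposition_unique grade_U[OF assms]] by (intro the1_equality)
qed

lemma B_nonzero: "b \<in> B ==> b ~= 0"
 using hom_basis(1) VS.dependent_zero by blast

lemma deg_unique:
 assumes "b \<in> B" "g \<in> carrier G" "b \<in> grade Y g"
 shows "dg b = g"
 unfolding yd_degree_def
proof (rule the_equality)
 fix h assume h: "h \<in> carrier G \<and> b \<in> grade Y h"
 have "(%k. if k = h then b else 0) = (%k. if k = g then b else 0)"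
  using component_grade[of h b] component_grade[OF assms(2,3)] h by simp
 from fun_cong[OF this, of g] show "h = g" using B_nonzero[OF assms(1)] by (simp split: if_splits)
qed (use assms in simp)

lemma dg: "b \<in> B ==> dg b \<in> carrier G" "b \<in> B ==> b \<in> grade Y (dg b)"
proof -
 have "dg b \<in> carrier G \<and> b \<in> grade Y (dg b)" if b: "b \<in> B"
 proof -
  obtain g where "g \<in> carrier G" "b \<in> grade Y g" using hom_basis(3) b by blast
  then show ?thesis using deg_unique[OF b] by simp
 qed
 then show "b \<in> B ==> dg b \<in> carrier G" "b \<in> B ==> b \<in> grade Y (dg b)" by blast+
qed

text \<open>By uniqueness of the decomposition, the homogeneous components are the parts of the basis expansion.\<close>

lemma component:
 assumes v: "v \<in> U"
 shows "component G Y v g = (\<Sum>b | b \<in> B \<and> dg b = g. co v b *s b)"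
proof -
 let ?c = "%g. \<Sum>b | b \<in> B \<and> dg b = g. co v b *s b"
 have out: "?c g = 0" if "g \<notin> dg ` B" for g
 proof -
  have "{b. b \<in> B \<and> dg b = g} = {}" using that by auto
  then show ?thesis by (simp only: sum.empty)
 qed
 then have fin: "finite {g. ?c g ~= 0}" "{g. ?c g ~= 0} \<subseteq> dg ` B"
  using finite_B by (auto intro: finite_subset[of _ "dg ` B"])
 have "(\<Sum>g | ?c g ~= 0. ?c g) = (\<Sum>g\<in>dg ` B. ?c g)"
  using fin finite_B by (intro sum.mono_neutral_left) auto
 also have "\<dots> = (\<Sum>b\<in>B. co v b *s b)"
  using sum.image_gen[OF finite_B, of "%b. co v b *s b" dg] by simp
 finally have "v = (\<Sum>g | ?c g ~= 0. ?c g)" using sum_rep[OF v] by simp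
 moreover have "?c g \<in> grade Y g" if "g \<in> carrier G" for g
  using grade_subspace[OF that] dg(2) by (intro VS.subspace_sum VS.subspace_scale) auto
 moreover have "?c g = 0" if "g \<notin> carrier G" for g
  using out[of g] that dg(1) by blast
 ultimately have "decomposition G Y v ?c"
  unfolding decomposition_def using fin by blast
 then have "component G Y v = ?c"
  unfolding component_def using bspec[OF decomposition_unique v] by (intro the1_equality)
 then show ?thesis by simp
qed

text \<open>A homogeneous vector is its own component, hence is expanded in basis vectors of its degree.\<close>

lemma grade_rep:
 assumes "g \<in> carrier G" "v \<in> grade Y g" "co v b ~= 0"
 shows "dg b = g"
proof (rule ccontr)
 assume "dg b ~= g"
 have b: "b \<in> B" using assms(3) rep_outside by blast
 have "(\<Sum>c | c \<in> B \<and> dg c = dg b. co v c *s c) = 0"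
  using component[OF grade_U[OF assms(1,2)], of "dg b"] component_grade[OF assms(1,2)] \<open>dg b ~= g\<close> by simp
 then have "co v b = 0"
  using b finite_B by (intro VS.independentD[OF hom_basis(1), where t = "{c. c \<in> B \<and> dg c = dg b}" and u = "co v"]) auto
 then show False using assms(3) by simp
qed

definition r :: "'g => 'v => 'v => complex"
 where "r g c d = co (act Y g d) c"

lemma rep_act:
 assumes g: "g \<in> carrier G" and v: "v \<in> U"
 shows "co (act Y g v) c = (\<Sum>d\<in>B. r g c d * co v d)"
 using functional_rep[of "%v. co (act Y g v) c", OF _ _ v] g
 by (simp add: r_def act_add act_scale rep_add rep_scale mult.commute)

sublocale Y: yd_matrix G B dg r
proof
 show "r g c d = 0" if "g \<in> carrier G" "d \<in> B" "c \<notin> B" for g c d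
  using that by (simp add: r_def rep_outside)
 show "r (g \<otimes> h) c d = (\<Sum>e\<in>B. r g c e * r h e d)" if "g \<in> carrier G" "h \<in> carrier G" "d \<in> B" for g h c d
  using that rep_act[of g "act Y h d" c] by (simp add: r_def act_act)
 show "dg c = g \<otimes> dg d \<otimes> inv g"
  if "g \<in> carrier G" "c \<in> B" "d \<in> B" "r g c d ~= 0" for g c d
  using that grade_rep[OF _ act_grade[OF that(1) dg(1)[OF that(3)] dg(2)[OF that(3)]], of c] dg(1)[OF that(3)]
  by (simp add: r_def)
qed (simp_all add: finite_B dg r_def act_one rep_basis)

subsection \<open>The dual module\<close>

abbreviation "Z \<equiv> dual G Y"
abbreviation "B' \<equiv> dual_basis G Y"
abbreviation "dg' \<equiv> yd_degree G Z"

definition \<beta> :: "'v => 'v => complex"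
 where "\<beta> b = (%v. co v b)"

lemma B': "B' = \<beta> ` B"
 by (simp add: dual_basis_def \<beta>_def[abs_def])

lemma dual_simps:
 "scale Z = (%c f v. c * f v)"
 "f \<in> vspace Z \<longleftrightarrow> (\<forall>v. v \<notin> U --> f v = 0) \<and> (\<forall>v\<in>U. \<forall>w\<in>U. f (v + w) = f v + f w) \<and> (\<forall>c. \<forall>v\<in>U. f (c *s v) = c * f v)"
 "act Z g f = (%v. if v \<in> U then f (act Y (inv g) v) else 0)"
 "f \<in> grade Z g \<longleftrightarrow> f \<in> vspace Z \<and> (\<forall>h\<in>carrier G. h ~= inv g --> (\<forall>v\<in>grade Y h. f v = 0))"
 by (simp_all add: dual_def Let_def)

lemma dual_rep: "f \<in> vspace Z ==> v \<in> U ==> f v = (\<Sum>b\<in>B. co v b * f b)"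
 by (rule functional_rep) (simp_all add: dual_simps)

lemma beta_vspace: "b \<in> B ==> \<beta> b \<in> vspace Z"
proof -
 assume "b \<in> B"
 have "co v b = 0" if "v \<notin> U" for v
  using that hom_basis(2) by (simp add: VS.representation_def)
 then show ?thesis by (simp add: dual_simps \<beta>_def rep_add rep_scale)
qed

lemma beta_value: "b \<in> B ==> \<beta> c b = (if c = b then 1 else 0)"
 by (simp add: \<beta>_def rep_basis)

lemma beta_inj: "inj_on \<beta> B"
proof
 fix b c assume b: "b \<in> B" and "c \<in> B" and eq: "\<beta> b = \<beta> c"
 have "(if b = b then 1 else 0) = (if c = b then 1 else (0::complex))"
  using fun_cong[OF eq, of b] unfolding beta_value[OF b] .
 then show "b = c" by (simp split: if_splits)
qed

lemma sum_B': "(\<Sum>c\<in>B'. h c) = (\<Sum>b\<in>B. h (\<beta> b))"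
 unfolding B' by (simp add: sum.reindex[OF beta_inj])

sublocale VD: vector_space "scale Z"
 by (rule vector_space.intro) (simp_all add: dual_simps(1) fun_eq_iff distrib_left distrib_right)

abbreviation "co' f c \<equiv> VD.representation B' f c"

lemma sum_fun_apply: "(\<Sum>i\<in>I. f i) v = (\<Sum>i\<in>I. (f i v :: complex))"
 by (induction I rule: infinite_finite_induct) (simp_all add: zero_fun_def plus_fun_def)

lemma dual_independent: "VD.independent B'"
proof
 assume "VD.dependent B'"
 then obtain t u b where t: "finite t" "t \<subseteq> B'" "(\<Sum>f\<in>t. scale Z (u f) f) = 0" "b \<in> t" "u b ~= 0"
  unfolding VD.dependent_explicit by blast
 obtain c where c: "c \<in> B" "b = \<beta> c" using t B' by blast
 have "(\<Sum>f\<in>t. scale Z (u f) f) c = (\<Sum>f\<in>t. if f = b then u f else 0)"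
  unfolding sum_fun_apply
 proof (rule sum.cong[OF refl])
  fix f assume "f \<in> t"
  then obtain d where "d \<in> B" "f = \<beta> d" using t(2) B' by blast
  then show "scale Z (u f) f c = (if f = b then u f else 0)"
   using c beta_value[OF c(1), of d] beta_inj by (auto simp: dual_simps(1) inj_on_def)
 qed
 then show False using t by simp
qed

lemma dual_sum:
 assumes "f \<in> vspace Z"
 shows "f = (\<Sum>b\<in>B. scale Z (f b) (\<beta> b))"
proof
 fix v
 show "f v = (\<Sum>b\<in>B. scale Z (f b) (\<beta> b)) v"
  using assms dual_rep[OF assms, of v] beta_vspace
  by (cases "v \<in> U") (auto simp: sum_fun_apply dual_simps(1) \<beta>_def mult.commute dual_simps(2))
qed

text \<open>The coefficient of a functional at a dual basis vector is the value at the corresponding basis vector.\<close>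

lemma rep'_beta:
 assumes f: "f \<in> vspace Z" and b: "b \<in> B"
 shows "co' f (\<beta> b) = f b"
proof -
 have "co' f = co' (\<Sum>c\<in>B. scale Z (f c) (\<beta> c))" using dual_sum[OF f] by simp
 also have "\<dots> = (%e. \<Sum>c\<in>B. co' (scale Z (f c) (\<beta> c)) e)"
  using B' by (intro VD.representation_sum[OF dual_independent] VD.span_scale VD.span_base) auto
 also have "\<dots> = (%e. \<Sum>c\<in>B. f c * co' (\<beta> c) e)"
  using B' VD.representation_scale[OF dual_independent VD.span_base]
  by (intro ext sum.cong refl) (metis imageI)
 finally have "co' f (\<beta> b) = (\<Sum>c\<in>B. f c * co' (\<beta> c) (\<beta> b))" by simp
 also have "\<dots> = (\<Sum>c\<in>B. if c = b then f c else 0)"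
  using VD.representation_basis[OF dual_independent] B' b beta_inj
  by (intro sum.cong refl) (auto simp: inj_on_def)
 also have "\<dots> = f b" using b finite_B by simp
 finally show ?thesis .
qed

lemma rep'_outside: "c \<notin> B' ==> co' f c = 0"
 using VD.representation_ne_zero by blast

lemma act'_vspace: "g \<in> carrier G ==> f \<in> vspace Z ==> act Z g f \<in> vspace Z"
 by (simp add: dual_simps act_add act_scale)

lemma act'_value: "b \<in> B ==> act Z g f b = f (act Y (inv g) b)"
 by (simp add: dual_simps)

lemma deg_beta:
 assumes b: "b \<in> B"
 shows "dg' (\<beta> b) = inv (dg b)"
 unfolding yd_degree_def[of G Z]
proof (rule the_equality)
 show "inv (dg b) \<in> carrier G \<and> \<beta> b \<in> grade Z (inv (dg b))"
  using b beta_vspace[OF b] dg(1)[OF b] grade_rep[of _ _ b]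
  by (auto simp: dual_simps(4) \<beta>_def)
 fix g assume g: "g \<in> carrier G \<and> \<beta> b \<in> grade Z g"
 have "dg b = inv g"
  using g dg[OF b] beta_value[OF b, of b] by (auto simp: dual_simps(4))
 then show "g = inv (dg b)" using g by simp
qed

definition r' :: "'g => ('v => complex) => ('v => complex) => complex"
 where "r' g c d = co' (act Z g d) c"

lemma r'_beta: "g \<in> carrier G ==> c \<in> B ==> d \<in> B ==> r' g (\<beta> c) (\<beta> d) = r (inv g) d c"
 by (simp add: r'_def rep'_beta act'_vspace beta_vspace act'_value) (simp add: r_def \<beta>_def)

lemma r'_outside: "c \<notin> B' ==> r' g c d = 0"
 by (simp add: r'_def rep'_outside)

sublocale D: yd_matrix G B' dg' r'
proof
 show "finite B'" using finite_B B' by simp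
 show "dg' f \<in> carrier G" if "f \<in> B'" for f
  using that deg_beta dg(1) by (auto simp: B')
 show "r' g c d = 0" if "g \<in> carrier G" "d \<in> B'" "c \<notin> B'" for g c d
  using that by (simp add: r'_outside)
 show "r' \<one> c d = (if c = d then 1 else 0)" if "c \<in> B'" "d \<in> B'" for c d
  using that beta_inj by (auto simp: B' r'_beta Y.r_one inj_on_def)
 show "r' (g \<otimes> h) c d = (\<Sum>e\<in>B'. r' g c e * r' h e d)" if gh: "g \<in> carrier G" "h \<in> carrier G" "d \<in> B'" for g h c d
 proof (cases "c \<in> B'")
  case True
  then obtain c0 d0 where c: "c0 \<in> B" "c = \<beta> c0" and d: "d0 \<in> B" "d = \<beta> d0" using gh(3) B' by blast
  have "(\<Sum>e\<in>B'. r' g c e * r' h e d) = (\<Sum>e\<in>B. r (inv h) d0 e * r (inv g) e c0)"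
   using c d gh by (simp add: sum_B' r'_beta mult.commute)
  also have "\<dots> = r (inv h \<otimes> inv g) d0 c0"
   using gh c by (simp add: Y.r_mult)
  also have "\<dots> = r' (g \<otimes> h) c d"
   using c d gh by (simp add: r'_beta G.inv_mult_group)
  finally show ?thesis by simp
 qed (simp add: r'_outside)
 show "dg' c = g \<otimes> dg' d \<otimes> inv g" if g: "g \<in> carrier G" and cd: "c \<in> B'" "d \<in> B'" "r' g c d ~= 0" for g c d
 proof -
  obtain c0 d0 where c: "c0 \<in> B" "c = \<beta> c0" and d: "d0 \<in> B" "d = \<beta> d0" using cd(1,2) B' by blast
  have "dg d0 = inv g \<otimes> dg c0 \<otimes> inv (inv g)"
   using g cd(3) c d by (intro Y.r_deg) (simp_all add: r'_beta)
  then have "inv (dg d0) = inv g \<otimes> inv (dg c0) \<otimes> g"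
   using g dg(1)[OF c(1)] by (simp add: G.inv_mult_group G.m_assoc)
  moreover have "g \<otimes> (inv g \<otimes> a \<otimes> g) \<otimes> inv g = a" if "a \<in> carrier G" for a
  proof -
   have "g \<otimes> (inv g \<otimes> a \<otimes> g) \<otimes> inv g = (g \<otimes> inv g) \<otimes> a \<otimes> (g \<otimes> inv g)"
    using g that by (simp only: G.m_assoc G.m_closed G.inv_closed)
   then show ?thesis using g that by simp
  qed
  ultimately show ?thesis
   using c d dg(1)[OF c(1)] by (simp add: deg_beta)
 qed
qed

sublocale P: yd_pair G B dg r B' dg' r' \<beta>
proof
 show "bij_betw \<beta> B B'" using beta_inj B' by (simp add: bij_betw_def)
qed (rule deg_beta r'_beta; assumption)+

subsection \<open>Vectors as tensors of degree one\<close>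

abbreviation "vecY v \<equiv> vec (scale Y) B v"
abbreviation "vecD f \<equiv> vec (scale Z) B' f"

lemma vec_value [simp]: "vecY v [b] = co v b" "vecD f [c] = co' f c"
 by (simp_all add: vec_def)

lemma vec_free: "vecY v \<in> carrier (free_space ((%c. [c]) ` B))" "vecD f \<in> carrier (free_space ((%c. [c]) ` B'))"
proof -
 have 1: "{w. vecY v w ~= 0} \<subseteq> (%c. [c]) ` B"
  using vec_support rep_outside by fastforce
 have 2: "{w. vecD f w ~= 0} \<subseteq> (%c. [c]) ` B'"
  using vec_support rep'_outside by fastforce
 show "vecY v \<in> carrier (free_space ((%c. [c]) ` B))"
  using 1 finite_subset[OF 1] by simp
 show "vecD f \<in> carrier (free_space ((%c. [c]) ` B'))"
  using 2 finite_subset[OF 2] by simp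
qed

lemma vec_closed: "vecY v \<in> carrier Y.T" "vecD f \<in> carrier D.T"
 using vec_free(1)[of v] vec_free(2)[of f] by auto

lemma vec_letter: "b \<in> B ==> vecY b = delta [b]" "c \<in> B' ==> vecD c = delta [c]"
 using VD.representation_basis[OF dual_independent]
 by (auto simp: vec_def fun_eq_iff delta_def rep_basis split: list.splits)

lemma vec_act_letter: "vecY (act Y g b) = Y.letter_act g b" "vecD (act Z g c) = D.letter_act g c"
 by (auto simp: vec_def Y.letter_act_def D.letter_act_def r_def r'_def fun_eq_iff split: list.split)

lemma vec_act:
 assumes "g \<in> carrier G"
 shows "v \<in> U ==> vecY (act Y g v) = Y.tact g (vecY v)"
  and "f \<in> vspace Z ==> vecD (act Z g f) = D.tact g (vecD f)"
proof -
 show "vecY (act Y g v) = Y.tact g (vecY v)" if "v \<in> U"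
  unfolding Y.tact_degree_one[OF assms vec_free(1)]
  using rep_act[OF assms that] by (simp add: vec_def fun_eq_iff split: list.split)
 assume f: "f \<in> vspace Z"
 have "co' (act Z g f) c = (\<Sum>d\<in>B'. r' g c d * co' f d)" for c
 proof (cases "c \<in> B'")
  case True
  then obtain b where b: "b \<in> B" "c = \<beta> b" using B' by blast
  have "co' (act Z g f) c = (\<Sum>d\<in>B. r (inv g) d b * f d)"
   using b assms f dual_rep[OF f, of "act Y (inv g) b"]
   by (simp add: rep'_beta act'_vspace act'_value r_def)
  then show ?thesis
   using b assms f by (simp add: sum_B' r'_beta rep'_beta)
 qed (simp add: rep'_outside r'_outside)
 then show "vecD (act Z g f) = D.tact g (vecD f)"
  unfolding D.tact_degree_one[OF assms vec_free(2)] by (simp add: vec_def fun_eq_iff split: list.split)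
qed

lemma braiding_value: "braiding G W E b c [e, f] = (if f = b then vec (scale W) E (act W (yd_degree G W b) c) [e] else 0)"
 by (simp add: braiding_def atMost_Suc delta_def vec_def numeral_2_eq_2)

lemma nichols_ideals [simp]:
 "nichols_ideal B (\<Psi>\<^sub>Y G Y) = Y.kern" "nichols_ideal B' (\<Psi>\<^sub>D G Y) = D.kern"
 using Y.nichols_ideal_kern[of "\<Psi>\<^sub>Y G Y"] D.nichols_ideal_kern[of "\<Psi>\<^sub>D G Y"]
 by (simp_all add: braiding_value vec_def r_def r'_def)

lemma nichols_algebras [simp]: "nichols_Y G Y = Y.N" "nichols_D G Y = D.N"
 by (simp_all add: nichols_algebra_def)

lemma pairing_coords: "f \<in> vspace Z ==> v \<in> U ==> f v = (\<Sum>b\<in>B. vecD f [\<beta> b] * vecY v [b])"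
 using dual_rep[of f v] by (simp add: rep'_beta mult.commute)

lemma pairing_component:
 assumes "f \<in> vspace Z" "v \<in> U"
 shows "f (component G Y v g) = (\<Sum>b | b \<in> B \<and> dg b = g. vecD f [\<beta> b] * vecY v [b])"
proof -
 have "f (\<Sum>b | b \<in> B \<and> dg b = g. co v b *s b) = (\<Sum>b | b \<in> B \<and> dg b = g. co v b * f b)"
  using assms(1) by (intro functional_sum) (simp_all add: dual_simps)
 then show ?thesis using assms by (simp add: component rep'_beta mult.commute)
qed

text \<open>
 By its definition the dual grading consists of functionals that vanish on all basis vectors but those of the
 inverse degree.
\<close>

lemma grade_vec:
 assumes "g \<in> carrier G" "f \<in> grade Z g"
 shows "vecD f \<in> carrier (free_space ((%c. [c]) ` {c \<in> B'. dg' c = g}))"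
proof -
 have f: "f \<in> vspace Z" using assms(2) by (simp add: dual_simps(4))
 have fb: "dg b = inv g" if "b \<in> B" "f b ~= 0" for b
  using assms that dg[of b] by (auto simp: dual_simps(4))
 have "{w. vecD f w ~= 0} \<subseteq> (%c. [c]) ` {c \<in> B'. dg' c = g}"
 proof (intro subsetI)
  fix w assume "w \<in> {w. vecD f w ~= 0}"
  then obtain c where c: "w = [c]" "co' f c ~= 0" using vec_support by fast
  then obtain b where b: "b \<in> B" "c = \<beta> b" using rep'_outside B' by blast
  then have "dg b = inv g" using fb[of b] c rep'_beta[OF f] by simp
  then show "w \<in> (%c. [c]) ` {c \<in> B'. dg' c = g}" using b c assms(1) by (simp add: deg_beta)
 qed
 then show ?thesis using vec_free(2)[of f] by simp
qed

end

section \<open>The group action on the braided Weyl algebra\<close>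

lemma algebra_isoI:
 assumes "complex_algebra A" "complex_algebra R" "alg_hom A R h" "alg_hom R A k"
  and "!!x. x \<in> carrier A ==> k (h x) = x" "!!y. y \<in> carrier R ==> h (k y) = y"
 shows "algebra_iso A R h"
proof -
 note H = alg_homD[OF assms(3)] and HL = linD[OF alg_homD(1)[OF assms(3)]]
 have "bij_betw h (carrier A) (carrier R)"
  by (rule bij_betw_byWitness[where f' = k])
   (use assms(5,6) HL(1) linD(1)[OF alg_homD(1)[OF assms(4)]] in auto)
 then show ?thesis
  using assms(1,2) H(2,3) HL by (auto simp: algebra_iso_def ring_iso_def ring_hom_def)
qed

lemma algebra_iso_hom: "algebra_iso A R h ==> alg_hom A R h"
 by (auto simp: algebra_iso_def ring_iso_def ring_hom_def alg_hom_def lin_def)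

lemma actionD:
 assumes "action G A \<alpha>"
 shows "g \<in> carrier G ==> alg_hom A A (\<alpha> g)" and "w \<in> carrier A ==> \<alpha> \<one>\<^bsub>G\<^esub> w = w"
  and "g \<in> carrier G ==> h \<in> carrier G ==> w \<in> carrier A ==> \<alpha> (g \<otimes>\<^bsub>G\<^esub> h) w = \<alpha> g (\<alpha> h w)"
 using assms by (simp_all add: action_def)

lemma minus_eq_iff:
 assumes "vspc A" "x \<in> carrier A" "y \<in> carrier A" "z \<in> carrier A"
 shows "x \<ominus>\<^bsub>A\<^esub> y = z \<longleftrightarrow> x = y \<oplus>\<^bsub>A\<^esub> z"
proof
 have yy: "y \<oplus>\<^bsub>A\<^esub> (- 1) \<odot>\<^bsub>A\<^esub> y = \<zero>\<^bsub>A\<^esub>"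
  using assms vspc_neg[of A y] vspc_simps(11)[of A y] by simp
 show "x = y \<oplus>\<^bsub>A\<^esub> z" if "x \<ominus>\<^bsub>A\<^esub> y = z"
 proof -
  have "y \<oplus>\<^bsub>A\<^esub> z = x \<oplus>\<^bsub>A\<^esub> (y \<oplus>\<^bsub>A\<^esub> (- 1) \<odot>\<^bsub>A\<^esub> y)"
   unfolding that[symmetric] using assms by (simp add: vspc_minus vspc_left_comm)
  then show ?thesis unfolding yy using assms by simp
 qed
 show "x \<ominus>\<^bsub>A\<^esub> y = z" if "x = y \<oplus>\<^bsub>A\<^esub> z"
 proof -
  have "x \<ominus>\<^bsub>A\<^esub> y = z \<oplus>\<^bsub>A\<^esub> (y \<oplus>\<^bsub>A\<^esub> (- 1) \<odot>\<^bsub>A\<^esub> y)"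
   unfolding that using assms by (simp add: vspc_minus vspc_assoc vspc_left_comm)
  then show ?thesis unfolding yy using assms by simp
 qed
qed

lemma lin_functional:
 assumes "vspc A" "n \<in> carrier A" "!!p q. \<phi> (%x. p x + q x) = \<phi> p + \<phi> q" "!!c p. \<phi> (%x. c * p x) = c * \<phi> p"
 shows "lin (free_space E) A (%p. \<phi> p \<odot>\<^bsub>A\<^esub> n)"
 using assms by (simp add: lin_def vspc_distl)

text \<open>Used to pass from relations between basis vectors to relations between arbitrary vectors and functionals.\<close>

lemma bilinear_eq_on_free:
 assumes A: "vspc A"
  and f: "!!q. q \<in> carrier (free_space E') ==> lin (free_space E) A (%p. f p q)"
   "!!p. p \<in> carrier (free_space E) ==> lin (free_space E') A (f p)"
  and g: "!!q. q \<in> carrier (free_space E') ==> lin (free_space E) A (%p. g p q)"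
   "!!p. p \<in> carrier (free_space E) ==> lin (free_space E') A (g p)"
  and eq: "!!x y. x \<in> E ==> y \<in> E' ==> f (delta x) (delta y) = g (delta x) (delta y)"
  and "p \<in> carrier (free_space E)" "q \<in> carrier (free_space E')"
 shows "f p q = g p q"
proof (rule lin_eq_on_free[OF f(1) g(1) A _ assms(7)])
 fix x assume x: "x \<in> E"
 show "f (delta x) q = g (delta x) q"
  using x eq delta_in_free_space[OF x] by (intro lin_eq_on_free[OF f(2) g(2) A _ assms(8)])
qed (rule assms(8))+

context yd_matrix
begin

lemma letter_act_degree:
 assumes g: "g \<in> carrier G" and b: "b \<in> B"
 shows "letter_act g b \<in> carrier (free_space ((%c. [c]) ` {c \<in> B. deg c = g \<otimes> deg b \<otimes> inv g}))"
proof -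
 have "{w. letter_act g b w ~= 0} \<subseteq> (%c. [c]) ` {c \<in> B. deg c = g \<otimes> deg b \<otimes> inv g}"
 proof
  fix w assume w: "w \<in> {w. letter_act g b w ~= 0}"
  then obtain c where c: "c \<in> B" "w = [c]" using letter_act_support[OF g b] by blast
  then have "r g c b ~= 0" using w by (simp add: letter_act_def)
  from r_deg[OF g c(1) b this] c
  show "w \<in> (%c. [c]) ` {c \<in> B. deg c = g \<otimes> deg b \<otimes> inv g}" by blast
 qed
 then show ?thesis using letter_act_free[OF g b] by simp
qed

text \<open>A homogeneous element is a combination of letters of the same degree, so the common factor can be taken out.\<close>

lemma degree_twist:
 assumes A: "complex_algebra A" and F: "lin T A F" and F': "lin T A F'" and a: "a \<in> carrier A"
  and eq: "!!b. b \<in> B ==> deg b = y ==> F' (delta [b]) = a \<otimes>\<^bsub>A\<^esub> F (delta [b])"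
  and q: "q \<in> carrier (free_space ((%c. [c]) ` {c \<in> B. deg c = y}))"
 shows "F' q = a \<otimes>\<^bsub>A\<^esub> F q"
proof -
 have sub: "(%c. [c]) ` {c \<in> B. deg c = y} \<subseteq> lists B" by auto
 show ?thesis
 proof (rule lin_eq_on_free[OF _ _ complex_algebra_vspc[OF A] _ q])
  show "lin (free_space ((%c. [c]) ` {c \<in> B. deg c = y})) A F'"
   using lin_subspace[OF sub] F' by simp
  show "lin (free_space ((%c. [c]) ` {c \<in> B. deg c = y})) A (%q. a \<otimes>\<^bsub>A\<^esub> F q)"
   using lin_subspace[OF sub] lin_comp[OF F lin_mult_left[OF A a]] by simp
 qed (use eq in auto)
qed

end

context yd_pair
begin

lemma sum_letters:
 assumes "b \<in> B" "v \<in> B"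
 shows "(\<Sum>c\<in>B. delta [\<beta> b] [\<beta> c] * delta [v] [c]) = (if b = v then 1 else 0)"
proof -
 have "(\<Sum>c\<in>B. delta [\<beta> b] [\<beta> c] * delta [v] [c]) = (\<Sum>c\<in>B. if c = b then (if b = v then 1 else 0) else 0)"
  using assms by (intro sum.cong refl) (auto simp: delta_def)
 then show ?thesis using assms by simp
qed

context
 fixes m
 assumes ok: "weyl_ok m"
begin

lemma weyl_algebra_rules:
 shows weyl_complex_algebra: "complex_algebra (weyl_rec m)"
  and weyl_mult_LR: "\<forall>a\<in>carrier Y.N. \<forall>c\<in>carrier D.N. m (left_in a) (right_in c) = tens a c"
  and weyl_mult_rel: "\<forall>b\<in>B. \<forall>v\<in>B. m (right_in (D.cl (delta [\<beta> b]))) (left_in (Y.cl (delta [v]))) =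
   m (left_in (Y.cl (Y.letter_act (x b) v))) (right_in (D.cl (delta [\<beta> b])))
    \<oplus>\<^bsub>V\<^esub> (if b = v then one_V else \<zero>\<^bsub>V\<^esub>)"
 using ok unfolding weyl_ok_def by - ((elim conjE, assumption)+)

lemma alg_hom_left: "alg_hom Y.N (weyl_rec m) (%a. left_in a)"
 and alg_hom_right: "alg_hom D.N (weyl_rec m) (%c. right_in c)"
 using ok TP.lin_tensor_left[of "\<one>\<^bsub>D.N\<^esub>"] TP.lin_tensor_right[of "\<one>\<^bsub>Y.N\<^esub>"]
 unfolding alg_hom_def weyl_ok_def by simp_all

lemma alg_hom_left_cl: "alg_hom Y.T (weyl_rec m) (%p. left_in (Y.cl p))"
 and alg_hom_right_cl: "alg_hom D.T (weyl_rec m) (%q. right_in (D.cl q))"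
 by (rule alg_hom_comp[OF Y.NI.alg_hom_coset alg_hom_left] alg_hom_comp[OF D.NI.alg_hom_coset alg_hom_right])+

text \<open>The cross relation for arbitrary vectors and homogeneous functionals, by bilinearity.\<close>

lemma weyl_relation:
 assumes g: "g \<in> carrier G" and p: "p \<in> carrier E1"
  and q: "q \<in> carrier (free_space ((%c. [c]) ` {c \<in> B'. deg' c = g}))"
 shows "m (right_in (D.cl q)) (left_in (Y.cl p)) =
  m (left_in (Y.cl (Y.tact g p))) (right_in (D.cl q)) \<oplus>\<^bsub>V\<^esub> (\<Sum>b\<in>B. q [\<beta> b] * p [b]) \<odot>\<^bsub>V\<^esub> one_V"
proof -
 note [simp del] = tensor_opaque
 let ?E = "(%c. [c]) ` {c \<in> B'. deg' c = g}" and ?L = "%p. left_in (Y.cl p)" and ?R = "%q. right_in (D.cl q)"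
 note CA = weyl_complex_algebra
 note LM = lin_mult_left[OF CA, simplified] and RM = lin_mult_right[OF CA, simplified]
 have s1: "(%c. [c]) ` B \<subseteq> lists B" and s2: "?E \<subseteq> lists B'" by auto
 have T1: "p \<in> carrier Y.T" if "p \<in> carrier E1" for p
  using that s1 unfolding tensor_algebra_simps(1) free_space_simps(1) by blast
 have T2: "q \<in> carrier D.T" if "q \<in> carrier (free_space ?E)" for q
  using that s2 unfolding tensor_algebra_simps(1) free_space_simps(1) by blast
 have L: "lin E1 V ?L" and R: "lin (free_space ?E) V ?R"
  using lin_subspace[OF s1] lin_subspace[OF s2] alg_homD(1)[OF alg_hom_left_cl] alg_homD(1)[OF alg_hom_right_cl] by simp_all
 have L': "lin E1 V (%p. ?L (Y.tact g p))"
  using lin_subspace[OF s1] lin_comp[OF alg_homD(1)[OF Y.alg_hom_tact[OF g]] alg_homD(1)[OF alg_hom_left_cl]] by simp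
 note c = linD(1)[OF L] linD(1)[OF R] linD(1)[OF L']
 note sums = sum.distrib distrib_left distrib_right sum_distrib_left mult_ac
 show ?thesis
 proof (rule bilinear_eq_on_free[where f = "%p q. m (?R q) (?L p)" and
    g = "%p q. m (?L (Y.tact g p)) (?R q) \<oplus>\<^bsub>V\<^esub> (\<Sum>b\<in>B. q [\<beta> b] * p [b]) \<odot>\<^bsub>V\<^esub> one_V",
    OF TP.vspc_tensor _ _ _ _ _ p q])
  fix q assume q: "q \<in> carrier (free_space ?E)"
  show "lin E1 V (%p. m (?R q) (?L p))" by (rule lin_comp[OF L LM[OF c(2)[OF q]]])
  show "lin E1 V (%p. m (?L (Y.tact g p)) (?R q) \<oplus>\<^bsub>V\<^esub> (\<Sum>b\<in>B. q [\<beta> b] * p [b]) \<odot>\<^bsub>V\<^esub> one_V)"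
   by (intro lin_add lin_comp[OF L' RM[OF c(2)[OF q]]] lin_functional TP.vspc_tensor one_V) (simp_all add: sums)
 next
  fix p assume p: "p \<in> carrier E1"
  show "lin (free_space ?E) V (%q. m (?R q) (?L p))" by (rule lin_comp[OF R RM[OF c(1)[OF p]]])
  show "lin (free_space ?E) V (%q. m (?L (Y.tact g p)) (?R q) \<oplus>\<^bsub>V\<^esub> (\<Sum>b\<in>B. q [\<beta> b] * p [b]) \<odot>\<^bsub>V\<^esub> one_V)"
   by (intro lin_add lin_comp[OF R LM[OF c(3)[OF p]]] lin_functional TP.vspc_tensor one_V) (simp_all add: sums)
 next
  fix w u assume "w \<in> (%c. [c]) ` B" "u \<in> ?E"
  then obtain v b where v: "v \<in> B" "w = [v]" and b: "b \<in> B" "x b = g" "u = [\<beta> b]" using beta_cases deg_dual by fastforce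
  have "(\<Sum>c\<in>B. delta u [\<beta> c] * delta w [c]) \<odot>\<^bsub>V\<^esub> one_V = (if b = v then one_V else \<zero>\<^bsub>V\<^esub>)"
   unfolding v(2) b(3) sum_letters[OF b(1) v(1)] using one_V by simp
  then show "m (?R (delta u)) (?L (delta w)) = m (?L (Y.tact g (delta w))) (?R (delta u)) \<oplus>\<^bsub>V\<^esub>
    (\<Sum>c\<in>B. delta u [\<beta> c] * delta w [c]) \<odot>\<^bsub>V\<^esub> one_V"
   using weyl_mult_rel b(1) v(1) Y.tact_letter[OF g v(1)] unfolding v(2) b(2)[symmetric] b(3) by simp
 qed
qed

text \<open>
 The translated generators satisfy the same relations: with \<open>f\<close> of degree \<open>x\<close>,
 \<open>g \<triangleright> f\<close> has degree \<open>g x g\<inverse>\<close>, and the pairing is invariant.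
\<close>

lemma weyl_automorphism:
 assumes g: "g \<in> carrier G"
 shows "\<exists>\<alpha>. alg_hom (weyl_rec m) (weyl_rec m) \<alpha> \<and> (\<forall>p\<in>carrier Y.T. \<forall>q\<in>carrier D.T.
  \<alpha> (tens (Y.cl p) (D.cl q)) = tens (Y.cl (Y.tact g p)) (D.cl (D.tact g q)))"
proof -
 note [simp del] = tensor_opaque
 let ?H = "%p. left_in (Y.cl (Y.tact g p))" and ?H' = "%q. right_in (D.cl (D.tact g q))"
 note Yt = Y.alg_hom_tact[OF g] and Dt = D.alg_hom_tact[OF g]
 note H = alg_hom_comp[OF Yt alg_hom_left_cl] and H' = alg_hom_comp[OF Dt alg_hom_right_cl]
 note Yc = linD(1)[OF alg_homD(1)[OF Yt]] and Dc = linD(1)[OF alg_homD(1)[OF Dt]]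
 have kY: "?H p = \<zero>\<^bsub>weyl_rec m\<^esub>" if "p \<in> Y.kern" for p
 proof -
  have "p \<in> carrier Y.T" "Y.tact g p \<in> Y.kern" using that Y.tact_kern[OF g that] unfolding Y.kern_def by blast+
  then have "Y.cl (Y.tact g p) = \<zero>\<^bsub>Y.N\<^esub>" using Y.NI.coset_zero_iff[OF Yc] by simp
  then show ?thesis using tens_lin_left(1) by simp
 qed
 have kD: "?H' q = \<zero>\<^bsub>weyl_rec m\<^esub>" if "q \<in> D.kern" for q
 proof -
  have "q \<in> carrier D.T" "D.tact g q \<in> D.kern" using that D.tact_kern[OF g that] unfolding D.kern_def by blast+
  then have "D.cl (D.tact g q) = \<zero>\<^bsub>D.N\<^esub>" using D.NI.coset_zero_iff[OF Dc] by simp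
  then show ?thesis using tens_lin_left(2) by simp
 qed
 have rel: "?H' (delta [\<beta> b]) \<otimes>\<^bsub>weyl_rec m\<^esub> ?H (delta [v]) = ?H (Y.letter_act (x b) v) \<otimes>\<^bsub>weyl_rec m\<^esub> ?H' (delta [\<beta> b])
   \<oplus>\<^bsub>weyl_rec m\<^esub> (if b = v then \<one>\<^bsub>weyl_rec m\<^esub> else \<zero>\<^bsub>weyl_rec m\<^esub>)" if b: "b \<in> B" and v: "v \<in> B" for b v
 proof -
  let ?y = "g \<otimes> x b \<otimes> inv g"
  have y: "?y \<in> carrier G" using g b by simp
  have "?y \<otimes> g = g \<otimes> x b" using g b by (simp add: Y.G.m_assoc)
  then have t: "Y.tact ?y (Y.letter_act g v) = Y.tact g (Y.letter_act (x b) v)"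
   using Y.tact_letter_act[OF y g v] Y.tact_letter_act[OF g x_closed[OF b] v] by simp
  have "(\<Sum>c\<in>B. D.letter_act g (\<beta> b) [\<beta> c] * Y.letter_act g v [c]) = (\<Sum>c\<in>B. r (inv g) b c * r g c v)"
   using g b by (intro sum.cong refl) (simp add: D.letter_act_def Y.letter_act_def r_dual)
  also have "\<dots> = (if b = v then 1 else 0)"
   using g b v Y.r_mult[of "inv g" g v b] by (simp add: Y.r_one)
  finally have "(\<Sum>c\<in>B. D.letter_act g (\<beta> b) [\<beta> c] * Y.letter_act g v [c]) \<odot>\<^bsub>V\<^esub> one_V = (if b = v then one_V else \<zero>\<^bsub>V\<^esub>)"
   using one_V by simp
  then show ?thesis
   using weyl_relation[OF y Y.letter_act_free[OF g v] D.letter_act_degree[OF g beta_in[OF b], unfolded deg_dual[OF b]]]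
   by (simp add: Y.tact_letter[OF g v] D.tact_letter[OF g beta_in[OF b]] t)
 qed
 from weyl_lift[OF ok weyl_complex_algebra H kY H' kD rel]
 show ?thesis using weyl_mult_LR Yc Dc by simp
qed

lemma weyl_action:
 "\<exists>\<alpha>. action G (weyl_rec m) \<alpha> \<and> (\<forall>g\<in>carrier G. \<forall>p\<in>carrier Y.T. \<forall>q\<in>carrier D.T.
  \<alpha> g (tens (Y.cl p) (D.cl q)) = tens (Y.cl (Y.tact g p)) (D.cl (D.tact g q)))"
proof -
 note [simp del] = tensor_opaque
 note CA = weyl_complex_algebra
 obtain \<alpha> where \<alpha>: "!!g. g \<in> carrier G ==> alg_hom (weyl_rec m) (weyl_rec m) (\<alpha> g)"
  and t: "!!g p q. g \<in> carrier G ==> p \<in> carrier Y.T ==> q \<in> carrier D.T ==>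
   \<alpha> g (tens (Y.cl p) (D.cl q)) = tens (Y.cl (Y.tact g p)) (D.cl (D.tact g q))"
  using weyl_automorphism by metis
 have e: "delta [] \<in> carrier Y.T" "delta [] \<in> carrier D.T" by (simp_all add: Y.word_closed D.word_closed)
 have te: "Y.tact g (delta []) = delta []" "D.tact g (delta []) = delta []" if "g \<in> carrier G" for g
  using alg_homD(2)[OF Y.alg_hom_tact[OF that]] alg_homD(2)[OF D.alg_hom_tact[OF that]] by simp_all
 have tv: "\<alpha> g (left_in (Y.cl p)) = left_in (Y.cl (Y.tact g p))" if "g \<in> carrier G" "p \<in> carrier Y.T" for g p
  using t[OF that e(2)] te(2)[OF that(1)] by (simp add: D.cl_one)
 have tf: "\<alpha> g (right_in (D.cl q)) = right_in (D.cl (D.tact g q))" if "g \<in> carrier G" "q \<in> carrier D.T" for g q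
  using t[OF that(1) e(1) that(2)] te(1)[OF that(1)] by (simp add: Y.cl_one)
 have one: "\<alpha> \<one> w = w" if "w \<in> carrier V" for w
 proof (rule weyl_unique[OF ok CA \<alpha> _ _ _ that])
  show "alg_hom (weyl_rec m) (weyl_rec m) (%w. w)" by (simp add: alg_hom_def lin_id)
 qed (simp_all add: tv tf Y.tact_letter D.tact_letter Y.letter_act_one D.letter_act_one Y.letter_closed D.letter_closed)
 have "\<alpha> (g \<otimes> h) w = \<alpha> g (\<alpha> h w)" if gh: "g \<in> carrier G" "h \<in> carrier G" and w: "w \<in> carrier V" for g h w
 proof (rule weyl_unique[OF ok CA \<alpha> alg_hom_comp[OF \<alpha> \<alpha>] _ _ w])
 qed (use gh in \<open>simp_all add: tv tf Y.tact_letter D.tact_letter Y.tact_letter_act D.tact_letter_act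
   Y.letter_closed D.letter_closed Y.letter_act_closed D.letter_act_closed\<close>)
 then have "action G (weyl_rec m) \<alpha>"
  using \<alpha> one by (simp add: action_def)
 then show ?thesis using t by blast
qed

end

end

subsection \<open>The action in terms of vectors and functionals\<close>

context yd_mod
begin

lemma beta_grade: "b \<in> B ==> \<beta> b \<in> grade Z (inv (dg b))"
 using beta_vspace[of b] dg(1)[of b] grade_rep[of _ _ b] by (auto simp: dual_simps(4) \<beta>_def)

lemma grade_vspace: "f \<in> grade Z g ==> f \<in> vspace Z"
 by (simp add: dual_simps(4))

lemma weyl_elements:
 "weyl_left G Y a = P.left_in a" "weyl_right G Y c = P.right_in c"
 "weyl_vec G Y v = P.left_in (Y.cl (vecY v))" "weyl_covec G Y f = P.right_in (D.cl (vecD f))"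
 by (simp_all add: weyl_left_def weyl_right_def weyl_vec_def weyl_covec_def)

lemma weyl_with: "weyl_with G Y m = P.weyl_rec m"
 by (simp add: weyl_with_def P.weyl_rec_def)

lemma weyl_mult_iff: "is_weyl_mult G Y m \<longleftrightarrow> P.weyl_ok m"
proof -
 note [simp del] = tensor_opaque
 let ?L = "%p. P.left_in (Y.cl p)" and ?R = "%q. P.right_in (D.cl q)" and ?W = "P.weyl_rec m"
 let ?A = "(\<forall>g\<in>carrier G. \<forall>f\<in>grade Z g. \<forall>v\<in>U. m (?R (vecD f)) (?L (vecY v)) \<ominus>\<^bsub>?W\<^esub> m (?L (vecY (act Y g v))) (?R (vecD f)) = f v \<odot>\<^bsub>P.V\<^esub> P.one_V)"
 let ?C = "(\<forall>b\<in>B. \<forall>v\<in>B. m (?R (delta [\<beta> b])) (?L (delta [v])) =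
    m (?L (Y.letter_act (P.x b) v)) (?R (delta [\<beta> b])) \<oplus>\<^bsub>P.V\<^esub> (if b = v then P.one_V else \<zero>\<^bsub>P.V\<^esub>))"
 have "?A \<longleftrightarrow> ?C"
  if CA: "complex_algebra ?W" and ok: "?C ==> P.weyl_ok m"
 proof -
  have mc: "m a c \<in> carrier P.V" if "a \<in> carrier P.V" "c \<in> carrier P.V" for a c
   using complex_algebra_simps(2)[OF CA] that by simp
  have LR: "?L p \<in> carrier P.V" "?R q \<in> carrier P.V" if "p \<in> carrier Y.T" "q \<in> carrier D.T" for p q
   using that by simp_all
  have minus: "m a c \<ominus>\<^bsub>?W\<^esub> m a' c' = k \<odot>\<^bsub>P.V\<^esub> P.one_V \<longleftrightarrow> m a c = m a' c' \<oplus>\<^bsub>P.V\<^esub> k \<odot>\<^bsub>P.V\<^esub> P.one_V"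
   if "a \<in> carrier P.V" "c \<in> carrier P.V" "a' \<in> carrier P.V" "c' \<in> carrier P.V" for a c a' c' k
   using minus_eq_iff[of ?W "m a c" "m a' c'" "k \<odot>\<^bsub>P.V\<^esub> P.one_V"] CA that mc P.one_V by simp
  show ?thesis
  proof
   assume A: ?A
   show ?C
   proof (intro ballI)
    fix b v assume b: "b \<in> B" and v: "v \<in> B"
    have "vecD (\<beta> b) = delta [\<beta> b]" "vecY v = delta [v]" "vecY (act Y (P.x b) v) = Y.letter_act (P.x b) v"
     using b v vec_letter vec_act_letter(1) by simp_all
    moreover have "\<beta> b v \<odot>\<^bsub>P.V\<^esub> P.one_V = (if b = v then P.one_V else \<zero>\<^bsub>P.V\<^esub>)"
     using beta_value[OF v, of b] P.one_V by simp
    moreover have "m (?R (vecD (\<beta> b))) (?L (vecY v)) \<ominus>\<^bsub>?W\<^esub> m (?L (vecY (act Y (P.x b) v))) (?R (vecD (\<beta> b))) = \<beta> b v \<odot>\<^bsub>P.V\<^esub> P.one_V"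
     using A P.x_closed[OF b] beta_grade[OF b] B_U[OF v] by blast
    ultimately show "m (?R (delta [\<beta> b])) (?L (delta [v])) =
     m (?L (Y.letter_act (P.x b) v)) (?R (delta [\<beta> b])) \<oplus>\<^bsub>P.V\<^esub> (if b = v then P.one_V else \<zero>\<^bsub>P.V\<^esub>)"
     using minus[of "?R (vecD (\<beta> b))" "?L (vecY v)" "?L (vecY (act Y (P.x b) v))" "?R (vecD (\<beta> b))" "\<beta> b v"]
      D.letter_closed[OF P.beta_in[OF b]] Y.letter_closed[OF v] Y.letter_act_closed[OF P.x_closed[OF b] v] by simp
   qed
  next
   assume ?C
   note ok = ok[OF this]
   show ?A
   proof (intro ballI)
    fix g f v assume g: "g \<in> carrier G" and f: "f \<in> grade Z g" and v: "v \<in> U"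
    show "m (?R (vecD f)) (?L (vecY v)) \<ominus>\<^bsub>?W\<^esub> m (?L (vecY (act Y g v))) (?R (vecD f)) = f v \<odot>\<^bsub>P.V\<^esub> P.one_V"
     using P.weyl_relation[OF ok g vec_free(1)[of v] grade_vec[OF g f]] pairing_coords[OF grade_vspace[OF f] v]
      minus[of "?R (vecD f)" "?L (vecY v)" "?L (vecY (act Y g v))" "?R (vecD f)" "f v"] LR vec_closed vec_act(1)[OF g v]
      linD(1)[OF alg_homD(1)[OF Y.alg_hom_tact[OF g]] vec_closed(1)[of v]]
     by simp
   qed
  qed
 qed
 then show ?thesis
  unfolding is_weyl_mult_def P.weyl_ok_def Let_def weyl_with weyl_elements nichols_algebras P.weyl_rec_simps by blast
qed

definition wm where "wm = (SOME m. is_weyl_mult G Y m)"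

abbreviation "W \<equiv> weyl_algebra G Y"

lemma W: "W = P.weyl_rec wm"
 by (simp add: weyl_algebra_def wm_def weyl_with)

lemma wm: "P.weyl_ok wm"
 using someI_ex[of "is_weyl_mult G Y"] P.weyl_ok_exists unfolding weyl_mult_iff wm_def by blast

lemma complex_algebra_W [simp]: "complex_algebra W"
 unfolding W by (rule P.weyl_complex_algebra[OF wm])

text \<open>
 The chosen automorphisms agree with the constructed ones, because both are determined by their values on the
 generators.
\<close>

lemma weyl_act:
 shows action_weyl_act: "action G W (weyl_act G Y)"
  and weyl_act_vec: "g \<in> carrier G ==> p \<in> carrier Y.T ==>
   weyl_act G Y g (P.left_in (Y.cl p)) = P.left_in (Y.cl (Y.tact g p))"
  and weyl_act_covec: "g \<in> carrier G ==> q \<in> carrier D.T ==>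
   weyl_act G Y g (P.right_in (D.cl q)) = P.right_in (D.cl (D.tact g q))"
proof -
 note [simp del] = tensor_opaque
 obtain \<alpha> where "action G (P.weyl_rec wm) \<alpha>" and t: "!!g p q. g \<in> carrier G ==> p \<in> carrier Y.T ==> q \<in> carrier D.T ==>
   \<alpha> g (P.tens (Y.cl p) (D.cl q)) = P.tens (Y.cl (Y.tact g p)) (D.cl (D.tact g q))"
  using P.weyl_action[OF wm] by blast
 then have a: "action G W \<alpha>" by (simp add: W)
 have hom: "!!g. g \<in> carrier G ==> alg_hom W W (\<alpha> g)" and one: "!!w. w \<in> carrier W ==> \<alpha> \<one> w = w"
  and mult: "!!g h w. g \<in> carrier G ==> h \<in> carrier G ==> w \<in> carrier W ==> \<alpha> (g \<otimes> h) w = \<alpha> g (\<alpha> h w)"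
  by (rule actionD[OF a]; assumption)+
 have e: "delta [] \<in> carrier Y.T" "delta [] \<in> carrier D.T" by (simp_all add: Y.word_closed D.word_closed)
 have te: "Y.tact g (delta []) = delta []" "D.tact g (delta []) = delta []" if "g \<in> carrier G" for g
  using alg_homD(2)[OF Y.alg_hom_tact[OF that]] alg_homD(2)[OF D.alg_hom_tact[OF that]] by simp_all
 have tv: "\<alpha> g (P.left_in (Y.cl p)) = P.left_in (Y.cl (Y.tact g p))" if "g \<in> carrier G" "p \<in> carrier Y.T" for g p
  using t[OF that e(2)] te(2)[OF that(1)] by (simp add: D.cl_one)
 have tf: "\<alpha> g (P.right_in (D.cl q)) = P.right_in (D.cl (D.tact g q))" if "g \<in> carrier G" "q \<in> carrier D.T" for g q
  using t[OF that(1) e(1) that(2)] te(1)[OF that(1)] by (simp add: Y.cl_one)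
 have eq: "weyl_act G Y g w = \<alpha> g w" if g: "g \<in> carrier G" and w: "w \<in> carrier W" for g w
 proof -
  let ?Q = "%\<alpha>. algebra_iso W W \<alpha> \<and> (\<forall>v\<in>U. \<alpha> (weyl_vec G Y v) = weyl_vec G Y (act Y g v)) \<and>
   (\<forall>f\<in>vspace Z. \<alpha> (weyl_covec G Y f) = weyl_covec G Y (act Z g f))"
  have "algebra_iso W W (\<alpha> g)"
   using g one mult[of "inv g" g] mult[of g "inv g"]
   by (intro algebra_isoI[where k = "\<alpha> (inv g)"] hom) simp_all
  then have "?Q (\<alpha> g)"
   using vec_closed by (simp add: weyl_elements tv tf g vec_act)
  then have Q: "?Q (weyl_act G Y g)" unfolding weyl_act_def by (rule someI[of ?Q])
  show ?thesis
  proof (rule P.weyl_unique[OF wm, where A = W and h = "weyl_act G Y g" and k = "\<alpha> g"])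
   show "alg_hom (P.weyl_rec wm) W (weyl_act G Y g)" using algebra_iso_hom Q W by metis
   show "alg_hom (P.weyl_rec wm) W (\<alpha> g)" using hom[OF g] W by simp
   show "weyl_act G Y g (P.left_in (Y.cl (delta [v]))) = \<alpha> g (P.left_in (Y.cl (delta [v])))" if v: "v \<in> B" for v
   proof -
    have "weyl_act G Y g (weyl_vec G Y v) = weyl_vec G Y (act Y g v)" using Q B_U[OF v] by blast
    then show ?thesis
     using v g by (simp add: weyl_elements vec_letter tv Y.letter_closed vec_act)
   qed
   show "weyl_act G Y g (P.right_in (D.cl (delta [\<beta> b]))) = \<alpha> g (P.right_in (D.cl (delta [\<beta> b])))" if b: "b \<in> B" for b
   proof -
    have "weyl_act G Y g (weyl_covec G Y (\<beta> b)) = weyl_covec G Y (act Z g (\<beta> b))" using Q beta_vspace[OF b] by blast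
    then show ?thesis
     using b g by (simp add: weyl_elements vec_letter tf D.letter_closed vec_act beta_vspace)
   qed
   show "w \<in> carrier P.V" using w W by simp
  qed simp
 qed
 have Wc: "carrier W = carrier P.V" by (simp add: W)
 have \<alpha>c: "\<alpha> g w \<in> carrier W" if "g \<in> carrier G" "w \<in> carrier W" for g w
  using linD(1)[OF alg_homD(1)[OF hom]] that by blast
 have "alg_hom W W (weyl_act G Y g)" if g: "g \<in> carrier G" for g
  using alg_homD[OF hom[OF g]] linD[OF alg_homD(1)[OF hom[OF g]]] eq[OF g] complex_algebra_W
  by (simp add: alg_hom_def lin_def)
 then show "action G W (weyl_act G Y)"
  using eq \<alpha>c one mult by (simp add: action_def)
 show "g \<in> carrier G ==> p \<in> carrier Y.T ==>
   weyl_act G Y g (P.left_in (Y.cl p)) = P.left_in (Y.cl (Y.tact g p))"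
  using eq tv Wc by simp
 show "g \<in> carrier G ==> q \<in> carrier D.T ==>
   weyl_act G Y g (P.right_in (D.cl q)) = P.right_in (D.cl (D.tact g q))"
  using eq tf Wc by simp
qed

sublocale WC: crossed_alg W G "weyl_act G Y"
 by (rule crossed_alg.intro) (simp_all add: action_weyl_act)

lemma weyl_crossed: "weyl_crossed G Y = WC.C"
 by (simp add: weyl_crossed_def)

end

section \<open>Two presentations by the same generators\<close>

text \<open>
 Conjugation is an algebra homomorphism; in this form covariance relations need to be checked on generators
 only.
\<close>

lemma conj_hom:
 assumes R: "complex_algebra R" and h: "alg_hom A R h" and a: "a \<in> carrier R" "a' \<in> carrier R"
  and inv: "a' \<otimes>\<^bsub>R\<^esub> a = \<one>\<^bsub>R\<^esub>" "a \<otimes>\<^bsub>R\<^esub> a' = \<one>\<^bsub>R\<^esub>"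
 shows "alg_hom A R (%t. a \<otimes>\<^bsub>R\<^esub> h t \<otimes>\<^bsub>R\<^esub> a')"
 unfolding alg_hom_def
proof (intro conjI ballI)
 note HD = alg_homD[OF h] and HL = linD[OF alg_homD(1)[OF h]]
 show "lin A R (%t. a \<otimes>\<^bsub>R\<^esub> h t \<otimes>\<^bsub>R\<^esub> a')"
  using lin_comp[OF lin_comp[OF HD(1) lin_mult_left[OF R a(1)]] lin_mult_right[OF R a(2)]] .
 show "a \<otimes>\<^bsub>R\<^esub> h \<one>\<^bsub>A\<^esub> \<otimes>\<^bsub>R\<^esub> a' = \<one>\<^bsub>R\<^esub>"
  using HD(2) inv(2) R a by simp
 fix s t assume s: "s \<in> carrier A" and t: "t \<in> carrier A"
 have "a \<otimes>\<^bsub>R\<^esub> h s \<otimes>\<^bsub>R\<^esub> a' \<otimes>\<^bsub>R\<^esub> (a \<otimes>\<^bsub>R\<^esub> h t \<otimes>\<^bsub>R\<^esub> a') = a \<otimes>\<^bsub>R\<^esub> h s \<otimes>\<^bsub>R\<^esub> (a' \<otimes>\<^bsub>R\<^esub> a) \<otimes>\<^bsub>R\<^esub> h t \<otimes>\<^bsub>R\<^esub> a'"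
  using R a HL(1)[OF s] HL(1)[OF t] by (simp add: algebra_assoc)
 then show "a \<otimes>\<^bsub>R\<^esub> h (s \<otimes>\<^bsub>A\<^esub> t) \<otimes>\<^bsub>R\<^esub> a' = a \<otimes>\<^bsub>R\<^esub> h s \<otimes>\<^bsub>R\<^esub> a' \<otimes>\<^bsub>R\<^esub> (a \<otimes>\<^bsub>R\<^esub> h t \<otimes>\<^bsub>R\<^esub> a')"
  using HD(3)[OF s t] inv(1) R a HL(1)[OF s] HL(1)[OF t] by (simp add: algebra_assoc)
qed

lemma conj_eq:
 assumes R: "complex_algebra R" and c: "a \<in> carrier R" "a' \<in> carrier R" "y \<in> carrier R" "z \<in> carrier R"
  and inv: "a' \<otimes>\<^bsub>R\<^esub> a = \<one>\<^bsub>R\<^esub>" "a \<otimes>\<^bsub>R\<^esub> a' = \<one>\<^bsub>R\<^esub>"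
 shows "a \<otimes>\<^bsub>R\<^esub> y \<otimes>\<^bsub>R\<^esub> a' = z \<longleftrightarrow> a \<otimes>\<^bsub>R\<^esub> y = z \<otimes>\<^bsub>R\<^esub> a"
proof
 assume "a \<otimes>\<^bsub>R\<^esub> y \<otimes>\<^bsub>R\<^esub> a' = z"
 then have "z \<otimes>\<^bsub>R\<^esub> a = a \<otimes>\<^bsub>R\<^esub> y \<otimes>\<^bsub>R\<^esub> (a' \<otimes>\<^bsub>R\<^esub> a)" using R c(1-3) by (auto simp: algebra_assoc)
 then show "a \<otimes>\<^bsub>R\<^esub> y = z \<otimes>\<^bsub>R\<^esub> a" using R c inv(1) by simp
next
 assume e: "a \<otimes>\<^bsub>R\<^esub> y = z \<otimes>\<^bsub>R\<^esub> a"
 have "a \<otimes>\<^bsub>R\<^esub> y \<otimes>\<^bsub>R\<^esub> a' = z \<otimes>\<^bsub>R\<^esub> (a \<otimes>\<^bsub>R\<^esub> a')" unfolding e using R c by (simp add: algebra_assoc)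
 then show "a \<otimes>\<^bsub>R\<^esub> y \<otimes>\<^bsub>R\<^esub> a' = z" using R c inv(2) by simp
qed

context yd_mod
begin

text \<open>
 Images of vectors, functionals and group elements in an algebra \<open>R\<close>, subject to the relations
 that both presentations share.
\<close>

definition covariant_triple
 where "covariant_triple R FY FD u \<longleftrightarrow> complex_algebra R \<and> alg_hom Y.T R FY \<and> alg_hom D.T R FD \<and>
  (\<forall>p\<in>Y.kern. FY p = \<zero>\<^bsub>R\<^esub>) \<and>
  (\<forall>g\<in>carrier G. u g \<in> carrier R) \<and> u \<one> = \<one>\<^bsub>R\<^esub> \<and>
  (\<forall>g\<in>carrier G. \<forall>h\<in>carrier G. u (g \<otimes> h) = u g \<otimes>\<^bsub>R\<^esub> u h) \<and>
  (\<forall>g\<in>carrier G. \<forall>b\<in>B. u g \<otimes>\<^bsub>R\<^esub> FY (delta [b]) = FY (Y.letter_act g b) \<otimes>\<^bsub>R\<^esub> u g) \<and>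
  (\<forall>g\<in>carrier G. \<forall>c\<in>B'. u g \<otimes>\<^bsub>R\<^esub> FD (delta [c]) = FD (D.letter_act g c) \<otimes>\<^bsub>R\<^esub> u g)"

definition weyl_triple
 where "weyl_triple R FY FD u \<longleftrightarrow> covariant_triple R FY FD u \<and>
  (\<forall>q\<in>D.kern. FD q = \<zero>\<^bsub>R\<^esub>) \<and>
  (\<forall>b\<in>B. \<forall>v\<in>B. FD (delta [\<beta> b]) \<otimes>\<^bsub>R\<^esub> FY (delta [v]) =
   FY (Y.letter_act (P.x b) v) \<otimes>\<^bsub>R\<^esub> FD (delta [\<beta> b]) \<oplus>\<^bsub>R\<^esub> (if b = v then \<one>\<^bsub>R\<^esub> else \<zero>\<^bsub>R\<^esub>))"

definition heisenberg_triple
 where "heisenberg_triple R FY FD u \<longleftrightarrow> covariant_triple R FY FD u \<and>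
  (\<forall>q\<in>nichols_ideal B' (flip_conj (\<Psi>\<^sub>D G Y)). FD q = \<zero>\<^bsub>R\<^esub>) \<and>
  (\<forall>b\<in>B. \<forall>v\<in>B. FD (delta [\<beta> b]) \<otimes>\<^bsub>R\<^esub> FY (delta [v]) =
   FY (delta [v]) \<otimes>\<^bsub>R\<^esub> FD (delta [\<beta> b]) \<oplus>\<^bsub>R\<^esub> (if b = v then u (dg v) else \<zero>\<^bsub>R\<^esub>))"

lemma flip_ideal:
 "q \<in> carrier D.T ==> D.untwist q \<in> nichols_ideal B' (flip_conj (\<Psi>\<^sub>D G Y)) \<longleftrightarrow> q \<in> D.kern"
 by (rule D.nichols_ideal_flip) (simp_all add: braiding_value vec_def r'_def)

context
 fixes R :: "(complex, 'a) module" and FY FD u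
 assumes triple: "covariant_triple R FY FD u"
begin

lemma triple_axioms:
 shows triple_R: "complex_algebra R" and triple_Y: "alg_hom Y.T R FY" and triple_D: "alg_hom D.T R FD"
  and triple_kern: "\<forall>p\<in>Y.kern. FY p = \<zero>\<^bsub>R\<^esub>"
  and triple_u': "\<forall>g\<in>carrier G. u g \<in> carrier R" and triple_one: "u \<one> = \<one>\<^bsub>R\<^esub>"
  and triple_mult': "\<forall>g\<in>carrier G. \<forall>h\<in>carrier G. u (g \<otimes> h) = u g \<otimes>\<^bsub>R\<^esub> u h"
  and triple_cov_Y': "\<forall>g\<in>carrier G. \<forall>b\<in>B. u g \<otimes>\<^bsub>R\<^esub> FY (delta [b]) = FY (Y.letter_act g b) \<otimes>\<^bsub>R\<^esub> u g"
  and triple_cov_D': "\<forall>g\<in>carrier G. \<forall>c\<in>B'. u g \<otimes>\<^bsub>R\<^esub> FD (delta [c]) = FD (D.letter_act g c) \<otimes>\<^bsub>R\<^esub> u g"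
 using triple unfolding covariant_triple_def by - ((elim conjE, assumption)+)

lemma triple_u: "g \<in> carrier G ==> u g \<in> carrier R"
 and triple_mult: "g \<in> carrier G ==> h \<in> carrier G ==> u (g \<otimes> h) = u g \<otimes>\<^bsub>R\<^esub> u h"
 and triple_cov_Y: "g \<in> carrier G ==> b \<in> B ==> u g \<otimes>\<^bsub>R\<^esub> FY (delta [b]) = FY (Y.letter_act g b) \<otimes>\<^bsub>R\<^esub> u g"
 and triple_cov_D: "g \<in> carrier G ==> c \<in> B' ==> u g \<otimes>\<^bsub>R\<^esub> FD (delta [c]) = FD (D.letter_act g c) \<otimes>\<^bsub>R\<^esub> u g"
 using triple_u' triple_mult' triple_cov_Y' triple_cov_D' by blast+

lemma triple_closed:
 "p \<in> carrier Y.T ==> FY p \<in> carrier R" "q \<in> carrier D.T ==> FD q \<in> carrier R"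
 by (rule linD(1)[OF alg_homD(1)[OF triple_Y]] linD(1)[OF alg_homD(1)[OF triple_D]]; assumption)+

lemma triple_inverse:
 assumes "g \<in> carrier G"
 shows "u (inv g) \<otimes>\<^bsub>R\<^esub> u g = \<one>\<^bsub>R\<^esub>" "u g \<otimes>\<^bsub>R\<^esub> u (inv g) = \<one>\<^bsub>R\<^esub>"
 using triple_mult[of "inv g" g] triple_mult[of g "inv g"] assms triple_one by simp_all

lemma triple_cancel: "g \<in> carrier G ==> y \<in> carrier R ==> u (inv g) \<otimes>\<^bsub>R\<^esub> (u g \<otimes>\<^bsub>R\<^esub> y) = y"
 "g \<in> carrier G ==> y \<in> carrier R ==> u g \<otimes>\<^bsub>R\<^esub> (u (inv g) \<otimes>\<^bsub>R\<^esub> y) = y"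
 using triple_inverse triple_R triple_u by (simp_all flip: algebra_assoc)

lemma triple_covariant_Y: "g \<in> carrier G ==> p \<in> carrier Y.T ==> u g \<otimes>\<^bsub>R\<^esub> FY p = FY (Y.tact g p) \<otimes>\<^bsub>R\<^esub> u g"
 by (rule Y.covariant[OF triple_R triple_u triple_one triple_mult triple_Y triple_cov_Y])

text \<open>
 The substitution \<open>f \<mapsto> u(k(x)) f\<close> for \<open>f\<close> of degree \<open>x\<close>. It is
 used with \<open>k(x) = x\<close> and \<open>k(x) = x\<inverse>\<close>; covariance only needs that
 \<open>k\<close> commutes with conjugation.
\<close>

definition twisted where "twisted k = extend_hom R (%c. u (k (dg' c)) \<otimes>\<^bsub>R\<^esub> FD (delta [c]))"

context
 fixes k :: "'g => 'g"
 assumes k: "!!y. y \<in> carrier G ==> k y \<in> carrier G"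
  and k_conj: "!!g y. g \<in> carrier G ==> y \<in> carrier G ==> k (g \<otimes> y \<otimes> inv g) \<otimes> g = g \<otimes> k y"
begin

lemma twisted_value_closed: "c \<in> B' ==> u (k (dg' c)) \<otimes>\<^bsub>R\<^esub> FD (delta [c]) \<in> carrier R"
 by (intro complex_algebra_simps(2) triple_R triple_u k D.deg_closed triple_closed D.letter_closed)

lemma alg_hom_twisted: "alg_hom D.T R (twisted k)"
 unfolding twisted_def by (rule alg_hom_extend_hom[OF triple_R twisted_value_closed])

lemma twisted_letter: "c \<in> B' ==> twisted k (delta [c]) = u (k (dg' c)) \<otimes>\<^bsub>R\<^esub> FD (delta [c])"
 unfolding twisted_def by (rule extend_hom_letter[OF triple_R twisted_value_closed])

lemma twisted_degree:
 assumes "y \<in> carrier G" "q \<in> carrier (free_space ((%c. [c]) ` {c \<in> B'. dg' c = y}))"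
 shows "twisted k q = u (k y) \<otimes>\<^bsub>R\<^esub> FD q"
 by (rule D.degree_twist[OF triple_R alg_homD(1)[OF triple_D] alg_homD(1)[OF alg_hom_twisted] triple_u[OF k[OF assms(1)]] _ assms(2)])
  (simp add: twisted_letter)

lemma twist_covariant: "covariant_triple R FY (twisted k) u"
proof -
 have "u g \<otimes>\<^bsub>R\<^esub> twisted k (delta [c]) = twisted k (D.letter_act g c) \<otimes>\<^bsub>R\<^esub> u g" if g: "g \<in> carrier G" and c: "c \<in> B'" for g c
 proof -
  let ?y = "dg' c" and ?z = "g \<otimes> dg' c \<otimes> inv g"
  have y: "?y \<in> carrier G" and z: "?z \<in> carrier G" using g c by simp_all
  note dc = triple_closed(2)[OF D.letter_closed[OF c]] and lc = triple_closed(2)[OF D.letter_act_closed[OF g c]]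
  note ky = triple_u[OF k[OF y]] and kz = triple_u[OF k[OF z]] and ug = triple_u[OF g]
  have "twisted k (D.letter_act g c) \<otimes>\<^bsub>R\<^esub> u g = u (k ?z) \<otimes>\<^bsub>R\<^esub> (FD (D.letter_act g c) \<otimes>\<^bsub>R\<^esub> u g)"
   unfolding twisted_degree[OF z D.letter_act_degree[OF g c]] by (rule algebra_assoc[OF triple_R kz lc ug])
  also have "\<dots> = u (k ?z) \<otimes>\<^bsub>R\<^esub> u g \<otimes>\<^bsub>R\<^esub> FD (delta [c])"
   unfolding triple_cov_D[OF g c, symmetric] by (rule algebra_assoc[OF triple_R kz ug dc, symmetric])
  also have "u (k ?z) \<otimes>\<^bsub>R\<^esub> u g = u g \<otimes>\<^bsub>R\<^esub> u (k ?y)"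
   using triple_mult[OF k[OF z] g] triple_mult[OF g k[OF y]] k_conj[OF g y] by simp
  also have "\<dots> \<otimes>\<^bsub>R\<^esub> FD (delta [c]) = u g \<otimes>\<^bsub>R\<^esub> twisted k (delta [c])"
   unfolding twisted_letter[OF c] by (rule algebra_assoc[OF triple_R ug ky dc])
  finally show ?thesis by simp
 qed
 then show ?thesis
  unfolding covariant_triple_def
  using triple_R triple_Y alg_hom_twisted triple_kern triple_u triple_one triple_mult triple_cov_Y by blast
qed

end

end

lemma conjugation_identities:
 assumes "g \<in> carrier G" "y \<in> carrier G"
 shows "g \<otimes> y \<otimes> inv g \<otimes> g = g \<otimes> y"
  and "inv (g \<otimes> y \<otimes> inv g) \<otimes> g = g \<otimes> inv y"
 using assms by (simp_all add: G.m_assoc G.inv_mult_group)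

text \<open>
 With \<open>f' = x f\<close>, the relations within the dual are those of \<open>twist_kills\<close>, and the
 cross relation is multiplied by \<open>x\<close>; its constant term becomes \<open>x deg v = 1\<close>.
\<close>

lemma heisenberg_to_weyl:
 assumes H: "heisenberg_triple R FY FD u"
 shows "weyl_triple R FY (twisted R FD u (%y. y)) u"
proof -
 have T: "covariant_triple R FY FD u" and kill: "\<forall>q\<in>nichols_ideal B' (flip_conj (\<Psi>\<^sub>D G Y)). FD q = \<zero>\<^bsub>R\<^esub>"
  and rel: "\<forall>b\<in>B. \<forall>v\<in>B. FD (delta [\<beta> b]) \<otimes>\<^bsub>R\<^esub> FY (delta [v]) =
   FY (delta [v]) \<otimes>\<^bsub>R\<^esub> FD (delta [\<beta> b]) \<oplus>\<^bsub>R\<^esub> (if b = v then u (dg v) else \<zero>\<^bsub>R\<^esub>)"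
  using H unfolding heisenberg_triple_def by - ((elim conjE, assumption)+)
 let ?F = "twisted R FD u (%y. y)"
 note k = _ conjugation_identities(1)
 note R = triple_R[OF T] and u = triple_u[OF T] and cl = triple_closed[OF T]
 have F: "alg_hom D.T R ?F" and letter: "!!c. c \<in> B' ==> ?F (delta [c]) = u (dg' c) \<otimes>\<^bsub>R\<^esub> FD (delta [c])"
  and TF: "covariant_triple R FY ?F u"
  by (rule alg_hom_twisted[OF T k] twisted_letter[OF T k] twist_covariant[OF T k]; assumption)+
 have "?F q = \<zero>\<^bsub>R\<^esub>" if "q \<in> D.kern" for q
  by (rule D.twist_kills[OF R u triple_one[OF T] triple_mult[OF T] triple_D[OF T] triple_cov_D[OF T] F letter _ that])
   (use kill flip_ideal in blast)+
 moreover have "?F (delta [\<beta> b]) \<otimes>\<^bsub>R\<^esub> FY (delta [v]) =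
   FY (Y.letter_act (P.x b) v) \<otimes>\<^bsub>R\<^esub> ?F (delta [\<beta> b]) \<oplus>\<^bsub>R\<^esub> (if b = v then \<one>\<^bsub>R\<^esub> else \<zero>\<^bsub>R\<^esub>)"
  if b: "b \<in> B" and v: "v \<in> B" for b v
 proof -
  let ?x = "u (P.x b)" and ?f = "FD (delta [\<beta> b])" and ?v = "FY (delta [v])" and ?w = "FY (Y.letter_act (P.x b) v)"
  have c: "?x \<in> carrier R" "?f \<in> carrier R" "?v \<in> carrier R" "?w \<in> carrier R" "u (dg v) \<in> carrier R"
   using b v by (auto intro!: u cl D.letter_closed Y.letter_closed Y.letter_act_closed)
  have d: "(if b = v then u (dg v) else \<zero>\<^bsub>R\<^esub>) \<in> carrier R" using c R by simp
  have "?F (delta [\<beta> b]) \<otimes>\<^bsub>R\<^esub> ?v = ?x \<otimes>\<^bsub>R\<^esub> (?f \<otimes>\<^bsub>R\<^esub> ?v)"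
   using algebra_assoc[OF R c(1-3)] b by (simp add: letter deg_beta)
  also have "\<dots> = ?x \<otimes>\<^bsub>R\<^esub> (?v \<otimes>\<^bsub>R\<^esub> ?f) \<oplus>\<^bsub>R\<^esub> ?x \<otimes>\<^bsub>R\<^esub> (if b = v then u (dg v) else \<zero>\<^bsub>R\<^esub>)"
   using algebra_distr[OF R c(1) _ d] R c rel b v by simp
  also have "?x \<otimes>\<^bsub>R\<^esub> (?v \<otimes>\<^bsub>R\<^esub> ?f) = (?x \<otimes>\<^bsub>R\<^esub> ?v) \<otimes>\<^bsub>R\<^esub> ?f"
   by (rule algebra_assoc[OF R c(1,3,2), symmetric])
  also have "\<dots> = ?w \<otimes>\<^bsub>R\<^esub> (?x \<otimes>\<^bsub>R\<^esub> ?f)"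
   unfolding triple_cov_Y[OF T P.x_closed[OF b] v] by (rule algebra_assoc[OF R c(4,1,2)])
  also have "?x \<otimes>\<^bsub>R\<^esub> (if b = v then u (dg v) else \<zero>\<^bsub>R\<^esub>) = (if b = v then \<one>\<^bsub>R\<^esub> else \<zero>\<^bsub>R\<^esub>)"
   using triple_inverse(1)[OF T dg(1)[OF v]] R c by auto
  finally show ?thesis using b by (simp add: letter deg_beta)
 qed
 ultimately show ?thesis unfolding weyl_triple_def using TF by blast
qed

text \<open>
 The inverse substitution, \<open>f \<mapsto> x\<inverse> f\<close>. As \<open>untwist\<close> is surjective,
 every relation of the flipped Nichols algebra comes from one of the original.
\<close>

lemma weyl_to_heisenberg:
 assumes H: "weyl_triple R FY FD u"
 shows "heisenberg_triple R FY (twisted R FD u (%y. inv y)) u"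
proof -
 have T: "covariant_triple R FY FD u" and kill: "\<forall>q\<in>D.kern. FD q = \<zero>\<^bsub>R\<^esub>"
  and rel: "\<forall>b\<in>B. \<forall>v\<in>B. FD (delta [\<beta> b]) \<otimes>\<^bsub>R\<^esub> FY (delta [v]) =
   FY (Y.letter_act (P.x b) v) \<otimes>\<^bsub>R\<^esub> FD (delta [\<beta> b]) \<oplus>\<^bsub>R\<^esub> (if b = v then \<one>\<^bsub>R\<^esub> else \<zero>\<^bsub>R\<^esub>)"
  using H unfolding weyl_triple_def by - ((elim conjE, assumption)+)
 let ?F = "twisted R FD u (%y. inv y)"
 note k = G.inv_closed conjugation_identities(2)
 note R = triple_R[OF T] and u = triple_u[OF T] and cl = triple_closed[OF T]
 have F: "alg_hom D.T R ?F" and letter: "!!c. c \<in> B' ==> ?F (delta [c]) = u (inv (dg' c)) \<otimes>\<^bsub>R\<^esub> FD (delta [c])"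
  and TF: "covariant_triple R FY ?F u"
  by (rule alg_hom_twisted[OF T k] twisted_letter[OF T k] twist_covariant[OF T k]; assumption)+
 \<comment> \<open>The inverse substitution undoes the substitution, so that \<open>untwist_kills\<close> applies to the new map.\<close>
 have tw: "FD (delta [c]) = u (dg' c) \<otimes>\<^bsub>R\<^esub> ?F (delta [c])" if "c \<in> B'" for c
  using triple_cancel(2)[OF T D.deg_closed[OF that] cl(2)[OF D.letter_closed[OF that]]] by (simp add: letter that)
 have "?F q = \<zero>\<^bsub>R\<^esub>" if q: "q \<in> nichols_ideal B' (flip_conj (\<Psi>\<^sub>D G Y))" for q
 proof -
  have "q \<in> carrier D.T" using q unfolding nichols_ideal_def by blast
  then obtain p where p: "p \<in> carrier D.T" "D.untwist p = q" using D.untwist_surj by blast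
  then have "p \<in> D.kern" using flip_ideal q by blast
  from D.untwist_kills[OF R u triple_one[OF T] triple_mult[OF T] F triple_cov_D[OF TF] triple_D[OF T] tw _ this] kill p(2)
  show ?thesis by blast
 qed
 moreover have "?F (delta [\<beta> b]) \<otimes>\<^bsub>R\<^esub> FY (delta [v]) =
   FY (delta [v]) \<otimes>\<^bsub>R\<^esub> ?F (delta [\<beta> b]) \<oplus>\<^bsub>R\<^esub> (if b = v then u (dg v) else \<zero>\<^bsub>R\<^esub>)"
  if b: "b \<in> B" and v: "v \<in> B" for b v
 proof -
  let ?x = "u (dg b)" and ?f = "FD (delta [\<beta> b])" and ?v = "FY (delta [v])" and ?w = "FY (Y.letter_act (P.x b) v)"
  have c: "?x \<in> carrier R" "?f \<in> carrier R" "?v \<in> carrier R" "?w \<in> carrier R"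
   using b v by (auto intro!: u cl D.letter_closed Y.letter_closed Y.letter_act_closed)
  have d: "(if b = v then \<one>\<^bsub>R\<^esub> else \<zero>\<^bsub>R\<^esub>) \<in> carrier R" using R by simp
  have l: "Y.letter_act (P.x b) v \<in> carrier Y.T" by (rule Y.letter_act_closed[OF P.x_closed[OF b] v])
  have xx: "inv (P.x b) = dg b" using b by simp
  have "Y.tact (dg b) (Y.letter_act (P.x b) v) = delta [v]"
   using b v by (simp add: Y.tact_letter_act Y.letter_act_one)
  then have cov: "?x \<otimes>\<^bsub>R\<^esub> ?w = ?v \<otimes>\<^bsub>R\<^esub> ?x"
   using triple_covariant_Y[OF T dg(1)[OF b] l] by simp
  have F: "?F (delta [\<beta> b]) = ?x \<otimes>\<^bsub>R\<^esub> ?f"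
   using letter[OF P.beta_in[OF b]] by (simp add: deg_beta[OF b] xx)
  have "?F (delta [\<beta> b]) \<otimes>\<^bsub>R\<^esub> ?v = ?x \<otimes>\<^bsub>R\<^esub> (?f \<otimes>\<^bsub>R\<^esub> ?v)"
   unfolding F by (rule algebra_assoc[OF R c(1-3)])
  also have "\<dots> = ?x \<otimes>\<^bsub>R\<^esub> (?w \<otimes>\<^bsub>R\<^esub> ?f) \<oplus>\<^bsub>R\<^esub> ?x \<otimes>\<^bsub>R\<^esub> (if b = v then \<one>\<^bsub>R\<^esub> else \<zero>\<^bsub>R\<^esub>)"
   using algebra_distr[OF R c(1) _ d] R c rel b v by simp
  also have "?x \<otimes>\<^bsub>R\<^esub> (?w \<otimes>\<^bsub>R\<^esub> ?f) = (?x \<otimes>\<^bsub>R\<^esub> ?w) \<otimes>\<^bsub>R\<^esub> ?f"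
   by (rule algebra_assoc[OF R c(1,4,2), symmetric])
  also have "\<dots> = ?v \<otimes>\<^bsub>R\<^esub> ?F (delta [\<beta> b])"
   unfolding cov F by (rule algebra_assoc[OF R c(3,1,2)])
  also have "?x \<otimes>\<^bsub>R\<^esub> (if b = v then \<one>\<^bsub>R\<^esub> else \<zero>\<^bsub>R\<^esub>) = (if b = v then u (dg v) else \<zero>\<^bsub>R\<^esub>)"
   using R c by auto
  finally show ?thesis .
 qed
 ultimately show ?thesis unfolding heisenberg_triple_def using TF by blast
qed

subsection \<open>The crossed product with the braided Weyl algebra\<close>

text \<open>The images of tensors over \<open>Y\<close> and over its dual in the crossed product.\<close>

abbreviation "kY p \<equiv> crossed W (P.left_in (Y.cl p)) \<one>"
abbreviation "kD q \<equiv> crossed W (P.right_in (D.cl q)) \<one>"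

lemma W_homs: "alg_hom Y.T W (%p. P.left_in (Y.cl p))" "alg_hom D.T W (%q. P.right_in (D.cl q))"
 unfolding W by (rule P.alg_hom_left_cl[OF wm] P.alg_hom_right_cl[OF wm])+

lemma W_unique:
 assumes "complex_algebra R" "alg_hom W R h" "alg_hom W R k"
  and "!!v. v \<in> B ==> h (P.left_in (Y.cl (delta [v]))) = k (P.left_in (Y.cl (delta [v])))"
  and "!!b. b \<in> B ==> h (P.right_in (D.cl (delta [\<beta> b]))) = k (P.right_in (D.cl (delta [\<beta> b])))"
  and "a \<in> carrier W"
 shows "h a = k a"
 using P.weyl_unique[OF wm assms(1) _ _ assms(4,5)] assms(2,3,6) by (simp add: W)

lemma weyl_triple_crossed: "weyl_triple WC.C kY kD (crossed W \<one>\<^bsub>W\<^esub>)"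
proof -
 note [simp del] = tensor_opaque WC.C_simps
 note LY = alg_hom_comp[OF W_homs(1) WC.alg_hom_crossed] and LD = alg_hom_comp[OF W_homs(2) WC.alg_hom_crossed]
 note cY = linD(1)[OF alg_homD(1)[OF W_homs(1)]] and cD = linD(1)[OF alg_homD(1)[OF W_homs(2)]]
 have cov: "crossed W \<one>\<^bsub>W\<^esub> g \<otimes>\<^bsub>WC.C\<^esub> crossed W a \<one> = crossed W (weyl_act G Y g a) \<one> \<otimes>\<^bsub>WC.C\<^esub> crossed W \<one>\<^bsub>W\<^esub> g"
  if "g \<in> carrier G" "a \<in> carrier W" for g a
  using that by (simp add: WC.crossed_mult)
 have zero: "crossed W \<zero>\<^bsub>W\<^esub> \<one> = \<zero>\<^bsub>WC.C\<^esub>"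
  using lin_zero[OF WC.lin_crossed[OF G.one_closed]] by simp
 have kY: "P.left_in (Y.cl p) = \<zero>\<^bsub>W\<^esub>" if "p \<in> Y.kern" for p
 proof -
  have "p \<in> carrier Y.T" using that unfolding Y.kern_def by blast
  then have "Y.cl p = \<zero>\<^bsub>Y.N\<^esub>" using Y.NI.coset_zero_iff that by blast
  then show ?thesis using P.tens_lin_left(1) by (simp add: W)
 qed
 have kD: "P.right_in (D.cl q) = \<zero>\<^bsub>W\<^esub>" if "q \<in> D.kern" for q
 proof -
  have "q \<in> carrier D.T" using that unfolding D.kern_def by blast
  then have "D.cl q = \<zero>\<^bsub>D.N\<^esub>" using D.NI.coset_zero_iff that by blast
  then show ?thesis using P.tens_lin_left(2) by (simp add: W)
 qed
 have rel: "kD (delta [\<beta> b]) \<otimes>\<^bsub>WC.C\<^esub> kY (delta [v]) =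
   kY (Y.letter_act (P.x b) v) \<otimes>\<^bsub>WC.C\<^esub> kD (delta [\<beta> b]) \<oplus>\<^bsub>WC.C\<^esub> (if b = v then \<one>\<^bsub>WC.C\<^esub> else \<zero>\<^bsub>WC.C\<^esub>)"
  if b: "b \<in> B" and v: "v \<in> B" for b v
 proof -
  let ?f = "P.right_in (D.cl (delta [\<beta> b]))" and ?v = "P.left_in (Y.cl (delta [v]))"
   and ?w = "P.left_in (Y.cl (Y.letter_act (P.x b) v))" and ?c = "%a. crossed W a \<one>"
  have c: "?f \<in> carrier W" "?v \<in> carrier W" "?w \<in> carrier W"
   using b v by (auto intro!: cY cD D.letter_closed Y.letter_closed Y.letter_act_closed)
  have "?f \<otimes>\<^bsub>W\<^esub> ?v = ?w \<otimes>\<^bsub>W\<^esub> ?f \<oplus>\<^bsub>W\<^esub> (if b = v then \<one>\<^bsub>W\<^esub> else \<zero>\<^bsub>W\<^esub>)"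
   using P.weyl_mult_rel[OF wm] b v by (simp add: W)
  then have "?c (?f \<otimes>\<^bsub>W\<^esub> ?v) = ?c (?w \<otimes>\<^bsub>W\<^esub> ?f) \<oplus>\<^bsub>WC.C\<^esub> ?c (if b = v then \<one>\<^bsub>W\<^esub> else \<zero>\<^bsub>W\<^esub>)"
   using c linD(2)[OF WC.lin_crossed[OF G.one_closed], of "?w \<otimes>\<^bsub>W\<^esub> ?f" "if b = v then \<one>\<^bsub>W\<^esub> else \<zero>\<^bsub>W\<^esub>"] by simp
  moreover have "?c (if b = v then \<one>\<^bsub>W\<^esub> else \<zero>\<^bsub>W\<^esub>) = (if b = v then \<one>\<^bsub>WC.C\<^esub> else \<zero>\<^bsub>WC.C\<^esub>)"
   using zero alg_homD(2)[OF WC.alg_hom_crossed] by simp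
  ultimately show ?thesis
   using alg_homD(3)[OF WC.alg_hom_crossed] c by simp
 qed
 have "covariant_triple WC.C kY kD (crossed W \<one>\<^bsub>W\<^esub>)"
  unfolding covariant_triple_def
 proof (intro conjI ballI)
  show "crossed W \<one>\<^bsub>W\<^esub> g \<in> carrier WC.C" if "g \<in> carrier G" for g using that by simp
  show "crossed W \<one>\<^bsub>W\<^esub> \<one> = \<one>\<^bsub>WC.C\<^esub>" using alg_homD(2)[OF WC.alg_hom_crossed] .
  show "crossed W \<one>\<^bsub>W\<^esub> (g \<otimes> h) = crossed W \<one>\<^bsub>W\<^esub> g \<otimes>\<^bsub>WC.C\<^esub> crossed W \<one>\<^bsub>W\<^esub> h"
   if "g \<in> carrier G" "h \<in> carrier G" for g h using that by (simp add: WC.crossed_mult)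
  show "crossed W \<one>\<^bsub>W\<^esub> g \<otimes>\<^bsub>WC.C\<^esub> kY (delta [b]) = kY (Y.letter_act g b) \<otimes>\<^bsub>WC.C\<^esub> crossed W \<one>\<^bsub>W\<^esub> g"
   if g: "g \<in> carrier G" and b: "b \<in> B" for g b
   using cov[OF g cY[OF Y.letter_closed[OF b]]] weyl_act_vec[OF g Y.letter_closed[OF b]] Y.tact_letter[OF g b] by simp
  show "crossed W \<one>\<^bsub>W\<^esub> g \<otimes>\<^bsub>WC.C\<^esub> kD (delta [c]) = kD (D.letter_act g c) \<otimes>\<^bsub>WC.C\<^esub> crossed W \<one>\<^bsub>W\<^esub> g"
   if g: "g \<in> carrier G" and c: "c \<in> B'" for g c
   using cov[OF g cD[OF D.letter_closed[OF c]]] weyl_act_covec[OF g D.letter_closed[OF c]] D.tact_letter[OF g c] by simp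
 qed (use LY LD kY zero in simp_all)
 then show ?thesis
  unfolding weyl_triple_def using kD zero rel by simp
qed

text \<open>
 The map on the braided Weyl algebra exists by \<open>weyl_lift\<close>; it is covariant because it is so on
 generators, and extends to the crossed product.
\<close>

lemma weyl_crossed_universal:
 assumes H: "weyl_triple R FY FD u"
 shows "\<exists>\<phi>. alg_hom WC.C R \<phi> \<and> (\<forall>p\<in>carrier Y.T. \<phi> (kY p) = FY p) \<and> (\<forall>q\<in>carrier D.T. \<phi> (kD q) = FD q) \<and>
  (\<forall>g\<in>carrier G. \<phi> (crossed W \<one>\<^bsub>W\<^esub> g) = u g)"
proof -
 note [simp del] = tensor_opaque WC.C_simps
 have T: "covariant_triple R FY FD u" and kill: "!!q. q \<in> D.kern ==> FD q = \<zero>\<^bsub>R\<^esub>"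
  and rel: "!!b v. b \<in> B ==> v \<in> B ==> FD (delta [\<beta> b]) \<otimes>\<^bsub>R\<^esub> FY (delta [v]) =
   FY (Y.letter_act (P.x b) v) \<otimes>\<^bsub>R\<^esub> FD (delta [\<beta> b]) \<oplus>\<^bsub>R\<^esub> (if b = v then \<one>\<^bsub>R\<^esub> else \<zero>\<^bsub>R\<^esub>)"
  using H unfolding weyl_triple_def by blast+
 note R = triple_R[OF T] and u = triple_u[OF T] and cl = triple_closed[OF T]
 obtain h where h: "alg_hom W R h"
  and hv: "!!p q. p \<in> carrier Y.T ==> q \<in> carrier D.T ==> h (P.tens (Y.cl p) (D.cl q)) = FY p \<otimes>\<^bsub>R\<^esub> FD q"
  using P.weyl_lift[OF wm R triple_Y[OF T] _ triple_D[OF T] kill rel] triple_kern[OF T] unfolding W by blast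
 have e: "delta [] \<in> carrier Y.T" "delta [] \<in> carrier D.T" by (simp_all add: Y.word_closed D.word_closed)
 have e1: "FY (delta []) = \<one>\<^bsub>R\<^esub>" "FD (delta []) = \<one>\<^bsub>R\<^esub>"
  using alg_homD(2)[OF triple_Y[OF T]] alg_homD(2)[OF triple_D[OF T]] by simp_all
 have hY: "h (P.left_in (Y.cl p)) = FY p" if "p \<in> carrier Y.T" for p
  using hv[OF that e(2)] cl(1)[OF that] R e1 by (simp add: D.cl_one)
 have hD: "h (P.right_in (D.cl q)) = FD q" if "q \<in> carrier D.T" for q
  using hv[OF e(1) that] cl(2)[OF that] R e1 by (simp add: Y.cl_one)
 have cov: "u g \<otimes>\<^bsub>R\<^esub> h a = h (weyl_act G Y g a) \<otimes>\<^bsub>R\<^esub> u g" if g: "g \<in> carrier G" and a: "a \<in> carrier W" for g a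
 proof -
  note inv = triple_inverse[OF T g] and ug = u[OF g] u[OF G.inv_closed[OF g]]
  note hc = linD(1)[OF alg_homD(1)[OF h]] and ga = WC.act_alg_hom[OF g]
  note c1 = conj_hom[OF R h ug inv] and c2 = alg_hom_comp[OF ga h]
  have "u g \<otimes>\<^bsub>R\<^esub> h a \<otimes>\<^bsub>R\<^esub> u (inv g) = h (weyl_act G Y g a)"
  proof (rule W_unique[OF R c1 c2 _ _ a])
   show "u g \<otimes>\<^bsub>R\<^esub> h (P.left_in (Y.cl (delta [v]))) \<otimes>\<^bsub>R\<^esub> u (inv g) = h (weyl_act G Y g (P.left_in (Y.cl (delta [v]))))"
    if v: "v \<in> B" for v
    unfolding weyl_act_vec[OF g Y.letter_closed[OF v]] Y.tact_letter[OF g v] hY[OF Y.letter_closed[OF v]] hY[OF Y.letter_act_closed[OF g v]]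
     conj_eq[OF R ug cl(1)[OF Y.letter_closed[OF v]] cl(1)[OF Y.letter_act_closed[OF g v]] inv]
    by (rule triple_cov_Y[OF T g v])
   show "u g \<otimes>\<^bsub>R\<^esub> h (P.right_in (D.cl (delta [\<beta> b]))) \<otimes>\<^bsub>R\<^esub> u (inv g) = h (weyl_act G Y g (P.right_in (D.cl (delta [\<beta> b]))))"
    if "b \<in> B" for b
   proof -
    note c = P.beta_in[OF that]
    show ?thesis
     unfolding weyl_act_covec[OF g D.letter_closed[OF c]] D.tact_letter[OF g c] hD[OF D.letter_closed[OF c]] hD[OF D.letter_act_closed[OF g c]]
      conj_eq[OF R ug cl(2)[OF D.letter_closed[OF c]] cl(2)[OF D.letter_act_closed[OF g c]] inv]
     by (rule triple_cov_D[OF T g c])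
   qed
  qed
  then show ?thesis
   using conj_eq[OF R ug hc[OF a] hc[OF WC.act_simps(1)[OF g a]] inv] by blast
 qed
 obtain \<phi> where \<phi>: "alg_hom WC.C R \<phi>" and v: "!!a g. a \<in> carrier W ==> g \<in> carrier G ==> \<phi> (crossed W a g) = h a \<otimes>\<^bsub>R\<^esub> u g"
  using WC.crossed_lift[OF R h u triple_one[OF T] triple_mult[OF T] cov] by blast
 have v1: "\<phi> (crossed W a \<one>) = h a" if "a \<in> carrier W" for a
  using v[OF that G.one_closed] triple_one[OF T] linD(1)[OF alg_homD(1)[OF h] that] R by simp
 have "\<phi> (crossed W \<one>\<^bsub>W\<^esub> g) = u g" if g: "g \<in> carrier G" for g
  using v[OF _ g, of "\<one>\<^bsub>W\<^esub>"] alg_homD(2)[OF h] u[OF g] R by simp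
 then show ?thesis
  using \<phi> v1 hY hD linD(1)[OF alg_homD(1)[OF W_homs(1)]] linD(1)[OF alg_homD(1)[OF W_homs(2)]] by auto
qed

text \<open>The crossed product is generated by vectors, functionals and group elements.\<close>

lemma weyl_crossed_unique:
 assumes R: "complex_algebra R" and h: "alg_hom WC.C R h" and k: "alg_hom WC.C R k"
  and "!!b. b \<in> B ==> h (kY (delta [b])) = k (kY (delta [b]))"
  and "!!b. b \<in> B ==> h (kD (delta [\<beta> b])) = k (kD (delta [\<beta> b]))"
  and "!!g. g \<in> carrier G ==> h (crossed W \<one>\<^bsub>W\<^esub> g) = k (crossed W \<one>\<^bsub>W\<^esub> g)"
  and "F \<in> carrier WC.C"
 shows "h F = k F"
proof (rule WC.crossed_unique[OF R h k _ assms(6,7)])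
 fix a assume a: "a \<in> carrier W"
 show "h (crossed W a \<one>) = k (crossed W a \<one>)"
  using W_unique[OF R alg_hom_comp[OF WC.alg_hom_crossed h] alg_hom_comp[OF WC.alg_hom_crossed k] _ _ a] assms(4,5) by simp
qed

end

section \<open>The universal property of the braided Heisenberg double\<close>

context yd_mod
begin

abbreviation "ST \<equiv> sum_algebra G Y"
abbreviation "iY \<equiv> inc_Y G Y"
abbreviation "iD \<equiv> inc_D G Y"

lemma ST: "ST = tensor_algebra (B <+> B')"
 by (simp add: sum_algebra_def)

lemma complex_algebra_ST [simp]: "complex_algebra ST"
 by (simp add: ST)

lemma ST_letter: "b \<in> B ==> delta [Inl b] \<in> carrier ST" "c \<in> B' ==> delta [Inr c] \<in> carrier ST"
 by (auto simp: ST)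

lemma alg_hom_inc: "alg_hom Y.T ST iY" "alg_hom D.T ST iD"
 unfolding inc_Y_def inc_D_def by (rule alg_hom_extend_hom[OF complex_algebra_ST ST_letter(1)] alg_hom_extend_hom[OF complex_algebra_ST ST_letter(2)]; assumption)+

lemma inc_letter: "b \<in> B ==> iY (delta [b]) = delta [Inl b]" "c \<in> B' ==> iD (delta [c]) = delta [Inr c]"
 unfolding inc_Y_def inc_D_def
 by (rule extend_hom_letter[OF complex_algebra_ST ST_letter(1)] extend_hom_letter[OF complex_algebra_ST ST_letter(2)]; assumption)+

lemma inc_closed: "p \<in> carrier Y.T ==> iY p \<in> carrier ST" "q \<in> carrier D.T ==> iD q \<in> carrier ST"
 by (rule linD(1)[OF alg_homD(1)[OF alg_hom_inc(1)]] linD(1)[OF alg_homD(1)[OF alg_hom_inc(2)]]; assumption)+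

lemma ST_unique:
 assumes R: "complex_algebra R" and h: "alg_hom ST R h" and k: "alg_hom ST R k"
  and "!!b. b \<in> B ==> h (delta [Inl b]) = k (delta [Inl b])" "!!c. c \<in> B' ==> h (delta [Inr c]) = k (delta [Inr c])"
  and "a \<in> carrier ST"
 shows "h a = k a"
 by (rule alg_hom_tensor_unique[OF R h[unfolded ST] k[unfolded ST] _ assms(6)[unfolded ST]]) (use assms(4,5) in auto)

lemma ST_lift:
 assumes R: "complex_algebra R" and FY: "alg_hom Y.T R FY" and FD: "alg_hom D.T R FD"
 shows "\<exists>h. alg_hom ST R h \<and> (\<forall>p\<in>carrier Y.T. h (iY p) = FY p) \<and> (\<forall>q\<in>carrier D.T. h (iD q) = FD q)"
proof -
 let ?v = "case_sum (%b. FY (delta [b])) (%c. FD (delta [c]))"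
 have v: "?v e \<in> carrier R" if "e \<in> B <+> B'" for e
  using that linD(1)[OF alg_homD(1)[OF FY] Y.letter_closed] linD(1)[OF alg_homD(1)[OF FD] D.letter_closed] by auto
 have h: "alg_hom ST R (extend_hom R ?v)"
  unfolding ST by (rule alg_hom_extend_hom[OF R v])
 have l: "extend_hom R ?v (delta [e]) = ?v e" if "e \<in> B <+> B'" for e
  by (rule extend_hom_letter[OF R v that])
 have "extend_hom R ?v (iY p) = FY p" if "p \<in> carrier Y.T" for p
  by (rule alg_hom_tensor_unique[OF R alg_hom_comp[OF alg_hom_inc(1) h] FY _ that]) (simp add: inc_letter l[OF InlI])
 moreover have "extend_hom R ?v (iD q) = FD q" if "q \<in> carrier D.T" for q
  by (rule alg_hom_tensor_unique[OF R alg_hom_comp[OF alg_hom_inc(2) h] FD _ that]) (simp add: inc_letter l[OF InrI])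
 ultimately show ?thesis using h by blast
qed

lemma sum_act:
 assumes g: "g \<in> carrier G"
 shows alg_hom_sum_act: "alg_hom ST ST (sum_act G Y g)"
  and sum_act_letter: "b \<in> B ==> sum_act G Y g (delta [Inl b]) = iY (Y.letter_act g b)"
   "c \<in> B' ==> sum_act G Y g (delta [Inr c]) = iD (D.letter_act g c)"
proof -
 let ?v = "case_sum (%b. iY (Y.letter_act g b)) (%c. iD (D.letter_act g c))"
 have e: "sum_act G Y g = extend_hom ST ?v"
  by (simp add: sum_act_def sum_vec_def sum_covec_def vec_act_letter)
 have v: "?v e \<in> carrier ST" if "e \<in> B <+> B'" for e
  using that inc_closed Y.letter_act_closed[OF g] D.letter_act_closed[OF g] by auto
 show "alg_hom ST ST (sum_act G Y g)"
  unfolding e by (subst (1) ST) (rule alg_hom_extend_hom[OF complex_algebra_ST v])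
 show "b \<in> B ==> sum_act G Y g (delta [Inl b]) = iY (Y.letter_act g b)"
  unfolding e using extend_hom_letter[where h = ?v and B = "B <+> B'", OF complex_algebra_ST v InlI] by simp
 show "c \<in> B' ==> sum_act G Y g (delta [Inr c]) = iD (D.letter_act g c)"
  unfolding e using extend_hom_letter[where h = ?v and B = "B <+> B'", OF complex_algebra_ST v InrI] by simp
qed

lemma sum_act_inc:
 assumes g: "g \<in> carrier G"
 shows "p \<in> carrier Y.T ==> sum_act G Y g (iY p) = iY (Y.tact g p)"
  and "q \<in> carrier D.T ==> sum_act G Y g (iD q) = iD (D.tact g q)"
proof -
 show "sum_act G Y g (iY p) = iY (Y.tact g p)" if "p \<in> carrier Y.T"
  by (rule alg_hom_tensor_unique[OF complex_algebra_ST alg_hom_comp[OF alg_hom_inc(1) alg_hom_sum_act[OF g]]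
     alg_hom_comp[OF Y.alg_hom_tact[OF g] alg_hom_inc(1)] _ that])
   (simp add: inc_letter sum_act_letter[OF g] Y.tact_letter[OF g])
 show "sum_act G Y g (iD q) = iD (D.tact g q)" if "q \<in> carrier D.T"
  by (rule alg_hom_tensor_unique[OF complex_algebra_ST alg_hom_comp[OF alg_hom_inc(2) alg_hom_sum_act[OF g]]
     alg_hom_comp[OF D.alg_hom_tact[OF g] alg_hom_inc(2)] _ that])
   (simp add: inc_letter sum_act_letter[OF g] D.tact_letter[OF g])
qed

lemma action_sum_act: "action G ST (sum_act G Y)"
proof -
 have id: "alg_hom ST ST (%a. a)" by (simp add: alg_hom_def P.lin_id)
 have "sum_act G Y \<one> a = a" if "a \<in> carrier ST" for a
  by (rule ST_unique[OF complex_algebra_ST alg_hom_sum_act[OF G.one_closed] id _ _ that])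
   (simp_all add: sum_act_letter[OF G.one_closed] Y.letter_act_one D.letter_act_one inc_letter)
 moreover have "sum_act G Y (g \<otimes> h) a = sum_act G Y g (sum_act G Y h a)"
  if gh: "g \<in> carrier G" "h \<in> carrier G" and a: "a \<in> carrier ST" for g h a
  by (rule ST_unique[OF complex_algebra_ST alg_hom_sum_act[OF G.m_closed[OF gh]]
     alg_hom_comp[OF alg_hom_sum_act[OF gh(2)] alg_hom_sum_act[OF gh(1)]] _ _ a])
   (simp_all add: gh sum_act_letter sum_act_inc Y.letter_act_closed D.letter_act_closed Y.tact_letter_act D.tact_letter_act
    del: tensor_algebra_simps(1))
 ultimately show ?thesis using alg_hom_sum_act by (simp add: action_def)
qed

sublocale SC: crossed_alg ST G "sum_act G Y"
 by (rule crossed_alg.intro) (simp_all add: action_sum_act)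

lemma big: "big_algebra G Y = SC.C" "big_inc G Y p = crossed ST p \<one>"
 by (simp_all add: big_algebra_def big_inc_def)

subsection \<open>The relations\<close>

text \<open>
 The element \<open>\<langle>f, v\<^sup>(\<^sup>0\<^sup>)\<rangle> v\<^sup>(\<^sup>1\<^sup>)\<close> as a
 bilinear function of coordinates.
\<close>

definition PT :: "('v list => complex) => (('v => complex) list => complex) => 'g => 'v sum_tensors"
 where "PT p q = (%g. if g \<in> carrier G then (\<Sum>b | b \<in> B \<and> dg b = g. q [\<beta> b] * p [b]) \<odot>\<^bsub>ST\<^esub> \<one>\<^bsub>ST\<^esub> else \<zero>\<^bsub>ST\<^esub>)"

lemma pairing_term:
 assumes "f \<in> vspace Z" "v \<in> U"
 shows "pairing_term G Y f v = PT (vecY v) (vecD f)"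
 unfolding pairing_term_def PT_def pairing_component[OF assms] ..

lemma PT_closed: "PT p q \<in> carrier SC.C"
proof -
 have "PT p q g = \<zero>\<^bsub>ST\<^esub>" if "g \<notin> dg ` B" for g
 proof -
  have "{b. b \<in> B \<and> dg b = g} = {}" using that by auto
  then have "(\<Sum>b | b \<in> B \<and> dg b = g. q [\<beta> b] * p [b]) = 0" by (simp only: sum.empty)
  then show ?thesis by (simp add: PT_def)
 qed
 then have "{g. PT p q g ~= \<zero>\<^bsub>ST\<^esub>} \<subseteq> dg ` B" by blast
 then have "finite {g. PT p q g ~= \<zero>\<^bsub>ST\<^esub>}" "{g. PT p q g ~= \<zero>\<^bsub>ST\<^esub>} \<subseteq> carrier G"
  using finite_subset[OF _ finite_imageI[OF finite_B]] dg(1) by (blast, blast)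
 moreover have "PT p q g \<in> carrier ST" for g by (simp add: PT_def)
 ultimately show ?thesis unfolding SC.carrier_C by blast
qed

lemma PT_lin: "lin (free_space E) SC.C (%p. PT p q)" "lin (free_space E') SC.C (PT p)"
 using PT_closed by (simp_all add: lin_def PT_def fun_eq_iff distrib_left distrib_right sum.distrib vspc_distl
   sum_distrib_left mult_ac)

lemma PT_letter:
 assumes b: "b \<in> B" and v: "v \<in> B"
 shows "PT (delta [v]) (delta [\<beta> b]) = (if b = v then crossed ST \<one>\<^bsub>ST\<^esub> (dg v) else \<zero>\<^bsub>SC.C\<^esub>)"
proof
 fix g
 have "(\<Sum>c | c \<in> B \<and> dg c = g. delta [\<beta> b] [\<beta> c] * delta [v] [c]) = (\<Sum>c | c \<in> B \<and> dg c = g. if c = b then (if b = v then 1 else 0) else 0)"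
  using b by (intro sum.cong refl) (auto simp: delta_def)
 also have "\<dots> = (if b = v \<and> dg v = g then 1 else 0)"
  using b finite_B by (simp add: sum.delta)
 finally show "PT (delta [v]) (delta [\<beta> b]) g = (if b = v then crossed ST \<one>\<^bsub>ST\<^esub> (dg v) else \<zero>\<^bsub>SC.C\<^esub>) g"
  using dg(1)[OF v] by (auto simp: PT_def crossed_def)
qed

lemma nichols_flip_closed: "q \<in> nichols_ideal B' (flip_conj (\<Psi>\<^sub>D G Y)) ==> q \<in> carrier D.T"
 unfolding nichols_ideal_def by blast

abbreviation "J p \<equiv> crossed ST p \<one>"

lemma J_inc: "alg_hom Y.T SC.C (%p. J (iY p))" "alg_hom D.T SC.C (%q. J (iD q))"
 by (rule alg_hom_comp[OF alg_hom_inc(1) SC.alg_hom_crossed] alg_hom_comp[OF alg_hom_inc(2) SC.alg_hom_crossed])+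

lemma J_closed: "p \<in> carrier Y.T ==> J (iY p) \<in> carrier SC.C" "q \<in> carrier D.T ==> J (iD q) \<in> carrier SC.C"
 by (rule linD(1)[OF alg_homD(1)[OF J_inc(1)]] linD(1)[OF alg_homD(1)[OF J_inc(2)]]; assumption)+

abbreviation "commutator p q \<equiv> J (iD q) \<otimes>\<^bsub>SC.C\<^esub> J (iY p) \<ominus>\<^bsub>SC.C\<^esub> J (iY p) \<otimes>\<^bsub>SC.C\<^esub> J (iD q) \<ominus>\<^bsub>SC.C\<^esub> PT p q"

lemma heisenberg_relations:
 "F \<in> heisenberg_relations G Y \<longleftrightarrow> (\<exists>p\<in>Y.kern. F = J (iY p)) \<or>
  (\<exists>q\<in>nichols_ideal B' (flip_conj (\<Psi>\<^sub>D G Y)). F = J (iD q)) \<or>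
  (\<exists>f\<in>vspace Z. \<exists>v\<in>U. F = commutator (vecY v) (vecD f))"
 unfolding heisenberg_relations_def Let_def big sum_vec_def sum_covec_def nichols_ideals(1)
 by (auto simp: image_iff pairing_term simp del: SC.C_simps) (metis pairing_term)+

lemma relations_closed: "heisenberg_relations G Y \<subseteq> carrier SC.C"
proof
 note [simp del] = tensor_opaque SC.C_simps
 fix F assume "F \<in> heisenberg_relations G Y"
 then show "F \<in> carrier SC.C"
  unfolding heisenberg_relations
 proof (elim disjE bexE)
  fix p assume "p \<in> Y.kern" "F = J (iY p)"
  moreover from this have "p \<in> carrier Y.T" unfolding Y.kern_def by blast
  ultimately show ?thesis using J_closed(1) by blast
 next
  fix q assume "q \<in> nichols_ideal B' (flip_conj (\<Psi>\<^sub>D G Y))" "F = J (iD q)"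
  then show ?thesis using J_closed(2) nichols_flip_closed by blast
 next
  fix f v assume "F = commutator (vecY v) (vecD f)"
  then show ?thesis using J_closed(1)[OF vec_closed(1)[of v]] J_closed(2)[OF vec_closed(2)[of f]] PT_closed by simp
 qed
qed

abbreviation "I \<equiv> heisenberg_ideal G Y"

lemma ideal_I: "ideal I SC.C"
 unfolding heisenberg_ideal_def big
 by (rule ring.genideal_ideal[OF complex_algebra_ring[OF SC.complex_algebra_C] relations_closed])

sublocale HI: algebra_ideal SC.C I
 by (rule algebra_ideal.intro[OF SC.complex_algebra_C ideal_I])

abbreviation "H \<equiv> heisenberg_double G Y"
abbreviation "\<pi> F \<equiv> I +>\<^bsub>SC.C\<^esub> F"
abbreviation "hY p \<equiv> \<pi> (J (iY p))"
abbreviation "hD q \<equiv> \<pi> (J (iD q))"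

lemma H: "H = quotient SC.C I"
 by (simp add: heisenberg_double_def big)

lemma complex_algebra_H [simp]: "complex_algebra H"
 unfolding H by (rule HI.complex_algebra_quotient)

lemma alg_hom_\<pi>: "alg_hom SC.C H (%F. \<pi> F)"
 unfolding H by (rule HI.alg_hom_coset)

lemma heis_elements:
 "heis_vec G Y v = hY (vecY v)" "heis_covec G Y f = hD (vecD f)" "heis_grp G Y g = \<pi> (crossed ST \<one>\<^bsub>ST\<^esub> g)"
 by (simp_all add: heis_vec_def heis_covec_def heis_grp_def big sum_vec_def sum_covec_def)

lemma relation_zero:
 assumes "F \<in> heisenberg_relations G Y"
 shows "\<pi> F = \<zero>\<^bsub>H\<^esub>"
proof -
 have "F \<in> I" using ring.genideal_self[OF complex_algebra_ring[OF SC.complex_algebra_C] relations_closed] assms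
  unfolding heisenberg_ideal_def big by blast
 then show ?thesis using HI.coset_zero_iff[of F] relations_closed assms unfolding H by blast
qed

lemma minus_minus_zero:
 assumes "vspc A" "x \<in> carrier A" "y \<in> carrier A" "z \<in> carrier A"
 shows "x \<ominus>\<^bsub>A\<^esub> y \<ominus>\<^bsub>A\<^esub> z = \<zero>\<^bsub>A\<^esub> \<longleftrightarrow> x = y \<oplus>\<^bsub>A\<^esub> z"
 using minus_eq_iff[OF assms(1), of "x \<ominus>\<^bsub>A\<^esub> y" z "\<zero>\<^bsub>A\<^esub>"] minus_eq_iff[OF assms] assms by simp

lemma heisenberg_triple_double: "heisenberg_triple H hY hD (heis_grp G Y)"
proof -
 note [simp del] = tensor_opaque SC.C_simps
 let ?u = "crossed ST \<one>\<^bsub>ST\<^esub>"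
 note P1 = alg_homD[OF alg_hom_\<pi>] and PL = linD[OF alg_homD(1)[OF alg_hom_\<pi>]]
 have uC: "?u g \<in> carrier SC.C" if "g \<in> carrier G" for g using that by simp
 have cov: "\<pi> (?u g) \<otimes>\<^bsub>H\<^esub> \<pi> (J a) = \<pi> (J (sum_act G Y g a)) \<otimes>\<^bsub>H\<^esub> \<pi> (?u g)" if "g \<in> carrier G" "a \<in> carrier ST" for g a
  using that P1(3)[of "?u g" "J a"] P1(3)[of "J (sum_act G Y g a)" "?u g"] by (simp add: SC.crossed_mult)
 have "covariant_triple H hY hD (heis_grp G Y)"
  unfolding covariant_triple_def heis_elements(3)[abs_def]
 proof (intro conjI ballI)
  show "alg_hom Y.T H hY" "alg_hom D.T H hD"
   by (rule alg_hom_comp[OF J_inc(1) alg_hom_\<pi>] alg_hom_comp[OF J_inc(2) alg_hom_\<pi>])+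
  show "hY p = \<zero>\<^bsub>H\<^esub>" if "p \<in> Y.kern" for p
   by (rule relation_zero) (use that heisenberg_relations in blast)
  show "\<pi> (?u g) \<in> carrier H" if "g \<in> carrier G" for g using PL(1)[OF uC[OF that]] .
  show "\<pi> (?u \<one>) = \<one>\<^bsub>H\<^esub>" using P1(2) alg_homD(2)[OF SC.alg_hom_crossed] by simp
  show "\<pi> (?u (g \<otimes> h)) = \<pi> (?u g) \<otimes>\<^bsub>H\<^esub> \<pi> (?u h)" if "g \<in> carrier G" "h \<in> carrier G" for g h
   using P1(3)[OF uC[OF that(1)] uC[OF that(2)]] that by (simp add: SC.crossed_mult)
  show "\<pi> (?u g) \<otimes>\<^bsub>H\<^esub> hY (delta [b]) = hY (Y.letter_act g b) \<otimes>\<^bsub>H\<^esub> \<pi> (?u g)" if "g \<in> carrier G" "b \<in> B" for g b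
   using cov[OF that(1) ST_letter(1)[OF that(2)]] that by (simp add: inc_letter sum_act_letter)
  show "\<pi> (?u g) \<otimes>\<^bsub>H\<^esub> hD (delta [c]) = hD (D.letter_act g c) \<otimes>\<^bsub>H\<^esub> \<pi> (?u g)" if "g \<in> carrier G" "c \<in> B'" for g c
   using cov[OF that(1) ST_letter(2)[OF that(2)]] that by (simp add: inc_letter sum_act_letter)
 qed simp
 moreover have "hD q = \<zero>\<^bsub>H\<^esub>" if "q \<in> nichols_ideal B' (flip_conj (\<Psi>\<^sub>D G Y))" for q
  by (rule relation_zero) (use that heisenberg_relations in blast)
 moreover have "hD (delta [\<beta> b]) \<otimes>\<^bsub>H\<^esub> hY (delta [v]) =
   hY (delta [v]) \<otimes>\<^bsub>H\<^esub> hD (delta [\<beta> b]) \<oplus>\<^bsub>H\<^esub> (if b = v then heis_grp G Y (dg v) else \<zero>\<^bsub>H\<^esub>)"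
  if b: "b \<in> B" and v: "v \<in> B" for b v
 proof -
  let ?f = "J (iD (delta [\<beta> b]))" and ?v = "J (iY (delta [v]))" and ?t = "PT (delta [v]) (delta [\<beta> b])"
  have "commutator (vecY v) (vecD (\<beta> b)) \<in> heisenberg_relations G Y"
   unfolding heisenberg_relations using beta_vspace[OF b] B_U[OF v] by blast
  then have z: "\<pi> (?f \<otimes>\<^bsub>SC.C\<^esub> ?v \<ominus>\<^bsub>SC.C\<^esub> ?v \<otimes>\<^bsub>SC.C\<^esub> ?f \<ominus>\<^bsub>SC.C\<^esub> ?t) = \<zero>\<^bsub>H\<^esub>"
   using relation_zero b v by (simp add: vec_letter)
  have c: "?f \<in> carrier SC.C" "?v \<in> carrier SC.C" "?t \<in> carrier SC.C"
   using b v J_closed PT_closed by (simp_all add: D.letter_closed Y.letter_closed)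
  have "\<pi> (?f \<otimes>\<^bsub>SC.C\<^esub> ?v) \<ominus>\<^bsub>H\<^esub> \<pi> (?v \<otimes>\<^bsub>SC.C\<^esub> ?f) \<ominus>\<^bsub>H\<^esub> \<pi> ?t = \<zero>\<^bsub>H\<^esub>"
   using z c by (simp add: lin_minus[OF P1(1)])
  then have "\<pi> (?f \<otimes>\<^bsub>SC.C\<^esub> ?v) = \<pi> (?v \<otimes>\<^bsub>SC.C\<^esub> ?f) \<oplus>\<^bsub>H\<^esub> \<pi> ?t"
   using minus_minus_zero[of H "\<pi> (?f \<otimes>\<^bsub>SC.C\<^esub> ?v)" "\<pi> (?v \<otimes>\<^bsub>SC.C\<^esub> ?f)" "\<pi> ?t"] c PL(1) by simp
  moreover have "\<pi> ?t = (if b = v then heis_grp G Y (dg v) else \<zero>\<^bsub>H\<^esub>)"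
   unfolding PT_letter[OF b v] heis_elements(3) using lin_zero[OF P1(1)] by simp
  ultimately show ?thesis using P1(3) c by simp
 qed
 ultimately show ?thesis unfolding heisenberg_triple_def by blast
qed

text \<open>
 The map on the crossed product of the free algebra sends all defining relations to zero; for the relations
 between \<open>f\<close> and \<open>v\<close> this is checked on basis vectors and extended by bilinearity.
\<close>

lemma heisenberg_universal:
 assumes T: "heisenberg_triple R FY FD u"
 shows "\<exists>\<psi>. alg_hom H R \<psi> \<and> (\<forall>p\<in>carrier Y.T. \<psi> (hY p) = FY p) \<and> (\<forall>q\<in>carrier D.T. \<psi> (hD q) = FD q) \<and>
  (\<forall>g\<in>carrier G. \<psi> (heis_grp G Y g) = u g)"
proof -
 note [simp del] = tensor_opaque SC.C_simps
 have T: "covariant_triple R FY FD u" and kill: "!!q. q \<in> nichols_ideal B' (flip_conj (\<Psi>\<^sub>D G Y)) ==> FD q = \<zero>\<^bsub>R\<^esub>"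
  and rel: "!!b v. b \<in> B ==> v \<in> B ==> FD (delta [\<beta> b]) \<otimes>\<^bsub>R\<^esub> FY (delta [v]) =
   FY (delta [v]) \<otimes>\<^bsub>R\<^esub> FD (delta [\<beta> b]) \<oplus>\<^bsub>R\<^esub> (if b = v then u (dg v) else \<zero>\<^bsub>R\<^esub>)"
  using T unfolding heisenberg_triple_def by blast+
 note R = triple_R[OF T] and u = triple_u[OF T] and cl = triple_closed[OF T]
 have RV: "vspc R" using R by simp
 obtain h where h: "alg_hom ST R h" and hY: "!!p. p \<in> carrier Y.T ==> h (iY p) = FY p" and hD: "!!q. q \<in> carrier D.T ==> h (iD q) = FD q"
  using ST_lift[OF R triple_Y[OF T] triple_D[OF T]] by blast
 have hl: "b \<in> B ==> h (delta [Inl b]) = FY (delta [b])" "c \<in> B' ==> h (delta [Inr c]) = FD (delta [c])" for b c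
  using hY[OF Y.letter_closed] hD[OF D.letter_closed] by (simp_all add: inc_letter)
 have cov: "u g \<otimes>\<^bsub>R\<^esub> h a = h (sum_act G Y g a) \<otimes>\<^bsub>R\<^esub> u g" if g: "g \<in> carrier G" and a: "a \<in> carrier ST" for g a
 proof -
  note inv = triple_inverse[OF T g] and ug = u[OF g] u[OF G.inv_closed[OF g]]
  note hc = linD(1)[OF alg_homD(1)[OF h]] and ga = alg_hom_sum_act[OF g]
  have "u g \<otimes>\<^bsub>R\<^esub> h a \<otimes>\<^bsub>R\<^esub> u (inv g) = h (sum_act G Y g a)"
  proof (rule ST_unique[OF R conj_hom[OF R h ug inv] alg_hom_comp[OF ga h] _ _ a])
   show "u g \<otimes>\<^bsub>R\<^esub> h (delta [Inl b]) \<otimes>\<^bsub>R\<^esub> u (inv g) = h (sum_act G Y g (delta [Inl b]))" if b: "b \<in> B" for b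
    unfolding sum_act_letter(1)[OF g b] hl(1)[OF b] hY[OF Y.letter_act_closed[OF g b]]
     conj_eq[OF R ug cl(1)[OF Y.letter_closed[OF b]] cl(1)[OF Y.letter_act_closed[OF g b]] inv]
    by (rule triple_cov_Y[OF T g b])
   show "u g \<otimes>\<^bsub>R\<^esub> h (delta [Inr c]) \<otimes>\<^bsub>R\<^esub> u (inv g) = h (sum_act G Y g (delta [Inr c]))" if c: "c \<in> B'" for c
    unfolding sum_act_letter(2)[OF g c] hl(2)[OF c] hD[OF D.letter_act_closed[OF g c]]
     conj_eq[OF R ug cl(2)[OF D.letter_closed[OF c]] cl(2)[OF D.letter_act_closed[OF g c]] inv]
    by (rule triple_cov_D[OF T g c])
  qed
  then show ?thesis
   using conj_eq[OF R ug hc[OF a] hc[OF SC.act_simps(1)[OF g a]] inv] by blast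
 qed
 obtain \<psi> where \<psi>: "alg_hom SC.C R \<psi>" and v: "!!a g. a \<in> carrier ST ==> g \<in> carrier G ==> \<psi> (crossed ST a g) = h a \<otimes>\<^bsub>R\<^esub> u g"
  using SC.crossed_lift[OF R h u triple_one[OF T] triple_mult[OF T] cov] by blast
 note \<psi>1 = alg_homD[OF \<psi>] and \<psi>L = linD[OF alg_homD(1)[OF \<psi>]]
 have vJ: "\<psi> (J a) = h a" if "a \<in> carrier ST" for a
  using v[OF that G.one_closed] triple_one[OF T] linD(1)[OF alg_homD(1)[OF h] that] R by simp
 have vY: "\<psi> (J (iY p)) = FY p" if "p \<in> carrier Y.T" for p using vJ[OF inc_closed(1)[OF that]] hY[OF that] by simp
 have vD: "\<psi> (J (iD q)) = FD q" if "q \<in> carrier D.T" for q using vJ[OF inc_closed(2)[OF that]] hD[OF that] by simp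
 have vu: "\<psi> (crossed ST \<one>\<^bsub>ST\<^esub> g) = u g" if g: "g \<in> carrier G" for g
  using v[OF _ g, of "\<one>\<^bsub>ST\<^esub>"] alg_homD(2)[OF h] u[OF g] R by simp
 have comm: "FD q \<otimes>\<^bsub>R\<^esub> FY p = FY p \<otimes>\<^bsub>R\<^esub> FD q \<oplus>\<^bsub>R\<^esub> \<psi> (PT p q)"
  if p: "p \<in> carrier (free_space ((%c. [c]) ` B))" and q: "q \<in> carrier (free_space ((%c. [c]) ` B'))" for p q
 proof -
  let ?E = "(%c. [c]) ` B" and ?E' = "(%c. [c]) ` B'"
  have s: "?E \<subseteq> lists B" "?E' \<subseteq> lists B'" by auto
  have LY: "lin (free_space ?E) R FY" and LD: "lin (free_space ?E') R FD"
   using lin_subspace[OF s(1)] lin_subspace[OF s(2)] alg_homD(1)[OF triple_Y[OF T]] alg_homD(1)[OF triple_D[OF T]] by simp_all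
  note c = linD(1)[OF LY] linD(1)[OF LD]
  show ?thesis
  proof (rule bilinear_eq_on_free[where f = "%p q. FD q \<otimes>\<^bsub>R\<^esub> FY p" and
     g = "%p q. FY p \<otimes>\<^bsub>R\<^esub> FD q \<oplus>\<^bsub>R\<^esub> \<psi> (PT p q)", OF RV _ _ _ _ _ p q])
   fix q assume q: "q \<in> carrier (free_space ?E')"
   show "lin (free_space ?E) R (%p. FD q \<otimes>\<^bsub>R\<^esub> FY p)" by (rule lin_comp[OF LY lin_mult_left[OF R c(2)[OF q]]])
   show "lin (free_space ?E) R (%p. FY p \<otimes>\<^bsub>R\<^esub> FD q \<oplus>\<^bsub>R\<^esub> \<psi> (PT p q))"
    by (rule lin_add[OF RV lin_comp[OF LY lin_mult_right[OF R c(2)[OF q]]] lin_comp[OF PT_lin(1) \<psi>1(1)]])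
  next
   fix p assume p: "p \<in> carrier (free_space ?E)"
   show "lin (free_space ?E') R (%q. FD q \<otimes>\<^bsub>R\<^esub> FY p)" by (rule lin_comp[OF LD lin_mult_right[OF R c(1)[OF p]]])
   show "lin (free_space ?E') R (%q. FY p \<otimes>\<^bsub>R\<^esub> FD q \<oplus>\<^bsub>R\<^esub> \<psi> (PT p q))"
    by (rule lin_add[OF RV lin_comp[OF LD lin_mult_left[OF R c(1)[OF p]]] lin_comp[OF PT_lin(2) \<psi>1(1)]])
  next
   fix w w' assume "w \<in> ?E" "w' \<in> ?E'"
   then obtain v b where v: "v \<in> B" "w = [v]" and b: "b \<in> B" "w' = [\<beta> b]" using P.beta_cases by blast
   have "\<psi> (PT (delta w) (delta w')) = (if b = v then u (dg v) else \<zero>\<^bsub>R\<^esub>)"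
    unfolding v(2) b(2) PT_letter[OF b(1) v(1)] using vu[OF dg(1)[OF v(1)]] lin_zero[OF \<psi>1(1)] RV by simp
   then show "FD (delta w') \<otimes>\<^bsub>R\<^esub> FY (delta w) = FY (delta w) \<otimes>\<^bsub>R\<^esub> FD (delta w') \<oplus>\<^bsub>R\<^esub> \<psi> (PT (delta w) (delta w'))"
    using rel[OF b(1) v(1)] by (simp add: v(2) b(2))
  qed
 qed
 \<comment> \<open>It suffices that the kernel contains the generators of the ideal.\<close>
 let ?K = "{F \<in> carrier SC.C. \<psi> F = \<zero>\<^bsub>R\<^esub>}"
 have "heisenberg_relations G Y \<subseteq> ?K"
 proof
  fix F assume F: "F \<in> heisenberg_relations G Y"
  then have "\<psi> F = \<zero>\<^bsub>R\<^esub>"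
   unfolding heisenberg_relations
  proof (elim disjE bexE)
   fix p assume p: "p \<in> Y.kern" "F = J (iY p)"
   moreover from this have "p \<in> carrier Y.T" unfolding Y.kern_def by blast
   ultimately show ?thesis using vY triple_kern[OF T] by simp
  next
   fix q assume "q \<in> nichols_ideal B' (flip_conj (\<Psi>\<^sub>D G Y))" "F = J (iD q)"
   then show ?thesis using vD kill nichols_flip_closed by simp
  next
   fix f v assume F: "F = commutator (vecY v) (vecD f)"
   note c = J_closed(1)[OF vec_closed(1)[of v]] J_closed(2)[OF vec_closed(2)[of f]] PT_closed[of "vecY v" "vecD f"]
   have "\<psi> F = FD (vecD f) \<otimes>\<^bsub>R\<^esub> FY (vecY v) \<ominus>\<^bsub>R\<^esub> FY (vecY v) \<otimes>\<^bsub>R\<^esub> FD (vecD f) \<ominus>\<^bsub>R\<^esub> \<psi> (PT (vecY v) (vecD f))"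
    unfolding F using c RV \<psi>1(3) vY[OF vec_closed(1)[of v]] vD[OF vec_closed(2)[of f]] by (simp add: lin_minus[OF \<psi>1(1)])
   then show ?thesis
    using minus_minus_zero[OF RV] comm[OF vec_free(1)[of v] vec_free(2)[of f]] R cl(1)[OF vec_closed(1)[of v]] cl(2)[OF vec_closed(2)[of f]] \<psi>L(1)[OF c(3)]
    by simp
  qed
  then show "F \<in> ?K" using F relations_closed by blast
 qed
 then have "I \<subseteq> ?K"
  unfolding heisenberg_ideal_def big
  by (intro ring.genideal_minimal complex_algebra_ring hom_kernel_ideal[OF _ R \<psi>] SC.complex_algebra_C)
 then have "\<psi> F = \<zero>\<^bsub>R\<^esub>" if "F \<in> I" for F using that by blast
 from HI.alg_descend[OF R \<psi> this] obtain k where k: "alg_hom H R k" "!!F. F \<in> carrier SC.C ==> k (\<pi> F) = \<psi> F"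
  unfolding H by blast
 have "k (hY p) = FY p" if "p \<in> carrier Y.T" for p using k(2)[OF J_closed(1)[OF that]] vY[OF that] by simp
 moreover have "k (hD q) = FD q" if "q \<in> carrier D.T" for q using k(2)[OF J_closed(2)[OF that]] vD[OF that] by simp
 moreover have "k (heis_grp G Y g) = u g" if "g \<in> carrier G" for g
  unfolding heis_elements(3) using k(2)[of "crossed ST \<one>\<^bsub>ST\<^esub> g"] vu[OF that] that by simp
 ultimately show ?thesis using k(1) by blast
qed

lemma heisenberg_unique:
 assumes R: "complex_algebra R" and h: "alg_hom H R h" and k: "alg_hom H R k"
  and Y: "!!b. b \<in> B ==> h (hY (delta [b])) = k (hY (delta [b]))"
  and D: "!!c. c \<in> B' ==> h (hD (delta [c])) = k (hD (delta [c]))"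
  and u: "!!g. g \<in> carrier G ==> h (heis_grp G Y g) = k (heis_grp G Y g)"
  and y: "y \<in> carrier H"
 shows "h y = k y"
proof -
 obtain F where F: "F \<in> carrier SC.C" "y = \<pi> F" using y unfolding H HI.carrier_quotient by blast
 note h1 = alg_hom_comp[OF alg_hom_\<pi> h] and k1 = alg_hom_comp[OF alg_hom_\<pi> k]
 have "h (\<pi> F) = k (\<pi> F)"
 proof (rule SC.crossed_unique[OF R h1 k1 _ _ F(1)])
  show "h (\<pi> (J a)) = k (\<pi> (J a))" if a: "a \<in> carrier ST" for a
   by (rule ST_unique[OF R alg_hom_comp[OF SC.alg_hom_crossed h1] alg_hom_comp[OF SC.alg_hom_crossed k1] _ _ a])
    (use Y D in \<open>simp_all add: inc_letter\<close>)
  show "h (\<pi> (crossed ST \<one>\<^bsub>ST\<^esub> g)) = k (\<pi> (crossed ST \<one>\<^bsub>ST\<^esub> g))" if "g \<in> carrier G" for g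
   using u[OF that] unfolding heis_elements(3) .
 qed
 then show ?thesis by (simp add: F(2))
qed

section \<open>The isomorphism\<close>

text \<open>
 On functionals the two maps are \<open>f \<mapsto> x f\<close> and \<open>f \<mapsto> x\<inverse> f\<close>,
 so both composites fix all generators.
\<close>

lemma weyl_heisenberg_iso:
 "\<exists>\<phi>. algebra_iso (weyl_crossed G Y) H \<phi> \<and>
  (\<forall>v\<in>U. \<phi> (crossed W (weyl_vec G Y v) \<one>) = heis_vec G Y v) \<and>
  (\<forall>y\<in>carrier G. \<forall>f\<in>grade Z y. \<phi> (crossed W (weyl_covec G Y f) \<one>) = heis_grp G Y y \<otimes>\<^bsub>H\<^esub> heis_covec G Y f) \<and>
  (\<forall>g\<in>carrier G. \<phi> (crossed W \<one>\<^bsub>W\<^esub> g) = heis_grp G Y g)"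
proof -
 note [simp del] = tensor_opaque SC.C_simps WC.C_simps
 let ?u = "heis_grp G Y" and ?w = "crossed W \<one>\<^bsub>W\<^esub>"
 have HT: "covariant_triple H hY hD ?u" and WT: "covariant_triple WC.C kY kD ?w"
  using heisenberg_triple_double weyl_triple_crossed unfolding heisenberg_triple_def weyl_triple_def by blast+
 let ?FD = "twisted H hD ?u (%y. y)" and ?KD = "twisted WC.C kD ?w (%y. inv y)"
 have k1: "y \<in> carrier G ==> y \<in> carrier G" for y .
 note k1 = k1 conjugation_identities(1) and k2 = G.inv_closed conjugation_identities(2)
 obtain \<phi> where \<phi>: "alg_hom WC.C H \<phi>" and \<phi>Y: "!!p. p \<in> carrier Y.T ==> \<phi> (kY p) = hY p"
  and \<phi>D: "!!q. q \<in> carrier D.T ==> \<phi> (kD q) = ?FD q" and \<phi>u: "!!g. g \<in> carrier G ==> \<phi> (?w g) = ?u g"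
  using weyl_crossed_universal[OF heisenberg_to_weyl[OF heisenberg_triple_double]] by blast
 obtain \<psi> where \<psi>: "alg_hom H WC.C \<psi>" and \<psi>Y: "!!p. p \<in> carrier Y.T ==> \<psi> (hY p) = kY p"
  and \<psi>D: "!!q. q \<in> carrier D.T ==> \<psi> (hD q) = ?KD q" and \<psi>u: "!!g. g \<in> carrier G ==> \<psi> (?u g) = ?w g"
  using heisenberg_universal[OF weyl_to_heisenberg[OF weyl_triple_crossed]] by blast
 have id: "alg_hom A A (%a. a)" for A :: "(complex, 'c) module" by (simp add: alg_hom_def P.lin_id)
 have "\<psi> (\<phi> a) = a" if a: "a \<in> carrier WC.C" for a
 proof (rule weyl_crossed_unique[OF WC.complex_algebra_C alg_hom_comp[OF \<phi> \<psi>] id _ _ _ a])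
  show "\<psi> (\<phi> (kY (delta [b]))) = kY (delta [b])" if "b \<in> B" for b
   using \<phi>Y \<psi>Y Y.letter_closed[OF that] by simp
  show "\<psi> (\<phi> (kD (delta [\<beta> b]))) = kD (delta [\<beta> b])" if b: "b \<in> B" for b
  proof -
   note c = P.beta_in[OF b] and dc = D.letter_closed[OF P.beta_in[OF b]]
   have "\<psi> (\<phi> (kD (delta [\<beta> b]))) = \<psi> (?u (dg' (\<beta> b)) \<otimes>\<^bsub>H\<^esub> hD (delta [\<beta> b]))"
    unfolding \<phi>D[OF dc] by (rule arg_cong[OF twisted_letter[OF HT k1 c]])
   also have "\<dots> = ?w (dg' (\<beta> b)) \<otimes>\<^bsub>WC.C\<^esub> ?KD (delta [\<beta> b])"
    using alg_homD(3)[OF \<psi> triple_u[OF HT D.deg_closed[OF c]] triple_closed(2)[OF HT dc]] \<psi>u[OF D.deg_closed[OF c]] \<psi>D[OF dc] by simp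
   also have "\<dots> = ?w (dg' (\<beta> b)) \<otimes>\<^bsub>WC.C\<^esub> (?w (inv (dg' (\<beta> b))) \<otimes>\<^bsub>WC.C\<^esub> kD (delta [\<beta> b]))"
    by (rule arg_cong[OF twisted_letter[OF WT k2 c]])
   also have "\<dots> = kD (delta [\<beta> b])"
    by (rule triple_cancel(2)[OF WT D.deg_closed[OF c] triple_closed(2)[OF WT dc]])
   finally show ?thesis .
  qed
  show "\<psi> (\<phi> (?w g)) = ?w g" if "g \<in> carrier G" for g using \<phi>u \<psi>u that by simp
 qed
 moreover have "\<phi> (\<psi> y) = y" if y: "y \<in> carrier H" for y
 proof (rule heisenberg_unique[OF complex_algebra_H alg_hom_comp[OF \<psi> \<phi>] id _ _ _ y])
  show "\<phi> (\<psi> (hY (delta [b]))) = hY (delta [b])" if "b \<in> B" for b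
   using \<phi>Y \<psi>Y Y.letter_closed[OF that] by simp
  show "\<phi> (\<psi> (hD (delta [c]))) = hD (delta [c])" if c: "c \<in> B'" for c
  proof -
   note dc = D.letter_closed[OF c] and ig = G.inv_closed[OF D.deg_closed[OF c]]
   have "\<phi> (\<psi> (hD (delta [c]))) = \<phi> (?w (inv (dg' c)) \<otimes>\<^bsub>WC.C\<^esub> kD (delta [c]))"
    unfolding \<psi>D[OF dc] by (rule arg_cong[OF twisted_letter[OF WT k2 c]])
   also have "\<dots> = ?u (inv (dg' c)) \<otimes>\<^bsub>H\<^esub> ?FD (delta [c])"
    using alg_homD(3)[OF \<phi> triple_u[OF WT ig] triple_closed(2)[OF WT dc]] \<phi>u[OF ig] \<phi>D[OF dc] by simp
   also have "\<dots> = ?u (inv (dg' c)) \<otimes>\<^bsub>H\<^esub> (?u (dg' c) \<otimes>\<^bsub>H\<^esub> hD (delta [c]))"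
    by (rule arg_cong[OF twisted_letter[OF HT k1 c]])
   also have "\<dots> = hD (delta [c])"
    by (rule triple_cancel(1)[OF HT D.deg_closed[OF c] triple_closed(2)[OF HT dc]])
   finally show ?thesis .
  qed
  show "\<phi> (\<psi> (?u g)) = ?u g" if "g \<in> carrier G" for g using \<phi>u \<psi>u that by simp
 qed
 ultimately have "algebra_iso WC.C H \<phi>"
  by (intro algebra_isoI[OF WC.complex_algebra_C complex_algebra_H \<phi> \<psi>])
 moreover have "\<phi> (crossed W (weyl_vec G Y v) \<one>) = heis_vec G Y v" for v
  unfolding weyl_elements heis_elements by (rule \<phi>Y[OF vec_closed(1)])
 moreover have "\<phi> (crossed W (weyl_covec G Y f) \<one>) = heis_grp G Y y \<otimes>\<^bsub>H\<^esub> heis_covec G Y f"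
  if "y \<in> carrier G" "f \<in> grade Z y" for y f
  unfolding weyl_elements heis_elements(2) \<phi>D[OF vec_closed(2)]
  by (rule twisted_degree[OF HT k1 that(1) grade_vec[OF that]])
 ultimately show ?thesis
  using \<phi>u unfolding weyl_crossed by blast
qed

end

theorem theorem8p8:
  fixes G :: "'g monoid" (structure) and Y :: "('g, 'v::ab_group_add) yd_module"
  assumes "fin_dim_yetter_drinfeld G Y"
  shows "\<exists>\<phi>. algebra_iso (weyl_crossed G Y) (heisenberg_double G Y) \<phi> \<and>
    (\<forall>v\<in>vspace Y.
      \<phi> (crossed (weyl_algebra G Y) (weyl_vec G Y v) \<one>\<^bsub>G\<^esub>) = heis_vec G Y v) \<and>
    (\<forall>x\<in>carrier G. \<forall>f\<in>grade (dual G Y) x.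
      \<phi> (crossed (weyl_algebra G Y) (weyl_covec G Y f) \<one>\<^bsub>G\<^esub>)
        = heis_grp G Y x \<otimes>\<^bsub>heisenberg_double G Y\<^esub> heis_covec G Y f) \<and>
    (\<forall>g\<in>carrier G.
      \<phi> (crossed (weyl_algebra G Y) \<one>\<^bsub>weyl_algebra G Y\<^esub> g) = heis_grp G Y g)"
  by (rule yd_mod.weyl_heisenberg_iso[OF yd_mod.intro[OF assms]])

end
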